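(* Let $\alpha>-1$, $0<p<\infty$ and $\beta\geq 2(\alpha+2)$. Suppose $u,v\in H(\mathbb{D})$ and $\varphi,\psi\in S(\mathbb{D})$. If $M_r(\omega_{\varphi,u}^{\alpha,2})$, $M_r(\omega_{\psi,v}^{\alpha,2})$, $M_r(\sigma_{\varphi,u,v}^{\alpha,2,\beta})$ and $M_r(\sigma_{\psi,u,v}^{\alpha,2,\beta})$ all belong to $L^{p/2}(\mathbb{D},d\lambda)$ for some (or equivalently, any) $r>0$, then $C_{u,\varphi}-C_{v,\psi}\in S_p(A_\alpha^2)$. Moreover, when $p\geq 2$, this condition is also necessary for $C_{u,\varphi}-C_{v,\psi}\in S_p(A_\alpha^2)$.
   Context: $\mathbb{D}$ is the open unit disc, $H(\mathbb{D})$ the analytic functions on $\mathbb{D}$, $S(\mathbb{D})$ the analytic self-maps of $\mathbb{D}$. $dA=\frac1\pi dx\,dy$ is normalized area measure, $dA_\alpha(z)=(\alpha+1)(1-|z|^2)^\alpha dA(z)$, and $A_\alpha^2(\mathbb{D})$ is the Hilbert space of $f\in H(\mathbb{D})$ with $\int_{\mathbb{D}}|f|^2dA_\alpha<\infty$. $d\lambda(z)=(1-|z|^2)^{-2}dA(z)$. For $u\in H(\mathbb{D})$, $\varphi\in S(\mathbb{D})$, $C_{u,\varphi}f=u\cdot(f\circ\varphi)$. The pseudo-hyperbolic distance is $d(z,w)=\left|\frac{z-w}{1-\bar z w}\right|$, the Bergman metric is $\beta(z,w)=\frac12\log\frac{1+d(z,w)}{1-d(z,w)}$, and $D(z,r)=\{w\in\mathbb{D}:\beta(z,w)<r\}$.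 Put $\rho(z)=d(\varphi(z),\psi(z))$. For a positive Borel measure $\mu$ and $\varphi\in S(\mathbb{D})$, $(\mu\circ\varphi^{-1})(E)=\mu(\varphi^{-1}(E))$. Define $\omega_{\varphi,u}^{\alpha,2}=(|\rho u|^2dA_\alpha)\circ\varphi^{-1}$, $\omega_{\psi,v}^{\alpha,2}=(|\rho v|^2dA_\alpha)\circ\psi^{-1}$, $\sigma_{\varphi,u,v}^{\alpha,2,\beta}=[(1-\rho)^\beta|u-v|^2dA_\alpha]\circ\varphi^{-1}$, $\sigma_{\psi,u,v}^{\alpha,2,\beta}=[(1-\rho)^\beta|u-v|^2dA_\alpha]\circ\psi^{-1}$. For a positive Borel measure $\mu$, $M_r(\mu)(z)=\mu(D(z,r))/(1-|z|^2)^{2+\alpha}$. $S_p(A_\alpha^2)$ denotes the Schatten $p$-class: compact operators on $A_\alpha^2(\mathbb{D})$ whose singular numbers form an $\ell^p$ sequence. *)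

theory Defs
  imports "HOL-Analysis.Analysis" "HOL-Complex_Analysis.Complex_Analysis"
begin

definition udisc :: "complex set" where
  "udisc = ball 0 1"

text \<open>Density of dA_alpha w.r.t. planar Lebesgue measure (dA = dx dy / pi).\<close>
definition dA_dens :: "real \<Rightarrow> complex \<Rightarrow> real" where
  "dA_dens \<alpha> z = (\<alpha> + 1) / pi * (1 - (cmod z)\<^sup>2) powr \<alpha>"

text \<open>Density of d lambda = (1-|z|^2)^(-2) dA w.r.t. planar Lebesgue measure.\<close>
definition dlambda_dens :: "complex \<Rightarrow> real" where
  "dlambda_dens z = 1 / (pi * (1 - (cmod z)\<^sup>2)\<^sup>2)"

definition bergman_int :: "real \<Rightarrow> (complex \<Rightarrow> complex) \<Rightarrow> ennreal" where
  "bergman_int \<alpha> f =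
     (\<integral>\<^sup>+ z. indicator udisc z * ennreal (dA_dens \<alpha> z * (cmod (f z))\<^sup>2) \<partial>lborel)"

definition in_A2 :: "real \<Rightarrow> (complex \<Rightarrow> complex) \<Rightarrow> bool" where
  "in_A2 \<alpha> f \<longleftrightarrow> f holomorphic_on udisc \<and> bergman_int \<alpha> f < \<infinity>"

definition A2_norm :: "real \<Rightarrow> (complex \<Rightarrow> complex) \<Rightarrow> real" where
  "A2_norm \<alpha> f = sqrt (enn2real (bergman_int \<alpha> f))"

type_synonym A2op = "(complex \<Rightarrow> complex) \<Rightarrow> (complex \<Rightarrow> complex)"

definition maps_A2 :: "real \<Rightarrow> A2op \<Rightarrow> bool" where
  "maps_A2 \<alpha> T \<longleftrightarrow> (\<forall>f. in_A2 \<alpha> f \<longrightarrow> in_A2 \<alpha> (T f))"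

definition linear_A2 :: "real \<Rightarrow> A2op \<Rightarrow> bool" where
  "linear_A2 \<alpha> T \<longleftrightarrow>
     (\<forall>f g. in_A2 \<alpha> f \<longrightarrow> in_A2 \<alpha> g \<longrightarrow>
        (\<forall>z\<in>udisc. T (\<lambda>w. f w + g w) z = T f z + T g z)) \<and>
     (\<forall>f c. in_A2 \<alpha> f \<longrightarrow> (\<forall>z\<in>udisc. T (\<lambda>w. c * f w) z = c * T f z))"

definition bounded_A2 :: "real \<Rightarrow> A2op \<Rightarrow> bool" where
  "bounded_A2 \<alpha> T \<longleftrightarrow> (\<exists>C. \<forall>f. in_A2 \<alpha> f \<longrightarrow> A2_norm \<alpha> (T f) \<le> C * A2_norm \<alpha> f)"

definition op_norm :: "real \<Rightarrow> A2op \<Rightarrow> ennreal" where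
  "op_norm \<alpha> T = (SUP f \<in> {f. in_A2 \<alpha> f \<and> A2_norm \<alpha> f \<le> 1}. ennreal (A2_norm \<alpha> (T f)))"

definition rank_le_A2 :: "real \<Rightarrow> nat \<Rightarrow> A2op \<Rightarrow> bool" where
  "rank_le_A2 \<alpha> n K \<longleftrightarrow> maps_A2 \<alpha> K \<and> linear_A2 \<alpha> K \<and> bounded_A2 \<alpha> K \<and>
     (\<exists>gs. length gs \<le> n \<and> (\<forall>g\<in>set gs. in_A2 \<alpha> g) \<and>
        (\<forall>f. in_A2 \<alpha> f \<longrightarrow> (\<exists>c. \<forall>z\<in>udisc. K f z = (\<Sum>i<length gs. c i * (gs ! i) z))))"

text \<open>n-th singular number s_n(T) (n = 0,1,2,...), realised as the n-th approximation
  number: distance in operator norm to operators of rank at most n.\<close>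
definition sing_num :: "real \<Rightarrow> A2op \<Rightarrow> nat \<Rightarrow> ennreal" where
  "sing_num \<alpha> T n = (INF K \<in> {K. rank_le_A2 \<alpha> n K}. op_norm \<alpha> (\<lambda>f z. T f z - K f z))"

definition compact_A2 :: "real \<Rightarrow> A2op \<Rightarrow> bool" where
  "compact_A2 \<alpha> T \<longleftrightarrow>
     (\<forall>fs. (\<forall>k. in_A2 \<alpha> (fs k) \<and> A2_norm \<alpha> (fs k) \<le> 1) \<longrightarrow>
        (\<exists>r::nat \<Rightarrow> nat. strict_mono r \<and>
           (\<forall>\<epsilon>>0. \<exists>N::nat. \<forall>m\<ge>N. \<forall>n\<ge>N.
              A2_norm \<alpha> (\<lambda>z. T (fs (r m)) z - T (fs (r n)) z) < \<epsilon>)))"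

definition schatten_A2 :: "real \<Rightarrow> real \<Rightarrow> A2op \<Rightarrow> bool" where
  "schatten_A2 \<alpha> p T \<longleftrightarrow> maps_A2 \<alpha> T \<and> linear_A2 \<alpha> T \<and> bounded_A2 \<alpha> T \<and>
     compact_A2 \<alpha> T \<and> summable (\<lambda>n. enn2real (sing_num \<alpha> T n) powr p)"

definition wcomp :: "(complex \<Rightarrow> complex) \<Rightarrow> (complex \<Rightarrow> complex) \<Rightarrow> A2op" where
  "wcomp u \<phi> f = (\<lambda>z. u z * f (\<phi> z))"

definition pseudo_hyp :: "complex \<Rightarrow> complex \<Rightarrow> real" where
  "pseudo_hyp z w = cmod ((z - w) / (1 - cnj z * w))"

definition bergman_metric :: "complex \<Rightarrow> complex \<Rightarrow> real" where
  "bergman_metric z w = 1/2 * ln ((1 + pseudo_hyp z w) / (1 - pseudo_hyp z w))"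

definition bdisc :: "complex \<Rightarrow> real \<Rightarrow> complex set" where
  "bdisc z r = {w \<in> udisc. bergman_metric z w < r}"

definition pull_meas :: "real \<Rightarrow> (complex \<Rightarrow> complex) \<Rightarrow> (complex \<Rightarrow> real) \<Rightarrow> complex set \<Rightarrow> ennreal" where
  "pull_meas \<alpha> \<phi> g E =
     (\<integral>\<^sup>+ w. indicator (udisc \<inter> \<phi> -` E) w * ennreal (dA_dens \<alpha> w * g w) \<partial>lborel)"

definition Mr :: "real \<Rightarrow> real \<Rightarrow> (complex \<Rightarrow> complex) \<Rightarrow> (complex \<Rightarrow> real) \<Rightarrow> complex \<Rightarrow> ennreal" where
  "Mr \<alpha> r \<phi> g z = pull_meas \<alpha> \<phi> g (bdisc z r) / ennreal ((1 - (cmod z)\<^sup>2) powr (2 + \<alpha>))"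

definition in_L_lambda :: "real \<Rightarrow> (complex \<Rightarrow> ennreal) \<Rightarrow> bool" where
  "in_L_lambda q M \<longleftrightarrow>
     (\<lambda>z. indicator udisc z * M z) \<in> borel_measurable lborel \<and>
     (AE z in lborel. z \<in> udisc \<longrightarrow> M z \<noteq> \<infinity>) \<and>
     (\<integral>\<^sup>+ z. indicator udisc z * ennreal (enn2real (M z) powr q) * ennreal (dlambda_dens z) \<partial>lborel) < \<infinity>"

definition rho :: "(complex \<Rightarrow> complex) \<Rightarrow> (complex \<Rightarrow> complex) \<Rightarrow> complex \<Rightarrow> real" where
  "rho \<phi> \<psi> z = pseudo_hyp (\<phi> z) (\<psi> z)"

definition cond_r :: "real \<Rightarrow> real \<Rightarrow> real \<Rightarrow> (complex \<Rightarrow> complex) \<Rightarrow> (complex \<Rightarrow> complex)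
    \<Rightarrow> (complex \<Rightarrow> complex) \<Rightarrow> (complex \<Rightarrow> complex) \<Rightarrow> real \<Rightarrow> bool" where
  "cond_r \<alpha> p \<beta> u v \<phi> \<psi> r \<longleftrightarrow>
     in_L_lambda (p/2) (Mr \<alpha> r \<phi> (\<lambda>z. (rho \<phi> \<psi> z * cmod (u z))\<^sup>2)) \<and>
     in_L_lambda (p/2) (Mr \<alpha> r \<psi> (\<lambda>z. (rho \<phi> \<psi> z * cmod (v z))\<^sup>2)) \<and>
     in_L_lambda (p/2) (Mr \<alpha> r \<phi> (\<lambda>z. (1 - rho \<phi> \<psi> z) powr \<beta> * (cmod (u z - v z))\<^sup>2)) \<and>
     in_L_lambda (p/2) (Mr \<alpha> r \<psi> (\<lambda>z. (1 - rho \<phi> \<psi> z) powr \<beta> * (cmod (u z - v z))\<^sup>2))"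

end

theory Submission
  imports Defs "Jordan_Normal_Form.Spectral_Radius"
begin

text \<open>Sufficiency. Cover the disc by a hyperbolic lattice and let \<open>b n\<close> be the averages of the
  pull-back measures over its cells, so that \<open>(b n)\<close> lies in \<open>l\<^sup>p\<^sup>/\<^sup>2\<close> by hypothesis. If \<open>f\<close> vanishes
  at \<open>N n\<close> suitable points of the \<open>n\<close>-th cell, the Schwarz lemma reduces its size there by a factor
  \<open>2 ^ N n\<close>, so the cell contributes only \<open>b n / 4 ^ N n\<close> to the squared norm of \<open>T f\<close>. Vanishing at
  \<open>\<Sum> N n\<close> points is a condition of that rank, which bounds the approximation numbers of \<open>T\<close>;
  taking \<open>N n\<close> to be the number of levels \<open>B / 4 ^ i\<close> below \<open>b n\<close> and summing geometric series
  gives the \<open>p\<close>-summability for every \<open>p > 0\<close>.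

  Necessity. Test \<open>T\<close> on the normalized reproducing kernels and on their normalized derivatives with
  respect to the base point. Together the two values control \<open>\<rho> u\<close>, \<open>\<rho> v\<close> and \<open>(1 - \<rho>)\<^sup>\<beta> (u - v)\<close>
  pointwise, so the averaging functions are bounded by the squared norms of the images. For
  \<open>p \<ge> 2\<close> Jensen's inequality in a basis of singular vectors bounds the \<open>L\<^sup>p(d\<lambda>)\<close> norm of these
  by the \<open>l\<^sup>p\<close> norm of the singular numbers, because both test families satisfy an
  \<open>L\<^sup>2(d\<lambda>)\<close> Bessel inequality.\<close>

section \<open>Integration over the disc\<close>

text \<open>The singular numbers are approximation numbers, so upper bounds require explicit
  operators of finite rank. Counting ranks replaces operator inequalities that hold only for some
  exponents; hence one argument serves all \<open>p > 0\<close>. Lower bounds do without a spectral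
  theorem for compact operators: on polynomials of bounded degree singular vectors come from
  eigenvectors of a Gram matrix, and Fatou's lemma removes the bound on the degree. The obstacle in
  the necessity part is cancellation: one kernel \<open>k\<close> only yields
  \<open>u * k (\<phi> w) - v * k (\<psi> w)\<close>, which may vanish although neither term does.
  The quotient of the second test function by the first takes values at \<open>\<phi> w\<close> and
  \<open>\<psi> w\<close> that differ by at least a constant times \<open>\<rho>\<close>, so the two
  equations can be solved for each term at the price of a factor \<open>\<rho>\<close>. Recovering
  \<open>u - v\<close> compares the kernel at the two points and costs
  \<open>(1 - \<rho>) powr (\<alpha> + 2)\<close>; squared, this is the threshold
  \<open>2 * (\<alpha> + 2)\<close> for \<open>\<beta>\<close>.\<close>

lemma lborel_complex_eq: "(lborel :: complex measure) = distr (lborel \<Otimes>\<^sub>M lborel) borel (\<lambda>(x, y). Complex x y)"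
proof (rule lborel_eqI)
  fix l u :: complex assume le: "\<And>b. b \<in> Basis \<Longrightarrow> l \<bullet> b \<le> u \<bullet> b"
  have meas: "(\<lambda>(x, y). Complex x y) \<in> borel_measurable (borel \<Otimes>\<^sub>M borel)"
    unfolding borel_prod by (intro borel_measurable_continuous_onI) (auto simp: split_beta Complex_eq intro!: continuous_intros)
  have le': "Re l \<le> Re u" "Im l \<le> Im u" using le[of 1] le[of \<i>] by (auto simp: Basis_complex_def)
  have "emeasure (distr (lborel \<Otimes>\<^sub>M lborel) borel (\<lambda>(x, y). Complex x y)) (box l u)
      = emeasure (lborel \<Otimes>\<^sub>M lborel) ({Re l <..< Re u} \<times> {Im l <..< Im u})"
    using meas by (subst emeasure_distr)
      (auto intro!: arg_cong2[where f=emeasure] simp: box_def Basis_complex_def space_pair_measure cong: measurable_cong_sets)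
  also have "\<dots> = ennreal ((Re u - Re l) * (Im u - Im l))"
    using le' by (simp add: lborel.emeasure_pair_measure_Times ennreal_mult)
  finally show "emeasure (distr (lborel \<Otimes>\<^sub>M lborel) borel (\<lambda>(x, y). Complex x y)) (box l u) = ennreal (\<Prod>b\<in>Basis. (u - l) \<bullet> b)"
    by (simp add: Basis_complex_def)
qed simp

lemma nn_integral_complex_iterated:
  fixes f :: "complex \<Rightarrow> ennreal"
  assumes [measurable]: "f \<in> borel_measurable borel"
  shows "(\<integral>\<^sup>+z. f z \<partial>lborel) = (\<integral>\<^sup>+x. \<integral>\<^sup>+y. f (Complex x y) \<partial>lborel \<partial>lborel)"
    and "(\<integral>\<^sup>+z. f z \<partial>lborel) = (\<integral>\<^sup>+y. \<integral>\<^sup>+x. f (Complex x y) \<partial>lborel \<partial>lborel)"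
proof -
  have meas: "(\<lambda>p. Complex (fst p) (snd p)) \<in> borel_measurable (borel \<Otimes>\<^sub>M borel)"
    unfolding borel_prod by (intro borel_measurable_continuous_onI) (auto simp: Complex_eq intro!: continuous_intros)
  have [measurable]: "(\<lambda>p. Complex (fst p) (snd p)) \<in> borel_measurable (lborel \<Otimes>\<^sub>M lborel)"
    using meas by (simp cong: measurable_cong_sets)
  have eq: "(\<integral>\<^sup>+z. f z \<partial>lborel) = (\<integral>\<^sup>+p. f (Complex (fst p) (snd p)) \<partial>(lborel \<Otimes>\<^sub>M lborel))"
    by (subst lborel_complex_eq, subst nn_integral_distr) (auto simp: split_beta)
  show "(\<integral>\<^sup>+z. f z \<partial>lborel) = (\<integral>\<^sup>+x. \<integral>\<^sup>+y. f (Complex x y) \<partial>lborel \<partial>lborel)"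
    unfolding eq by (subst lborel.nn_integral_fst[symmetric]) auto
  show "(\<integral>\<^sup>+z. f z \<partial>lborel) = (\<integral>\<^sup>+y. \<integral>\<^sup>+x. f (Complex x y) \<partial>lborel \<partial>lborel)"
    unfolding eq by (subst lborel_pair.nn_integral_snd[symmetric]) (auto simp: split_beta)
qed

text \<open>On each horizontal line the shear is a translation, so one-dimensional translation
  invariance and Fubini suffice.\<close>

lemma nn_integral_shear_Re:
  fixes f :: "complex \<Rightarrow> ennreal"
  assumes [measurable]: "f \<in> borel_measurable borel"
  shows "(\<integral>\<^sup>+z. f (z + of_real (a * Im z)) \<partial>lborel) = (\<integral>\<^sup>+z. f z \<partial>lborel)"
proof -
  have C: "(\<lambda>x. Complex x y) \<in> borel_measurable borel" for y
    by (intro borel_measurable_continuous_onI) (auto simp: Complex_eq intro!: continuous_intros)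
  have "(\<integral>\<^sup>+z. f (z + of_real (a * Im z)) \<partial>lborel)
      = (\<integral>\<^sup>+y. \<integral>\<^sup>+x. f (Complex (a * y + x) y) \<partial>lborel \<partial>lborel)"
    by (subst nn_integral_complex_iterated(2)) (auto intro!: nn_integral_cong arg_cong[where f=f] simp: complex_eq_iff)
  also have "\<dots> = (\<integral>\<^sup>+y. \<integral>\<^sup>+x. f (Complex x y) \<partial>distr lborel borel ((+) (a * y)) \<partial>lborel)"
    using C by (intro nn_integral_cong) (subst nn_integral_distr, auto)
  also have "\<dots> = (\<integral>\<^sup>+z. f z \<partial>lborel)"
    by (simp add: lborel_distr_plus nn_integral_complex_iterated(2))
  finally show ?thesis .
qed

lemma nn_integral_shear_Im:
  fixes f :: "complex \<Rightarrow> ennreal"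
  assumes [measurable]: "f \<in> borel_measurable borel"
  shows "(\<integral>\<^sup>+z. f (z + \<i> * of_real (a * Re z)) \<partial>lborel) = (\<integral>\<^sup>+z. f z \<partial>lborel)"
proof -
  have C: "(\<lambda>x. Complex y x) \<in> borel_measurable borel" for y
    by (intro borel_measurable_continuous_onI) (auto simp: Complex_eq intro!: continuous_intros)
  have "(\<integral>\<^sup>+z. f (z + \<i> * of_real (a * Re z)) \<partial>lborel)
      = (\<integral>\<^sup>+y. \<integral>\<^sup>+x. f (Complex y (a * y + x)) \<partial>lborel \<partial>lborel)"
    by (subst nn_integral_complex_iterated(1)) (auto intro!: nn_integral_cong arg_cong[where f=f] simp: complex_eq_iff)
  also have "\<dots> = (\<integral>\<^sup>+y. \<integral>\<^sup>+x. f (Complex y x) \<partial>distr lborel borel ((+) (a * y)) \<partial>lborel)"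
    using C by (intro nn_integral_cong) (subst nn_integral_distr, auto)
  also have "\<dots> = (\<integral>\<^sup>+z. f z \<partial>lborel)"
    by (simp add: lborel_distr_plus nn_integral_complex_iterated(1))
  finally show ?thesis .
qed

text \<open>A rotation by an angle that is not a multiple of \<^term>\<open>pi\<close> is a product of three shears,
  each of which preserves Lebesgue measure by Fubini.\<close>

lemma distr_lborel_rotation:
  assumes "cmod \<zeta> = 1" "Im \<zeta> \<noteq> 0"
  shows "distr lborel borel ((*) \<zeta>) = (lborel :: complex measure)"
proof (rule measure_eqI)
  fix A :: "complex set" assume "A \<in> sets (distr lborel borel ((*) \<zeta>))"
  then have [measurable]: "A \<in> sets borel" by simp
  define s c where "s = Im \<zeta>" and "c = Re \<zeta>"
  have s: "s \<noteq> 0" and sc: "c\<^sup>2 + s\<^sup>2 = 1"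
    using assms by (auto simp: s_def c_def cmod_def)
  \<comment> \<open>For \<open>\<zeta>\<close> at angle \<open>t\<close> this is
    \<open>- tan (t / 2)\<close>. Horizontal shears with this coefficient before and after the
    vertical shear with coefficient \<open>sin t\<close> compose to the rotation; the division is
    why \<open>Im \<zeta>\<close> must not vanish.\<close>
  define a where "a = (c - 1) / s"
  have as: "a * s = c - 1" using s by (simp add: a_def)
  have "s * (a + a * c) = a * s * (1 + c)" by (simp add: algebra_simps)
  also have "\<dots> = s * (- s)" unfolding as using sc by (simp add: algebra_simps power2_eq_square)
  finally have ac: "a + a * c = - s" using s by (simp only: mult_cancel_left) simp
  define H V where "H = (\<lambda>z::complex. z + of_real (a * Im z))" and "V = (\<lambda>z::complex. z + \<i> * of_real (s * Re z))"
  have HVH: "H (V (H z)) = \<zeta> * z" for z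
  proof (rule complex_eqI)
    have "Re (H (V (H z))) = Re z * (1 + a * s) + Im z * (a + a * (1 + a * s))"
      by (simp add: H_def V_def algebra_simps)
    also have "\<dots> = c * Re z - s * Im z" using as ac by (simp add: algebra_simps)
    finally show "Re (H (V (H z))) = Re (\<zeta> * z)" by (simp add: c_def s_def)
    have "Im (H (V (H z))) = Im z * (1 + a * s) + s * Re z"
      by (simp add: H_def V_def algebra_simps)
    also have "\<dots> = c * Im z + s * Re z" unfolding as by simp
    finally show "Im (H (V (H z))) = Im (\<zeta> * z)" by (simp add: c_def s_def)
  qed
  have [measurable]: "H \<in> borel_measurable borel" "V \<in> borel_measurable borel"
    unfolding H_def V_def by measurable
  have [measurable]: "(*) \<zeta> \<in> borel_measurable borel"
    by (intro borel_measurable_continuous_onI continuous_intros)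
  have "emeasure (distr lborel borel ((*) \<zeta>)) A = (\<integral>\<^sup>+z. indicator A (\<zeta> * z) \<partial>lborel)"
    by (subst nn_integral_indicator[symmetric], simp, subst nn_integral_distr) auto
  also have "\<dots> = (\<integral>\<^sup>+z. indicator A (H (V (H z))) \<partial>lborel)" by (simp add: HVH)
  also have "\<dots> = (\<integral>\<^sup>+z. indicator A (H (V z)) \<partial>lborel)"
    using nn_integral_shear_Re[of "\<lambda>z. indicator A (H (V z))" a] by (simp add: H_def)
  also have "\<dots> = (\<integral>\<^sup>+z. indicator A (H z) \<partial>lborel)"
    using nn_integral_shear_Im[of "\<lambda>z. indicator A (H z)" s] by (simp add: V_def)
  also have "\<dots> = (\<integral>\<^sup>+z. indicator A z \<partial>lborel)"
    using nn_integral_shear_Re[of "\<lambda>z. indicator A z" a] by (simp add: H_def)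
  also have "\<dots> = emeasure lborel A" by simp
  finally show "emeasure (distr lborel borel ((*) \<zeta>)) A = emeasure lborel A" .
qed simp

text \<open>Substituting \<open>\<zeta> * w\<close> for \<open>w\<close> preserves the measure and
  the radial factor but multiplies the integral by \<open>q = \<zeta> ^ n * cnj \<zeta> ^ m\<close>;
  since \<open>q\<close> differs from 1 the integral is 0. Every step also holds for a
  non-integrable function, whose Bochner integral is 0 by convention.\<close>

lemma monomials_orthogonal_radial:
  fixes g :: "real \<Rightarrow> real"
  assumes [measurable]: "g \<in> borel_measurable borel" and nm: "n \<noteq> m"
  shows "(LINT w|lborel. g (cmod w) *\<^sub>R (w ^ n * cnj w ^ m)) = 0"
proof -
  define k where "k = (if n > m then n - m else m - n)"
  have k: "k > 0" using nm by (auto simp: k_def)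
  \<comment> \<open>The angle \<open>1 / k\<close> lies strictly between 0 and \<open>pi\<close>, so
    that the rotation lemma applies, and \<open>\<zeta> ^ k = cis 1\<close> is different from
    1.\<close>
  define \<zeta> where "\<zeta> = cis (1 / k)"
  have "sin (1 / real k) \<noteq> 0"
  proof -
    have "1 / real k \<le> 1" "0 < 1 / real k" using k by auto
    then show ?thesis using sin_gt_zero[of "1 / real k"] pi_gt3 by auto
  qed
  then have rot: "distr lborel borel ((*) \<zeta>) = lborel"
    by (intro distr_lborel_rotation) (auto simp: \<zeta>_def)
  have "\<zeta> ^ k = cis 1" using k unfolding \<zeta>_def by (subst Complex.DeMoivre) simp
  then have zk: "\<zeta> ^ k \<noteq> 1" using sin_gt_zero[of 1] pi_gt3 by (auto simp: complex_eq_iff)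
  have u: "\<zeta> * cnj \<zeta> = 1" by (simp add: \<zeta>_def cis_cnj cis_mult)
  define q where "q = \<zeta> ^ n * cnj \<zeta> ^ m"
  have "q = \<zeta> ^ k \<or> q = cnj (\<zeta> ^ k)"
  proof (cases "n > m")
    case True
    then have "q = \<zeta> ^ (n - m) * (\<zeta> * cnj \<zeta>) ^ m"
      unfolding q_def power_mult_distrib mult.assoc[symmetric] power_add[symmetric] by simp
    then show ?thesis using u True by (simp add: k_def)
  next
    case False
    then have "cnj \<zeta> ^ m = cnj \<zeta> ^ n * cnj \<zeta> ^ (m - n)" by (simp flip: power_add)
    then have "q = cnj \<zeta> ^ (m - n) * (\<zeta> * cnj \<zeta>) ^ n"
      unfolding q_def power_mult_distrib by simp
    then show ?thesis using u False nm by (simp add: k_def)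
  qed
  then have q: "q \<noteq> 1" using zk by (metis complex_cnj_cancel_iff complex_cnj_one)
  let ?F = "\<lambda>w::complex. g (cmod w) *\<^sub>R (w ^ n * cnj w ^ m)"
  have [measurable]: "(\<lambda>w::complex. w ^ n * cnj w ^ m) \<in> borel_measurable borel"
    by (intro borel_measurable_continuous_onI continuous_intros)
  have [measurable]: "(*) \<zeta> \<in> borel_measurable borel"
    by (intro borel_measurable_continuous_onI continuous_intros)
  have "(LINT w|lborel. ?F w) = (LINT w|distr lborel borel ((*) \<zeta>). ?F w)" by (simp add: rot)
  also have "\<dots> = (LINT w|lborel. ?F (\<zeta> * w))"
    by (subst integral_distr) auto
  also have "\<dots> = (LINT w|lborel. q * ?F w)"
    by (intro Bochner_Integration.integral_cong) (auto simp: q_def norm_mult \<zeta>_def power_mult_distrib)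
  also have "\<dots> = q * (LINT w|lborel. ?F w)" by (rule integral_mult_right_zero)
  finally show ?thesis using q by (auto simp: mult_cancel_right1)
qed

text \<open>A disc of radius \<open>sqrt x\<close> has area \<open>pi * x\<close>: the image of
  planar measure on the disc under \<open>(cmod z)\<^sup>2\<close> is therefore \<open>pi\<close>
  times Lebesgue measure on the unit interval. The two measures are compared on the rays
  \<open>{x<..}\<close>, which determine finite measures on the line.\<close>

lemma nn_integral_disc_radial:
  fixes F :: "real \<Rightarrow> ennreal"
  assumes [measurable]: "F \<in> borel_measurable borel"
  shows "(\<integral>\<^sup>+z. indicator udisc z * F ((cmod z)\<^sup>2) \<partial>lborel) = ennreal pi * (\<integral>\<^sup>+x. indicator {0..1} x * F x \<partial>lborel)"
proof -
  have [measurable]: "udisc \<in> sets borel" by (simp add: udisc_def)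
  define N where "N = distr (density lborel (indicator udisc :: complex \<Rightarrow> ennreal)) borel (\<lambda>z. (cmod z)\<^sup>2)"
  define N' where "N' = density lborel (\<lambda>x. ennreal pi * indicator {0..1::real} x)"
  have em_ball: "emeasure lborel (ball (0::complex) t) = ennreal (pi * t\<^sup>2)" if "t \<ge> 0" for t
    using that by (simp add: emeasure_ball unit_ball_vol_2 power2_eq_square)
  have em_cball: "emeasure lborel (cball (0::complex) t) = ennreal (pi * t\<^sup>2)" if "t \<ge> 0" for t
    using that by (simp add: emeasure_cball unit_ball_vol_2 power2_eq_square)
  have N1: "emeasure N {x<..} = emeasure lborel {z \<in> udisc. x < (cmod z)\<^sup>2}" for x
  proof -
    have [measurable]: "(\<lambda>z::complex. (cmod z)\<^sup>2) -` {x<..} \<in> sets borel"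
      using measurable_sets_borel[of "\<lambda>z::complex. (cmod z)\<^sup>2" borel "{x<..}"] by simp
    have "emeasure N {x<..} = emeasure (density lborel (indicator udisc :: complex \<Rightarrow> ennreal)) ((\<lambda>z. (cmod z)\<^sup>2) -` {x<..})"
      unfolding N_def by (subst emeasure_distr) simp_all
    also have "\<dots> = (\<integral>\<^sup>+z. indicator ({z \<in> udisc. x < (cmod z)\<^sup>2}) z \<partial>lborel)"
      by (subst emeasure_density, simp, simp, rule nn_integral_cong) (simp split: split_indicator)
    also have "\<dots> = emeasure lborel {z \<in> udisc. x < (cmod z)\<^sup>2}"
      by (rule nn_integral_indicator) simp
    finally show ?thesis .
  qed
  have N'1: "emeasure N' {x<..} = ennreal pi * emeasure lborel ({0..1} \<inter> {x<..})" for x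
  proof -
    have "emeasure N' {x<..} = (\<integral>\<^sup>+y. ennreal pi * indicator ({0..1} \<inter> {x<..}) y \<partial>lborel)"
      unfolding N'_def by (subst emeasure_density, simp, simp, rule nn_integral_cong) (simp split: split_indicator)
    also have "\<dots> = ennreal pi * (\<integral>\<^sup>+y. indicator ({0..1} \<inter> {x<..}) y \<partial>lborel)"
      by (rule nn_integral_cmult) simp
    also have "\<dots> = ennreal pi * emeasure lborel ({0..1} \<inter> {x<..})"
      by (subst nn_integral_indicator) auto
    finally show ?thesis .
  qed
  have eq: "emeasure N {x<..} = emeasure N' {x<..}" for x
  proof -
    consider "x < 0" | "0 \<le> x" "x < 1" | "1 \<le> x" by linarith
    then show ?thesis
    proof cases
      case 1
      have "x < (cmod z)\<^sup>2" for z :: complex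
        by (rule less_le_trans[OF 1 zero_le_power2])
      then have "{z \<in> udisc. x < (cmod z)\<^sup>2} = ball 0 1" "{0..1} \<inter> {x<..} = {0..1}"
        using 1 by (auto simp: udisc_def)
      then show ?thesis using em_ball[of 1] unfolding N1 N'1 by simp
    next
      case 2
      have "{z \<in> udisc. x < (cmod z)\<^sup>2} = ball 0 1 - cball 0 (sqrt x)"
      proof -
        have iff: "x < (cmod z)\<^sup>2 \<longleftrightarrow> sqrt x < cmod z" for z :: complex
          using real_sqrt_less_iff[of x "(cmod z)\<^sup>2"] unfolding real_sqrt_abs by simp
        show ?thesis by (rule Set.set_eqI) (simp add: udisc_def iff not_le)
      qed
      moreover have "emeasure lborel (ball 0 1 - cball (0::complex) (sqrt x)) = emeasure lborel (ball (0::complex) 1) - emeasure lborel (cball (0::complex) (sqrt x))"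
      proof (rule emeasure_Diff)
        have "sqrt x < 1" using 2 by simp
        then show "cball (0::complex) (sqrt x) \<subseteq> ball 0 1" by (auto simp del: real_sqrt_lt_1_iff)
      qed (use 2 em_cball[of "sqrt x"] in auto)
      moreover have "\<dots> = ennreal (pi * (1 - x))"
        using 2 em_ball[of 1] em_cball[of "sqrt x"] by (simp add: ennreal_minus algebra_simps)
      moreover have "{0..1} \<inter> {x<..} = {x<..1}" using 2 by auto
      ultimately show ?thesis using 2 unfolding N1 N'1 by (simp add: ennreal_mult)
    next
      case 3
      have "(cmod z)\<^sup>2 \<le> 1" if "cmod z < 1" for z :: complex
        using that by (intro power_le_one) auto
      then have "{z \<in> udisc. x < (cmod z)\<^sup>2} = {}" "{0..1} \<inter> {x<..} = {}"
        using 3 by (force simp: udisc_def)+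
      then show ?thesis unfolding N1 N'1 by (simp only:) simp
    qed
  qed
  have "N = N'"
  proof (rule measure_eqI_lessThan)
    show "sets N = sets borel" "sets N' = sets borel" by (auto simp: N_def N'_def)
    show "emeasure N {x<..} < \<infinity>" for x
    proof -
      have "emeasure N {x<..} \<le> emeasure lborel (ball (0::complex) 1)"
        unfolding N1 by (intro emeasure_mono) (auto simp: udisc_def)
      then show ?thesis using em_ball[of 1] by (simp add: le_less_trans)
    qed
    show "emeasure N {x<..} = emeasure N' {x<..}" for x by (rule eq)
  qed
  then have "(\<integral>\<^sup>+x. F x \<partial>N) = (\<integral>\<^sup>+x. F x \<partial>N')" by simp
  moreover have "(\<integral>\<^sup>+x. F x \<partial>N) = (\<integral>\<^sup>+z. indicator udisc z * F ((cmod z)\<^sup>2) \<partial>lborel)"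
    unfolding N_def by (subst nn_integral_distr, simp, simp, subst nn_integral_density) auto
  moreover have "(\<integral>\<^sup>+x. F x \<partial>N') = (\<integral>\<^sup>+x. ennreal pi * (indicator {0..1} x * F x) \<partial>lborel)"
    unfolding N'_def by (subst nn_integral_density) (auto simp: mult.assoc)
  moreover have "\<dots> = ennreal pi * (\<integral>\<^sup>+x. indicator {0..1} x * F x \<partial>lborel)"
    by (rule nn_integral_cmult) simp
  ultimately show ?thesis by simp
qed

text \<open>The squared \<open>A2_norm\<close> of \<open>z ^ n\<close>. Its reciprocal is
  \<open>binom_coeff (\<alpha> + 2) n\<close>, which is what makes the binomial series the
  reproducing kernel.\<close>

definition monomial_norm2 :: "real \<Rightarrow> nat \<Rightarrow> real" where
  "monomial_norm2 \<alpha> n = (\<alpha> + 1) * Beta (real n + 1) (\<alpha> + 1)"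

lemma monomial_norm2_pos: "\<alpha> > -1 \<Longrightarrow> monomial_norm2 \<alpha> n > 0"
  by (simp add: monomial_norm2_def Beta_def Gamma_real_pos)

lemma bergman_int_monomial:
  assumes "\<alpha> > -1"
  shows "bergman_int \<alpha> (\<lambda>z. z ^ n) = ennreal (monomial_norm2 \<alpha> n)"
proof -
  have "bergman_int \<alpha> (\<lambda>z. z ^ n) = (\<integral>\<^sup>+z. indicator udisc z * ennreal ((\<alpha> + 1) / pi * (1 - (cmod z)\<^sup>2) powr \<alpha> * ((cmod z)\<^sup>2) ^ n) \<partial>lborel)"
    unfolding bergman_int_def dA_dens_def by (simp add: norm_power power_mult[symmetric] mult.commute)
  also have "\<dots> = ennreal pi * (\<integral>\<^sup>+x. indicator {0..1} x * ennreal ((\<alpha> + 1) / pi * (1 - x) powr \<alpha> * x ^ n) \<partial>lborel)"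
    by (rule nn_integral_disc_radial) measurable
  also have "(\<integral>\<^sup>+x. indicator {0..1} x * ennreal ((\<alpha> + 1) / pi * (1 - x) powr \<alpha> * x ^ n) \<partial>lborel)
     = (\<integral>\<^sup>+x. ennreal ((\<alpha> + 1) / pi) * (ennreal (x powr (real n + 1 - 1) * (1 - x) powr (\<alpha> + 1 - 1)) * indicator {0..1} x) \<partial>lborel)"
  \<comment> \<open>The point 0 is removed because \<open>0 powr 0 = 0\<close> whereas
    \<open>0 ^ 0 = 1\<close>.\<close>
  proof (intro nn_integral_cong_AE AE_I[where N="{0}"])
    show "{x \<in> space lborel. \<not> indicator {0..1} x * ennreal ((\<alpha> + 1) / pi * (1 - x) powr \<alpha> * x ^ n) =
       ennreal ((\<alpha> + 1) / pi) * (ennreal (x powr (real n + 1 - 1) * (1 - x) powr (\<alpha> + 1 - 1)) * indicator {0..1} x)} \<subseteq> {0}"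
    proof -
      have "x ^ n = x powr real n" if "x \<noteq> 0" "0 \<le> x" for x :: real
        using that by (simp add: powr_realpow)
      then show ?thesis
        using assms by (auto simp: indicator_def less_le ennreal_mult[symmetric] mult_ac)
    qed
  qed auto
  also have "\<dots> = ennreal ((\<alpha> + 1) / pi) * (\<integral>\<^sup>+x. ennreal (x powr (real n + 1 - 1) * (1 - x) powr (\<alpha> + 1 - 1)) * indicator {0..1} x \<partial>lborel)"
    by (rule nn_integral_cmult) measurable
  also have "(\<integral>\<^sup>+x. ennreal (x powr (real n + 1 - 1) * (1 - x) powr (\<alpha> + 1 - 1)) * indicator {0..1} x \<partial>lborel) = ennreal (Beta (real n + 1) (\<alpha> + 1))"
    using assms by (intro nn_integral_has_integral_lebesgue' has_integral_Beta_real) auto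
  also have "ennreal pi * (ennreal ((\<alpha> + 1) / pi) * ennreal (Beta (real n + 1) (\<alpha> + 1)))
      = ennreal (pi * ((\<alpha> + 1) / pi * Beta (real n + 1) (\<alpha> + 1)))"
    using assms monomial_norm2_pos[OF assms, of n]
    by (subst ennreal_mult'[symmetric], simp, subst ennreal_mult'[symmetric]) auto
  finally show ?thesis unfolding monomial_norm2_def by simp
qed

section \<open>The inner product of the Bergman space\<close>

text \<open>Elements of the space are functions on the whole plane with arbitrary values off the
  disc. A weight that vanishes there lets inner products be plane integrals without restricting the
  functions.\<close>

definition A2_weight :: "real \<Rightarrow> complex \<Rightarrow> real" where
  "A2_weight \<alpha> z = indicat_real udisc z * dA_dens \<alpha> z"

definition A2_inner :: "real \<Rightarrow> (complex \<Rightarrow> complex) \<Rightarrow> (complex \<Rightarrow> complex) \<Rightarrow> complex" where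
  "A2_inner \<alpha> f g = (LINT z|lborel. A2_weight \<alpha> z *\<^sub>R (f z * cnj (g z)))"

lemma open_udisc: "open udisc" by (simp add: udisc_def)

lemma udisc_borel [measurable]: "udisc \<in> sets borel" by (simp add: udisc_def)

lemma mem_udisc: "z \<in> udisc \<longleftrightarrow> cmod z < 1" by (simp add: udisc_def)

lemma A2_weight_nonneg: "\<alpha> > -1 \<Longrightarrow> A2_weight \<alpha> z \<ge> 0"
  by (simp add: A2_weight_def dA_dens_def)

lemma A2_weight_outside: "z \<notin> udisc \<Longrightarrow> A2_weight \<alpha> z = 0"
  by (simp add: A2_weight_def)

lemma A2_weight_measurable [measurable]: "A2_weight \<alpha> \<in> borel_measurable borel"
  unfolding A2_weight_def dA_dens_def by measurable

lemma measurable_indicator_holomorphic: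
  assumes "f holomorphic_on udisc"
  shows "(\<lambda>z. indicat_real udisc z *\<^sub>R f z) \<in> borel_measurable borel"
  using assms by (intro borel_measurable_continuous_on_indicator holomorphic_on_imp_continuous_on) auto

lemma measurable_weight_mult:
  fixes h :: "complex \<Rightarrow> complex"
  assumes "(\<lambda>z. indicat_real udisc z *\<^sub>R h z) \<in> borel_measurable borel"
  shows "(\<lambda>z. A2_weight \<alpha> z *\<^sub>R h z) \<in> borel_measurable borel"
proof -
  define H where "H = (\<lambda>z. indicat_real udisc z *\<^sub>R h z)"
  have [measurable]: "H \<in> borel_measurable borel" using assms by (simp add: H_def)
  have eq: "(\<lambda>z. A2_weight \<alpha> z *\<^sub>R h z) = (\<lambda>z. A2_weight \<alpha> z *\<^sub>R H z)"
    by (auto simp: A2_weight_def indicator_def H_def)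
  show ?thesis unfolding eq by measurable
qed

lemma measurable_weight_inner:
  assumes "f holomorphic_on udisc" "g holomorphic_on udisc"
  shows "(\<lambda>z. A2_weight \<alpha> z *\<^sub>R (f z * cnj (g z))) \<in> borel_measurable borel"
proof (rule measurable_weight_mult)
  define F G where "F = (\<lambda>z. indicat_real udisc z *\<^sub>R f z)" and "G = (\<lambda>z. indicat_real udisc z *\<^sub>R g z)"
  have [measurable]: "F \<in> borel_measurable borel" "G \<in> borel_measurable borel" "cnj \<in> borel_measurable borel"
    using assms[THEN measurable_indicator_holomorphic]
    by (auto simp: F_def G_def intro!: borel_measurable_continuous_onI continuous_intros)
  have eq: "(\<lambda>z. indicat_real udisc z *\<^sub>R (f z * cnj (g z))) = (\<lambda>z. F z * cnj (G z))"
    by (auto simp: indicator_def F_def G_def)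
  show "(\<lambda>z. indicat_real udisc z *\<^sub>R (f z * cnj (g z))) \<in> borel_measurable borel"
    unfolding eq by measurable
qed

lemma measurable_weight_norm2:
  assumes "f holomorphic_on udisc"
  shows "(\<lambda>z. A2_weight \<alpha> z * (cmod (f z))\<^sup>2) \<in> borel_measurable borel"
proof -
  define F where "F = (\<lambda>z. indicat_real udisc z *\<^sub>R f z)"
  have [measurable]: "F \<in> borel_measurable borel"
    using measurable_indicator_holomorphic[OF assms] by (simp add: F_def)
  have eq: "(\<lambda>z. A2_weight \<alpha> z * (cmod (f z))\<^sup>2) = (\<lambda>z. A2_weight \<alpha> z * (cmod (F z))\<^sup>2)"
    by (auto simp: A2_weight_def indicator_def F_def)
  show ?thesis unfolding eq by measurable
qed

lemma bergman_int_weight: "bergman_int \<alpha> f = (\<integral>\<^sup>+z. ennreal (A2_weight \<alpha> z * (cmod (f z))\<^sup>2) \<partial>lborel)"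
  unfolding bergman_int_def A2_weight_def by (intro nn_integral_cong) (auto simp: indicator_def)

lemma bergman_int_cong: "(\<And>z. z \<in> udisc \<Longrightarrow> f z = g z) \<Longrightarrow> bergman_int \<alpha> f = bergman_int \<alpha> g"
  unfolding bergman_int_def by (intro nn_integral_cong) (auto simp: indicator_def)

lemma A2_norm_cong: "(\<And>z. z \<in> udisc \<Longrightarrow> f z = g z) \<Longrightarrow> A2_norm \<alpha> f = A2_norm \<alpha> g"
  unfolding A2_norm_def by (simp cong: bergman_int_cong)

lemma in_A2_cong: "(\<And>z. z \<in> udisc \<Longrightarrow> f z = g z) \<Longrightarrow> in_A2 \<alpha> f = in_A2 \<alpha> g"
  unfolding in_A2_def using bergman_int_cong[of f g \<alpha>] holomorphic_cong[of udisc udisc f g] by auto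

lemma A2_inner_cong:
  "(\<And>z. z \<in> udisc \<Longrightarrow> f z = f' z) \<Longrightarrow> (\<And>z. z \<in> udisc \<Longrightarrow> g z = g' z) \<Longrightarrow> A2_inner \<alpha> f g = A2_inner \<alpha> f' g'"
  unfolding A2_inner_def by (intro Bochner_Integration.integral_cong) (auto simp: A2_weight_def indicator_def)

lemma A2_norm_nonneg [simp]: "A2_norm \<alpha> f \<ge> 0" by (simp add: A2_norm_def)

context
  fixes \<alpha> :: real
  assumes alpha: "\<alpha> > -1"
begin

lemma in_A2_integrable:
  assumes "in_A2 \<alpha> f"
  shows "integrable lborel (\<lambda>z. A2_weight \<alpha> z * (cmod (f z))\<^sup>2)"
  using assms measurable_weight_norm2[of f \<alpha>] A2_weight_nonneg[OF alpha]
  by (intro integrableI_nonneg) (auto simp: in_A2_def bergman_int_weight)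

lemma A2_norm_square_integral:
  assumes "f holomorphic_on udisc"
  shows "(A2_norm \<alpha> f)\<^sup>2 = (LINT z|lborel. A2_weight \<alpha> z * (cmod (f z))\<^sup>2)"
  using measurable_weight_norm2[OF assms, of \<alpha>] A2_weight_nonneg[OF alpha]
  by (simp add: A2_norm_def bergman_int_weight integral_eq_nn_integral)

lemma bergman_int_A2_norm: "in_A2 \<alpha> f \<Longrightarrow> bergman_int \<alpha> f = ennreal ((A2_norm \<alpha> f)\<^sup>2)"
  by (simp add: A2_norm_def in_A2_def)

lemma A2_inner_integrable:
  assumes "in_A2 \<alpha> f" "in_A2 \<alpha> g"
  shows "integrable lborel (\<lambda>z. A2_weight \<alpha> z *\<^sub>R (f z * cnj (g z)))"
proof (rule Bochner_Integration.integrable_bound)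
  show "integrable lborel (\<lambda>z. A2_weight \<alpha> z * (cmod (f z))\<^sup>2 + A2_weight \<alpha> z * (cmod (g z))\<^sup>2)"
    using assms by (intro Bochner_Integration.integrable_add in_A2_integrable)
  show "(\<lambda>z. A2_weight \<alpha> z *\<^sub>R (f z * cnj (g z))) \<in> borel_measurable lborel"
    using assms measurable_weight_inner[of f g \<alpha>] by (simp add: in_A2_def)
  show "AE z in lborel. norm (A2_weight \<alpha> z *\<^sub>R (f z * cnj (g z)))
      \<le> norm (A2_weight \<alpha> z * (cmod (f z))\<^sup>2 + A2_weight \<alpha> z * (cmod (g z))\<^sup>2)"
  proof (intro AE_I2)
    fix z
    have "cmod (f z) * cmod (g z) \<le> (cmod (f z))\<^sup>2 + (cmod (g z))\<^sup>2"
    proof -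
      have "0 \<le> cmod (f z) * cmod (g z)" by simp
      then show ?thesis using sum_squares_bound[of "cmod (f z)" "cmod (g z)"] by linarith
    qed
    then have "A2_weight \<alpha> z * (cmod (f z) * cmod (g z)) \<le> A2_weight \<alpha> z * ((cmod (f z))\<^sup>2 + (cmod (g z))\<^sup>2)"
      using A2_weight_nonneg[OF alpha] by (intro mult_left_mono)
    then show "norm (A2_weight \<alpha> z *\<^sub>R (f z * cnj (g z)))
      \<le> norm (A2_weight \<alpha> z * (cmod (f z))\<^sup>2 + A2_weight \<alpha> z * (cmod (g z))\<^sup>2)"
      using A2_weight_nonneg[OF alpha, of z] by (simp add: norm_mult algebra_simps)
  qed
qed

lemma in_A2_bound:
  assumes "f holomorphic_on udisc" "in_A2 \<alpha> g" "\<And>z. z \<in> udisc \<Longrightarrow> cmod (f z) \<le> B * cmod (g z)"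
  shows "in_A2 \<alpha> f" "B \<ge> 0 \<Longrightarrow> A2_norm \<alpha> f \<le> B * A2_norm \<alpha> g"
proof -
  have "bergman_int \<alpha> f \<le> (\<integral>\<^sup>+z. ennreal (B\<^sup>2) * ennreal (A2_weight \<alpha> z * (cmod (g z))\<^sup>2) \<partial>lborel)"
    unfolding bergman_int_weight
  proof (intro nn_integral_mono)
    fix z
    show "ennreal (A2_weight \<alpha> z * (cmod (f z))\<^sup>2) \<le> ennreal (B\<^sup>2) * ennreal (A2_weight \<alpha> z * (cmod (g z))\<^sup>2)"
    proof (cases "z \<in> udisc")
      case True
      have "(cmod (f z))\<^sup>2 \<le> (B * cmod (g z))\<^sup>2" using assms(3)[OF True] by (intro power_mono) auto
      then have "A2_weight \<alpha> z * (cmod (f z))\<^sup>2 \<le> A2_weight \<alpha> z * (B * cmod (g z))\<^sup>2"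
        using A2_weight_nonneg[OF alpha] by (intro mult_left_mono)
      then show ?thesis using A2_weight_nonneg[OF alpha, of z]
        by (simp add: ennreal_mult[symmetric] power_mult_distrib mult_ac)
    qed (simp add: A2_weight_outside)
  qed
  also have "\<dots> = ennreal (B\<^sup>2) * bergman_int \<alpha> g"
    unfolding bergman_int_weight using assms(2) measurable_weight_norm2[of g \<alpha>]
    by (intro nn_integral_cmult) (auto simp: in_A2_def)
  finally have le: "bergman_int \<alpha> f \<le> ennreal (B\<^sup>2) * bergman_int \<alpha> g" .
  have "\<dots> < \<infinity>" using assms(2) by (simp add: in_A2_def ennreal_mult_less_top)
  from le_less_trans[OF le this] show f: "in_A2 \<alpha> f" using assms(1) by (simp add: in_A2_def)
  assume B: "B \<ge> 0"
  have "ennreal ((A2_norm \<alpha> f)\<^sup>2) \<le> ennreal ((B * A2_norm \<alpha> g)\<^sup>2)"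
    using le unfolding bergman_int_A2_norm[OF f] bergman_int_A2_norm[OF assms(2)]
    by (simp only: power_mult_distrib ennreal_mult' zero_le_power2)
  then have "(A2_norm \<alpha> f)\<^sup>2 \<le> (B * A2_norm \<alpha> g)\<^sup>2" by (subst (asm) ennreal_le_iff) simp_all
  then show "A2_norm \<alpha> f \<le> B * A2_norm \<alpha> g" by (rule power2_le_imp_le) (simp add: B)
qed

lemma in_A2_cmult: "in_A2 \<alpha> f \<Longrightarrow> in_A2 \<alpha> (\<lambda>z. c * f z)"
  by (rule in_A2_bound(1)[of _ f "cmod c"]) (auto simp: in_A2_def norm_mult intro!: holomorphic_intros)

lemma in_A2_add:
  assumes "in_A2 \<alpha> f" "in_A2 \<alpha> g"
  shows "in_A2 \<alpha> (\<lambda>z. f z + g z)"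
proof -
  have "bergman_int \<alpha> (\<lambda>z. f z + g z) \<le> (\<integral>\<^sup>+z. ennreal (2 * (A2_weight \<alpha> z * (cmod (f z))\<^sup>2) + 2 * (A2_weight \<alpha> z * (cmod (g z))\<^sup>2)) \<partial>lborel)"
    unfolding bergman_int_weight
  proof (intro nn_integral_mono ennreal_leI)
    fix z
    have "(cmod (f z + g z))\<^sup>2 \<le> (cmod (f z) + cmod (g z))\<^sup>2"
      by (intro power_mono norm_triangle_ineq) auto
    also have "\<dots> \<le> 2 * (cmod (f z))\<^sup>2 + 2 * (cmod (g z))\<^sup>2"
      using sum_squares_bound[of "cmod (f z)" "cmod (g z)"] by (simp add: power2_sum)
    finally have "A2_weight \<alpha> z * (cmod (f z + g z))\<^sup>2 \<le> A2_weight \<alpha> z * (2 * (cmod (f z))\<^sup>2 + 2 * (cmod (g z))\<^sup>2)"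
      using A2_weight_nonneg[OF alpha] by (intro mult_left_mono)
    then show "A2_weight \<alpha> z * (cmod (f z + g z))\<^sup>2 \<le> 2 * (A2_weight \<alpha> z * (cmod (f z))\<^sup>2) + 2 * (A2_weight \<alpha> z * (cmod (g z))\<^sup>2)"
      by (simp add: algebra_simps)
  qed
  also have "\<dots> < \<infinity>"
    using A2_weight_nonneg[OF alpha] assms[THEN in_A2_integrable]
    by (subst nn_integral_eq_integral) auto
  finally show ?thesis using assms by (auto simp: in_A2_def intro!: holomorphic_intros)
qed

lemma in_A2_zero: "in_A2 \<alpha> (\<lambda>z. 0)"
  by (simp add: in_A2_def bergman_int_weight)

lemma in_A2_diff: "in_A2 \<alpha> f \<Longrightarrow> in_A2 \<alpha> g \<Longrightarrow> in_A2 \<alpha> (\<lambda>z. f z - g z)"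
  using in_A2_add[of f "\<lambda>z. (-1) * g z"] in_A2_cmult[of g "-1"] by simp

lemma in_A2_sum: "(\<And>i. i \<in> I \<Longrightarrow> in_A2 \<alpha> (f i)) \<Longrightarrow> in_A2 \<alpha> (\<lambda>z. \<Sum>i\<in>I. f i z)"
  by (induction I rule: infinite_finite_induct) (auto simp: in_A2_zero intro!: in_A2_add)

lemma in_A2_monomial: "in_A2 \<alpha> (\<lambda>z. z ^ n)"
  by (auto simp: in_A2_def bergman_int_monomial[OF alpha] intro!: holomorphic_intros)

lemma in_A2_bounded:
  assumes "f holomorphic_on udisc" "\<And>z. z \<in> udisc \<Longrightarrow> cmod (f z) \<le> B"
  shows "in_A2 \<alpha> f" "B \<ge> 0 \<Longrightarrow> A2_norm \<alpha> f \<le> B"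
proof -
  have one: "in_A2 \<alpha> (\<lambda>z. 1)" using in_A2_monomial[of 0] by simp
  \<comment> \<open>The weighted area is a probability measure, so the supremum norm dominates
    \<open>A2_norm\<close>; later this bounds the tails of power series.\<close>
  have "bergman_int \<alpha> (\<lambda>z. 1) = 1"
    using bergman_int_monomial[OF alpha, of 0] alpha Gamma_plus1[of "\<alpha> + 1"] Gamma_real_pos[of "\<alpha> + 1"]
    by (simp add: monomial_norm2_def Beta_def add.commute Gamma_eq_zero_iff nonpos_Ints_def)
  then have "A2_norm \<alpha> (\<lambda>z. 1) = 1" by (simp add: A2_norm_def)
  then show "in_A2 \<alpha> f" "B \<ge> 0 \<Longrightarrow> A2_norm \<alpha> f \<le> B"
    using in_A2_bound[OF assms(1) one, of B] assms(2) by auto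
qed

lemma A2_inner_self: "in_A2 \<alpha> f \<Longrightarrow> A2_inner \<alpha> f f = of_real ((A2_norm \<alpha> f)\<^sup>2)"
proof -
  assume f: "in_A2 \<alpha> f"
  have "A2_inner \<alpha> f f = (LINT z|lborel. complex_of_real (A2_weight \<alpha> z * (cmod (f z))\<^sup>2))"
    unfolding A2_inner_def complex_norm_square[symmetric] by (simp add: scaleR_conv_of_real complex_norm_square)
  also have "\<dots> = of_real (LINT z|lborel. A2_weight \<alpha> z * (cmod (f z))\<^sup>2)" by (rule integral_complex_of_real)
  finally show ?thesis using f by (simp add: A2_norm_square_integral in_A2_def)
qed

lemma A2_inner_cnj: "cnj (A2_inner \<alpha> f g) = A2_inner \<alpha> g f"
  unfolding A2_inner_def by (subst Bochner_Integration.integral_cnj[symmetric]) (simp add: mult.commute)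

lemma A2_inner_add_left:
  assumes "in_A2 \<alpha> f" "in_A2 \<alpha> g" "in_A2 \<alpha> h"
  shows "A2_inner \<alpha> (\<lambda>z. f z + g z) h = A2_inner \<alpha> f h + A2_inner \<alpha> g h"
  using Bochner_Integration.integral_add[OF A2_inner_integrable[OF assms(1,3)] A2_inner_integrable[OF assms(2,3)]]
  by (simp add: A2_inner_def algebra_simps)

lemma A2_inner_cmult_left: "A2_inner \<alpha> (\<lambda>z. c * f z) g = c * A2_inner \<alpha> f g"
  unfolding A2_inner_def
  by (subst integral_mult_right_zero[symmetric], rule Bochner_Integration.integral_cong) auto

lemma A2_inner_diff_left:
  assumes "in_A2 \<alpha> f" "in_A2 \<alpha> g" "in_A2 \<alpha> h"
  shows "A2_inner \<alpha> (\<lambda>z. f z - g z) h = A2_inner \<alpha> f h - A2_inner \<alpha> g h"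
  using A2_inner_add_left[OF assms(1) in_A2_cmult[OF assms(2), of "-1"] assms(3)] A2_inner_cmult_left[of "-1" g h]
  by simp

lemma A2_inner_zero_left: "A2_inner \<alpha> (\<lambda>z. 0) g = 0"
  by (simp add: A2_inner_def)

lemma A2_inner_sum_left:
  assumes "\<And>i. i \<in> I \<Longrightarrow> in_A2 \<alpha> (f i)" "in_A2 \<alpha> g"
  shows "A2_inner \<alpha> (\<lambda>z. \<Sum>i\<in>I. c i * f i z) g = (\<Sum>i\<in>I. c i * A2_inner \<alpha> (f i) g)"
  using assms
proof (induction I rule: infinite_finite_induct)
  case (insert x F)
  have "A2_inner \<alpha> (\<lambda>z. c x * f x z + (\<Sum>i\<in>F. c i * f i z)) g = A2_inner \<alpha> (\<lambda>z. c x * f x z) g + A2_inner \<alpha> (\<lambda>z. \<Sum>i\<in>F. c i * f i z) g"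
    using insert by (intro A2_inner_add_left in_A2_cmult in_A2_sum) auto
  then show ?case using insert by (simp add: A2_inner_cmult_left)
qed (simp_all add: A2_inner_zero_left)

lemma A2_inner_sum_right:
  assumes "\<And>i. i \<in> I \<Longrightarrow> in_A2 \<alpha> (f i)" "in_A2 \<alpha> g"
  shows "A2_inner \<alpha> g (\<lambda>z. \<Sum>i\<in>I. c i * f i z) = (\<Sum>i\<in>I. cnj (c i) * A2_inner \<alpha> g (f i))"
proof -
  have "cnj (A2_inner \<alpha> (\<lambda>z. \<Sum>i\<in>I. c i * f i z) g) = cnj (\<Sum>i\<in>I. c i * A2_inner \<alpha> (f i) g)"
    using A2_inner_sum_left[of I f g c] assms by simp
  then show ?thesis by (simp add: A2_inner_cnj cnj_sum)
qed

text \<open>The squared norm of a difference is expanded without any orthogonality assumption. One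
  term with a free coefficient yields the Cauchy-Schwarz and triangle inequalities, and an
  orthonormal system yields Bessel's.\<close>

lemma A2_norm_sub_proj:
  assumes "in_A2 \<alpha> f" "\<And>i. i < n \<Longrightarrow> in_A2 \<alpha> (e i)"
  shows "complex_of_real ((A2_norm \<alpha> (\<lambda>z. f z - (\<Sum>i<n. c i * e i z)))\<^sup>2)
    = of_real ((A2_norm \<alpha> f)\<^sup>2) - (\<Sum>i<n. cnj (c i) * A2_inner \<alpha> f (e i)) - (\<Sum>i<n. c i * A2_inner \<alpha> (e i) f)
      + (\<Sum>i<n. \<Sum>j<n. c i * cnj (c j) * A2_inner \<alpha> (e i) (e j))"
proof -
  let ?g = "\<lambda>z. \<Sum>i<n. c i * e i z"
  have g: "in_A2 \<alpha> ?g" using assms by (intro in_A2_sum in_A2_cmult) auto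
  have "complex_of_real ((A2_norm \<alpha> (\<lambda>z. f z - ?g z))\<^sup>2) = A2_inner \<alpha> (\<lambda>z. f z - ?g z) (\<lambda>z. f z - ?g z)"
    using assms g by (simp add: A2_inner_self in_A2_diff)
  also have "\<dots> = A2_inner \<alpha> f (\<lambda>z. f z - ?g z) - A2_inner \<alpha> ?g (\<lambda>z. f z - ?g z)"
    using assms g by (intro A2_inner_diff_left in_A2_diff) auto
  also have "A2_inner \<alpha> f (\<lambda>z. f z - ?g z) = cnj (A2_inner \<alpha> (\<lambda>z. f z - ?g z) f)" by (simp add: A2_inner_cnj)
  also have "\<dots> = A2_inner \<alpha> f f - A2_inner \<alpha> f ?g"
    using assms g by (simp add: A2_inner_diff_left A2_inner_cnj)
  also have "A2_inner \<alpha> ?g (\<lambda>z. f z - ?g z) = cnj (A2_inner \<alpha> (\<lambda>z. f z - ?g z) ?g)" by (simp add: A2_inner_cnj)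
  also have "\<dots> = A2_inner \<alpha> ?g f - A2_inner \<alpha> ?g ?g"
    using assms g by (simp add: A2_inner_diff_left A2_inner_cnj)
  also have "A2_inner \<alpha> f ?g = (\<Sum>i<n. cnj (c i) * A2_inner \<alpha> f (e i))"
    using assms by (intro A2_inner_sum_right) auto
  also have "A2_inner \<alpha> ?g f = (\<Sum>i<n. c i * A2_inner \<alpha> (e i) f)"
    using assms by (intro A2_inner_sum_left) auto
  also have "A2_inner \<alpha> ?g ?g = (\<Sum>i<n. c i * A2_inner \<alpha> (e i) ?g)"
    using assms g by (intro A2_inner_sum_left) auto
  also have "\<dots> = (\<Sum>i<n. c i * (\<Sum>j<n. cnj (c j) * A2_inner \<alpha> (e i) (e j)))"
    using assms by (intro sum.cong refl arg_cong2[where f="(*)"] A2_inner_sum_right) auto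
  finally show ?thesis using assms
    by (simp add: A2_inner_self sum_distrib_left mult.assoc algebra_simps)
qed

text \<open>With \<open>c\<close> the inner product, the squared norm of
  \<open>f - t * c * g\<close> is a nonnegative quadratic in the real number \<open>t\<close>. It is
  evaluated at its minimum \<open>1 / (A2_norm \<alpha> g)\<^sup>2\<close>; if
  \<open>A2_norm \<alpha> g\<close> is 0, a large \<open>t\<close> would make it negative unless
  \<open>c\<close> is 0.\<close>

lemma A2_inner_Cauchy_Schwarz:
  assumes "in_A2 \<alpha> f" "in_A2 \<alpha> g"
  shows "cmod (A2_inner \<alpha> f g) \<le> A2_norm \<alpha> f * A2_norm \<alpha> g"
proof -
  define c where "c = A2_inner \<alpha> f g"
  have *: "0 \<le> (A2_norm \<alpha> f)\<^sup>2 - 2 * t * (cmod c)\<^sup>2 + t\<^sup>2 * (cmod c)\<^sup>2 * (A2_norm \<alpha> g)\<^sup>2" for t :: real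
  proof -
    have gf: "A2_inner \<alpha> g f = cnj c" by (simp add: c_def A2_inner_cnj)
    have cc: "cnj c * c = of_real ((cmod c)\<^sup>2)" "c * cnj c = of_real ((cmod c)\<^sup>2)"
      by (simp_all only: complex_norm_square mult.commute)
    have "complex_of_real ((A2_norm \<alpha> (\<lambda>z. f z - (\<Sum>i<1::nat. (of_real t * c) * g z)))\<^sup>2)
      = of_real ((A2_norm \<alpha> f)\<^sup>2) - of_real t * (cnj c * c) - of_real t * (c * cnj c) + of_real t * of_real t * (c * cnj c) * of_real ((A2_norm \<alpha> g)\<^sup>2)"
      using assms by (subst A2_norm_sub_proj) (simp_all add: c_def[symmetric] gf A2_inner_self mult_ac)
    also have "\<dots> = of_real ((A2_norm \<alpha> f)\<^sup>2 - 2 * t * (cmod c)\<^sup>2 + t\<^sup>2 * (cmod c)\<^sup>2 * (A2_norm \<alpha> g)\<^sup>2)"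
      unfolding cc by (simp add: power2_eq_square algebra_simps)
    finally have "(A2_norm \<alpha> (\<lambda>z. f z - (\<Sum>i<1::nat. (of_real t * c) * g z)))\<^sup>2
       = (A2_norm \<alpha> f)\<^sup>2 - 2 * t * (cmod c)\<^sup>2 + t\<^sup>2 * (cmod c)\<^sup>2 * (A2_norm \<alpha> g)\<^sup>2"
      by (simp only: of_real_eq_iff)
    then show ?thesis by (metis zero_le_power2)
  qed
  have "(cmod c)\<^sup>2 \<le> (A2_norm \<alpha> f)\<^sup>2 * (A2_norm \<alpha> g)\<^sup>2"
  proof (cases "A2_norm \<alpha> g = 0")
    case False
    then have "0 \<le> (A2_norm \<alpha> f)\<^sup>2 - (cmod c)\<^sup>2 / (A2_norm \<alpha> g)\<^sup>2"
      using *[of "1 / (A2_norm \<alpha> g)\<^sup>2"] by (simp add: power2_eq_square field_simps)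
    then show ?thesis using False by (simp add: field_simps)
  next
    case True
    have "(cmod c)\<^sup>2 = 0"
    proof (rule ccontr)
      assume "(cmod c)\<^sup>2 \<noteq> 0"
      then show False using *[of "((A2_norm \<alpha> f)\<^sup>2 + 1) / (2 * (cmod c)\<^sup>2)"] True by (simp add: field_simps)
    qed
    then show ?thesis by simp
  qed
  then have "(cmod c)\<^sup>2 \<le> (A2_norm \<alpha> f * A2_norm \<alpha> g)\<^sup>2" by (simp add: power_mult_distrib)
  then show ?thesis unfolding c_def by (rule power2_le_imp_le) simp
qed

lemma A2_norm_triangle:
  assumes "in_A2 \<alpha> f" "in_A2 \<alpha> g"
  shows "A2_norm \<alpha> (\<lambda>z. f z + g z) \<le> A2_norm \<alpha> f + A2_norm \<alpha> g"
proof (rule power2_le_imp_le)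
  have "complex_of_real ((A2_norm \<alpha> (\<lambda>z. f z - (\<Sum>i<1::nat. (-1) * g z)))\<^sup>2)
    = of_real ((A2_norm \<alpha> f)\<^sup>2) + A2_inner \<alpha> f g + cnj (A2_inner \<alpha> f g) + of_real ((A2_norm \<alpha> g)\<^sup>2)"
    using assms by (subst A2_norm_sub_proj) (simp_all add: A2_inner_cnj A2_inner_self)
  then have "Re (complex_of_real ((A2_norm \<alpha> (\<lambda>z. f z + g z))\<^sup>2))
    = Re (of_real ((A2_norm \<alpha> f)\<^sup>2) + A2_inner \<alpha> f g + cnj (A2_inner \<alpha> f g) + of_real ((A2_norm \<alpha> g)\<^sup>2))"
    by simp
  then have "(A2_norm \<alpha> (\<lambda>z. f z + g z))\<^sup>2 = (A2_norm \<alpha> f)\<^sup>2 + 2 * Re (A2_inner \<alpha> f g) + (A2_norm \<alpha> g)\<^sup>2"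
    by (simp only: Re_complex_of_real plus_complex.sel complex_cnj) simp
  also have "\<dots> \<le> (A2_norm \<alpha> f)\<^sup>2 + 2 * (A2_norm \<alpha> f * A2_norm \<alpha> g) + (A2_norm \<alpha> g)\<^sup>2"
    using A2_inner_Cauchy_Schwarz[OF assms] complex_Re_le_cmod[of "A2_inner \<alpha> f g"] by simp
  finally show "(A2_norm \<alpha> (\<lambda>z. f z + g z))\<^sup>2 \<le> (A2_norm \<alpha> f + A2_norm \<alpha> g)\<^sup>2"
    by (simp add: power2_sum)
qed simp

lemma A2_norm_cmult: "in_A2 \<alpha> f \<Longrightarrow> A2_norm \<alpha> (\<lambda>z. c * f z) = cmod c * A2_norm \<alpha> f"
proof -
  assume f: "in_A2 \<alpha> f"
  have "complex_of_real ((A2_norm \<alpha> (\<lambda>z. c * f z))\<^sup>2) = A2_inner \<alpha> (\<lambda>z. c * f z) (\<lambda>z. c * f z)"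
    using f by (simp add: A2_inner_self in_A2_cmult)
  also have "\<dots> = c * cnj (A2_inner \<alpha> (\<lambda>z. c * f z) f)" by (simp only: A2_inner_cmult_left[of c f "\<lambda>z. c * f z"] A2_inner_cnj)
  also have "\<dots> = (c * cnj c) * of_real ((A2_norm \<alpha> f)\<^sup>2)"
    using f by (simp add: A2_inner_cmult_left A2_inner_self)
  also have "\<dots> = of_real ((cmod c * A2_norm \<alpha> f)\<^sup>2)"
    unfolding power_mult_distrib of_real_mult complex_norm_square by (rule refl)
  finally have "(A2_norm \<alpha> (\<lambda>z. c * f z))\<^sup>2 = (cmod c * A2_norm \<alpha> f)\<^sup>2" by (simp only: of_real_eq_iff)
  then show ?thesis by simp
qed

definition A2_orthonormal :: "nat \<Rightarrow> (nat \<Rightarrow> complex \<Rightarrow> complex) \<Rightarrow> bool" where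
  "A2_orthonormal n e \<longleftrightarrow> (\<forall>i<n. in_A2 \<alpha> (e i)) \<and> (\<forall>i<n. \<forall>j<n. A2_inner \<alpha> (e i) (e j) = (if i = j then 1 else 0))"

lemma A2_orthonormal_residual:
  assumes "A2_orthonormal n e" "in_A2 \<alpha> f"
  shows "(A2_norm \<alpha> (\<lambda>z. f z - (\<Sum>i<n. A2_inner \<alpha> f (e i) * e i z)))\<^sup>2 = (A2_norm \<alpha> f)\<^sup>2 - (\<Sum>i<n. (cmod (A2_inner \<alpha> f (e i)))\<^sup>2)"
proof -
  have e: "\<And>i. i < n \<Longrightarrow> in_A2 \<alpha> (e i)" using assms by (auto simp: A2_orthonormal_def)
  have on: "A2_inner \<alpha> (e i) (e j) = (if i = j then 1 else 0)" if "i < n" "j < n" for i j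
    using assms that by (auto simp: A2_orthonormal_def)
  have ec: "A2_inner \<alpha> (e i) f = cnj (A2_inner \<alpha> f (e i))" for i by (simp add: A2_inner_cnj)
  let ?c = "\<lambda>i. A2_inner \<alpha> f (e i)"
  have "(\<Sum>i<n. \<Sum>j<n. ?c i * cnj (?c j) * A2_inner \<alpha> (e i) (e j)) = (\<Sum>i<n. \<Sum>j<n. if i = j then ?c i * cnj (?c j) else 0)"
    by (intro sum.cong refl) (auto simp: on)
  also have "\<dots> = (\<Sum>i<n. ?c i * cnj (?c i))" by (simp add: sum.delta)
  finally have dbl: "(\<Sum>i<n. \<Sum>j<n. ?c i * cnj (?c j) * A2_inner \<alpha> (e i) (e j)) = (\<Sum>i<n. ?c i * cnj (?c i))" .
  have "complex_of_real ((A2_norm \<alpha> (\<lambda>z. f z - (\<Sum>i<n. ?c i * e i z)))\<^sup>2)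
      = of_real ((A2_norm \<alpha> f)\<^sup>2) - (\<Sum>i<n. ?c i * cnj (?c i))"
    by (subst A2_norm_sub_proj[OF assms(2) e], assumption, unfold dbl ec) (simp add: mult.commute)
  also have "\<dots> = of_real ((A2_norm \<alpha> f)\<^sup>2 - (\<Sum>i<n. (cmod (?c i))\<^sup>2))"
    unfolding of_real_diff of_real_sum complex_norm_square by (rule refl)
  finally show ?thesis by (simp only: of_real_eq_iff)
qed

lemma A2_Bessel:
  assumes "A2_orthonormal n e" "in_A2 \<alpha> f"
  shows "(\<Sum>i<n. (cmod (A2_inner \<alpha> f (e i)))\<^sup>2) \<le> (A2_norm \<alpha> f)\<^sup>2"
proof -
  have "0 \<le> (A2_norm \<alpha> f)\<^sup>2 - (\<Sum>i<n. (cmod (A2_inner \<alpha> f (e i)))\<^sup>2)"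
    unfolding A2_orthonormal_residual[OF assms, symmetric] by (rule zero_le_power2)
  then show ?thesis by linarith
qed

lemma A2_residual_orthogonal:
  assumes "A2_orthonormal n e" "in_A2 \<alpha> f" "j < n"
  shows "A2_inner \<alpha> (\<lambda>z. f z - (\<Sum>i<n. A2_inner \<alpha> f (e i) * e i z)) (e j) = 0"
proof -
  have e: "\<And>i. i < n \<Longrightarrow> in_A2 \<alpha> (e i)" using assms by (auto simp: A2_orthonormal_def)
  have "A2_inner \<alpha> (\<lambda>z. f z - (\<Sum>i<n. A2_inner \<alpha> f (e i) * e i z)) (e j)
     = A2_inner \<alpha> f (e j) - A2_inner \<alpha> (\<lambda>z. \<Sum>i<n. A2_inner \<alpha> f (e i) * e i z) (e j)"
    using assms e by (intro A2_inner_diff_left in_A2_sum in_A2_cmult) auto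
  also have "A2_inner \<alpha> (\<lambda>z. \<Sum>i<n. A2_inner \<alpha> f (e i) * e i z) (e j) = (\<Sum>i<n. A2_inner \<alpha> f (e i) * A2_inner \<alpha> (e i) (e j))"
    using assms e by (intro A2_inner_sum_left) auto
  also have "\<dots> = (\<Sum>i<n. if i = j then A2_inner \<alpha> f (e i) else 0)"
    using assms by (intro sum.cong refl) (auto simp: A2_orthonormal_def)
  also have "\<dots> = A2_inner \<alpha> f (e j)" using assms(3) by simp
  finally show ?thesis by simp
qed

end

section \<open>Power series and reproducing kernels\<close>

context
  fixes \<alpha> :: real
  assumes alpha: "\<alpha> > -1"
begin

lemma A2_inner_radial:
  "A2_inner \<alpha> f g = (LINT w|lborel. (if cmod w < 1 then (\<alpha> + 1) / pi * (1 - (cmod w)\<^sup>2) powr \<alpha> else 0) *\<^sub>R (f w * cnj (g w)))"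
  unfolding A2_inner_def A2_weight_def dA_dens_def mem_udisc
  by (intro Bochner_Integration.integral_cong) (auto simp: indicator_def mem_udisc)

lemma A2_inner_monomials:
  "A2_inner \<alpha> (\<lambda>w. w ^ n) (\<lambda>w. w ^ m) = (if n = m then of_real (monomial_norm2 \<alpha> n) else 0)"
proof (cases "n = m")
  case True
  have "(A2_norm \<alpha> (\<lambda>w. w ^ n))\<^sup>2 = monomial_norm2 \<alpha> n"
    using monomial_norm2_pos[OF alpha, of n] by (simp add: A2_norm_def bergman_int_monomial[OF alpha])
  then show ?thesis using True A2_inner_self[OF alpha in_A2_monomial[OF alpha], of n] by simp
next
  case False
  have "A2_inner \<alpha> (\<lambda>w. w ^ n) (\<lambda>w. w ^ m)
    = (LINT w|lborel. (\<lambda>r. if r < 1 then (\<alpha> + 1) / pi * (1 - r\<^sup>2) powr \<alpha> else 0) (cmod w) *\<^sub>R (w ^ n * cnj w ^ m))"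
    unfolding A2_inner_radial by simp
  also have "\<dots> = 0" using False by (intro monomials_orthogonal_radial) measurable
  finally show ?thesis using False by simp
qed

text \<open>The Taylor series of \<open>f\<close> is only known to converge uniformly on smaller
  discs, where its terms can be integrated one by one. Dominated convergence then passes from radius
  \<open>1 - 1 / (k + 2)\<close> to the full disc; the shift by 2 keeps the radii strictly between 0
  and 1.\<close>

lemma A2_inner_truncated_limit:
  assumes f: "in_A2 \<alpha> f" and g: "in_A2 \<alpha> g"
  shows "(\<lambda>k. LINT w|lborel. (if cmod w < 1 - 1 / real (k + 2) then A2_weight \<alpha> w else 0) *\<^sub>R (f w * cnj (g w))) \<longlonglongrightarrow> A2_inner \<alpha> f g"
  unfolding A2_inner_def
proof (rule integral_dominated_convergence)
  let ?F = "\<lambda>w. A2_weight \<alpha> w *\<^sub>R (f w * cnj (g w))"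
  show meas: "?F \<in> borel_measurable lborel"
    using f g measurable_weight_inner[of f g \<alpha>] by (simp add: in_A2_def)
  show "integrable lborel (\<lambda>w. norm (?F w))"
    using A2_inner_integrable[OF alpha f g] by (rule integrable_norm)
  fix k
  define H where "H = ?F"
  have [measurable]: "H \<in> borel_measurable borel" using meas by (simp add: H_def)
  have eq: "(\<lambda>w. (if cmod w < 1 - 1 / real (k + 2) then A2_weight \<alpha> w else 0) *\<^sub>R (f w * cnj (g w)))
      = (\<lambda>w. if cmod w < 1 - 1 / real (k + 2) then H w else 0)"
    by (auto simp: H_def)
  show "(\<lambda>w. (if cmod w < 1 - 1 / real (k + 2) then A2_weight \<alpha> w else 0) *\<^sub>R (f w * cnj (g w))) \<in> borel_measurable lborel"
    unfolding eq by measurable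
  show "AE w in lborel. norm ((if cmod w < 1 - 1 / real (k + 2) then A2_weight \<alpha> w else 0) *\<^sub>R (f w * cnj (g w))) \<le> norm (?F w)"
    by (intro AE_I2) auto
next
  show "AE w in lborel. (\<lambda>k. (if cmod w < 1 - 1 / real (k + 2) then A2_weight \<alpha> w else 0) *\<^sub>R (f w * cnj (g w))) \<longlonglongrightarrow> A2_weight \<alpha> w *\<^sub>R (f w * cnj (g w))"
  proof (intro AE_I2 tendsto_eventually)
    fix w :: complex
    show "\<forall>\<^sub>F k in sequentially. (if cmod w < 1 - 1 / real (k + 2) then A2_weight \<alpha> w else 0) *\<^sub>R (f w * cnj (g w)) = A2_weight \<alpha> w *\<^sub>R (f w * cnj (g w))"
    proof (cases "cmod w < 1")
      case True
      have "(\<lambda>k. 1 - 1 / real (k + 2)) \<longlonglongrightarrow> 1 - 0"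
        by (intro tendsto_diff tendsto_const LIMSEQ_ignore_initial_segment[OF lim_1_over_n])
      then have "\<forall>\<^sub>F k in sequentially. cmod w < 1 - 1 / real (k + 2)"
        using True by (intro order_tendstoD(1)) auto
      then show ?thesis by eventually_elim simp
    qed (auto simp: A2_weight_outside mem_udisc)
  qed
qed

lemma truncated_monomial_integrable:
  assumes "t < 1"
  shows "integrable lborel (\<lambda>w. (if cmod w < t then A2_weight \<alpha> w else 0) *\<^sub>R (w ^ m * cnj w ^ n))"
proof (rule Bochner_Integration.integrable_bound)
  show "integrable lborel (\<lambda>w. A2_weight \<alpha> w *\<^sub>R (w ^ m * cnj (w ^ n)))"
    by (intro A2_inner_integrable[OF alpha] in_A2_monomial[OF alpha])
  have "(\<lambda>w. w ^ m * cnj w ^ n) \<in> borel_measurable borel"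
    by (intro borel_measurable_continuous_onI continuous_intros)
  then show "(\<lambda>w. (if cmod w < t then A2_weight \<alpha> w else 0) *\<^sub>R (w ^ m * cnj w ^ n)) \<in> borel_measurable lborel"
    by measurable
qed auto

text \<open>On a disc of radius \<open>t < 1\<close> the Taylor series of \<open>f\<close> may be
  integrated termwise against \<open>cnj w ^ n\<close>, and radial orthogonality leaves only the
  term of degree \<open>n\<close>. Both sides of the resulting identity have limits as
  \<open>t\<close> tends to 1.\<close>

lemma A2_inner_monomial_coeff:
  assumes f: "in_A2 \<alpha> f"
  shows "A2_inner \<alpha> f (\<lambda>w. w ^ n) = (deriv ^^ n) f 0 / fact n * of_real (monomial_norm2 \<alpha> n)"
proof -
  define a where "a m = (deriv ^^ m) f 0 / fact m" for m
  have hol: "f holomorphic_on ball 0 1" using f by (simp add: in_A2_def udisc_def)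
  have ser: "(\<lambda>m. a m * w ^ m) sums f w" if "cmod w < 1" for w
    using holomorphic_power_series[OF hol, of w] that by (simp add: a_def)
  \<comment> \<open>Convergence at the larger radius \<open>(t + 1) / 2\<close>, still inside the
    disc, gives absolute convergence at radius \<open>t\<close>.\<close>
  have asum: "summable (\<lambda>m. norm (a m * of_real t ^ m))" if "0 \<le> t" "t < 1" for t
  proof -
    have "summable (\<lambda>m. a m * (of_real ((t + 1) / 2)) ^ m)"
      using ser[of "of_real ((t + 1) / 2)"] that by (simp add: sums_iff)
    then show ?thesis using that by (intro powser_insidea[where x="of_real ((t + 1) / 2)"]) auto
  qed
  define I where "I t g = (LINT w|lborel. (if cmod w < t then A2_weight \<alpha> w else 0) *\<^sub>R (g w * cnj w ^ n))" for t g
  have trunc: "I t f = a n * I t (\<lambda>w. w ^ n)" if t: "0 < t" "t < 1" for t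
  proof -
    let ?w = "\<lambda>w. if cmod w < t then A2_weight \<alpha> w else 0"
    let ?F = "\<lambda>m w. a m * (?w w *\<^sub>R (w ^ m * cnj w ^ n))"
    have Fint: "integrable lborel (?F m)" for m
      by (intro integrable_mult_right truncated_monomial_integrable t)
    have wle: "norm (?w w *\<^sub>R (w ^ m * cnj w ^ n)) \<le> t ^ m * A2_weight \<alpha> w" for w m
    proof (cases "cmod w < t")
      case True
      have "cmod w ^ m * cmod w ^ n \<le> t ^ m * 1"
        using True t by (intro mult_mono power_mono power_le_one) auto
      then have "A2_weight \<alpha> w * (cmod w ^ m * cmod w ^ n) \<le> A2_weight \<alpha> w * (t ^ m * 1)"
        using A2_weight_nonneg[OF alpha] by (intro mult_left_mono)
      then show ?thesis using True A2_weight_nonneg[OF alpha, of w] by (simp add: norm_mult norm_power mult.commute)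
    qed (use t A2_weight_nonneg[OF alpha, of w] in simp)
    have Fle: "norm (?F m w) \<le> norm (a m * of_real t ^ m) * A2_weight \<alpha> w" for m w
    proof -
      have "norm (?F m w) = norm (a m) * norm (?w w *\<^sub>R (w ^ m * cnj w ^ n))" by (rule norm_mult)
      also have "\<dots> \<le> norm (a m) * (t ^ m * A2_weight \<alpha> w)" by (intro mult_left_mono wle) simp
      finally show ?thesis using t by (simp add: norm_mult norm_power mult.assoc)
    qed
    have Wint: "integrable lborel (A2_weight \<alpha>)"
      using in_A2_integrable[OF alpha in_A2_monomial[OF alpha, of 0]] by simp
    have "I t f = (LINT w|lborel. (\<Sum>m. ?F m w))"
      unfolding I_def
    proof (intro Bochner_Integration.integral_cong refl)
      fix w
      show "?w w *\<^sub>R (f w * cnj w ^ n) = (\<Sum>m. ?F m w)"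
      proof (cases "cmod w < t")
        case True
        then have "(\<lambda>m. a m * w ^ m) sums f w" using ser t by simp
        then have "(\<lambda>m. (of_real (?w w) * cnj w ^ n) * (a m * w ^ m)) sums ((of_real (?w w) * cnj w ^ n) * f w)"
          by (rule sums_mult)
        then show ?thesis by (simp add: sums_iff scaleR_conv_of_real mult_ac)
      qed simp
    qed
    also have "\<dots> = (\<Sum>m. LINT w|lborel. ?F m w)"
    proof (rule integral_suminf[OF Fint])
      show "AE w in lborel. summable (\<lambda>m. norm (?F m w))"
      proof (intro AE_I2)
        fix w
        have "summable (\<lambda>m. norm (a m * of_real t ^ m) * A2_weight \<alpha> w)"
          using asum[of t] t by (intro summable_mult2) auto
        then show "summable (\<lambda>m. norm (?F m w))"
          by (rule summable_comparison_test'[where N = 0], unfold real_norm_def abs_norm_cancel) (rule Fle)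
      qed
      show "summable (\<lambda>m. LINT w|lborel. norm (?F m w))"
      proof (rule summable_comparison_test')
        show "summable (\<lambda>m. norm (a m * of_real t ^ m) * (LINT w|lborel. A2_weight \<alpha> w))"
          using asum[of t] t by (intro summable_mult2) auto
        fix m
        have "(LINT w|lborel. norm (?F m w)) \<le> (LINT w|lborel. norm (a m * of_real t ^ m) * A2_weight \<alpha> w)"
          by (intro integral_mono integrable_norm Fint integrable_mult_right Wint Fle)
        then show "norm (LINT w|lborel. norm (?F m w)) \<le> norm (a m * of_real t ^ m) * (LINT w|lborel. A2_weight \<alpha> w)"
          by simp
      qed
    qed
    also have "(\<lambda>m. LINT w|lborel. ?F m w) = (\<lambda>m. if m = n then a n * I t (\<lambda>w. w ^ n) else 0)"
    proof
      fix m
      show "(LINT w|lborel. ?F m w) = (if m = n then a n * I t (\<lambda>w. w ^ n) else 0)"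
      proof (cases "m = n")
        case False
        have "(LINT w|lborel. ?w w *\<^sub>R (w ^ m * cnj w ^ n))
          = (LINT w|lborel. (\<lambda>r. if r < t then (\<alpha> + 1) / pi * (1 - r\<^sup>2) powr \<alpha> else 0) (cmod w) *\<^sub>R (w ^ m * cnj w ^ n))"
          using t by (intro Bochner_Integration.integral_cong) (auto simp: A2_weight_def dA_dens_def mem_udisc)
        also have "\<dots> = 0" using False by (intro monomials_orthogonal_radial) measurable
        finally show ?thesis using False by (subst integral_mult_right_zero) simp
      next
        case True
        then show ?thesis unfolding I_def by (subst integral_mult_right_zero) simp
      qed
    qed
    also have "(\<Sum>m. if m = n then a n * I t (\<lambda>w. w ^ n) else 0) = a n * I t (\<lambda>w. w ^ n)"
      using sums_single[of n "\<lambda>_. a n * I t (\<lambda>w. w ^ n)"] by (simp add: sums_iff)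
    finally show ?thesis .
  qed
  have t01: "0 < 1 - 1 / real (k + 2)" "1 - 1 / real (k + 2) < 1" for k by (auto simp: field_simps)
  have "(\<lambda>k. I (1 - 1 / real (k + 2)) f) \<longlonglongrightarrow> A2_inner \<alpha> f (\<lambda>w. w ^ n)"
    using A2_inner_truncated_limit[OF f in_A2_monomial[OF alpha, of n]] by (simp add: I_def)
  moreover have "(\<lambda>k. I (1 - 1 / real (k + 2)) f) \<longlonglongrightarrow> a n * A2_inner \<alpha> (\<lambda>w. w ^ n) (\<lambda>w. w ^ n)"
    unfolding trunc[OF t01]
    using A2_inner_truncated_limit[OF in_A2_monomial[OF alpha, of n] in_A2_monomial[OF alpha, of n]]
    by (intro tendsto_mult_left) (simp add: I_def)
  ultimately have "A2_inner \<alpha> f (\<lambda>w. w ^ n) = a n * A2_inner \<alpha> (\<lambda>w. w ^ n) (\<lambda>w. w ^ n)"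
    by (rule LIMSEQ_unique)
  then show ?thesis by (simp add: A2_inner_monomials a_def)
qed

text \<open>Absolutely summable coefficients make the series of \<open>G\<close> converge uniformly
  on the whole disc, so it can be integrated termwise without truncation. Kernels and test functions
  take the place of \<open>G\<close>.\<close>

lemma A2_inner_powser:
  assumes f: "in_A2 \<alpha> f" and c: "summable (\<lambda>n. norm (c n))" and G: "\<And>w. w \<in> udisc \<Longrightarrow> (\<lambda>n. c n * w ^ n) sums G w"
  shows "(\<lambda>n. cnj (c n) * A2_inner \<alpha> f (\<lambda>w. w ^ n)) sums A2_inner \<alpha> f G"
proof -
  let ?F = "\<lambda>n w. cnj (c n) * (A2_weight \<alpha> w *\<^sub>R (f w * cnj (w ^ n)))"
  have Fint: "integrable lborel (?F n)" for n
    by (intro integrable_mult_right A2_inner_integrable[OF alpha] f in_A2_monomial[OF alpha])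
  have Wint: "integrable lborel (\<lambda>w. A2_weight \<alpha> w * cmod (f w))"
    using A2_inner_integrable[OF alpha f in_A2_monomial[OF alpha, of 0], THEN integrable_norm]
      A2_weight_nonneg[OF alpha] by (simp add: norm_mult)
  have Fle: "norm (?F n w) \<le> norm (c n) * (A2_weight \<alpha> w * cmod (f w))" for n w
  proof (cases "w \<in> udisc")
    case True
    then have "cmod (f w) * cmod w ^ n \<le> cmod (f w) * 1"
      by (intro mult_left_mono power_le_one) (auto simp: mem_udisc)
    then have "A2_weight \<alpha> w * (cmod (f w) * cmod w ^ n) \<le> A2_weight \<alpha> w * (cmod (f w) * 1)"
      by (rule mult_left_mono[OF _ A2_weight_nonneg[OF alpha]])
    then have "norm (c n) * (A2_weight \<alpha> w * (cmod (f w) * cmod w ^ n)) \<le> norm (c n) * (A2_weight \<alpha> w * (cmod (f w) * 1))"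
      by (rule mult_left_mono) simp
    moreover have "norm (?F n w) = norm (c n) * (A2_weight \<alpha> w * (cmod (f w) * cmod w ^ n))"
      using A2_weight_nonneg[OF alpha, of w] by (simp only: norm_mult norm_scaleR complex_mod_cnj norm_power abs_of_nonneg)
    ultimately show ?thesis by simp
  qed (simp add: A2_weight_outside)
  have sm: "summable (\<lambda>n. LINT w|lborel. norm (?F n w))"
  proof (rule summable_comparison_test')
    show "summable (\<lambda>n. norm (c n) * (LINT w|lborel. A2_weight \<alpha> w * cmod (f w)))"
      using c by (rule summable_mult2)
    fix n
    have "(LINT w|lborel. norm (?F n w)) \<le> (LINT w|lborel. norm (c n) * (A2_weight \<alpha> w * cmod (f w)))"
      by (intro integral_mono integrable_norm Fint integrable_mult_right Wint Fle)
    then show "norm (LINT w|lborel. norm (?F n w)) \<le> norm (c n) * (LINT w|lborel. A2_weight \<alpha> w * cmod (f w))"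
      by simp
  qed
  have ae: "AE w in lborel. summable (\<lambda>n. norm (?F n w))"
  proof (intro AE_I2)
    fix w
    have "summable (\<lambda>n. norm (c n) * (A2_weight \<alpha> w * cmod (f w)))"
      using c by (rule summable_mult2)
    then show "summable (\<lambda>n. norm (?F n w))"
      by (rule summable_comparison_test'[where N = 0], unfold real_norm_def abs_norm_cancel) (rule Fle)
  qed
  have "(\<lambda>n. LINT w|lborel. ?F n w) sums (LINT w|lborel. (\<Sum>n. ?F n w))"
    using sums_integral[OF Fint ae sm] .
  moreover have "(LINT w|lborel. ?F n w) = cnj (c n) * A2_inner \<alpha> f (\<lambda>w. w ^ n)" for n
    unfolding A2_inner_def by (rule integral_mult_right_zero)
  moreover have "(LINT w|lborel. (\<Sum>n. ?F n w)) = A2_inner \<alpha> f G"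
    unfolding A2_inner_def
  proof (intro Bochner_Integration.integral_cong refl)
    fix w
    show "(\<Sum>n. ?F n w) = A2_weight \<alpha> w *\<^sub>R (f w * cnj (G w))"
    proof (cases "w \<in> udisc")
      case True
      then have "(\<lambda>n. cnj (c n * w ^ n)) sums cnj (G w)" using G by (simp only: sums_cnj)
      then have "(\<lambda>n. (of_real (A2_weight \<alpha> w) * f w) * cnj (c n * w ^ n)) sums ((of_real (A2_weight \<alpha> w) * f w) * cnj (G w))"
        by (rule sums_mult)
      then show ?thesis by (simp add: sums_iff scaleR_conv_of_real mult_ac)
    qed (simp add: A2_weight_outside)
  qed
  ultimately show ?thesis by simp
qed

text \<open>The tail of the coefficient series bounds the remainder uniformly on the disc, hence in
  \<open>A2_norm\<close>. Through this convergence polynomial truncations can stand in for the test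
  functions in the necessity part.\<close>

lemma A2_norm_powser_tail:
  assumes c: "summable (\<lambda>n. norm (c n))" and G: "\<And>w. w \<in> udisc \<Longrightarrow> (\<lambda>n. c n * w ^ n) sums G w"
    and hol: "G holomorphic_on udisc"
  shows "in_A2 \<alpha> G" "(\<lambda>N. A2_norm \<alpha> (\<lambda>w. G w - (\<Sum>n<N. c n * w ^ n))) \<longlonglongrightarrow> 0"
proof -
  have bd: "cmod (G w - (\<Sum>n<N. c n * w ^ n)) \<le> (\<Sum>n. norm (c (n + N)))" if "w \<in> udisc" for w N
  proof -
    have "(\<lambda>n. c (n + N) * w ^ (n + N)) sums (G w - (\<Sum>n<N. c n * w ^ n))"
      using sums_split_initial_segment[OF G[OF that], of N] by simp
    then have "G w - (\<Sum>n<N. c n * w ^ n) = (\<Sum>n. c (n + N) * w ^ (n + N))" by (simp add: sums_iff)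
    also have "norm \<dots> \<le> (\<Sum>n. norm (c (n + N)))"
    proof (rule norm_suminf_le)
      show "norm (c (n + N) * w ^ (n + N)) \<le> norm (c (n + N))" for n
        using that power_le_one[of "cmod w" "n + N"]
        by (auto simp: norm_mult norm_power mem_udisc intro!: mult_right_le_one_le)
      show "summable (\<lambda>n. norm (c (n + N)))" using c by (rule summable_ignore_initial_segment)
    qed
    finally show ?thesis .
  qed
  have nn: "0 \<le> (\<Sum>n. norm (c (n + N)))" for N
    using summable_ignore_initial_segment[OF c] by (intro suminf_nonneg) auto
  have "\<And>w. w \<in> udisc \<Longrightarrow> cmod (G w) \<le> (\<Sum>n. norm (c n))" using bd[of _ 0] by simp
  then show "in_A2 \<alpha> G" by (rule in_A2_bounded(1)[OF alpha hol])
  have le: "A2_norm \<alpha> (\<lambda>w. G w - (\<Sum>n<N. c n * w ^ n)) \<le> (\<Sum>n. norm (c (n + N)))" for N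
    by (rule in_A2_bounded(2)[OF alpha _ bd nn]) (intro holomorphic_intros hol)
  have lim: "(\<lambda>N. \<Sum>n. norm (c (n + N))) \<longlonglongrightarrow> 0"
    using suminf_exist_split2[OF c] .
  show "(\<lambda>N. A2_norm \<alpha> (\<lambda>w. G w - (\<Sum>n<N. c n * w ^ n))) \<longlonglongrightarrow> 0"
    by (rule tendsto_sandwich[OF _ _ tendsto_const lim]) (auto simp: le)
qed

end

section \<open>Binomial series and the Bergman kernel\<close>

definition binom_coeff :: "real \<Rightarrow> nat \<Rightarrow> real" where
  "binom_coeff s n = pochhammer s n / fact n"

text \<open>\<open>binom_coeff s n\<close> is the Taylor coefficient of
  \<open>(1 - x) powr (- s)\<close>: the sign in the generalized binomial coefficient of
  \<open>- s\<close> cancels that of \<open>(- x) ^ n\<close>.\<close>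

lemma binomial_kernel_series:
  fixes z w :: complex
  assumes "cmod z < 1" "cmod w \<le> 1"
  shows "(\<lambda>n. (of_real (binom_coeff s n) * cnj z ^ n) * w ^ n) sums (1 - cnj z * w) powr of_real (- s)"
    and "summable (\<lambda>n. norm (of_real (binom_coeff s n) * cnj z ^ n))"
proof -
  have coeff: "((- of_real s :: complex) gchoose n) = (-1) ^ n * of_real (binom_coeff s n)" for n
    by (simp add: gbinomial_pochhammer binom_coeff_def pochhammer_of_real)
  have "cmod (- cnj z * w) < 1"
  proof -
    have "cmod z * cmod w \<le> cmod z * 1" using assms by (intro mult_left_mono) auto
    then show ?thesis using assms by (simp add: norm_mult)
  qed
  from gen_binomial_complex[OF this, of "- of_real s"]
  have "(\<lambda>n. (- of_real s gchoose n) * (- cnj z * w) ^ n) sums (1 - cnj z * w) powr (- of_real s)" by simp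
  moreover have "(- of_real s gchoose n) * (- cnj z * w) ^ n = (of_real (binom_coeff s n) * cnj z ^ n) * w ^ n" for n
  proof -
    have "(- cnj z * w) ^ n = (-1) ^ n * (cnj z ^ n * w ^ n)"
      by (metis mult_minus1 power_mult_distrib mult.assoc)
    moreover have "(-1) ^ n * (-1) ^ n = (1::complex)" by (simp flip: power_mult_distrib)
    ultimately show ?thesis unfolding coeff by (simp add: mult_ac)
  qed
  ultimately show "(\<lambda>n. (of_real (binom_coeff s n) * cnj z ^ n) * w ^ n) sums (1 - cnj z * w) powr of_real (- s)"
    by simp
  have "ereal (norm (cnj z)) < conv_radius (\<lambda>n. (- of_real s :: complex) gchoose n)"
    using assms by (simp add: conv_radius_gchoose)
  from abs_summable_in_conv_radius[OF this]
  show "summable (\<lambda>n. norm (of_real (binom_coeff s n) * cnj z ^ n))"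
    unfolding coeff by (simp add: norm_mult norm_power)
qed

text \<open>Written with Gamma both factors are explicit and cancel. This is the coefficient form of
  the reproducing property.\<close>

lemma monomial_norm2_binom_coeff:
  assumes "\<alpha> > -1"
  shows "binom_coeff (\<alpha> + 2) n * monomial_norm2 \<alpha> n = 1"
proof -
  have "\<alpha> + 2 \<notin> \<int>\<^sub>\<le>\<^sub>0" using assms by (auto elim!: nonpos_Ints_cases)
  then have "pochhammer (\<alpha> + 2) n = Gamma (\<alpha> + 2 + real n) / Gamma (\<alpha> + 2)"
    by (rule pochhammer_Gamma)
  moreover have "\<alpha> + 1 \<notin> \<int>\<^sub>\<le>\<^sub>0" using assms by (auto elim!: nonpos_Ints_cases)
  then have "Gamma (\<alpha> + 2) = (\<alpha> + 1) * Gamma (\<alpha> + 1)"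
    using Gamma_plus1[of "\<alpha> + 1"] by (simp add: add.assoc)
  moreover have "Gamma (real n + 1) = fact n" using Gamma_fact[of n] by (simp add: add.commute)
  moreover have "Gamma (\<alpha> + 2 + real n) \<noteq> 0" "Gamma (\<alpha> + 1) \<noteq> 0"
    by (rule not_sym, rule less_imp_neq, rule Gamma_real_pos, use assms in simp)+
  moreover have "(G / (a * g)) / F * (a * (F * g / G)) = 1" if "G \<noteq> 0" "g \<noteq> 0" "F \<noteq> 0" "a \<noteq> 0" for G g F a :: real
    using that by simp
  moreover have "real n + 1 + (\<alpha> + 1) = \<alpha> + 2 + real n" by simp
  ultimately show ?thesis using assms
    unfolding binom_coeff_def monomial_norm2_def Beta_def by (simp only:) simp
qed

text \<open>The points \<open>1 - cnj z * w\<close> stay in the open right half-plane, away from the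
  branch cut of \<open>powr\<close>, so kernels are holomorphic and their denominators do not
  vanish.\<close>

lemma one_minus_cnj_mult_Re_pos:
  assumes "cmod z < 1" "cmod w < 1"
  shows "Re (1 - cnj z * w) > 0" "1 - cnj z * w \<notin> \<real>\<^sub>\<le>\<^sub>0" "1 - cnj z * w \<noteq> 0"
proof -
  have "cmod z * cmod w \<le> cmod z * 1" using assms by (intro mult_left_mono) auto
  then have "cmod (cnj z * w) < 1" using assms by (simp add: norm_mult)
  then show pos: "Re (1 - cnj z * w) > 0" using complex_Re_le_cmod[of "cnj z * w"] by simp
  show nr: "1 - cnj z * w \<notin> \<real>\<^sub>\<le>\<^sub>0" using pos by (auto simp: complex_nonpos_Reals_iff)
  show "1 - cnj z * w \<noteq> 0" by (metis pos less_irrefl zero_complex.sel(1))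
qed

definition bergman_kernel :: "real \<Rightarrow> complex \<Rightarrow> complex \<Rightarrow> complex" where
  "bergman_kernel \<alpha> z w = (1 - cnj z * w) powr of_real (- (\<alpha> + 2))"

text \<open>The derivative of \<open>bergman_kernel \<alpha> z w\<close> with respect to
  \<open>cnj z\<close>, divided by \<open>\<alpha> + 2\<close>.\<close>

definition bergman_kernel' :: "real \<Rightarrow> complex \<Rightarrow> complex \<Rightarrow> complex" where
  "bergman_kernel' \<alpha> z w = w / (1 - cnj z * w) * bergman_kernel \<alpha> z w"

text \<open>The factor \<open>w\<close> shifts the binomial coefficients for exponent
  \<open>\<alpha> + 3\<close> by one degree; degree 0 is separated because subtraction on naturals
  would not make it vanish.\<close>

definition bergman_kernel_coeff' :: "real \<Rightarrow> complex \<Rightarrow> nat \<Rightarrow> complex" where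
  "bergman_kernel_coeff' \<alpha> z n = (if n = 0 then 0 else of_real (binom_coeff (\<alpha> + 3) (n - 1)) * cnj z ^ (n - 1))"

lemma bergman_kernel_holomorphic:
  assumes "z \<in> udisc"
  shows "bergman_kernel \<alpha> z holomorphic_on udisc"
  unfolding bergman_kernel_def using assms one_minus_cnj_mult_Re_pos(2)
  by (intro holomorphic_intros) (auto simp: mem_udisc)

lemma bergman_kernel_series:
  assumes "z \<in> udisc"
  shows "w \<in> udisc \<Longrightarrow> (\<lambda>n. (of_real (binom_coeff (\<alpha> + 2) n) * cnj z ^ n) * w ^ n) sums bergman_kernel \<alpha> z w"
    and "summable (\<lambda>n. norm (of_real (binom_coeff (\<alpha> + 2) n) * cnj z ^ n))"
  using binomial_kernel_series[of z w "\<alpha> + 2"] binomial_kernel_series(2)[of z 0 "\<alpha> + 2"] assms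
  by (auto simp: bergman_kernel_def mem_udisc)

lemma bergman_kernel'_series:
  assumes "z \<in> udisc"
  shows "w \<in> udisc \<Longrightarrow> (\<lambda>n. bergman_kernel_coeff' \<alpha> z n * w ^ n) sums bergman_kernel' \<alpha> z w"
    and "summable (\<lambda>n. norm (bergman_kernel_coeff' \<alpha> z n))"
proof -
  show "summable (\<lambda>n. norm (bergman_kernel_coeff' \<alpha> z n))"
    using binomial_kernel_series(2)[of z 0 "\<alpha> + 3"] assms
    by (subst summable_Suc_iff[symmetric]) (simp add: bergman_kernel_coeff'_def mem_udisc)
  assume w: "w \<in> udisc"
  let ?X = "1 - cnj z * w"
  have X: "?X \<noteq> 0" using one_minus_cnj_mult_Re_pos(3)[of z w] assms w by (simp add: mem_udisc)
  have "(\<lambda>n. w * ((of_real (binom_coeff (\<alpha> + 3) n) * cnj z ^ n) * w ^ n)) sums (w * ?X powr of_real (- (\<alpha> + 3)))"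
    using binomial_kernel_series(1)[of z w "\<alpha> + 3"] assms w by (intro sums_mult) (auto simp: mem_udisc)
  moreover have "w * ?X powr of_real (- (\<alpha> + 3)) = bergman_kernel' \<alpha> z w"
  proof -
    have e: "complex_of_real (- (\<alpha> + 3)) = of_real (- (\<alpha> + 2)) - 1" by simp
    show ?thesis unfolding e powr_diff bergman_kernel'_def bergman_kernel_def using X by simp
  qed
  ultimately have "(\<lambda>n. bergman_kernel_coeff' \<alpha> z (Suc n) * w ^ Suc n) sums bergman_kernel' \<alpha> z w"
    by (simp add: bergman_kernel_coeff'_def mult_ac)
  then show "(\<lambda>n. bergman_kernel_coeff' \<alpha> z n * w ^ n) sums bergman_kernel' \<alpha> z w"
    by (subst (asm) sums_Suc_iff) (simp add: bergman_kernel_coeff'_def)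
qed

context
  fixes \<alpha> :: real
  assumes alpha: "\<alpha> > -1"
begin

lemma in_A2_bergman_kernel:
  assumes "z \<in> udisc"
  shows "in_A2 \<alpha> (bergman_kernel \<alpha> z)"
  using A2_norm_powser_tail(1)[OF alpha bergman_kernel_series(2,1) bergman_kernel_holomorphic] assms by auto

text \<open>Each kernel coefficient contains the reciprocal of the monomial norm, so the termwise
  inner product is the Taylor series of \<open>f\<close> at \<open>z\<close>.\<close>

lemma A2_reproducing:
  assumes f: "in_A2 \<alpha> f" and z: "z \<in> udisc"
  shows "A2_inner \<alpha> f (bergman_kernel \<alpha> z) = f z"
proof -
  have "(\<lambda>n. cnj (of_real (binom_coeff (\<alpha> + 2) n) * cnj z ^ n) * A2_inner \<alpha> f (\<lambda>w. w ^ n)) sums A2_inner \<alpha> f (bergman_kernel \<alpha> z)"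
    by (rule A2_inner_powser[OF alpha f bergman_kernel_series(2)[OF z] bergman_kernel_series(1)[OF z]])
  moreover have "cnj (of_real (binom_coeff (\<alpha> + 2) n) * cnj z ^ n) * A2_inner \<alpha> f (\<lambda>w. w ^ n) = (deriv ^^ n) f 0 / fact n * z ^ n" for n
  proof -
    have "cnj (of_real (binom_coeff (\<alpha> + 2) n) * cnj z ^ n) * A2_inner \<alpha> f (\<lambda>w. w ^ n)
        = of_real (binom_coeff (\<alpha> + 2) n * monomial_norm2 \<alpha> n) * ((deriv ^^ n) f 0 / fact n * z ^ n)"
      unfolding A2_inner_monomial_coeff[OF alpha f] by (simp add: mult_ac)
    then show ?thesis unfolding monomial_norm2_binom_coeff[OF alpha] by simp
  qed
  moreover have "(\<lambda>n. (deriv ^^ n) f 0 / fact n * z ^ n) sums f z"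
    using holomorphic_power_series[of f 0 1 z] f z by (simp add: in_A2_def udisc_def)
  ultimately show ?thesis using sums_unique2 by auto
qed

lemma A2_norm_bergman_kernel:
  assumes z: "z \<in> udisc"
  shows "(A2_norm \<alpha> (bergman_kernel \<alpha> z))\<^sup>2 = (1 - (cmod z)\<^sup>2) powr (- (\<alpha> + 2))"
proof -
  have "complex_of_real ((A2_norm \<alpha> (bergman_kernel \<alpha> z))\<^sup>2) = bergman_kernel \<alpha> z z"
    using A2_reproducing[OF in_A2_bergman_kernel[OF z] z] A2_inner_self[OF alpha in_A2_bergman_kernel[OF z]] by simp
  also have "\<dots> = of_real (1 - (cmod z)\<^sup>2) powr of_real (- (\<alpha> + 2))"
    unfolding bergman_kernel_def of_real_diff complex_norm_square by (simp add: mult.commute)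
  also have "\<dots> = of_real ((1 - (cmod z)\<^sup>2) powr (- (\<alpha> + 2)))"
    using z by (intro powr_of_real) (auto simp: mem_udisc abs_square_le_1)
  finally show ?thesis by (simp only: of_real_eq_iff)
qed

text \<open>Coefficient form of the fact that pairing with \<open>bergman_kernel'\<close> evaluates
  the derivative at \<open>z\<close> divided by \<open>\<alpha> + 2\<close>.\<close>

lemma bergman_kernel_coeff'_monomial_norm2:
  "bergman_kernel_coeff' \<alpha> z n * of_real (monomial_norm2 \<alpha> n) = of_nat n * cnj z ^ (n - 1) / of_real (\<alpha> + 2)"
proof (cases n)
  case 0
  then show ?thesis by (simp add: bergman_kernel_coeff'_def)
next
  case (Suc k)
  have "(\<alpha> + 2) * binom_coeff (\<alpha> + 3) k = real n * binom_coeff (\<alpha> + 2) n"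
    by (simp add: binom_coeff_def Suc pochhammer_rec add.assoc del: of_nat_Suc)
  then have "binom_coeff (\<alpha> + 3) k * monomial_norm2 \<alpha> n = real n * (binom_coeff (\<alpha> + 2) n * monomial_norm2 \<alpha> n) / (\<alpha> + 2)"
    using alpha by (simp add: field_simps)
  then have "binom_coeff (\<alpha> + 3) k * monomial_norm2 \<alpha> n = real n / (\<alpha> + 2)"
    unfolding monomial_norm2_binom_coeff[OF alpha] by simp
  then have "complex_of_real (binom_coeff (\<alpha> + 3) k) * of_real (monomial_norm2 \<alpha> n) = of_real (real n / (\<alpha> + 2))"
    by (metis of_real_mult)
  moreover have "bergman_kernel_coeff' \<alpha> z n * of_real (monomial_norm2 \<alpha> n)
    = (complex_of_real (binom_coeff (\<alpha> + 3) k) * of_real (monomial_norm2 \<alpha> n)) * cnj z ^ k"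
    by (simp add: bergman_kernel_coeff'_def Suc mult_ac)
  ultimately show ?thesis by (simp add: Suc)
qed

end

section \<open>Pseudo-hyperbolic geometry and lattices\<close>

lemma norm_one_minus_cnj_mult_ge:
  assumes "cmod z < 1" "cmod w < 1"
  shows "1 - cmod z \<le> cmod (1 - cnj z * w)" "1 - cmod w \<le> cmod (1 - cnj z * w)"
proof -
  have *: "1 - cmod z * cmod w \<le> cmod (1 - cnj z * w)"
    using norm_triangle_ineq2[of 1 "cnj z * w"] by (simp add: norm_mult)
  have "cmod z * cmod w \<le> cmod z" "cmod z * cmod w \<le> cmod w"
    using assms mult_left_mono[of "cmod w" 1 "cmod z"] mult_right_mono[of "cmod z" 1 "cmod w"] by auto
  then show "1 - cmod z \<le> cmod (1 - cnj z * w)" "1 - cmod w \<le> cmod (1 - cnj z * w)"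
    using * by auto
qed

lemma pseudo_hyp_identity:
  "(cmod (1 - cnj z * w))\<^sup>2 = (cmod (z - w))\<^sup>2 + (1 - (cmod z)\<^sup>2) * (1 - (cmod w)\<^sup>2)"
  unfolding cmod_power2 by (simp add: power2_eq_square algebra_simps)

lemma pseudo_hyp_commute: "pseudo_hyp z w = pseudo_hyp w z"
proof -
  have "cmod (1 - cnj z * w) = cmod (cnj (1 - cnj z * w))" by (simp only: complex_mod_cnj)
  then show ?thesis by (simp add: pseudo_hyp_def norm_divide norm_minus_commute mult.commute)
qed

lemma pseudo_hyp_mult:
  assumes "cmod z < 1" "cmod w < 1"
  shows "cmod (z - w) = pseudo_hyp z w * cmod (1 - cnj z * w)"
  using one_minus_cnj_mult_Re_pos(3)[OF assms] by (simp add: pseudo_hyp_def norm_divide)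

lemma pseudo_hyp_bounds:
  assumes "cmod z < 1" "cmod w < 1"
  shows "0 \<le> pseudo_hyp z w" "pseudo_hyp z w < 1"
proof -
  have "0 < (1 - (cmod z)\<^sup>2) * (1 - (cmod w)\<^sup>2)"
    using assms by (intro mult_pos_pos) (auto simp: abs_square_less_1)
  then have "(cmod (z - w))\<^sup>2 < (cmod (1 - cnj z * w))\<^sup>2"
    unfolding pseudo_hyp_identity by simp
  then have "cmod (z - w) < cmod (1 - cnj z * w)" by (rule power2_less_imp_less) simp
  then show "pseudo_hyp z w < 1" by (simp add: pseudo_hyp_def norm_divide divide_less_eq)
qed (simp add: pseudo_hyp_def)

text \<open>\<open>bergman_metric\<close> is the inverse hyperbolic tangent of
  \<open>pseudo_hyp\<close>, so its discs are pseudo-hyperbolic discs of radius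
  \<open>tanh r\<close>. This removes the logarithm from all later estimates.\<close>

lemma mem_bdisc:
  assumes "cmod z < 1"
  shows "w \<in> bdisc z r \<longleftrightarrow> cmod w < 1 \<and> pseudo_hyp z w < tanh r"
proof (cases "cmod w < 1")
  case True
  define d where "d = pseudo_hyp z w"
  have d: "0 \<le> d" "d < 1" using pseudo_hyp_bounds[OF assms True] by (auto simp: d_def)
  have "bergman_metric z w < r \<longleftrightarrow> ln ((1 + d) / (1 - d)) < 2 * r" by (auto simp: bergman_metric_def d_def)
  also have "\<dots> \<longleftrightarrow> (1 + d) / (1 - d) < exp (2 * r)"
  proof -
    have "(1 + d) / (1 - d) > 0" using d by simp
    then have "exp (ln ((1 + d) / (1 - d))) = (1 + d) / (1 - d)" by (rule exp_ln)
    then show ?thesis using exp_less_cancel_iff[of "ln ((1 + d) / (1 - d))" "2 * r"] by (simp only:)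
  qed
  also have "\<dots> \<longleftrightarrow> exp (- 2 * r) * (1 + d) < 1 - d"
    using d by (simp add: exp_minus field_simps)
  also have "\<dots> \<longleftrightarrow> d < (1 - exp (- 2 * r)) / (1 + exp (- 2 * r))"
    by (subst pos_less_divide_eq) (auto simp: algebra_simps add_pos_pos)
  also have "(1 - exp (- 2 * r)) / (1 + exp (- 2 * r)) = tanh r" by (simp add: tanh_real_altdef)
  finally show ?thesis using True by (simp add: bdisc_def mem_udisc d_def)
qed (simp add: bdisc_def mem_udisc)

text \<open>In \<open>1 - cnj z * w = (1 - cnj z * z) + cnj z * (z - w)\<close> the last term is at
  most \<open>t * cmod (1 - cnj z * w)\<close> and is absorbed on the left, leaving at most
  \<open>2 * (1 - cmod z)\<close>. The roles of \<open>z\<close> and \<open>w\<close> can be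
  exchanged.\<close>

lemma pseudo_hyp_le_comparison:
  assumes z: "cmod z < 1" and w: "cmod w < 1" and t: "pseudo_hyp z w \<le> t" "t < 1"
  shows "cmod (1 - cnj z * w) \<le> 2 / (1 - t) * (1 - cmod z)" "cmod (1 - cnj z * w) \<le> 2 / (1 - t) * (1 - cmod w)"
proof -
  have main: "cmod (1 - cnj z * w) \<le> 2 / (1 - t) * (1 - cmod z)"
    if z: "cmod z < 1" and w: "cmod w < 1" and t: "pseudo_hyp z w \<le> t" for z w
  proof -
    have "1 - cnj z * w = (1 - cnj z * z) + cnj z * (z - w)" by (simp add: algebra_simps)
    then have "cmod (1 - cnj z * w) \<le> cmod (1 - cnj z * z) + cmod (cnj z * (z - w))"
      by (metis norm_triangle_ineq)
    also have "cmod (1 - cnj z * z) = 1 - (cmod z)\<^sup>2"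
    proof -
      have "1 - cnj z * z = of_real (1 - (cmod z)\<^sup>2)"
        unfolding of_real_diff complex_norm_square by (simp add: mult.commute)
      then show ?thesis using z by (simp only: norm_of_real) (simp add: abs_square_le_1)
    qed
    also have "1 - (cmod z)\<^sup>2 = (1 - cmod z) * (1 + cmod z)" by (simp add: power2_eq_square algebra_simps)
    also have "(1 - cmod z) * (1 + cmod z) \<le> (1 - cmod z) * 2" using z by (intro mult_left_mono) auto
    also have "cmod (cnj z * (z - w)) \<le> t * cmod (1 - cnj z * w)"
    proof -
      have "cmod (cnj z * (z - w)) \<le> 1 * cmod (z - w)"
        unfolding norm_mult complex_mod_cnj using z by (intro mult_right_mono) auto
      also have "1 * cmod (z - w) \<le> t * cmod (1 - cnj z * w)"
        using t by (simp add: pseudo_hyp_mult[OF z w] mult_right_mono)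
      finally show ?thesis .
    qed
    finally have "(1 - t) * cmod (1 - cnj z * w) \<le> 2 * (1 - cmod z)" by (simp add: algebra_simps)
    then show ?thesis using assms(4) by (simp add: field_simps)
  qed
  show "cmod (1 - cnj z * w) \<le> 2 / (1 - t) * (1 - cmod z)" by (rule main[OF z w t(1)])
  have "cmod (1 - cnj w * z) \<le> 2 / (1 - t) * (1 - cmod w)"
    by (rule main[OF w z]) (use t(1) in \<open>simp add: pseudo_hyp_commute\<close>)
  moreover have "cmod (1 - cnj z * w) = cmod (cnj (1 - cnj z * w))" by (simp only: complex_mod_cnj)
  ultimately show "cmod (1 - cnj z * w) \<le> 2 / (1 - t) * (1 - cmod w)" by (simp add: mult.commute)
qed

text \<open>A hyperbolic lattice in Euclidean terms: a ball whose radius is a small multiple of the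
  distance of its centre from the unit circle is comparable to a hyperbolic disc. Balls of full
  radius cover, those of a quarter of it are disjoint, and indexing by all naturals turns sums over
  cells into series.\<close>

definition disc_lattice :: "real \<Rightarrow> (nat \<Rightarrow> complex) \<Rightarrow> bool" where
  "disc_lattice \<eta> a \<longleftrightarrow> (\<forall>n. cmod (a n) < 1) \<and>
     (\<forall>z. cmod z < 1 \<longrightarrow> (\<exists>n. cmod (z - a n) < \<eta> * (1 - cmod (a n)))) \<and>
     disjoint_family (\<lambda>n. ball (a n) (\<eta> / 4 * (1 - cmod (a n))))"

text \<open>If the balls met, their centres would be closer than \<open>2 / 3 * \<eta>\<close> times
  the smaller boundary distance, since the larger boundary distance exceeds the smaller by at most
  the distance of the centres.\<close>

lemma separated_balls_disjoint:
  fixes a b :: complex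
  assumes \<eta>: "0 < \<eta>" "\<eta> \<le> 1" and far: "\<eta> * min (1 - cmod a) (1 - cmod b) \<le> cmod (a - b)"
    and ab: "cmod a < 1" "cmod b < 1"
  shows "ball a (\<eta> / 4 * (1 - cmod a)) \<inter> ball b (\<eta> / 4 * (1 - cmod b)) = {}"
proof -
  have main: False if ab: "1 - cmod b \<le> 1 - cmod a" "\<eta> * (1 - cmod b) \<le> cmod (a - b)" "cmod b < 1"
    and x: "cmod (a - x) < \<eta> / 4 * (1 - cmod a)" "cmod (b - x) < \<eta> / 4 * (1 - cmod b)" for a b x :: complex
  proof -
    define m D where "m = 1 - cmod b" and "D = cmod (a - b)"
    have "D \<le> cmod (a - x) + cmod (b - x)"
      unfolding D_def using norm_triangle_ineq4[of "a - x" "b - x"] by simp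
    moreover have am: "1 - cmod a \<le> m + D"
      unfolding m_def D_def using norm_triangle_ineq2[of b a] by (simp add: norm_minus_commute)
    have "\<eta> / 4 * (1 - cmod a) \<le> \<eta> / 4 * (m + D)" using \<eta> am by (intro mult_left_mono) auto
    ultimately have "D < \<eta> / 4 * (m + D) + \<eta> / 4 * m" using x by (simp add: m_def)
    moreover have "\<eta> / 4 * (m + D) + \<eta> / 4 * m = \<eta> / 2 * m + \<eta> / 4 * D" by (simp add: field_simps)
    ultimately have "D < \<eta> / 2 * m + \<eta> / 4 * D" by linarith
    also have "\<eta> / 4 * D \<le> 1 / 4 * D" using \<eta> by (intro mult_right_mono) (auto simp: D_def)
    finally have "3 / 4 * D < \<eta> / 2 * m" by simp
    moreover have "\<eta> * m \<le> D" "0 < \<eta> * m" using ab \<eta> by (auto simp: m_def D_def)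
    ultimately show False by simp
  qed
  show ?thesis
  proof (rule ccontr)
    assume "\<not> ?thesis"
    then obtain x where x: "cmod (a - x) < \<eta> / 4 * (1 - cmod a)" "cmod (b - x) < \<eta> / 4 * (1 - cmod b)"
      by (auto simp: dist_norm)
    show False
    proof (cases "1 - cmod b \<le> 1 - cmod a")
      case True
      then have "min (1 - cmod a) (1 - cmod b) = 1 - cmod b" by (rule min_absorb2)
      then show False using main[of b a x] far ab x True by simp
    next
      case False
      then have "min (1 - cmod a) (1 - cmod b) = 1 - cmod a" by (intro min_absorb1) simp
      then show False using main[of a b x] far ab x False by (simp add: norm_minus_commute)
    qed
  qed
qed

text \<open>A maximal separated set from Zorn's lemma covers the disc, because an uncovered point
  could be added. It is countable since the disjoint balls around its points are open, and infinite,
  so the naturals enumerate it without repetition.\<close>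

lemma disc_lattice_exists:
  assumes \<eta>: "0 < \<eta>" "\<eta> < 1"
  obtains a where "disc_lattice \<eta> a"
proof -
  define far where "far a b \<longleftrightarrow> \<eta> * min (1 - cmod a) (1 - cmod b) \<le> cmod (a - b)" for a b :: complex
  define \<A> where "\<A> = {S. S \<subseteq> udisc \<and> (\<forall>a\<in>S. \<forall>b\<in>S. a \<noteq> b \<longrightarrow> far a b)}"
  have "\<exists>M\<in>\<A>. \<forall>X\<in>\<A>. M \<subseteq> X \<longrightarrow> X = M"
  proof (rule subset_Zorn_nonempty)
    show "\<A> \<noteq> {}" by (auto simp: \<A>_def)
    fix \<C> assume "\<C> \<noteq> {}" and ch: "subset.chain \<A> \<C>"
    have sub: "\<C> \<subseteq> \<A>" using ch by (simp add: subset_chain_def)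
    have "far a b" if "a \<in> X" "X \<in> \<C>" "b \<in> Y" "Y \<in> \<C>" "a \<noteq> b" for a b X Y
    proof -
      have "X \<subseteq> Y \<or> Y \<subseteq> X" using ch that by (auto simp: subset_chain_def)
      then have "\<exists>Z\<in>\<C>. a \<in> Z \<and> b \<in> Z" using that by blast
      then show ?thesis using that(5) sub unfolding \<A>_def by blast
    qed
    then show "\<Union>\<C> \<in> \<A>" using sub by (auto simp: \<A>_def)
  qed
  then obtain S where S: "S \<in> \<A>" and max: "\<And>X. X \<in> \<A> \<Longrightarrow> S \<subseteq> X \<Longrightarrow> X = S" by blast
  have Sd: "cmod a < 1" if "a \<in> S" for a using S that by (auto simp: \<A>_def mem_udisc)
  have Sfar: "far a b" if "a \<in> S" "b \<in> S" "a \<noteq> b" for a b using S that by (auto simp: \<A>_def)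
  have cover: "\<exists>a\<in>S. cmod (z - a) < \<eta> * (1 - cmod a)" if z: "cmod z < 1" for z
  proof (cases "z \<in> S")
    case True
    then show ?thesis using \<eta> z by (intro bexI[of _ z]) auto
  next
    case False
    have "insert z S \<notin> \<A>" using max[of "insert z S"] False by auto
    moreover have "insert z S \<subseteq> udisc" using z S by (auto simp: mem_udisc \<A>_def)
    ultimately obtain a b where ab: "a \<in> insert z S" "b \<in> insert z S" "a \<noteq> b" "\<not> far a b"
      by (auto simp: \<A>_def)
    then obtain c where "c \<in> S" "\<not> far z c"
      using Sfar by (auto simp: far_def norm_minus_commute min.commute)
    then show ?thesis
    proof (intro bexI[of _ c])
      have "cmod (z - c) < \<eta> * min (1 - cmod z) (1 - cmod c)" using \<open>\<not> far z c\<close> by (simp add: far_def)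
      also have "\<dots> \<le> \<eta> * (1 - cmod c)" using \<eta> by (intro mult_left_mono) auto
      finally show "cmod (z - c) < \<eta> * (1 - cmod c)" .
    qed
  qed
  define B where "B a = ball a (\<eta> / 4 * (1 - cmod a))" for a :: complex
  have cB: "a \<in> B a" if "a \<in> S" for a using \<eta> Sd[OF that] by (simp add: B_def)
  have disj: "B a \<inter> B b = {}" if "a \<in> S" "b \<in> S" "a \<noteq> b" for a b
    unfolding B_def using \<eta> Sfar[OF that] Sd that
    by (intro separated_balls_disjoint) (auto simp: far_def)
  have inj: "inj_on B S" using disj cB by (intro inj_onI) blast
  have "countable (B ` S)"
  proof (rule countable_disjoint_open_subsets)
    show "disjoint (B ` S)"
    proof (unfold disjoint_def, intro ballI impI)
      fix X Y assume "X \<in> B ` S" "Y \<in> B ` S" "X \<noteq> Y"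
      then obtain x y where "x \<in> S" "y \<in> S" "X = B x" "Y = B y" "x \<noteq> y" by blast
      then show "X \<inter> Y = {}" using disj by blast
    qed
  qed (auto simp: B_def)
  then have cnt: "countable S" using inj by (metis countable_image_inj_on)
  have inf: "infinite S"
  proof
    assume fin: "finite S"
    have ne: "S \<noteq> {}" using cover[of 0] by auto
    \<comment> \<open>Every point covered by the finite set has distance at least \<open>e\<close>
      from the unit circle, so the real point \<open>1 - e / 2\<close> contradicts the covering
      property.\<close>
    define e where "e = (1 - \<eta>) * Min ((\<lambda>a. 1 - cmod a) ` S)"
    have e: "e > 0" using fin ne Sd \<eta> by (auto simp: e_def intro!: mult_pos_pos)
    have e1: "e \<le> 1"
    proof -
      have "Min ((\<lambda>a. 1 - cmod a) ` S) \<in> (\<lambda>a. 1 - cmod a) ` S" using fin ne by (intro Min_in) auto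
      then obtain a where a: "a \<in> S" "Min ((\<lambda>a. 1 - cmod a) ` S) = 1 - cmod a" by auto
      have "(1 - \<eta>) * (1 - cmod a) \<le> 1" using \<eta> Sd[OF a(1)] by (intro mult_le_one) auto
      then show ?thesis by (simp add: e_def a(2))
    qed
    define z where "z = complex_of_real (1 - e / 2)"
    have z: "cmod z = 1 - e / 2" using e e1 unfolding z_def norm_of_real by simp
    then obtain a where a: "a \<in> S" "cmod (z - a) < \<eta> * (1 - cmod a)" using cover[of z] e by auto
    have "1 - cmod a \<le> (1 - cmod z) + cmod (z - a)" using norm_triangle_ineq2[of z a] by simp
    then have "(1 - \<eta>) * (1 - cmod a) \<le> e / 2" using a z by (simp add: algebra_simps)
    moreover have "e \<le> (1 - \<eta>) * (1 - cmod a)"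
      unfolding e_def using fin a \<eta> by (intro mult_left_mono Min_le) auto
    ultimately show False using e by simp
  qed
  have bij: "bij_betw (from_nat_into S) UNIV S" using cnt inf by (rule bij_betw_from_nat_into)
  show ?thesis
  proof (rule that[of "from_nat_into S"], unfold disc_lattice_def, intro conjI allI impI)
    have mem: "from_nat_into S n \<in> S" for n using bij by (auto simp: bij_betw_def)
    then show "cmod (from_nat_into S n) < 1" for n using Sd by blast
    show "\<exists>n. cmod (z - from_nat_into S n) < \<eta> * (1 - cmod (from_nat_into S n))" if "cmod z < 1" for z
      using cover[OF that] bij by (metis bij_betw_imp_surj_on imageE)
    show "disjoint_family (\<lambda>n. ball (from_nat_into S n) (\<eta> / 4 * (1 - cmod (from_nat_into S n))))"
      using disj mem bij unfolding disjoint_family_on_def B_def bij_betw_def inj_on_def by blast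
  qed
qed

text \<open>Points within bounded hyperbolic distance of \<open>a\<close>, in Euclidean terms. The
  second condition keeps the region away from the unit circle, which the ball of radius
  \<open>C * (1 - cmod a)\<close> may reach.\<close>

definition whitney_region :: "real \<Rightarrow> complex \<Rightarrow> complex set" where
  "whitney_region C a = {z. cmod (z - a) \<le> C * (1 - cmod a) \<and> 1 - cmod a \<le> C * (1 - cmod z)}"

lemma whitney_region_borel [measurable]: "whitney_region C a \<in> sets borel"
  unfolding whitney_region_def by measurable

lemma whitney_region_subset_disc:
  assumes "cmod a < 1" "C > 0" "z \<in> whitney_region C a"
  shows "cmod z < 1"
proof -
  have "0 < C * (1 - cmod z)" using assms by (auto simp: whitney_region_def)
  then show ?thesis using assms(2) by (simp add: zero_less_mult_iff)
qed

lemma whitney_region_comparison: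
  assumes "cmod a < 1" "C \<ge> 1" "z \<in> whitney_region C a"
  shows "1 - cmod z \<le> (1 + C) * (1 - cmod a)" "cmod (z - a) \<le> C * (1 - cmod a)" "1 - cmod a \<le> C * (1 - cmod z)"
proof -
  show 1: "cmod (z - a) \<le> C * (1 - cmod a)" "1 - cmod a \<le> C * (1 - cmod z)" using assms by (auto simp: whitney_region_def)
  show "1 - cmod z \<le> (1 + C) * (1 - cmod a)"
    using 1 norm_triangle_ineq2[of a z] by (simp add: algebra_simps norm_minus_commute)
qed

lemma measure_ball_complex: "t \<ge> 0 \<Longrightarrow> measure lborel (ball (a::complex) t) = pi * t\<^sup>2"
  by (simp add: content_ball unit_ball_vol_2 power2_eq_square)

text \<open>For fixed \<open>z\<close>, the disjoint quarter balls of all cells whose region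
  contains \<open>z\<close> have radii comparable to \<open>1 - cmod z\<close> and fit into one ball
  about \<open>z\<close> of comparable radius. Comparing areas bounds their number.\<close>

lemma disc_lattice_overlap:
  assumes lat: "disc_lattice \<eta> a" and \<eta>: "0 < \<eta>" "\<eta> < 1" and C: "C \<ge> 1"
  obtains N :: nat where "\<And>z. finite {n. z \<in> whitney_region C (a n)}" "\<And>z. card {n. z \<in> whitney_region C (a n)} \<le> N"
proof -
  \<comment> \<open>The square of the quotient of the outer radius by the least inner radius; both
    are proportional to \<open>1 - cmod z\<close>, which cancels, so \<open>N\<close> depends on
    \<open>C\<close> and \<open>\<eta>\<close> only.\<close>
  define N where "N = nat \<lceil>(((C + 1) * C) / (\<eta> / 4 / (1 + C)))\<^sup>2\<rceil>"
  have a1: "cmod (a n) < 1" for n using lat by (simp add: disc_lattice_def)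
  have main: "card F \<le> N" if F: "finite F" "F \<subseteq> {n. z \<in> whitney_region C (a n)}" for F z
  proof (cases "F = {}")
    case False
    then obtain n0 where n0: "z \<in> whitney_region C (a n0)" using F by auto
    define d where "d = 1 - cmod z"
    have d: "d > 0" using whitney_region_subset_disc[OF a1 _ n0] C by (simp add: d_def)
    let ?B = "\<lambda>n. ball (a n) (\<eta> / 4 * (1 - cmod (a n)))"
    have big: "\<eta> / 4 * (d / (1 + C)) \<le> \<eta> / 4 * (1 - cmod (a n))" if "n \<in> F" for n
      using whitney_region_comparison(1)[OF a1 C] that F C \<eta> unfolding d_def
      by (intro mult_left_mono) (auto simp: divide_le_eq mult.commute)
    have sub: "?B n \<subseteq> ball z ((C + 1) * C * d)" if "n \<in> F" for n
    proof
      fix x assume x: "x \<in> ?B n"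
      have zr: "z \<in> whitney_region C (a n)" using that F by auto
      have "\<eta> / 4 * (1 - cmod (a n)) \<le> 1 * (1 - cmod (a n))" using \<eta> a1[of n] by (intro mult_right_mono) auto
      then have "cmod (a n - x) < 1 - cmod (a n)" using x by (auto simp: dist_norm)
      moreover have "cmod (z - x) \<le> cmod (z - a n) + cmod (a n - x)" using norm_triangle_ineq[of "z - a n" "a n - x"] by simp
      ultimately have "cmod (z - x) < (C + 1) * (1 - cmod (a n))"
        using whitney_region_comparison(2)[OF a1 C zr] by (simp add: algebra_simps)
      also have "\<dots> \<le> (C + 1) * (C * d)"
        using whitney_region_comparison(3)[OF a1 C zr] C unfolding d_def by (intro mult_left_mono) auto
      finally show "x \<in> ball z ((C + 1) * C * d)" by (simp add: dist_norm mult.assoc)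
    qed
    have "real (card F) * (pi * (\<eta> / 4 * (d / (1 + C)))\<^sup>2) = (\<Sum>n\<in>F. pi * (\<eta> / 4 * (d / (1 + C)))\<^sup>2)" by simp
    also have "\<dots> \<le> (\<Sum>n\<in>F. measure lborel (?B n))"
    proof (rule sum_mono)
      fix n assume "n \<in> F"
      have "(\<eta> / 4 * (d / (1 + C)))\<^sup>2 \<le> (\<eta> / 4 * (1 - cmod (a n)))\<^sup>2"
        using big[OF \<open>n \<in> F\<close>] \<eta> d C by (intro power_mono) auto
      moreover have "measure lborel (?B n) = pi * (\<eta> / 4 * (1 - cmod (a n)))\<^sup>2"
        using \<eta> a1[of n] by (intro measure_ball_complex) auto
      ultimately show "pi * (\<eta> / 4 * (d / (1 + C)))\<^sup>2 \<le> measure lborel (?B n)" by simp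
    qed
    also have "\<dots> = measure lborel (\<Union>n\<in>F. ?B n)"
    proof (rule measure_finite_Union[symmetric])
      show "disjoint_family_on ?B F" using lat by (auto simp: disc_lattice_def disjoint_family_on_def)
      show "emeasure lborel (?B i) \<noteq> \<infinity>" for i using emeasure_lborel_ball_finite by (simp add: less_top[symmetric])
    qed (use F in auto)
    also have "\<dots> \<le> measure lborel (ball z ((C + 1) * C * d))"
      using sub emeasure_lborel_ball_finite by (intro measure_mono_fmeasurable) (auto simp: fmeasurable_def F)
    also have "\<dots> = pi * ((C + 1) * C * d)\<^sup>2" using C d by (intro measure_ball_complex) auto
    finally have "real (card F) * (\<eta> / 4 * (d / (1 + C)))\<^sup>2 \<le> ((C + 1) * C * d)\<^sup>2" by (simp add: mult.left_commute)
    then have "real (card F) \<le> ((C + 1) * C * d)\<^sup>2 / (\<eta> / 4 * (d / (1 + C)))\<^sup>2"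
      using d \<eta> C by (subst pos_le_divide_eq) auto
    also have "\<dots> = (((C + 1) * C * d) / (\<eta> / 4 * (d / (1 + C))))\<^sup>2" by (simp only: power_divide)
    also have "((C + 1) * C * d) / (\<eta> / 4 * (d / (1 + C))) = ((C + 1) * C) / (\<eta> / 4 / (1 + C))"
      using d by simp
    finally show ?thesis unfolding N_def by linarith
  qed simp
  have fin: "finite {n. z \<in> whitney_region C (a n)}" for z
  proof (rule ccontr)
    assume "infinite {n. z \<in> whitney_region C (a n)}"
    then obtain F where "F \<subseteq> {n. z \<in> whitney_region C (a n)}" "finite F" "card F = Suc N"
      using infinite_arbitrarily_large by blast
    then show False using main[of F z] by auto
  qed
  show ?thesis using that[of N] fin main by auto
qed

text \<open>On the region the density is at most \<open>C\<^sup>2 / (pi * m\<^sup>2)\<close> with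
  \<open>m = 1 - cmod a\<close>, and the region lies in a disc of area
  \<open>pi * (C * m)\<^sup>2\<close>.\<close>

lemma dlambda_whitney_region:
  assumes "cmod a < 1" "C \<ge> 1"
  shows "(\<integral>\<^sup>+z. indicator (whitney_region C a) z * ennreal (dlambda_dens z) \<partial>lborel) \<le> ennreal (C ^ 4)"
proof -
  define m where "m = 1 - cmod a"
  have m: "m > 0" using assms by (simp add: m_def)
  have "(\<integral>\<^sup>+z. indicator (whitney_region C a) z * ennreal (dlambda_dens z) \<partial>lborel)
     \<le> (\<integral>\<^sup>+z. ennreal (C\<^sup>2 / (pi * m\<^sup>2)) * indicator (cball a (C * m)) z \<partial>lborel)"
  proof (intro nn_integral_mono)
    fix z
    show "indicator (whitney_region C a) z * ennreal (dlambda_dens z) \<le> ennreal (C\<^sup>2 / (pi * m\<^sup>2)) * indicator (cball a (C * m)) z"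
    proof (cases "z \<in> whitney_region C a")
      case True
      have z: "cmod z < 1" using whitney_region_subset_disc[OF assms(1) _ True] assms by simp
      have "1 - cmod z \<le> 1 - (cmod z)\<^sup>2" using z by (simp add: power2_eq_square mult_left_le)
      moreover have "m / C \<le> 1 - cmod z"
        using whitney_region_comparison(3)[OF assms True] assms by (simp add: m_def field_simps)
      ultimately have "m / C \<le> 1 - (cmod z)\<^sup>2" by simp
      then have "(m / C)\<^sup>2 \<le> (1 - (cmod z)\<^sup>2)\<^sup>2" using m assms by (intro power_mono) auto
      then have "1 / (pi * (1 - (cmod z)\<^sup>2)\<^sup>2) \<le> 1 / (pi * (m / C)\<^sup>2)"
        using m assms by (intro divide_left_mono mult_left_mono mult_pos_pos) auto
      also have "\<dots> = C\<^sup>2 / (pi * m\<^sup>2)" by (simp add: power_divide)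
      finally have "dlambda_dens z \<le> C\<^sup>2 / (pi * m\<^sup>2)" by (simp add: dlambda_dens_def)
      moreover have "z \<in> cball a (C * m)" using whitney_region_comparison(2)[OF assms True]
        by (simp add: m_def dist_norm norm_minus_commute)
      ultimately show ?thesis using True by (simp add: ennreal_leI)
    qed simp
  qed
  also have "\<dots> = ennreal (C\<^sup>2 / (pi * m\<^sup>2)) * emeasure lborel (cball a (C * m))"
    by (rule nn_integral_cmult_indicator) simp
  also have "emeasure lborel (cball a (C * m)) = ennreal (pi * (C * m)\<^sup>2)"
    using assms m by (simp add: emeasure_cball unit_ball_vol_2 power2_eq_square)
  also have "ennreal (C\<^sup>2 / (pi * m\<^sup>2)) * ennreal (pi * (C * m)\<^sup>2) = ennreal (C\<^sup>2 / (pi * m\<^sup>2) * (pi * (C * m)\<^sup>2))"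
    using m by (intro ennreal_mult[symmetric]) auto
  also have "C\<^sup>2 / (pi * m\<^sup>2) * (pi * (C * m)\<^sup>2) = C ^ 4"
    using m by (simp add: power_mult_distrib field_simps flip: power_add)
  finally show ?thesis .
qed

text \<open>With \<open>m = 1 - cmod a\<close>, the quantity \<open>1 - (cmod z)\<^sup>2\<close> is
  at most \<open>4 * m\<close> on the quarter ball, so the density is at least
  \<open>1 / (16 * pi * m\<^sup>2)\<close>; the ball has area
  \<open>pi * \<eta>\<^sup>2 * m\<^sup>2 / 16\<close>, whence 256.\<close>

lemma dlambda_ball_lower:
  assumes "cmod a < 1" "0 < \<eta>" "\<eta> < 1"
  shows "ennreal (\<eta>\<^sup>2 / 256) \<le> (\<integral>\<^sup>+z. indicator (ball a (\<eta> / 4 * (1 - cmod a))) z * ennreal (dlambda_dens z) \<partial>lborel)"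
proof -
  define m where "m = 1 - cmod a"
  have m: "m > 0" using assms by (simp add: m_def)
  have "ennreal (\<eta>\<^sup>2 / 256) = ennreal (1 / (16 * pi * m\<^sup>2) * (pi * (\<eta> / 4 * m)\<^sup>2))"
    using m by (simp add: power_mult_distrib power_divide field_simps)
  also have "\<dots> = ennreal (1 / (16 * pi * m\<^sup>2)) * ennreal (pi * (\<eta> / 4 * m)\<^sup>2)"
    using m by (intro ennreal_mult) auto
  also have "ennreal (pi * (\<eta> / 4 * m)\<^sup>2) = emeasure lborel (ball a (\<eta> / 4 * m))"
    using assms m by (simp add: emeasure_ball unit_ball_vol_2 power2_eq_square)
  also have "ennreal (1 / (16 * pi * m\<^sup>2)) * emeasure lborel (ball a (\<eta> / 4 * m))
      = (\<integral>\<^sup>+z. ennreal (1 / (16 * pi * m\<^sup>2)) * indicator (ball a (\<eta> / 4 * m)) z \<partial>lborel)"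
    by (rule nn_integral_cmult_indicator[symmetric]) simp
  also have "\<dots> \<le> (\<integral>\<^sup>+z. indicator (ball a (\<eta> / 4 * m)) z * ennreal (dlambda_dens z) \<partial>lborel)"
  proof (intro nn_integral_mono)
    fix z
    show "ennreal (1 / (16 * pi * m\<^sup>2)) * indicator (ball a (\<eta> / 4 * m)) z \<le> indicator (ball a (\<eta> / 4 * m)) z * ennreal (dlambda_dens z)"
    proof (cases "z \<in> ball a (\<eta> / 4 * m)")
      case True
      have "\<eta> / 4 * m \<le> 1 / 4 * m" using assms m by (intro mult_right_mono) auto
      then have az: "cmod (a - z) < 1 / 4 * m" using True by (simp add: dist_norm)
      have z1: "1 - cmod z \<le> 2 * m" "cmod z < 1"
        using az norm_triangle_ineq2[of a z] norm_triangle_ineq2[of z a] m by (auto simp: m_def norm_minus_commute)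
      have "1 - (cmod z)\<^sup>2 = (1 - cmod z) * (1 + cmod z)" by (simp add: power2_eq_square algebra_simps)
      also have "\<dots> \<le> (2 * m) * 2" using z1 m by (intro mult_mono) auto
      finally have "(1 - (cmod z)\<^sup>2)\<^sup>2 \<le> (4 * m)\<^sup>2" using z1 by (intro power_mono) (auto simp: abs_square_le_1)
      moreover have "0 < 1 - (cmod z)\<^sup>2" using z1 by (simp add: abs_square_less_1)
      ultimately have "1 / (pi * (4 * m)\<^sup>2) \<le> dlambda_dens z"
        unfolding dlambda_dens_def using m by (intro divide_left_mono mult_left_mono mult_pos_pos) auto
      then show ?thesis using True by (simp add: ennreal_leI power_mult_distrib mult_ac)
    qed simp
  qed
  finally show ?thesis by (simp add: m_def)
qed

section \<open>Averages of pull-back measures\<close>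

lemma dlambda_dens_measurable [measurable]: "dlambda_dens \<in> borel_measurable borel"
  unfolding dlambda_dens_def by measurable

definition pull_density :: "real \<Rightarrow> (complex \<Rightarrow> real) \<Rightarrow> complex \<Rightarrow> ennreal" where
  "pull_density \<alpha> g w = indicator udisc w * ennreal (dA_dens \<alpha> w * g w)"

definition admissible_map :: "(complex \<Rightarrow> complex) \<Rightarrow> bool" where
  "admissible_map \<phi> \<longleftrightarrow> continuous_on udisc \<phi> \<and> \<phi> ` udisc \<subseteq> udisc"

lemma admissible_map_measurable:
  assumes "admissible_map \<phi>"
  shows "(\<lambda>w. if w \<in> udisc then \<phi> w else 0) \<in> borel_measurable borel"
proof -
  have "(\<lambda>w. indicat_real udisc w *\<^sub>R \<phi> w) \<in> borel_measurable borel"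
    using assms by (intro borel_measurable_continuous_on_indicator) (auto simp: admissible_map_def)
  moreover have "(\<lambda>w. indicat_real udisc w *\<^sub>R \<phi> w) = (\<lambda>w. if w \<in> udisc then \<phi> w else 0)"
    by (auto simp: indicator_def)
  ultimately show ?thesis by simp
qed

lemma pull_density_measurable:
  assumes "continuous_on udisc g"
  shows "pull_density \<alpha> g \<in> borel_measurable borel"
proof -
  have "(\<lambda>w. indicat_real udisc w *\<^sub>R g w) \<in> borel_measurable borel"
    using assms by (intro borel_measurable_continuous_on_indicator) auto
  then have "(\<lambda>w. ennreal (A2_weight \<alpha> w * (indicat_real udisc w *\<^sub>R g w))) \<in> borel_measurable borel"
    by (intro measurable_compose[OF _ measurable_ennreal] borel_measurable_times A2_weight_measurable)
  moreover have "(\<lambda>w. ennreal (A2_weight \<alpha> w * (indicat_real udisc w *\<^sub>R g w))) = pull_density \<alpha> g"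
    by (auto simp: pull_density_def A2_weight_def indicator_def)
  ultimately show ?thesis by simp
qed

lemma pull_meas_pull_density:
  "pull_meas \<alpha> \<phi> g E = (\<integral>\<^sup>+w. pull_density \<alpha> g w * indicator E (\<phi> w) \<partial>lborel)"
  unfolding pull_meas_def pull_density_def by (intro nn_integral_cong) (auto simp: indicator_def)

lemma pull_meas_mono: "E \<subseteq> F \<Longrightarrow> pull_meas \<alpha> \<phi> g E \<le> pull_meas \<alpha> \<phi> g F"
  unfolding pull_meas_pull_density by (intro nn_integral_mono mult_left_mono) (auto simp: indicator_def)

text \<open>Change of variables for the pull-back measure, for countable step functions.
  \<open>pull_meas\<close> is a set function defined by an integral, so no image measure has to be
  constructed.\<close>

lemma pull_meas_sum:
  assumes \<phi>: "admissible_map \<phi>" and g: "continuous_on udisc g" and B: "\<And>n. B n \<in> sets borel"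
  shows "(\<lambda>w. pull_density \<alpha> g w * (\<Sum>n. S n * indicator (B n) (\<phi> w))) \<in> borel_measurable borel"
    and "(\<integral>\<^sup>+w. pull_density \<alpha> g w * (\<Sum>n. S n * indicator (B n) (\<phi> w)) \<partial>lborel) = (\<Sum>n. S n * pull_meas \<alpha> \<phi> g (B n))"
proof -
  \<comment> \<open>\<open>\<phi>\<close> is controlled only on the disc; this extension by 0 is
    Borel on the plane, and the density vanishes where the two may differ.\<close>
  define \<phi>' where "\<phi>' w = (if w \<in> udisc then \<phi> w else 0)" for w
  have [measurable]: "\<phi>' \<in> borel_measurable borel" using admissible_map_measurable[OF \<phi>] by (simp add: \<phi>'_def[abs_def])
  have [measurable]: "pull_density \<alpha> g \<in> borel_measurable borel" using g by (rule pull_density_measurable)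
  have [measurable]: "B n \<in> sets borel" for n by (rule B)
  have out: "pull_density \<alpha> g w = 0" if "w \<notin> udisc" for w using that by (simp add: pull_density_def)
  have pm: "pull_meas \<alpha> \<phi> g E = (\<integral>\<^sup>+w. pull_density \<alpha> g w * indicator E (\<phi>' w) \<partial>lborel)" for E
    unfolding pull_meas_pull_density by (intro nn_integral_cong) (auto simp: \<phi>'_def out)
  have eq: "pull_density \<alpha> g w * (\<Sum>n. S n * indicator (B n) (\<phi> w)) = (\<Sum>n. S n * (pull_density \<alpha> g w * indicator (B n) (\<phi>' w)))" for w
  proof (cases "w \<in> udisc")
    case True
    then show ?thesis by (simp add: \<phi>'_def mult.left_commute flip: ennreal_suminf_cmult)
  qed (simp add: out)
  show "(\<lambda>w. pull_density \<alpha> g w * (\<Sum>n. S n * indicator (B n) (\<phi> w))) \<in> borel_measurable borel"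
    unfolding eq by measurable
  have "(\<integral>\<^sup>+w. (\<Sum>n. S n * (pull_density \<alpha> g w * indicator (B n) (\<phi>' w))) \<partial>lborel)
      = (\<Sum>n. \<integral>\<^sup>+w. S n * (pull_density \<alpha> g w * indicator (B n) (\<phi>' w)) \<partial>lborel)"
    by (rule nn_integral_suminf) measurable
  also have "\<dots> = (\<Sum>n. S n * pull_meas \<alpha> \<phi> g (B n))"
    unfolding pm by (intro suminf_cong nn_integral_cmult) measurable
  finally show "(\<integral>\<^sup>+w. pull_density \<alpha> g w * (\<Sum>n. S n * indicator (B n) (\<phi> w)) \<partial>lborel) = (\<Sum>n. S n * pull_meas \<alpha> \<phi> g (B n))"
    unfolding eq .
qed

lemma pull_meas_sum_bound:
  assumes \<phi>: "admissible_map \<phi>" and g: "continuous_on udisc g" and B: "\<And>n. B n \<in> sets borel"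
    and H: "\<And>w. w \<in> udisc \<Longrightarrow> H w \<le> (\<Sum>n. S n * indicator (B n) (\<phi> w))"
  shows "(\<integral>\<^sup>+w. pull_density \<alpha> g w * H w \<partial>lborel) \<le> (\<Sum>n. S n * pull_meas \<alpha> \<phi> g (B n))"
proof -
  have "(\<integral>\<^sup>+w. pull_density \<alpha> g w * H w \<partial>lborel) \<le> (\<integral>\<^sup>+w. pull_density \<alpha> g w * (\<Sum>n. S n * indicator (B n) (\<phi> w)) \<partial>lborel)"
  proof (intro nn_integral_mono)
    fix w
    show "pull_density \<alpha> g w * H w \<le> pull_density \<alpha> g w * (\<Sum>n. S n * indicator (B n) (\<phi> w))"
      using H[of w] by (cases "w \<in> udisc") (auto simp: pull_density_def intro!: mult_left_mono)
  qed
  then show ?thesis by (simp add: pull_meas_sum[OF \<phi> g B])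
qed

definition lattice_cell :: "real \<Rightarrow> (nat \<Rightarrow> complex) \<Rightarrow> nat \<Rightarrow> complex set" where
  "lattice_cell \<eta> a n = ball (a n) (\<eta> * (1 - cmod (a n)))"

text \<open>The discrete counterpart of \<open>Mr\<close>, with \<open>1 - cmod (a n)\<close> in
  place of \<open>1 - (cmod (a n))\<^sup>2\<close>; the two differ by a factor between 1 and
  2.\<close>

definition lattice_avg :: "real \<Rightarrow> real \<Rightarrow> (nat \<Rightarrow> complex) \<Rightarrow> (complex \<Rightarrow> complex) \<Rightarrow> (complex \<Rightarrow> real) \<Rightarrow> nat \<Rightarrow> ennreal" where
  "lattice_avg \<alpha> \<eta> a \<phi> g n = pull_meas \<alpha> \<phi> g (lattice_cell \<eta> a n) * ennreal (inverse ((1 - cmod (a n)) powr (\<alpha> + 2)))"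

text \<open>Finiteness is demanded separately because \<open>enn2real\<close> sends infinity to
  0.\<close>

definition lattice_summable :: "real \<Rightarrow> real \<Rightarrow> real \<Rightarrow> (nat \<Rightarrow> complex) \<Rightarrow> (complex \<Rightarrow> complex) \<Rightarrow> (complex \<Rightarrow> real) \<Rightarrow> bool" where
  "lattice_summable \<alpha> q \<eta> a \<phi> g \<longleftrightarrow> (\<forall>n. lattice_avg \<alpha> \<eta> a \<phi> g n < \<infinity>) \<and>
     (\<Sum>n. ennreal (enn2real (lattice_avg \<alpha> \<eta> a \<phi> g n) powr q)) < \<infinity>"

lemma Mr_eq:
  assumes "cmod z < 1"
  shows "Mr \<alpha> r \<phi> g z = pull_meas \<alpha> \<phi> g (bdisc z r) * ennreal (inverse ((1 - (cmod z)\<^sup>2) powr (\<alpha> + 2)))"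
proof -
  have "0 < (1 - (cmod z)\<^sup>2) powr (\<alpha> + 2)" using assms by (simp add: abs_square_less_1 abs_square_eq_1)
  then show ?thesis by (simp add: Mr_def divide_ennreal_def inverse_ennreal add.commute)
qed

text \<open>Two points \<open>z\<close>, \<open>x\<close> of the cell are closer than
  \<open>2 * \<eta> * m\<close> with \<open>m = 1 - cmod (a n)\<close>, while
  \<open>cmod (1 - cnj z * x)\<close> is at least \<open>(1 - \<eta>) * m\<close>. Their
  pseudo-hyperbolic distance is thus below \<open>4 * \<eta>\<close>, whence the bound on
  \<open>\<eta>\<close>.\<close>

lemma lattice_cell_subset_bdisc:
  assumes a: "cmod (a n) < 1" and \<eta>: "0 < \<eta>" "\<eta> \<le> tanh r / 4" and z: "z \<in> lattice_cell \<eta> a n"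
  shows "lattice_cell \<eta> a n \<subseteq> bdisc z r" "cmod z < 1"
proof -
  have \<eta>1: "\<eta> < 1 / 4" and r: "r > 0" using \<eta> tanh_real_lt_1[of r] tanh_real_pos_iff[of r] by linarith+
  have in1: "(1 - \<eta>) * (1 - cmod (a n)) \<le> 1 - cmod x" if "x \<in> lattice_cell \<eta> a n" for x
    using that norm_triangle_ineq2[of x "a n"] by (simp add: lattice_cell_def dist_norm norm_minus_commute algebra_simps)
  have pos: "0 < (1 - \<eta>) * (1 - cmod (a n))" using \<eta>1 a by simp
  have lt1: "cmod x < 1" if "x \<in> lattice_cell \<eta> a n" for x using in1[OF that] pos by linarith
  show z1: "cmod z < 1" by (rule lt1[OF z])
  show "lattice_cell \<eta> a n \<subseteq> bdisc z r"
  proof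
    fix x assume x: "x \<in> lattice_cell \<eta> a n"
    have "cmod (z - x) \<le> cmod (z - a n) + cmod (a n - x)" using norm_triangle_ineq[of "z - a n" "a n - x"] by simp
    also have "\<dots> < 2 * \<eta> * (1 - cmod (a n))" using x z by (simp add: lattice_cell_def dist_norm norm_minus_commute)
    finally have "pseudo_hyp z x * cmod (1 - cnj z * x) < 2 * \<eta> * (1 - cmod (a n))"
      using pseudo_hyp_mult[OF z1 lt1[OF x]] by simp
    also have "\<dots> \<le> 4 * \<eta> * ((1 - \<eta>) * (1 - cmod (a n)))"
    proof -
      have "\<eta> * (1 - cmod (a n)) * 2 \<le> \<eta> * (1 - cmod (a n)) * (4 * (1 - \<eta>))" using \<eta> \<eta>1 a by (intro mult_left_mono) auto
      then show ?thesis by (simp add: algebra_simps)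
    qed
    also have "\<dots> \<le> tanh r * cmod (1 - cnj z * x)"
      using in1[OF z] norm_one_minus_cnj_mult_ge(1)[OF z1 lt1[OF x]] \<eta> pos r by (intro mult_mono) auto
    finally have "pseudo_hyp z x < tanh r" by (simp add: mult_less_cancel_right)
    then show "x \<in> bdisc z r" using lt1[OF x] by (simp add: mem_bdisc[OF z1])
  qed
qed

text \<open>For \<open>z\<close> in a quarter ball the whole cell lies in \<open>bdisc z r\<close>,
  so the cell average is at most a constant times \<open>Mr\<close> at every such \<open>z\<close>.
  The quarter balls are disjoint and their hyperbolic area is bounded below, so integration over
  them sums the \<open>q\<close>-th powers.\<close>

lemma in_L_lambda_imp_lattice_summable:
  assumes \<alpha>: "\<alpha> > -1" and q: "q > 0" and lat: "disc_lattice \<eta> a" and \<eta>: "0 < \<eta>" "\<eta> \<le> tanh r / 4"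
    and L: "in_L_lambda q (Mr \<alpha> r \<phi> g)"
  shows "lattice_summable \<alpha> q \<eta> a \<phi> g"
proof -
  define M where "M = Mr \<alpha> r \<phi> g"
  define b where "b = lattice_avg \<alpha> \<eta> a \<phi> g"
  define B where "B n = ball (a n) (\<eta> / 4 * (1 - cmod (a n)))" for n
  have a: "cmod (a n) < 1" for n using lat by (simp add: disc_lattice_def)
  have [measurable]: "B n \<in> sets borel" for n by (simp add: B_def)
  have \<eta>1: "\<eta> < 1" using \<eta> tanh_real_lt_1[of r] by linarith
  have B_cell: "B n \<subseteq> lattice_cell \<eta> a n" for n
    unfolding B_def lattice_cell_def using \<eta> a[of n] by (intro subset_ball mult_right_mono) auto
  have le: "b n \<le> ennreal (4 powr (\<alpha> + 2)) * M z" "z \<in> udisc" if "z \<in> B n" for n z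
  proof -
    have zc: "z \<in> lattice_cell \<eta> a n" using that B_cell by auto
    note sub = lattice_cell_subset_bdisc[OF a \<eta> zc]
    show "z \<in> udisc" using sub(2) by (simp add: mem_udisc)
    define m where "m = 1 - cmod (a n)"
    have m: "m > 0" using a by (simp add: m_def)
    have "\<eta> * m \<le> 1 * m" using \<eta>1 m by (intro mult_right_mono) auto
    then have "1 - cmod z \<le> 2 * m"
      using zc norm_triangle_ineq2[of "a n" z] by (simp add: lattice_cell_def dist_norm m_def)
    then have "(1 - cmod z) * (1 + cmod z) \<le> (2 * m) * 2" using sub(2) m by (intro mult_mono) auto
    then have "1 - (cmod z)\<^sup>2 \<le> 4 * m" by (simp add: power2_eq_square algebra_simps)
    moreover have p: "0 < 1 - (cmod z)\<^sup>2" using sub(2) by (simp add: abs_square_less_1)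
    ultimately have "(1 - (cmod z)\<^sup>2) powr (\<alpha> + 2) \<le> (4 * m) powr (\<alpha> + 2)" using \<alpha> by (intro powr_mono2) auto
    also have "\<dots> = 4 powr (\<alpha> + 2) * m powr (\<alpha> + 2)" using m by (simp add: powr_mult)
    finally have "inverse (m powr (\<alpha> + 2)) \<le> 4 powr (\<alpha> + 2) * inverse ((1 - (cmod z)\<^sup>2) powr (\<alpha> + 2))"
      using m p by (simp add: field_simps)
    then have "ennreal (inverse (m powr (\<alpha> + 2))) \<le> ennreal (4 powr (\<alpha> + 2)) * ennreal (inverse ((1 - (cmod z)\<^sup>2) powr (\<alpha> + 2)))"
      by (subst ennreal_mult[symmetric]) (auto intro!: ennreal_leI)
    then have "b n \<le> pull_meas \<alpha> \<phi> g (bdisc z r) * (ennreal (4 powr (\<alpha> + 2)) * ennreal (inverse ((1 - (cmod z)\<^sup>2) powr (\<alpha> + 2))))"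
      unfolding b_def lattice_avg_def m_def[symmetric] by (intro mult_mono pull_meas_mono sub) auto
    then show "b n \<le> ennreal (4 powr (\<alpha> + 2)) * M z" by (simp add: M_def Mr_eq[OF sub(2)] mult_ac)
  qed
  have Mfin: "AE z in lborel. z \<in> udisc \<longrightarrow> M z \<noteq> \<infinity>" using L by (simp add: in_L_lambda_def M_def)
  \<comment> \<open>An infinite average would make \<open>M\<close> infinite on a ball of positive
    area, against its finiteness almost everywhere.\<close>
  have bfin: "b n < \<infinity>" for n
  proof (rule ccontr)
    assume "\<not> b n < \<infinity>"
    then have "b n = \<infinity>" by (simp add: less_top[symmetric])
    then have "M z = \<infinity>" if "z \<in> B n" for z
      using le[OF that] by (simp add: top_unique ennreal_mult_eq_top_iff)
    then have "AE z in lborel. z \<notin> B n" using Mfin le(2) by (auto elim!: eventually_mono)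
    then have "B n \<in> null_sets lborel" by (subst AE_iff_null_sets) (auto simp: B_def)
    then have "emeasure lborel (B n) = 0" by (rule null_setsD1)
    moreover have "emeasure lborel (B n) = ennreal (pi * (\<eta> / 4 * (1 - cmod (a n)))\<^sup>2)"
      unfolding B_def using \<eta> a[of n] by (simp add: emeasure_ball unit_ball_vol_2 power2_eq_square)
    ultimately show False using \<eta> a[of n] by simp
  qed
  define Q where "Q z = indicator udisc z * ennreal (enn2real (M z) powr q) * ennreal (dlambda_dens z)" for z
  have [measurable]: "(\<lambda>z. indicator udisc z * M z) \<in> borel_measurable borel"
    using L by (simp add: in_L_lambda_def M_def)
  have Qm [measurable]: "Q \<in> borel_measurable borel"
  proof -
    have "(\<lambda>z. indicator udisc z * ennreal (enn2real (indicator udisc z * M z) powr q) * ennreal (dlambda_dens z)) \<in> borel_measurable borel"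
      by measurable
    moreover have "(\<lambda>z. indicator udisc z * ennreal (enn2real (indicator udisc z * M z) powr q) * ennreal (dlambda_dens z)) = Q"
      by (auto simp: Q_def indicator_def)
    ultimately show ?thesis by simp
  qed
  have Qfin: "(\<integral>\<^sup>+z. Q z \<partial>lborel) < \<infinity>" using L by (simp add: in_L_lambda_def M_def Q_def)
  define K where "K = (4 powr (\<alpha> + 2)) powr q"
  have cell_le: "ennreal (enn2real (b n) powr q) * ennreal (\<eta>\<^sup>2 / 256) \<le> ennreal K * emeasure (density lborel Q) (B n)" for n
  proof -
    have "ennreal (enn2real (b n) powr q) * ennreal (\<eta>\<^sup>2 / 256)
      \<le> ennreal (enn2real (b n) powr q) * (\<integral>\<^sup>+z. indicator (B n) z * ennreal (dlambda_dens z) \<partial>lborel)"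
      unfolding B_def by (intro mult_left_mono dlambda_ball_lower a \<eta> \<eta>1) auto
    also have "\<dots> = (\<integral>\<^sup>+z. ennreal (enn2real (b n) powr q) * (indicator (B n) z * ennreal (dlambda_dens z)) \<partial>lborel)"
      by (rule nn_integral_cmult[symmetric]) measurable
    also have "\<dots> \<le> (\<integral>\<^sup>+z. ennreal K * (Q z * indicator (B n) z) \<partial>lborel)"
    proof (intro nn_integral_mono_AE, use Mfin in eventually_elim)
      fix z assume fin: "z \<in> udisc \<longrightarrow> M z \<noteq> \<infinity>"
      show "ennreal (enn2real (b n) powr q) * (indicator (B n) z * ennreal (dlambda_dens z)) \<le> ennreal K * (Q z * indicator (B n) z)"
      proof (cases "z \<in> B n")
        case True
        have Mz: "M z < \<infinity>" using fin le(2)[OF True] by (simp add: less_top[symmetric])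
        have "enn2real (b n) \<le> enn2real (ennreal (4 powr (\<alpha> + 2)) * M z)"
          using le(1)[OF True] Mz by (intro enn2real_mono) (auto simp: ennreal_mult_less_top)
        also have "\<dots> = 4 powr (\<alpha> + 2) * enn2real (M z)" by (simp add: enn2real_mult)
        finally have "enn2real (b n) powr q \<le> (4 powr (\<alpha> + 2) * enn2real (M z)) powr q"
          using q by (intro powr_mono2) auto
        also have "\<dots> = K * enn2real (M z) powr q" by (simp add: K_def powr_mult)
        finally have "ennreal (enn2real (b n) powr q) \<le> ennreal (K * enn2real (M z) powr q)" by (rule ennreal_leI)
        also have "\<dots> = ennreal K * ennreal (enn2real (M z) powr q)" by (rule ennreal_mult) (auto simp: K_def)
        finally show ?thesis using True le(2)[OF True]
          by (simp add: Q_def mult.assoc[symmetric] mult_right_mono)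
      qed simp
    qed
    also have "\<dots> = ennreal K * (\<integral>\<^sup>+z. Q z * indicator (B n) z \<partial>lborel)"
      by (rule nn_integral_cmult) measurable
    also have "\<dots> = ennreal K * emeasure (density lborel Q) (B n)"
      by (subst emeasure_density) (auto simp: B_def)
    finally show ?thesis .
  qed
  have "(\<Sum>n. ennreal (enn2real (b n) powr q)) * ennreal (\<eta>\<^sup>2 / 256) = (\<Sum>n. ennreal (enn2real (b n) powr q) * ennreal (\<eta>\<^sup>2 / 256))"
    by (rule ennreal_suminf_multc[symmetric])
  also have "\<dots> \<le> (\<Sum>n. ennreal K * emeasure (density lborel Q) (B n))"
    by (intro suminf_le cell_le) auto
  also have "\<dots> = ennreal K * (\<Sum>n. emeasure (density lborel Q) (B n))" by (rule ennreal_suminf_cmult)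
  finally have sum_le: "(\<Sum>n. ennreal (enn2real (b n) powr q)) * ennreal (\<eta>\<^sup>2 / 256)
    \<le> ennreal K * (\<Sum>n. emeasure (density lborel Q) (B n))" .
  have "(\<Sum>n. emeasure (density lborel Q) (B n)) = emeasure (density lborel Q) (\<Union>n. B n)"
    using lat by (intro suminf_emeasure) (auto simp: B_def disc_lattice_def)
  also have "\<dots> \<le> emeasure (density lborel Q) UNIV" by (intro emeasure_mono) auto
  also have "\<dots> = (\<integral>\<^sup>+z. Q z \<partial>lborel)" by (subst emeasure_density) auto
  finally have em: "(\<Sum>n. emeasure (density lborel Q) (B n)) \<le> (\<integral>\<^sup>+z. Q z \<partial>lborel)" .
  note sum_le
  also have "ennreal K * (\<Sum>n. emeasure (density lborel Q) (B n)) \<le> ennreal K * (\<integral>\<^sup>+z. Q z \<partial>lborel)"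
    by (rule mult_left_mono[OF em]) simp
  also have "\<dots> < \<infinity>" using Qfin by (simp add: ennreal_mult_less_top)
  finally have "(\<Sum>n. ennreal (enn2real (b n) powr q)) < \<infinity>"
    using \<eta> by (auto simp: ennreal_mult_less_top)
  then show ?thesis using bfin by (simp add: lattice_summable_def b_def)
qed

text \<open>With \<open>K = 2 / (1 - tanh R)\<close> from \<open>pseudo_hyp_le_comparison\<close>,
  moving between \<open>z\<close> and \<open>w\<close> changes boundary distances by at most the
  factor \<open>K\<close>, and moving within the cell by at most the factor 2; the region has
  constant \<open>2 * K + 1\<close>.\<close>

lemma bdisc_lattice_cell_whitney:
  assumes a: "cmod (a n) < 1" and \<eta>: "0 < \<eta>" "\<eta> \<le> 1 / 2" and z: "cmod z < 1" and R: "R > 0"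
    and w: "w \<in> bdisc z R" "w \<in> lattice_cell \<eta> a n"
  shows "z \<in> whitney_region (4 / (1 - tanh R) + 1) (a n)"
proof -
  define K where "K = 2 / (1 - tanh R)"
  have t: "0 < tanh R" "tanh R < 1" using R tanh_real_lt_1 by auto
  have K2: "K \<ge> 2" using t by (simp add: K_def field_simps)
  have w1: "cmod w < 1" and d: "pseudo_hyp z w \<le> tanh R" using w(1) z by (auto simp: mem_bdisc)
  define m where "m = 1 - cmod (a n)"
  have m: "m > 0" using a by (simp add: m_def)
  have c: "cmod (w - a n) < \<eta> * m" using w(2) by (simp add: lattice_cell_def m_def dist_norm norm_minus_commute)
  have em: "\<eta> * m \<le> 1 / 2 * m" using \<eta> m by (intro mult_right_mono) auto
  have X: "cmod (1 - cnj z * w) \<le> K * (1 - cmod z)" "cmod (1 - cnj z * w) \<le> K * (1 - cmod w)"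
    using pseudo_hyp_le_comparison[OF z w1 d t(2)] by (auto simp: K_def)
  have X': "1 - cmod w \<le> cmod (1 - cnj z * w)" by (rule norm_one_minus_cnj_mult_ge[OF z w1])
  have wa: "1 - cmod w \<le> m + cmod (w - a n)" "m \<le> (1 - cmod w) + cmod (w - a n)"
    using norm_triangle_ineq2[of "a n" w] norm_triangle_ineq2[of w "a n"] by (auto simp: m_def norm_minus_commute)
  have wm: "1 - cmod w \<le> 2 * m" using wa c em m by linarith
  have "m \<le> (1 - cmod w) + 1 / 2 * m" using wa c em by linarith
  then have mw: "m \<le> 2 * (1 - cmod w)" by (simp add: field_simps)
  note mw
  also have "2 * (1 - cmod w) \<le> 2 * cmod (1 - cnj z * w)" using X' by simp
  also have "\<dots> \<le> 2 * (K * (1 - cmod z))" using X(1) by simp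
  also have "\<dots> \<le> (2 * K + 1) * (1 - cmod z)" using z by (simp add: algebra_simps)
  finally have 1: "m \<le> (2 * K + 1) * (1 - cmod z)" .
  have "cmod (z - w) \<le> tanh R * cmod (1 - cnj z * w)"
    using d by (simp add: pseudo_hyp_mult[OF z w1] mult_right_mono)
  also have "\<dots> \<le> 1 * cmod (1 - cnj z * w)" using t by (intro mult_right_mono) auto
  also have "1 * cmod (1 - cnj z * w) \<le> K * (2 * m)"
    using order_trans[OF X(2) mult_left_mono[OF wm]] K2 by simp
  finally have "cmod (z - a n) \<le> K * (2 * m) + 1 / 2 * m"
    using c em norm_triangle_ineq[of "z - w" "w - a n"] by simp
  also have "\<dots> \<le> (2 * K + 1) * m" using m by (simp add: algebra_simps)
  finally show ?thesis using 1 by (simp add: whitney_region_def K_def m_def)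
qed

text \<open>A sum of at most \<open>N\<close> terms is at most \<open>N\<close> times the largest
  one. This works for every \<open>q > 0\<close>, where convexity would require
  \<open>q \<ge> 1\<close>.\<close>

lemma powr_sum_le:
  fixes x :: "nat \<Rightarrow> real"
  assumes "finite J" "card J \<le> N" "\<And>n. x n \<ge> 0" "q > 0"
  shows "(\<Sum>n\<in>J. x n) powr q \<le> real N powr q * (\<Sum>n\<in>J. x n powr q)"
proof (cases "J = {}")
  case False
  have "Max (x ` J) \<in> x ` J" using assms(1) False by (intro Max_in) auto
  then obtain k where k1: "k \<in> J" "Max (x ` J) = x k" by auto
  have k: "k \<in> J" "\<And>n. n \<in> J \<Longrightarrow> x n \<le> x k"
    using k1 assms(1) by (auto simp flip: k1(2))
  have "(\<Sum>n\<in>J. x n) \<le> real (card J) * x k" using sum_bounded_above[of J x "x k"] k by simp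
  also have "\<dots> \<le> real N * x k" using assms by (intro mult_right_mono) auto
  finally have "(\<Sum>n\<in>J. x n) powr q \<le> (real N * x k) powr q"
    using assms by (intro powr_mono2 sum_nonneg) auto
  also have "\<dots> = real N powr q * x k powr q" using assms by (simp add: powr_mult)
  also have "\<dots> \<le> real N powr q * (\<Sum>n\<in>J. x n powr q)"
    using k assms by (intro mult_left_mono member_le_sum) auto
  finally show ?thesis .
qed simp

text \<open>Membership of \<open>\<phi> w\<close> in \<open>bdisc z R\<close> is a jointly
  measurable condition on \<open>z\<close> and \<open>w\<close>, so the average is a parameter
  integral of a jointly measurable function.\<close>

lemma Mr_measurable:
  assumes \<phi>: "admissible_map \<phi>" and g: "continuous_on udisc g"
  shows "(\<lambda>z. indicator udisc z * Mr \<alpha> R \<phi> g z) \<in> borel_measurable lborel"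
proof -
  define \<phi>' where "\<phi>' w = (if w \<in> udisc then \<phi> w else 0)" for w
  have [measurable]: "\<phi>' \<in> borel_measurable borel" using admissible_map_measurable[OF \<phi>] by (simp add: \<phi>'_def[abs_def])
  have [measurable]: "pull_density \<alpha> g \<in> borel_measurable borel" using g by (rule pull_density_measurable)
  have [measurable]: "cnj \<in> borel_measurable borel" by (intro borel_measurable_continuous_onI continuous_intros)
  define F where "F z w = (if cmod ((z - \<phi>' w) / (1 - cnj z * \<phi>' w)) < tanh R then pull_density \<alpha> g w else 0)" for z w
  have F [measurable]: "(\<lambda>z. \<integral>\<^sup>+w. F z w \<partial>lborel) \<in> borel_measurable borel"
    unfolding F_def by measurable
  have "indicator udisc z * Mr \<alpha> R \<phi> g z = indicator udisc z * (\<integral>\<^sup>+w. F z w \<partial>lborel) * ennreal (inverse ((1 - (cmod z)\<^sup>2) powr (\<alpha> + 2)))" for z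
  proof (cases "z \<in> udisc")
    case True
    have "pull_meas \<alpha> \<phi> g (bdisc z R) = (\<integral>\<^sup>+w. F z w \<partial>lborel)"
      unfolding pull_meas_pull_density
    proof (intro nn_integral_cong)
      fix w
      show "pull_density \<alpha> g w * indicator (bdisc z R) (\<phi> w) = F z w"
      proof (cases "w \<in> udisc")
        case w: True
        then have "\<phi> w \<in> udisc" using \<phi> by (auto simp: admissible_map_def)
        then show ?thesis using w True
          by (simp add: F_def \<phi>'_def indicator_def mem_bdisc mem_udisc pseudo_hyp_def)
      qed (simp add: F_def pull_density_def)
    qed
    then show ?thesis using True by (simp add: Mr_eq mem_udisc)
  qed simp
  moreover have "(\<lambda>z. indicator udisc z * (\<integral>\<^sup>+w. F z w \<partial>lborel) * ennreal (inverse ((1 - (cmod z)\<^sup>2) powr (\<alpha> + 2)))) \<in> borel_measurable borel"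
    by measurable
  ultimately show ?thesis by simp
qed

text \<open>The cells that meet \<open>bdisc z R\<close> are among the boundedly many whose Whitney
  region contains \<open>z\<close>, so \<open>Mr\<close> is at most a constant times the sum of
  their averages. The \<open>q\<close>-th powers are then integrated region by region.
  \<open>R\<close> is unrelated to \<open>\<eta>\<close>, which is what makes the radius
  exchangeable.\<close>

lemma lattice_summable_imp_in_L_lambda:
  assumes \<alpha>: "\<alpha> > -1" and q: "q > 0" and lat: "disc_lattice \<eta> a" and \<eta>: "0 < \<eta>" "\<eta> \<le> 1 / 2"
    and \<phi>: "admissible_map \<phi>" and g: "continuous_on udisc g" and R: "R > 0"
    and L: "lattice_summable \<alpha> q \<eta> a \<phi> g"
  shows "in_L_lambda q (Mr \<alpha> R \<phi> g)"
proof -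
  define C where "C = 4 / (1 - tanh R) + 1"
  have C: "C \<ge> 1" using tanh_real_lt_1[of R] by (simp add: C_def)
  define b where "b = lattice_avg \<alpha> \<eta> a \<phi> g"
  have a: "cmod (a n) < 1" for n using lat by (simp add: disc_lattice_def)
  obtain N where N: "\<And>z. finite {n. z \<in> whitney_region C (a n)}" "\<And>z. card {n. z \<in> whitney_region C (a n)} \<le> N"
    using disc_lattice_overlap[OF lat _ _ C] \<eta> by auto
  have bfin: "b n < \<infinity>" for n using L by (simp add: lattice_summable_def b_def)
  have M_le: "Mr \<alpha> R \<phi> g z \<le> ennreal (C powr (\<alpha> + 2)) * (\<Sum>n | z \<in> whitney_region C (a n). b n)" if z: "cmod z < 1" for z
  proof -
    let ?J = "{n. z \<in> whitney_region C (a n)}"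
    have "pull_meas \<alpha> \<phi> g (bdisc z R) = (\<integral>\<^sup>+w. pull_density \<alpha> g w * indicator (bdisc z R) (\<phi> w) \<partial>lborel)"
      by (rule pull_meas_pull_density)
    also have "\<dots> \<le> (\<Sum>n. indicator ?J n * pull_meas \<alpha> \<phi> g (lattice_cell \<eta> a n))"
    proof (rule pull_meas_sum_bound[OF \<phi> g])
      fix w assume "w \<in> udisc"
      show "(indicator (bdisc z R) (\<phi> w) :: ennreal) \<le> (\<Sum>n. indicator ?J n * indicator (lattice_cell \<eta> a n) (\<phi> w))"
      proof (cases "\<phi> w \<in> bdisc z R")
        case True
        then have "cmod (\<phi> w) < 1" by (simp add: bdisc_def mem_udisc)
        then obtain n where n: "\<phi> w \<in> lattice_cell \<eta> a n"
          using lat by (auto simp: disc_lattice_def lattice_cell_def dist_norm norm_minus_commute)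
        then have "n \<in> ?J" using bdisc_lattice_cell_whitney[OF a \<eta> z R True n] by (simp add: C_def)
        then have "indicator (bdisc z R) (\<phi> w) \<le> (indicator ?J n * indicator (lattice_cell \<eta> a n) (\<phi> w) :: ennreal)"
          using n by (simp add: indicator_def)
        also have "\<dots> = (\<Sum>i\<in>{n}. indicator ?J i * indicator (lattice_cell \<eta> a i) (\<phi> w))"
          by (simp only: sum.insert sum.empty finite.emptyI empty_iff not_False_eq_True add_0_right)
        also have "\<dots> \<le> (\<Sum>n. indicator ?J n * indicator (lattice_cell \<eta> a n) (\<phi> w))"
          by (rule sum_le_suminf) auto
        finally show ?thesis .
      qed simp
    qed (simp add: lattice_cell_def)
    also have "\<dots> = (\<Sum>n\<in>?J. pull_meas \<alpha> \<phi> g (lattice_cell \<eta> a n))"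
      using N(1)[of z] by (subst suminf_finite[of ?J]) auto
    finally have "Mr \<alpha> R \<phi> g z \<le> (\<Sum>n\<in>?J. pull_meas \<alpha> \<phi> g (lattice_cell \<eta> a n)) * ennreal (inverse ((1 - (cmod z)\<^sup>2) powr (\<alpha> + 2)))"
      unfolding Mr_eq[OF z] by (intro mult_right_mono) auto
    also have "\<dots> = (\<Sum>n\<in>?J. pull_meas \<alpha> \<phi> g (lattice_cell \<eta> a n) * ennreal (inverse ((1 - (cmod z)\<^sup>2) powr (\<alpha> + 2))))"
      by (rule sum_distrib_right)
    also have "\<dots> \<le> (\<Sum>n\<in>?J. ennreal (C powr (\<alpha> + 2)) * b n)"
    proof (rule sum_mono)
      fix n assume "n \<in> ?J"
      then have zr: "z \<in> whitney_region C (a n)" by simp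
      define m where "m = 1 - cmod (a n)"
      have m: "m > 0" using a by (simp add: m_def)
      have "1 - cmod z \<le> 1 - (cmod z)\<^sup>2" using z by (simp add: power2_eq_square mult_left_le)
      then have "C * (1 - cmod z) \<le> C * (1 - (cmod z)\<^sup>2)" using C by (intro mult_left_mono) auto
      then have "m \<le> C * (1 - (cmod z)\<^sup>2)" using whitney_region_comparison(3)[OF a C zr] by (simp add: m_def)
      then have "m powr (\<alpha> + 2) \<le> (C * (1 - (cmod z)\<^sup>2)) powr (\<alpha> + 2)" using m \<alpha> by (intro powr_mono2) auto
      also have "\<dots> = C powr (\<alpha> + 2) * (1 - (cmod z)\<^sup>2) powr (\<alpha> + 2)" using C z by (simp add: powr_mult abs_square_le_1)
      finally have "inverse ((1 - (cmod z)\<^sup>2) powr (\<alpha> + 2)) \<le> C powr (\<alpha> + 2) * inverse (m powr (\<alpha> + 2))"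
        using m z by (simp add: field_simps abs_square_less_1 abs_square_eq_1)
      then have "ennreal (inverse ((1 - (cmod z)\<^sup>2) powr (\<alpha> + 2))) \<le> ennreal (C powr (\<alpha> + 2)) * ennreal (inverse (m powr (\<alpha> + 2)))"
        by (subst ennreal_mult[symmetric]) (auto intro!: ennreal_leI)
      then have "pull_meas \<alpha> \<phi> g (lattice_cell \<eta> a n) * ennreal (inverse ((1 - (cmod z)\<^sup>2) powr (\<alpha> + 2)))
         \<le> pull_meas \<alpha> \<phi> g (lattice_cell \<eta> a n) * (ennreal (C powr (\<alpha> + 2)) * ennreal (inverse (m powr (\<alpha> + 2))))"
        by (intro mult_left_mono) auto
      also have "\<dots> = ennreal (C powr (\<alpha> + 2)) * b n" by (simp add: b_def lattice_avg_def m_def mult_ac)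
      finally show "pull_meas \<alpha> \<phi> g (lattice_cell \<eta> a n) * ennreal (inverse ((1 - (cmod z)\<^sup>2) powr (\<alpha> + 2))) \<le> ennreal (C powr (\<alpha> + 2)) * b n" .
    qed
    finally show ?thesis by (simp add: sum_distrib_left)
  qed
  have sfin: "(\<Sum>n | z \<in> whitney_region C (a n). b n) < \<infinity>" for z
    using bfin N(1)[of z] by (simp add: ennreal_sum_less_top)
  have Mfin: "Mr \<alpha> R \<phi> g z < \<infinity>" if "cmod z < 1" for z
    using sfin by (intro le_less_trans[OF M_le[OF that]]) (simp add: ennreal_mult_less_top)
  define K where "K = (C powr (\<alpha> + 2)) powr q * real N powr q"
  have K0: "K \<ge> 0" by (simp add: K_def)
  have "(\<integral>\<^sup>+z. indicator udisc z * ennreal (enn2real (Mr \<alpha> R \<phi> g z) powr q) * ennreal (dlambda_dens z) \<partial>lborel)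
     \<le> (\<integral>\<^sup>+z. (\<Sum>n. ennreal (K * enn2real (b n) powr q) * (indicator (whitney_region C (a n)) z * ennreal (dlambda_dens z))) \<partial>lborel)"
  proof (intro nn_integral_mono)
    fix z
    show "indicator udisc z * ennreal (enn2real (Mr \<alpha> R \<phi> g z) powr q) * ennreal (dlambda_dens z)
      \<le> (\<Sum>n. ennreal (K * enn2real (b n) powr q) * (indicator (whitney_region C (a n)) z * ennreal (dlambda_dens z)))"
    proof (cases "z \<in> udisc")
      case True
      then have z: "cmod z < 1" by (simp add: mem_udisc)
      let ?J = "{n. z \<in> whitney_region C (a n)}"
      have "enn2real (Mr \<alpha> R \<phi> g z) \<le> enn2real (ennreal (C powr (\<alpha> + 2)) * (\<Sum>n\<in>?J. b n))"
        using M_le[OF z] sfin[of z] by (intro enn2real_mono) (auto simp: ennreal_mult_less_top)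
      also have "\<dots> = C powr (\<alpha> + 2) * (\<Sum>n\<in>?J. enn2real (b n))"
        using bfin by (simp add: enn2real_mult enn2real_sum)
      finally have "enn2real (Mr \<alpha> R \<phi> g z) powr q \<le> (C powr (\<alpha> + 2) * (\<Sum>n\<in>?J. enn2real (b n))) powr q"
        using q by (intro powr_mono2) auto
      also have "\<dots> = (C powr (\<alpha> + 2)) powr q * (\<Sum>n\<in>?J. enn2real (b n)) powr q" by (simp add: powr_mult sum_nonneg)
      also have "\<dots> \<le> (C powr (\<alpha> + 2)) powr q * (real N powr q * (\<Sum>n\<in>?J. enn2real (b n) powr q))"
        using N[of z] q by (intro mult_left_mono powr_sum_le) auto
      also have "\<dots> = (\<Sum>n\<in>?J. K * enn2real (b n) powr q)" by (simp add: K_def sum_distrib_left mult.assoc)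
      finally have "ennreal (enn2real (Mr \<alpha> R \<phi> g z) powr q) \<le> ennreal (\<Sum>n\<in>?J. K * enn2real (b n) powr q)" by (rule ennreal_leI)
      also have "\<dots> = (\<Sum>n\<in>?J. ennreal (K * enn2real (b n) powr q))"
        using K0 by (subst sum_ennreal) auto
      finally have "ennreal (enn2real (Mr \<alpha> R \<phi> g z) powr q) * ennreal (dlambda_dens z) \<le> (\<Sum>n\<in>?J. ennreal (K * enn2real (b n) powr q)) * ennreal (dlambda_dens z)"
        by (intro mult_right_mono) auto
      also have "\<dots> = (\<Sum>n\<in>?J. ennreal (K * enn2real (b n) powr q) * (indicator (whitney_region C (a n)) z * ennreal (dlambda_dens z)))"
        by (simp add: sum_distrib_right)
      also have "\<dots> \<le> (\<Sum>n. ennreal (K * enn2real (b n) powr q) * (indicator (whitney_region C (a n)) z * ennreal (dlambda_dens z)))"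
        by (rule sum_le_suminf) (use N(1)[of z] in auto)
      finally show ?thesis using True by simp
    qed simp
  qed
  also have "\<dots> = (\<Sum>n. \<integral>\<^sup>+z. ennreal (K * enn2real (b n) powr q) * (indicator (whitney_region C (a n)) z * ennreal (dlambda_dens z)) \<partial>lborel)"
    by (rule nn_integral_suminf) measurable
  also have "\<dots> = (\<Sum>n. ennreal (K * enn2real (b n) powr q) * (\<integral>\<^sup>+z. indicator (whitney_region C (a n)) z * ennreal (dlambda_dens z) \<partial>lborel))"
    by (intro suminf_cong nn_integral_cmult) measurable
  also have "\<dots> \<le> (\<Sum>n. ennreal (K * enn2real (b n) powr q) * ennreal (C ^ 4))"
    by (intro suminf_le mult_left_mono dlambda_whitney_region a C) auto
  also have "\<dots> = (\<Sum>n. ennreal K * ennreal (C ^ 4) * ennreal (enn2real (b n) powr q))"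
    by (intro suminf_cong) (simp add: ennreal_mult K0 mult_ac)
  also have "\<dots> = ennreal K * ennreal (C ^ 4) * (\<Sum>n. ennreal (enn2real (b n) powr q))" by (rule ennreal_suminf_cmult)
  also have "\<dots> < \<infinity>" using L by (simp add: lattice_summable_def b_def ennreal_mult_less_top)
  finally have fin: "(\<integral>\<^sup>+z. indicator udisc z * ennreal (enn2real (Mr \<alpha> R \<phi> g z) powr q) * ennreal (dlambda_dens z) \<partial>lborel) < \<infinity>" .
  have "AE z in lborel. z \<in> udisc \<longrightarrow> Mr \<alpha> R \<phi> g z \<noteq> \<infinity>"
    using Mfin by (intro AE_I2) (simp add: mem_udisc less_top)
  then show ?thesis unfolding in_L_lambda_def using Mr_measurable[OF \<phi> g] fin by blast
qed

section \<open>Local estimates for holomorphic functions\<close>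

lemma measurable_ennreal_norm_square:
  fixes F :: "complex \<Rightarrow> complex"
  assumes [measurable]: "F \<in> borel_measurable borel"
  shows "(\<lambda>w. ennreal ((cmod (F w))\<^sup>2)) \<in> borel_measurable borel"
  by measurable

text \<open>Divide out the zero and apply the maximum principle: on the circle about
  \<open>a\<close> of radius \<open>R\<close> the divisor \<open>x - b\<close> has modulus at least
  \<open>R - cmod (b - a)\<close>.\<close>

lemma holomorphic_factor_zero_bound:
  assumes hol: "f holomorphic_on U" and U: "open U" "cball a R \<subseteq> U" and b: "cmod (b - a) < R" "f b = 0"
    and M: "\<And>x. x \<in> cball a R \<Longrightarrow> cmod (f x) \<le> M"
  obtains g where "g holomorphic_on U" "\<And>x. x \<in> U \<Longrightarrow> f x = (x - b) * g x"
    "\<And>x. x \<in> cball a R \<Longrightarrow> cmod (g x) \<le> M / (R - cmod (b - a))"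
proof -
  define g where "g x = (if x = b then deriv f b else f x / (x - b))" for x
  have holg: "g holomorphic_on U"
    by (rule pole_theorem_open_0[OF hol U(1), of b]) (auto simp: g_def b)
  have eq: "f x = (x - b) * g x" for x using b by (auto simp: g_def)
  have "cmod (g x) \<le> M / (R - cmod (b - a))" if x: "x \<in> cball a R" for x
  proof (rule maximum_modulus_frontier[of g "cball a R"])
    show "g holomorphic_on interior (cball a R)"
      using holg U interior_subset by (meson holomorphic_on_subset subset_trans)
    show "continuous_on (closure (cball a R)) g"
      using holg U by (auto intro!: holomorphic_on_imp_continuous_on elim: holomorphic_on_subset)
    fix y assume "y \<in> frontier (cball a R)"
    moreover have R: "R > 0" using b(1) norm_ge_zero[of "b - a"] by linarith
    ultimately have y: "cmod (y - a) = R" by (auto simp: frontier_cball sphere_def dist_norm norm_minus_commute)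
    have "R - cmod (b - a) \<le> cmod (y - b)"
      using norm_triangle_ineq2[of "y - a" "b - a"] y by simp
    moreover have "cmod (f y) = cmod (y - b) * cmod (g y)" by (simp add: eq norm_mult)
    moreover have "cmod (f y) \<le> M" using M[of y] y by (simp add: dist_norm norm_minus_commute)
    ultimately have "(R - cmod (b - a)) * cmod (g y) \<le> M"
      by (metis mult_right_mono norm_ge_zero order_trans)
    then show "cmod (g y) \<le> M / (R - cmod (b - a))" using b(1) by (simp add: field_simps)
  qed (use x in auto)
  then show ?thesis using that[of g] holg eq by blast
qed

text \<open>Zeros are divided out one at a time; each division costs at most
  \<open>1 / (R - t)\<close> on the large disc, and multiplying back at \<open>w\<close> contributes
  at most \<open>c + t\<close>. The gain is real when \<open>c + t < R - t\<close>.\<close>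

lemma holomorphic_many_zeros_bound:
  assumes "finite S" and "f holomorphic_on U" and U: "open U" "cball a R \<subseteq> U" and R: "0 \<le> t" "t < R"
    and "S \<subseteq> cball a t" and "\<And>x. x \<in> S \<Longrightarrow> f x = 0"
    and "\<And>x. x \<in> cball a R \<Longrightarrow> cmod (f x) \<le> M"
    and w: "w \<in> cball a c" "c \<le> R"
  shows "cmod (f w) \<le> ((c + t) / (R - t)) ^ card S * M"
  using assms(1,2,7,8,9)
proof (induction S arbitrary: f M rule: finite_induct)
  case empty
  then show ?case using w by (simp add: subset_eq)
next
  case (insert b S)
  have b: "cmod (b - a) \<le> t" using insert.prems(2) by (auto simp: dist_norm norm_minus_commute)
  obtain g where g: "g holomorphic_on U" "\<And>x. x \<in> U \<Longrightarrow> f x = (x - b) * g x"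
    "\<And>x. x \<in> cball a R \<Longrightarrow> cmod (g x) \<le> M / (R - cmod (b - a))"
  proof (rule holomorphic_factor_zero_bound[OF insert.prems(1) U, of b M])
    show "cmod (b - a) < R" using b R by linarith
    show "f b = 0" using insert.prems(3) by simp
    show "cmod (f x) \<le> M" if "x \<in> cball a R" for x using that by (rule insert.prems(4))
  qed blast
  have "g x = 0" if "x \<in> S" for x
  proof -
    have "x \<in> U" using that insert.prems(2) U R by (auto simp: subset_eq dist_norm)
    moreover have "x \<noteq> b" "f x = 0" using that insert by auto
    ultimately show ?thesis using g(2)[of x] by simp
  qed
  moreover have "S \<subseteq> cball a t" using insert.prems by auto
  ultimately have "cmod (g w) \<le> ((c + t) / (R - t)) ^ card S * (M / (R - cmod (b - a)))"
    using insert.IH[OF g(1), of "M / (R - cmod (b - a))"] g(3) by blast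
  have "cmod (f a) \<le> M" using insert.prems(4)[of a] R by simp
  then have M: "M \<ge> 0" by (rule order_trans[OF norm_ge_zero])
  have c: "0 \<le> c" using w(1) by (auto intro: order_trans[OF zero_le_dist])
  have wb: "cmod (w - b) \<le> c + t"
    using norm_triangle_ineq[of "w - a" "a - b"] w b by (simp add: dist_norm norm_minus_commute)
  have "w \<in> U" using w U by (auto simp: subset_eq)
  then have "cmod (f w) = cmod (w - b) * cmod (g w)" by (simp add: g(2) norm_mult)
  also have "\<dots> \<le> (c + t) * (((c + t) / (R - t)) ^ card S * (M / (R - cmod (b - a))))"
    using wb \<open>cmod (g w) \<le> _\<close> c R by (intro mult_mono) auto
  also have "\<dots> \<le> (c + t) * (((c + t) / (R - t)) ^ card S * (M / (R - t)))"
    using b R c M by (intro mult_left_mono divide_left_mono mult_pos_pos) auto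
  also have "\<dots> = ((c + t) / (R - t)) ^ card (insert b S) * M"
    using insert.hyps by simp
  finally show ?case .
qed

lemma nn_integral_lborel_affine_complex:
  fixes F :: "complex \<Rightarrow> ennreal"
  assumes [measurable]: "F \<in> borel_measurable borel" and t: "t > 0"
  shows "(\<integral>\<^sup>+w. F w \<partial>lborel) = ennreal (t\<^sup>2) * (\<integral>\<^sup>+w. F (x + t *\<^sub>R w) \<partial>lborel)"
proof -
  have "(\<integral>\<^sup>+w. F w \<partial>lborel) = (\<integral>\<^sup>+w. F w \<partial>density (distr lborel borel (\<lambda>w. x + t *\<^sub>R w)) (\<lambda>_. ennreal (\<bar>t\<bar> ^ DIM(complex))))"
    using lborel_affine[of t x] t by simp
  also have "\<dots> = (\<integral>\<^sup>+w. ennreal (t\<^sup>2) * F (x + t *\<^sub>R w) \<partial>lborel)"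
    by (subst nn_integral_density, simp, simp, subst nn_integral_distr) auto
  also have "\<dots> = ennreal (t\<^sup>2) * (\<integral>\<^sup>+w. F (x + t *\<^sub>R w) \<partial>lborel)"
    by (rule nn_integral_cmult) measurable
  finally show ?thesis .
qed

text \<open>After rescaling to the unit disc this is the reproducing property at 0 in the unweighted
  space: the kernel at 0 has norm 1, and Cauchy-Schwarz bounds the value.\<close>

lemma sub_mean_value_square:
  assumes hol: "f holomorphic_on U" and U: "open U" "cball x t \<subseteq> U" and t: "t > 0"
  shows "ennreal ((cmod (f x))\<^sup>2) \<le> ennreal (1 / (pi * t\<^sup>2)) * (\<integral>\<^sup>+w. indicator (ball x t) w * ennreal ((cmod (f w))\<^sup>2) \<partial>lborel)"
proof -
  define g where "g w = f (x + t *\<^sub>R w)" for w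
  have in_ball: "x + t *\<^sub>R w \<in> cball x t" if "cmod w \<le> 1" for w using that t by (simp add: dist_norm mult_left_le)
  have holg: "g holomorphic_on udisc"
    unfolding g_def
  proof (rule holomorphic_on_compose_gen[unfolded o_def, OF _ hol])
    show "(\<lambda>w. x + t *\<^sub>R w) holomorphic_on udisc" unfolding scaleR_conv_of_real by (intro holomorphic_intros)
    show "(\<lambda>w. x + t *\<^sub>R w) ` udisc \<subseteq> U" using in_ball U by (force simp: mem_udisc)
  qed
  have "compact (f ` cball x t)"
    using hol U by (intro compact_continuous_image holomorphic_on_imp_continuous_on) (auto elim: holomorphic_on_subset)
  then obtain B where B: "\<And>y. y \<in> cball x t \<Longrightarrow> cmod (f y) \<le> B"
    using compact_imp_bounded bounded_iff by (metis image_eqI)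
  have g: "in_A2 0 g" by (rule in_A2_bounded(1)[OF _ holg, of 0 B]) (use B in_ball in \<open>auto simp: g_def mem_udisc\<close>)
  have "A2_inner 0 g (bergman_kernel 0 0) = g 0" by (rule A2_reproducing) (auto simp: g mem_udisc)
  moreover have "A2_norm 0 (bergman_kernel 0 0) = 1"
    using A2_norm_bergman_kernel[of 0 0] by (simp add: mem_udisc power2_eq_1_iff) (smt (verit) A2_norm_nonneg)
  ultimately have "cmod (g 0) \<le> A2_norm 0 g"
    using A2_inner_Cauchy_Schwarz[of 0 g "bergman_kernel 0 0"] in_A2_bergman_kernel[of 0 0] g by (simp add: mem_udisc)
  then have "ennreal ((cmod (f x))\<^sup>2) \<le> ennreal ((A2_norm 0 g)\<^sup>2)" by (intro ennreal_leI power_mono) (auto simp: g_def)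
  also have "\<dots> = bergman_int 0 g" using bergman_int_A2_norm[OF _ g] by simp
  also have "\<dots> = (\<integral>\<^sup>+w. ennreal (1 / pi) * (indicator (ball x t) (x + t *\<^sub>R w) * ennreal ((cmod (f (x + t *\<^sub>R w)))\<^sup>2)) \<partial>lborel)"
    unfolding bergman_int_def
  proof (intro nn_integral_cong)
    fix w
    have "x + t *\<^sub>R w \<in> ball x t \<longleftrightarrow> w \<in> udisc" using t by (simp add: dist_norm mem_udisc)
    moreover have "(1 - (cmod w)\<^sup>2) powr 0 = 1" if "w \<in> udisc" using that by (simp add: mem_udisc abs_square_eq_1)
    ultimately show "indicator udisc w * ennreal (dA_dens 0 w * (cmod (g w))\<^sup>2)
      = ennreal (1 / pi) * (indicator (ball x t) (x + t *\<^sub>R w) * ennreal ((cmod (f (x + t *\<^sub>R w)))\<^sup>2))"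
      by (auto simp: dA_dens_def g_def ennreal_mult[symmetric] split: split_indicator)
  qed
  also have "\<dots> = ennreal (1 / pi) * (\<integral>\<^sup>+w. indicator (ball x t) (x + t *\<^sub>R w) * ennreal ((cmod (f (x + t *\<^sub>R w)))\<^sup>2) \<partial>lborel)"
  proof (rule nn_integral_cmult)
    have "(\<lambda>w. indicat_real udisc w *\<^sub>R g w) \<in> borel_measurable borel" by (rule measurable_indicator_holomorphic[OF holg])
    then have m: "(\<lambda>w. ennreal ((cmod (indicat_real udisc w *\<^sub>R g w))\<^sup>2)) \<in> borel_measurable borel"
      by (rule measurable_ennreal_norm_square)
    have eq: "(\<lambda>w. ennreal ((cmod (indicat_real udisc w *\<^sub>R g w))\<^sup>2))
      = (\<lambda>w. indicator (ball x t) (x + t *\<^sub>R w) * ennreal ((cmod (f (x + t *\<^sub>R w)))\<^sup>2))"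
      using t by (auto simp: g_def indicator_def dist_norm mem_udisc)
    show "(\<lambda>w. indicator (ball x t) (x + t *\<^sub>R w) * ennreal ((cmod (f (x + t *\<^sub>R w)))\<^sup>2)) \<in> borel_measurable lborel" using m unfolding eq by simp
  qed
  also have "(\<integral>\<^sup>+w. indicator (ball x t) (x + t *\<^sub>R w) * ennreal ((cmod (f (x + t *\<^sub>R w)))\<^sup>2) \<partial>lborel)
     = ennreal (1 / t\<^sup>2) * (\<integral>\<^sup>+w. indicator (ball x t) w * ennreal ((cmod (f w))\<^sup>2) \<partial>lborel)"
  proof -
    have cont: "continuous_on (ball x t) f"
      using hol U ball_subset_cball[of x t] by (meson holomorphic_on_imp_continuous_on holomorphic_on_subset subset_trans)
    then have "(\<lambda>w. indicat_real (ball x t) w *\<^sub>R f w) \<in> borel_measurable borel"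
      by (intro borel_measurable_continuous_on_indicator) auto
    then have m: "(\<lambda>w. ennreal ((cmod (indicat_real (ball x t) w *\<^sub>R f w))\<^sup>2)) \<in> borel_measurable borel"
      by (rule measurable_ennreal_norm_square)
    have eq: "(\<lambda>w. ennreal ((cmod (indicat_real (ball x t) w *\<^sub>R f w))\<^sup>2))
      = (\<lambda>w. indicator (ball x t) w * ennreal ((cmod (f w))\<^sup>2))" by (auto simp: indicator_def)
    have "(\<integral>\<^sup>+w. indicator (ball x t) w * ennreal ((cmod (f w))\<^sup>2) \<partial>lborel)
      = ennreal (t\<^sup>2) * (\<integral>\<^sup>+w. indicator (ball x t) (x + t *\<^sub>R w) * ennreal ((cmod (f (x + t *\<^sub>R w)))\<^sup>2) \<partial>lborel)"
      using m t unfolding eq by (intro nn_integral_lborel_affine_complex)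
    moreover have "ennreal (1 / t\<^sup>2) * ennreal (t\<^sup>2) = 1" using t by (simp flip: ennreal_mult)
    ultimately show ?thesis by (simp add: mult.assoc[symmetric])
  qed
  finally show ?thesis using t by (simp add: mult.assoc[symmetric] ennreal_mult[symmetric])
qed

definition local_mass :: "real \<Rightarrow> (complex \<Rightarrow> complex) \<Rightarrow> complex \<Rightarrow> ennreal" where
  "local_mass \<alpha> f a = (\<integral>\<^sup>+w. indicator (ball a ((1 - cmod a) / 2)) w * ennreal (A2_weight \<alpha> w * (cmod (f w))\<^sup>2) \<partial>lborel)"

text \<open>With \<open>m = 1 - cmod a\<close>, the ball of radius \<open>m / 10\<close> about
  \<open>x\<close> lies in the ball of radius \<open>m / 2\<close> about \<open>a\<close>, since
  \<open>2 / 5 + 1 / 10 = 1 / 2\<close>. There the weight is at least a constant times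
  \<open>m powr \<alpha>\<close>, and the mean value inequality applies.\<close>

lemma local_sup_bound:
  assumes \<alpha>: "\<alpha> > -1"
  obtains K where "K > 0"
    "\<And>f a x. f holomorphic_on udisc \<Longrightarrow> cmod a < 1 \<Longrightarrow> x \<in> cball a (2 / 5 * (1 - cmod a)) \<Longrightarrow>
       ennreal ((cmod (f x))\<^sup>2) \<le> ennreal (K * inverse ((1 - cmod a) powr (\<alpha> + 2))) * local_mass \<alpha> f a"
proof -
  \<comment> \<open>\<open>1 - (cmod w)\<^sup>2\<close> lies between \<open>m / 2\<close> and
    \<open>3 * m\<close>; the sign of \<open>\<alpha>\<close> decides which end bounds the weight
    from below.\<close>
  define \<kappa> where "\<kappa> = min ((1 / 2) powr \<alpha>) (3 powr \<alpha>)"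
  have \<kappa>: "\<kappa> > 0" by (simp add: \<kappa>_def)
  \<comment> \<open>The 100 is the inverse square of the averaging radius \<open>m / 10\<close> in
    units of \<open>m\<close>.\<close>
  define K where "K = 100 / ((\<alpha> + 1) * \<kappa>)"
  have K: "K > 0" using \<kappa> \<alpha> by (simp add: K_def)
  have "ennreal ((cmod (f x))\<^sup>2) \<le> ennreal (K * inverse ((1 - cmod a) powr (\<alpha> + 2))) * local_mass \<alpha> f a"
    if hol: "f holomorphic_on udisc" and a: "cmod a < 1" and x: "x \<in> cball a (2 / 5 * (1 - cmod a))" for f a x
  proof -
    define m where "m = 1 - cmod a"
    have m: "m > 0" using a by (simp add: m_def)
    have sub: "ball x (m / 10) \<subseteq> ball a (m / 2)"
    proof
      fix y assume "y \<in> ball x (m / 10)"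
      then show "y \<in> ball a (m / 2)" using x dist_triangle[of a y x] by (simp add: m_def)
    qed
    have sub1: "cball x (m / 10) \<subseteq> udisc"
    proof
      fix y assume "y \<in> cball x (m / 10)"
      then have "dist a y \<le> m / 2" using x dist_triangle[of a y x] by (simp add: m_def)
      then show "y \<in> udisc" using m norm_triangle_ineq2[of y a] by (simp add: m_def mem_udisc dist_norm norm_minus_commute)
    qed
    have wt: "(\<alpha> + 1) / pi * (\<kappa> * m powr \<alpha>) \<le> A2_weight \<alpha> w" if "w \<in> ball a (m / 2)" for w
    proof -
      have w: "m / 2 \<le> 1 - cmod w" "1 - cmod w \<le> 3 / 2 * m"
        using that norm_triangle_ineq2[of w a] norm_triangle_ineq2[of a w] by (auto simp: m_def dist_norm norm_minus_commute)
      then have w1: "cmod w < 1" using m by linarith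
      have e: "1 - (cmod w)\<^sup>2 = (1 - cmod w) * (1 + cmod w)" by (simp add: power2_eq_square algebra_simps)
      have lo: "1 / 2 * m \<le> 1 - (cmod w)\<^sup>2"
      proof -
        have "(1 - cmod w) * 1 \<le> (1 - cmod w) * (1 + cmod w)" using w1 by (intro mult_left_mono) auto
        then show ?thesis using w e by simp
      qed
      have hi: "1 - (cmod w)\<^sup>2 \<le> 3 * m"
      proof -
        have "(1 - cmod w) * (1 + cmod w) \<le> (3 / 2 * m) * 2" using w w1 m by (intro mult_mono) auto
        then show ?thesis using e by simp
      qed
      have "\<kappa> * m powr \<alpha> \<le> (1 - (cmod w)\<^sup>2) powr \<alpha>"
      proof (cases "\<alpha> \<ge> 0")
        case True
        have "\<kappa> * m powr \<alpha> \<le> (1 / 2) powr \<alpha> * m powr \<alpha>" by (intro mult_right_mono) (auto simp: \<kappa>_def)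
        also have "\<dots> = (1 / 2 * m) powr \<alpha>" using m by (subst powr_mult) auto
        also have "\<dots> \<le> (1 - (cmod w)\<^sup>2) powr \<alpha>" using lo m True by (intro powr_mono2) auto
        finally show ?thesis .
      next
        case False
        have "\<kappa> * m powr \<alpha> \<le> 3 powr \<alpha> * m powr \<alpha>" by (intro mult_right_mono) (auto simp: \<kappa>_def)
        also have "\<dots> = (3 * m) powr \<alpha>" using m by (subst powr_mult) auto
        also have "\<dots> \<le> (1 - (cmod w)\<^sup>2) powr \<alpha>" using hi lo m False by (intro powr_mono2') auto
        finally show ?thesis .
      qed
      then have "(\<alpha> + 1) / pi * (\<kappa> * m powr \<alpha>) \<le> (\<alpha> + 1) / pi * (1 - (cmod w)\<^sup>2) powr \<alpha>"
        using \<alpha> by (intro mult_left_mono) auto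
      then show ?thesis using w1 by (simp add: A2_weight_def dA_dens_def mem_udisc)
    qed
    define W where "W = (\<alpha> + 1) / pi * (\<kappa> * m powr \<alpha>)"
    have W: "W > 0" using \<alpha> \<kappa> m by (simp add: W_def)
    have "ennreal ((cmod (f x))\<^sup>2) \<le> ennreal (1 / (pi * (m / 10)\<^sup>2)) * (\<integral>\<^sup>+w. indicator (ball x (m / 10)) w * ennreal ((cmod (f w))\<^sup>2) \<partial>lborel)"
      using m by (intro sub_mean_value_square[OF hol open_udisc sub1]) auto
    also have "(\<integral>\<^sup>+w. indicator (ball x (m / 10)) w * ennreal ((cmod (f w))\<^sup>2) \<partial>lborel)
       \<le> (\<integral>\<^sup>+w. ennreal (1 / W) * (indicator (ball a (m / 2)) w * ennreal (A2_weight \<alpha> w * (cmod (f w))\<^sup>2)) \<partial>lborel)"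
    proof (intro nn_integral_mono)
      fix w
      show "indicator (ball x (m / 10)) w * ennreal ((cmod (f w))\<^sup>2)
        \<le> ennreal (1 / W) * (indicator (ball a (m / 2)) w * ennreal (A2_weight \<alpha> w * (cmod (f w))\<^sup>2))"
      proof (cases "w \<in> ball x (m / 10)")
        case True
        then have wa: "w \<in> ball a (m / 2)" using sub by blast
        have "W * (cmod (f w))\<^sup>2 \<le> A2_weight \<alpha> w * (cmod (f w))\<^sup>2" using wt[OF wa] by (intro mult_right_mono) (auto simp: W_def)
        then have "(cmod (f w))\<^sup>2 \<le> 1 / W * (A2_weight \<alpha> w * (cmod (f w))\<^sup>2)" using W by (simp add: field_simps)
        then have "ennreal ((cmod (f w))\<^sup>2) \<le> ennreal (1 / W * (A2_weight \<alpha> w * (cmod (f w))\<^sup>2))" by (rule ennreal_leI)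
        also have "\<dots> = ennreal (1 / W) * ennreal (A2_weight \<alpha> w * (cmod (f w))\<^sup>2)"
          using W A2_weight_nonneg[OF \<alpha>, of w] by (intro ennreal_mult) auto
        finally show ?thesis using True wa by simp
      qed simp
    qed
    also have "\<dots> = ennreal (1 / W) * local_mass \<alpha> f a"
      unfolding local_mass_def m_def using measurable_weight_norm2[OF hol, of \<alpha>]
      by (intro nn_integral_cmult borel_measurable_times_ennreal borel_measurable_indicator measurable_compose[OF _ measurable_ennreal]) simp_all
    finally have "ennreal ((cmod (f x))\<^sup>2) \<le> ennreal (1 / (pi * (m / 10)\<^sup>2)) * (ennreal (1 / W) * local_mass \<alpha> f a)"
      by (simp add: mult_left_mono)
    also have "\<dots> = ennreal (1 / (pi * (m / 10)\<^sup>2) * (1 / W)) * local_mass \<alpha> f a"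
      using W m by (subst ennreal_mult) (auto simp only: mult.assoc zero_le_divide_1_iff less_imp_le zero_le_mult_iff pi_ge_zero zero_le_power2)
    also have "1 / (pi * (m / 10)\<^sup>2) * (1 / W) = K * inverse (m powr (\<alpha> + 2))"
    proof -
      have "m powr (\<alpha> + 2) = m powr \<alpha> * m\<^sup>2" using m by (simp add: powr_add)
      then show ?thesis using m \<alpha> \<kappa> by (simp add: W_def K_def field_simps power2_eq_square)
    qed
    finally show ?thesis by (simp add: m_def)
  qed
  then show ?thesis using that K by blast
qed

text \<open>The balls that carry \<open>local_mass\<close> lie in the Whitney regions with constant
  2, whose overlap is bounded.\<close>

lemma local_mass_sum_le:
  assumes \<alpha>: "\<alpha> > -1" and lat: "disc_lattice \<eta> a" and \<eta>: "0 < \<eta>" "\<eta> < 1"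
  obtains N :: nat where "\<And>f. in_A2 \<alpha> f \<Longrightarrow> (\<Sum>n. local_mass \<alpha> f (a n)) \<le> of_nat N * bergman_int \<alpha> f"
proof -
  obtain N where N: "\<And>z. finite {n. z \<in> whitney_region 2 (a n)}" "\<And>z. card {n. z \<in> whitney_region 2 (a n)} \<le> N"
    using disc_lattice_overlap[OF lat \<eta>, of 2] by auto
  have a: "cmod (a n) < 1" for n using lat by (simp add: disc_lattice_def)
  have sub: "z \<in> whitney_region 2 (a n)" if "z \<in> ball (a n) ((1 - cmod (a n)) / 2)" for z n
    using that norm_triangle_ineq2[of z "a n"] a[of n]
    by (auto simp: whitney_region_def dist_norm norm_minus_commute)
  have "(\<Sum>n. local_mass \<alpha> f (a n)) \<le> of_nat N * bergman_int \<alpha> f" if f: "in_A2 \<alpha> f" for f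
  proof -
    let ?h = "\<lambda>w. ennreal (A2_weight \<alpha> w * (cmod (f w))\<^sup>2)"
    have h: "?h \<in> borel_measurable borel"
      using f measurable_weight_norm2[of f \<alpha>]
      by (intro measurable_compose[OF _ measurable_ennreal]) (simp add: in_A2_def)
    have "(\<Sum>n. local_mass \<alpha> f (a n)) = (\<integral>\<^sup>+w. (\<Sum>n. indicator (ball (a n) ((1 - cmod (a n)) / 2)) w * ?h w) \<partial>lborel)"
      unfolding local_mass_def using h
      by (intro nn_integral_suminf[symmetric] borel_measurable_times_ennreal borel_measurable_indicator) simp_all
    also have "\<dots> \<le> (\<integral>\<^sup>+w. of_nat N * ?h w \<partial>lborel)"
    proof (intro nn_integral_mono)
      fix w
      have "(\<Sum>n. indicator (ball (a n) ((1 - cmod (a n)) / 2)) w * ?h w) \<le> (\<Sum>n. indicator {n. w \<in> whitney_region 2 (a n)} n * ?h w)"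
      proof (intro suminf_le mult_right_mono)
        show "indicator (ball (a n) ((1 - cmod (a n)) / 2)) w \<le> (indicator {n. w \<in> whitney_region 2 (a n)} n :: ennreal)" for n
          using sub[of w n] unfolding indicator_def mem_Collect_eq by (cases "w \<in> whitney_region 2 (a n)") auto
      qed auto
      also have "\<dots> = (\<Sum>n\<in>{n. w \<in> whitney_region 2 (a n)}. ?h w)"
        using N(1)[of w] by (subst suminf_finite[of "{n. w \<in> whitney_region 2 (a n)}"]) auto
      also have "\<dots> = of_nat (card {n. w \<in> whitney_region 2 (a n)}) * ?h w" by simp
      also have "\<dots> \<le> of_nat N * ?h w" using N(2)[of w] by (intro mult_right_mono) auto
      finally show "(\<Sum>n. indicator (ball (a n) ((1 - cmod (a n)) / 2)) w * ?h w) \<le> of_nat N * ?h w" .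
    qed
    also have "\<dots> = of_nat N * bergman_int \<alpha> f"
      unfolding bergman_int_weight using h by (intro nn_integral_cmult) simp
    finally show ?thesis .
  qed
  then show ?thesis using that by blast
qed

text \<open>With \<open>m = 1 - cmod a\<close>, zeros within \<open>m / 20\<close>, points within
  \<open>m / 10\<close> and the supremum over radius \<open>2 / 5 * m\<close> give the factor
  \<open>(3 / 20) / (7 / 20) = 3 / 7\<close> per zero, which is below \<open>1 / 2\<close>; squaring
  turns this into \<open>1 / 4\<close>.\<close>

lemma local_sup_bound_zeros:
  assumes \<alpha>: "\<alpha> > -1"
  obtains K where "K > 0"
    "\<And>f a x S. f holomorphic_on udisc \<Longrightarrow> cmod a < 1 \<Longrightarrow> x \<in> cball a (1 / 10 * (1 - cmod a)) \<Longrightarrow>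
       finite S \<Longrightarrow> S \<subseteq> cball a (1 / 20 * (1 - cmod a)) \<Longrightarrow> (\<And>y. y \<in> S \<Longrightarrow> f y = 0) \<Longrightarrow>
       ennreal ((cmod (f x))\<^sup>2) \<le> ennreal ((1 / 4) ^ card S * K * inverse ((1 - cmod a) powr (\<alpha> + 2))) * local_mass \<alpha> f a"
proof -
  obtain K where K: "K > 0"
    "\<And>f a x. f holomorphic_on udisc \<Longrightarrow> cmod a < 1 \<Longrightarrow> x \<in> cball a (2 / 5 * (1 - cmod a)) \<Longrightarrow>
       ennreal ((cmod (f x))\<^sup>2) \<le> ennreal (K * inverse ((1 - cmod a) powr (\<alpha> + 2))) * local_mass \<alpha> f a"
    using local_sup_bound[OF \<alpha>] by blast
  have "ennreal ((cmod (f x))\<^sup>2) \<le> ennreal ((1 / 4) ^ card S * K * inverse ((1 - cmod a) powr (\<alpha> + 2))) * local_mass \<alpha> f a"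
    if hol: "f holomorphic_on udisc" and a: "cmod a < 1" and x: "x \<in> cball a (1 / 10 * (1 - cmod a))"
      and S: "finite S" "S \<subseteq> cball a (1 / 20 * (1 - cmod a))" "\<And>y. y \<in> S \<Longrightarrow> f y = 0" for f a x S
  proof -
    define m where "m = 1 - cmod a"
    have m: "m > 0" using a by (simp add: m_def)
    have sub: "cball a (2 / 5 * m) \<subseteq> udisc"
    proof
      fix y assume "y \<in> cball a (2 / 5 * m)"
      then show "y \<in> udisc" using m norm_triangle_ineq2[of y a] by (simp add: m_def mem_udisc dist_norm norm_minus_commute)
    qed
    \<comment> \<open>The supremum is attained, so the bound by \<open>local_mass\<close> can be
      applied at a point.\<close>
    have "\<exists>y\<in>cball a (2 / 5 * m). \<forall>z\<in>cball a (2 / 5 * m). cmod (f z) \<le> cmod (f y)"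
    proof (rule continuous_attains_sup)
      show "continuous_on (cball a (2 / 5 * m)) (\<lambda>y. cmod (f y))"
        using hol sub by (intro continuous_intros holomorphic_on_imp_continuous_on) (auto elim: holomorphic_on_subset)
    qed (use m in auto)
    then obtain y where y: "y \<in> cball a (2 / 5 * m)" "\<And>z. z \<in> cball a (2 / 5 * m) \<Longrightarrow> cmod (f z) \<le> cmod (f y)"
      by blast
    have "cmod (f x) \<le> ((1 / 10 * m + 1 / 20 * m) / (2 / 5 * m - 1 / 20 * m)) ^ card S * cmod (f y)"
    proof (rule holomorphic_many_zeros_bound[OF S(1) hol open_udisc sub])
      show "0 \<le> 1 / 20 * m" "1 / 20 * m < 2 / 5 * m" "1 / 10 * m \<le> 2 / 5 * m" using m by auto
      show "S \<subseteq> cball a (1 / 20 * m)" "x \<in> cball a (1 / 10 * m)" using S x by (auto simp: m_def)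
    qed (use S y in auto)
    also have "(1 / 10 * m + 1 / 20 * m) / (2 / 5 * m - 1 / 20 * m) = 3 / 7" using m by (simp add: field_simps)
    also have "(3 / 7) ^ card S * cmod (f y) \<le> (1 / 2) ^ card S * cmod (f y)" by (intro mult_right_mono power_mono) auto
    finally have "(cmod (f x))\<^sup>2 \<le> ((1 / 2) ^ card S * cmod (f y))\<^sup>2" by (intro power_mono) auto
    also have "\<dots> = (1 / 4) ^ card S * (cmod (f y))\<^sup>2"
    proof -
      have "((1 / 2 :: real) ^ card S)\<^sup>2 = ((1 / 2)\<^sup>2) ^ card S" by (simp only: power_mult[symmetric] mult.commute)
      then show ?thesis by (simp add: power_mult_distrib power2_eq_square)
    qed
    finally have "ennreal ((cmod (f x))\<^sup>2) \<le> ennreal ((1 / 4) ^ card S) * ennreal ((cmod (f y))\<^sup>2)"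
      by (subst ennreal_mult[symmetric]) (auto intro: ennreal_leI)
    also have "\<dots> \<le> ennreal ((1 / 4) ^ card S) * (ennreal (K * inverse (m powr (\<alpha> + 2))) * local_mass \<alpha> f a)"
      using K(2)[OF hol a, of y] y(1) by (intro mult_left_mono) (auto simp: m_def)
    also have "\<dots> = ennreal ((1 / 4) ^ card S * (K * inverse (m powr (\<alpha> + 2)))) * local_mass \<alpha> f a"
      using K(1) by (subst ennreal_mult) (auto simp: mult.assoc)
    finally show ?thesis by (simp add: m_def mult.assoc)
  qed
  then show ?thesis using that K(1) by blast
qed

text \<open>\<open>f - f y\<close> vanishes at \<open>y\<close>, so
  \<open>f x - f y = (x - y) * g x\<close> with \<open>g\<close> bounded by \<open>2 * M\<close>
  divided by \<open>m / 10 - m / 25\<close>, where \<open>m = 1 - cmod a\<close>. This divisor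
  exceeds \<open>m / 20\<close>, whence the constant \<open>2 * 20\<close>.\<close>

lemma difference_bound:
  assumes hol: "f holomorphic_on udisc" and a: "cmod a < 1"
    and x: "x \<in> cball a (1 / 25 * (1 - cmod a))" and y: "y \<in> cball a (1 / 25 * (1 - cmod a))"
    and M: "\<And>z. z \<in> cball a (1 / 10 * (1 - cmod a)) \<Longrightarrow> cmod (f z) \<le> M"
  shows "cmod (f x - f y) * (1 - cmod a) \<le> 40 * cmod (x - y) * M"
proof -
  define m where "m = 1 - cmod a"
  have m: "m > 0" using a by (simp add: m_def)
  have sub: "cball a (1 / 10 * m) \<subseteq> udisc"
  proof
    fix y assume "y \<in> cball a (1 / 10 * m)"
    then show "y \<in> udisc" using m norm_triangle_ineq2[of y a] by (simp add: m_def mem_udisc dist_norm norm_minus_commute)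
  qed
  have ya: "cmod (y - a) \<le> 1 / 25 * m" using y by (simp add: dist_norm m_def norm_minus_commute)
  have y': "y \<in> cball a (1 / 10 * m)" and x': "x \<in> cball a (1 / 10 * m)" using x y m by (auto simp: m_def)
  have M2: "cmod (f z - f y) \<le> 2 * M" if "z \<in> cball a (1 / 10 * m)" for z
    using M[of z] M[of y] that y' norm_triangle_ineq4[of "f z" "f y"] by (simp add: m_def)
  have M0: "M \<ge> 0" using M[of y] y' order_trans[OF norm_ge_zero] by (auto simp: m_def)
  obtain g where g: "\<And>z. z \<in> udisc \<Longrightarrow> f z - f y = (z - y) * g z"
    "\<And>z. z \<in> cball a (1 / 10 * m) \<Longrightarrow> cmod (g z) \<le> 2 * M / (1 / 10 * m - cmod (y - a))"
  proof (rule holomorphic_factor_zero_bound[of "\<lambda>z. f z - f y" udisc a "1 / 10 * m" y "2 * M"])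
    show "(\<lambda>z. f z - f y) holomorphic_on udisc" using hol by (intro holomorphic_intros)
    show "cmod (y - a) < 1 / 10 * m" using ya m by linarith
  qed (use sub open_udisc M2 in auto)
  have "x \<in> udisc" using x' sub by blast
  then have "cmod (f x - f y) = cmod (x - y) * cmod (g x)" by (simp add: g norm_mult)
  also have "\<dots> \<le> cmod (x - y) * (2 * M / (1 / 10 * m - cmod (y - a)))" by (intro mult_left_mono g(2) x') auto
  also have "\<dots> \<le> cmod (x - y) * (2 * M / (1 / 20 * m))"
    using ya m M0 by (intro mult_left_mono divide_left_mono mult_pos_pos) auto
  finally show ?thesis using m by (simp add: m_def[symmetric] field_simps)
qed

text \<open>If the pseudo-hyperbolic distance \<open>d\<close> is at least \<open>1 / 100\<close>
  the two terms are estimated separately, since \<open>1 \<le> 100 * d\<close> supplies the missing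
  factor \<open>d\<close>. Otherwise
  \<open>u * f x - v * f y = u * (f x - f y) + (u - v) * f y\<close>: the first term gains the
  factor \<open>d\<close> from \<open>difference_bound\<close>, and
  \<open>(1 - d) powr \<beta>\<close> is bounded below in the second. The 20000 is twice the square
  of 100.\<close>

lemma weighted_difference_pointwise:
  assumes hol: "f holomorphic_on udisc" and lat: "disc_lattice (1 / 100) a" and \<beta>: "\<beta> \<ge> 0"
    and x: "cmod x < 1" and y: "cmod y < 1"
    and S: "\<And>n z. z \<in> cball (a n) (1 / 10 * (1 - cmod (a n))) \<Longrightarrow> cmod (f z) \<le> S n"
    and n: "x \<in> lattice_cell (1 / 100) a n" and k: "y \<in> lattice_cell (1 / 100) a k"
  shows "(cmod (u * f x - v * f y))\<^sup>2 \<le> (20000 + 2 / (99 / 100) powr \<beta>) *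
    ((pseudo_hyp x y * cmod u)\<^sup>2 * (S n)\<^sup>2 + ((pseudo_hyp x y * cmod v)\<^sup>2 + (1 - pseudo_hyp x y) powr \<beta> * (cmod (u - v))\<^sup>2) * (S k)\<^sup>2)"
proof -
  define d where "d = pseudo_hyp x y"
  have d: "0 \<le> d" "d < 1" using pseudo_hyp_bounds[OF x y] by (auto simp: d_def)
  have a: "cmod (a n) < 1" for n using lat by (simp add: disc_lattice_def)
  have cell: "z \<in> cball (a n) (1 / 10 * (1 - cmod (a n)))" if "z \<in> lattice_cell (1 / 100) a n" for z n
    using that a[of n] by (auto simp: lattice_cell_def)
  have fx: "cmod (f x) \<le> S n" and fy: "cmod (f y) \<le> S k" using S cell n k by auto
  have two: "(cmod (p - q))\<^sup>2 \<le> 2 * (cmod p)\<^sup>2 + 2 * (cmod q)\<^sup>2" for p q :: complex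
  proof -
    have "(cmod (p - q))\<^sup>2 \<le> (cmod p + cmod q)\<^sup>2" by (intro power_mono norm_triangle_ineq4) auto
    then show ?thesis using sum_squares_bound[of "cmod p" "cmod q"] by (simp add: power2_sum)
  qed
  define A B E where "A = (d * cmod u)\<^sup>2 * (S n)\<^sup>2" and "B = (d * cmod v)\<^sup>2 * (S k)\<^sup>2"
    and "E = (1 - d) powr \<beta> * (cmod (u - v))\<^sup>2 * (S k)\<^sup>2"
  have nn: "A \<ge> 0" "B \<ge> 0" "E \<ge> 0" by (auto simp: A_def B_def E_def)
  have p99: "0 < (99 / 100 :: real) powr \<beta>" by simp
  have "(cmod (u * f x - v * f y))\<^sup>2 \<le> 20000 * A + 20000 * B + 2 / (99 / 100) powr \<beta> * E"
  proof (cases "d \<ge> 1 / 100")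
    case True
    have le: "(cmod (c * g))\<^sup>2 \<le> 10000 * ((d * cmod c)\<^sup>2 * s\<^sup>2)" if "cmod g \<le> s" for c g :: complex and s
    proof -
      have "cmod g * 1 \<le> s * (100 * d)" using that True order_trans[OF norm_ge_zero that] by (intro mult_mono) auto
      then have "cmod (c * g) \<le> cmod c * (s * (100 * d))" by (simp add: norm_mult mult_left_mono)
      then have "(cmod (c * g))\<^sup>2 \<le> (cmod c * (s * (100 * d)))\<^sup>2" by (intro power_mono) auto
      then show ?thesis by (simp add: power_mult_distrib mult_ac)
    qed
    have "(cmod (u * f x - v * f y))\<^sup>2 \<le> 20000 * A + 20000 * B"
      using two[of "u * f x" "v * f y"] le[OF fx, of u] le[OF fy, of v] by (simp add: A_def B_def)
    then show ?thesis using nn p99 by (simp add: add_increasing2)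
  next
    case False
    define m where "m = 1 - cmod (a n)"
    have m: "m > 0" using a by (simp add: m_def)
    have xa: "cmod (x - a n) < 1 / 100 * m" using n by (simp add: lattice_cell_def m_def dist_norm norm_minus_commute)
    have xm: "1 - cmod x \<le> 101 / 100 * m"
      using xa norm_triangle_ineq2[of "a n" x] by (simp add: m_def norm_minus_commute)
    have "cmod (1 - cnj x * y) \<le> 2 / (1 - 1 / 100) * (1 - cmod x)"
      by (rule pseudo_hyp_le_comparison[OF x y]) (use False in \<open>auto simp: d_def\<close>)
    also have "\<dots> \<le> 2 / (1 - 1 / 100) * (101 / 100 * m)" using xm by (intro mult_left_mono) auto
    also have "\<dots> \<le> 5 / 2 * m" using m by simp
    finally have X: "cmod (1 - cnj x * y) \<le> 5 / 2 * m" .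
    have "cmod (x - y) = d * cmod (1 - cnj x * y)" by (simp add: d_def pseudo_hyp_mult[OF x y])
    also have "\<dots> \<le> d * (5 / 2 * m)" using X d by (intro mult_left_mono)
    finally have xy: "cmod (x - y) \<le> d * (5 / 2 * m)" .
    also have "\<dots> \<le> 1 / 100 * (5 / 2 * m)" using False m by (intro mult_right_mono) auto
    \<comment> \<open>\<open>1 / 100 + 1 / 40\<close> is below \<open>1 / 25\<close>, so
      \<open>y\<close> is still close enough to the centre of the cell of \<open>x\<close> for
      \<open>difference_bound\<close>.\<close>
    finally have ya: "cmod (y - a n) \<le> 1 / 25 * m"
      using xa norm_triangle_ineq[of "y - x" "x - a n"] m by (simp add: norm_minus_commute)
    have diff: "cmod (f x - f y) * m \<le> 40 * cmod (x - y) * S n"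
      unfolding m_def by (rule difference_bound[OF hol a _ _ S])
        (use xa ya m in \<open>auto simp: m_def dist_norm norm_minus_commute\<close>)
    have S0: "S n \<ge> 0" using order_trans[OF norm_ge_zero fx] .
    have "40 * cmod (x - y) * S n \<le> 40 * (d * (5 / 2 * m)) * S n"
      using xy S0 by (intro mult_right_mono) auto
    also have "40 * (d * (5 / 2 * m)) * S n = (100 * d * S n) * m" by simp
    finally have "cmod (f x - f y) * m \<le> (100 * d * S n) * m" using diff by linarith
    then have "cmod (f x - f y) \<le> 100 * d * S n" using m by (rule mult_right_le_imp_le)
    then have "cmod (u * (f x - f y)) \<le> cmod u * (100 * d * S n)" by (simp add: norm_mult mult_left_mono)
    then have "(cmod (u * (f x - f y)))\<^sup>2 \<le> (cmod u * (100 * d * S n))\<^sup>2" by (intro power_mono) auto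
    then have 1: "(cmod (u * (f x - f y)))\<^sup>2 \<le> 10000 * A" by (simp add: A_def power_mult_distrib mult_ac)
    have "(99 / 100) powr \<beta> \<le> (1 - d) powr \<beta>" using False \<beta> by (intro powr_mono2) auto
    then have "1 \<le> 1 / (99 / 100) powr \<beta> * (1 - d) powr \<beta>" using p99 by (simp add: field_simps)
    then have "1 * ((cmod (u - v))\<^sup>2 * (S k)\<^sup>2) \<le> (1 / (99 / 100) powr \<beta> * (1 - d) powr \<beta>) * ((cmod (u - v))\<^sup>2 * (S k)\<^sup>2)"
      by (rule mult_right_mono) simp
    moreover have "(cmod ((u - v) * f y))\<^sup>2 \<le> (cmod (u - v))\<^sup>2 * (S k)\<^sup>2"
      unfolding norm_mult power_mult_distrib using fy by (intro mult_left_mono power_mono) auto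
    ultimately have 2: "(cmod ((u - v) * f y))\<^sup>2 \<le> 1 / (99 / 100) powr \<beta> * E" by (simp add: E_def mult_ac)
    have "u * f x - v * f y = u * (f x - f y) - (- ((u - v) * f y))" by (simp add: algebra_simps)
    then have "(cmod (u * f x - v * f y))\<^sup>2 \<le> 2 * (cmod (u * (f x - f y)))\<^sup>2 + 2 * (cmod ((u - v) * f y))\<^sup>2"
      using two[of "u * (f x - f y)" "- ((u - v) * f y)"] by simp
    also have "\<dots> \<le> 2 * (10000 * A) + 2 * (1 / (99 / 100) powr \<beta> * E)" using 1 2 by linarith
    finally show ?thesis using nn by simp
  qed
  also have "\<dots> \<le> (20000 + 2 / (99 / 100) powr \<beta>) * (A + (B + E))"
  proof -
    define c where "c = 2 / (99 / 100 :: real) powr \<beta>"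
    have "0 \<le> c * A" "0 \<le> c * B" using nn p99 by (auto simp: c_def)
    then have "20000 * A + 20000 * B + c * E \<le> (20000 + c) * (A + (B + E))"
      using nn by (simp add: algebra_simps)
    then show ?thesis by (simp only: c_def)
  qed
  finally show ?thesis by (simp add: A_def B_def E_def d_def algebra_simps)
qed

section \<open>The difference of two weighted composition operators\<close>

locale weighted_pair =
  fixes \<alpha> \<beta> :: real and u v \<phi> \<psi> :: "complex \<Rightarrow> complex"
  assumes alpha: "\<alpha> > -1" and beta: "\<beta> \<ge> 2 * (\<alpha> + 2)"
    and u: "u holomorphic_on udisc" and v: "v holomorphic_on udisc"
    and phi: "\<phi> holomorphic_on udisc" "\<phi> ` udisc \<subseteq> udisc"
    and psi: "\<psi> holomorphic_on udisc" "\<psi> ` udisc \<subseteq> udisc"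
begin

definition T :: A2op where "T = (\<lambda>f z. wcomp u \<phi> f z - wcomp v \<psi> f z)"

text \<open>The densities before transport: \<open>dens_u\<close> is carried by
  \<open>\<phi>\<close>, \<open>dens_v\<close> by \<open>\<psi>\<close>, and \<open>dens_uv\<close>
  by each of the two maps.\<close>

definition dens_u :: "complex \<Rightarrow> real" where "dens_u z = (rho \<phi> \<psi> z * cmod (u z))\<^sup>2"
definition dens_v :: "complex \<Rightarrow> real" where "dens_v z = (rho \<phi> \<psi> z * cmod (v z))\<^sup>2"
definition dens_uv :: "complex \<Rightarrow> real" where "dens_uv z = (1 - rho \<phi> \<psi> z) powr \<beta> * (cmod (u z - v z))\<^sup>2"

lemma T_apply: "T f z = u z * f (\<phi> z) - v z * f (\<psi> z)"
  by (simp add: T_def wcomp_def)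

lemma map_in_disc:
  assumes "cmod z < 1"
  shows "cmod (\<phi> z) < 1" "cmod (\<psi> z) < 1"
  using phi(2) psi(2) assms by (auto simp: image_subset_iff mem_udisc)

lemma admissible: "admissible_map \<phi>" "admissible_map \<psi>"
  using phi psi by (auto simp: admissible_map_def intro: holomorphic_on_imp_continuous_on)

lemma rho_bounds:
  assumes "cmod z < 1"
  shows "0 \<le> rho \<phi> \<psi> z" "rho \<phi> \<psi> z < 1"
  using pseudo_hyp_bounds[OF map_in_disc[OF assms]] by (auto simp: rho_def)

lemma continuous_rho: "continuous_on udisc (rho \<phi> \<psi>)"
proof -
  have "1 - cnj (\<phi> z) * \<psi> z \<noteq> 0" if "z \<in> udisc" for z
    using one_minus_cnj_mult_Re_pos(3)[OF map_in_disc] that by (simp add: mem_udisc)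
  then show ?thesis
    unfolding rho_def pseudo_hyp_def using phi psi
    by (intro continuous_intros) (auto intro: holomorphic_on_imp_continuous_on)
qed

lemma continuous_dens:
  "continuous_on udisc dens_u" "continuous_on udisc dens_v" "continuous_on udisc dens_uv"
proof -
  show "continuous_on udisc dens_u" "continuous_on udisc dens_v"
    unfolding dens_u_def dens_v_def using continuous_rho u v
    by (auto intro!: continuous_intros holomorphic_on_imp_continuous_on)
  show "continuous_on udisc dens_uv"
    unfolding dens_uv_def using continuous_rho u v rho_bounds(2)
    by (intro continuous_intros) (fastforce intro: holomorphic_on_imp_continuous_on simp: mem_udisc)+
qed

lemma dens_nonneg: "dens_u z \<ge> 0" "dens_v z \<ge> 0" "dens_uv z \<ge> 0"
  by (auto simp: dens_u_def dens_v_def dens_uv_def)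

lemma T_holomorphic:
  assumes "f holomorphic_on udisc"
  shows "T f holomorphic_on udisc"
proof -
  have "(f \<circ> \<phi>) holomorphic_on udisc" "(f \<circ> \<psi>) holomorphic_on udisc"
    using phi psi assms by (auto intro: holomorphic_on_compose_gen)
  then have "(\<lambda>z. u z * f (\<phi> z) - v z * f (\<psi> z)) holomorphic_on udisc"
    using u v unfolding o_def by (intro holomorphic_intros)
  then show ?thesis unfolding T_apply[abs_def] .
qed

lemma T_linear: "linear_A2 \<alpha> T"
  by (simp add: linear_A2_def T_apply algebra_simps)

text \<open>One average for each term of \<open>weighted_difference_pointwise\<close>; there
  \<open>u - v\<close> multiplies the value at the second point, so \<open>dens_uv\<close> is taken
  along \<open>\<psi>\<close>.\<close>

definition total_avg :: "(nat \<Rightarrow> complex) \<Rightarrow> nat \<Rightarrow> ennreal" where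
  "total_avg a n = lattice_avg \<alpha> (1 / 100) a \<phi> dens_u n + lattice_avg \<alpha> (1 / 100) a \<psi> dens_v n + lattice_avg \<alpha> (1 / 100) a \<psi> dens_uv n"

text \<open>The values of \<open>f\<close> at \<open>\<phi> w\<close> and \<open>\<psi> w\<close>
  are replaced by suprema over neighbourhoods of the cells containing these points, and the weights
  then integrate to cell averages. \<open>S n\<close> is a set of prescribed zeros near the centre
  of the \<open>n\<close>-th cell; each zero gains a factor 4 in the squared supremum.\<close>

lemma T_lattice_bound:
  assumes lat: "disc_lattice (1 / 100) a"
  obtains K where "K > 0"
    "\<And>f S. f holomorphic_on udisc \<Longrightarrow> (\<And>n. finite (S n)) \<Longrightarrow> (\<And>n. S n \<subseteq> cball (a n) (1 / 20 * (1 - cmod (a n)))) \<Longrightarrow>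
      (\<And>n x. x \<in> S n \<Longrightarrow> f x = 0) \<Longrightarrow>
      bergman_int \<alpha> (T f) \<le> ennreal K * (\<Sum>n. total_avg a n * ennreal ((1 / 4) ^ card (S n)) * local_mass \<alpha> f (a n))"
proof -
  have a: "cmod (a n) < 1" for n using lat by (simp add: disc_lattice_def)
  obtain K where K: "K > 0"
    "\<And>f a x S. f holomorphic_on udisc \<Longrightarrow> cmod a < 1 \<Longrightarrow> x \<in> cball a (1 / 10 * (1 - cmod a)) \<Longrightarrow>
       finite S \<Longrightarrow> S \<subseteq> cball a (1 / 20 * (1 - cmod a)) \<Longrightarrow> (\<And>y. y \<in> S \<Longrightarrow> f y = 0) \<Longrightarrow>
       ennreal ((cmod (f x))\<^sup>2) \<le> ennreal ((1 / 4) ^ card S * K * inverse ((1 - cmod a) powr (\<alpha> + 2))) * local_mass \<alpha> f a"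
    using local_sup_bound_zeros[OF alpha] by blast
  define K0 where "K0 = 20000 + 2 / (99 / 100 :: real) powr \<beta>"
  have K0: "K0 > 0" by (simp add: K0_def add_pos_nonneg)
  have "bergman_int \<alpha> (T f) \<le> ennreal (K0 * K) * (\<Sum>n. total_avg a n * ennreal ((1 / 4) ^ card (S n)) * local_mass \<alpha> f (a n))"
    if hol: "f holomorphic_on udisc" and S: "\<And>n. finite (S n)" "\<And>n. S n \<subseteq> cball (a n) (1 / 20 * (1 - cmod (a n)))"
      "\<And>n x. x \<in> S n \<Longrightarrow> f x = 0" for f S
  proof -
    have "\<exists>y\<in>cball (a n) (1 / 10 * (1 - cmod (a n))). \<forall>z\<in>cball (a n) (1 / 10 * (1 - cmod (a n))). cmod (f z) \<le> cmod (f y)" for n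
    proof (rule continuous_attains_sup)
      have "cball (a n) (1 / 10 * (1 - cmod (a n))) \<subseteq> udisc"
      proof
        fix z assume "z \<in> cball (a n) (1 / 10 * (1 - cmod (a n)))"
        then show "z \<in> udisc" using a[of n] norm_triangle_ineq2[of z "a n"] by (simp add: mem_udisc dist_norm norm_minus_commute)
      qed
      then show "continuous_on (cball (a n) (1 / 10 * (1 - cmod (a n)))) (\<lambda>y. cmod (f y))"
        using hol by (intro continuous_intros holomorphic_on_imp_continuous_on) (auto elim: holomorphic_on_subset)
    qed (use a[of n] in auto)
    then obtain y where y: "\<And>n. y n \<in> cball (a n) (1 / 10 * (1 - cmod (a n)))"
      "\<And>n z. z \<in> cball (a n) (1 / 10 * (1 - cmod (a n))) \<Longrightarrow> cmod (f z) \<le> cmod (f (y n))"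
      by metis
    define s where "s n = (cmod (f (y n)))\<^sup>2" for n
    \<comment> \<open>Cells overlap, so a point may collect several suprema; what matters is only
      that \<open>H \<theta> w\<close> is at least \<open>s n\<close> for each cell containing
      \<open>\<theta> w\<close>.\<close>
    define H where "H \<theta> w = (\<Sum>n. ennreal (s n) * indicator (lattice_cell (1 / 100) a n) (\<theta> w))" for \<theta> :: "complex \<Rightarrow> complex" and w
    have H_ge: "ennreal (s n) \<le> H \<theta> w" if "\<theta> w \<in> lattice_cell (1 / 100) a n" for \<theta> w n
    proof -
      have "ennreal (s n) = (\<Sum>i\<in>{n}. ennreal (s i) * indicator (lattice_cell (1 / 100) a i) (\<theta> w))"
        using that by (simp only: sum.insert sum.empty finite.emptyI empty_iff not_False_eq_True add_0_right) simp
      also have "\<dots> \<le> H \<theta> w" unfolding H_def by (rule sum_le_suminf) auto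
      finally show ?thesis .
    qed
    have pt: "ennreal (A2_weight \<alpha> w * (cmod (T f w))\<^sup>2)
      \<le> ennreal K0 * (pull_density \<alpha> dens_u w * H \<phi> w + (pull_density \<alpha> dens_v w * H \<psi> w + pull_density \<alpha> dens_uv w * H \<psi> w))" for w
    proof (cases "w \<in> udisc")
      case True
      then have w: "cmod w < 1" by (simp add: mem_udisc)
      note m = map_in_disc[OF w]
      obtain n where n: "\<phi> w \<in> lattice_cell (1 / 100) a n"
        using lat m by (auto simp: disc_lattice_def lattice_cell_def dist_norm norm_minus_commute)
      obtain k where k: "\<psi> w \<in> lattice_cell (1 / 100) a k"
        using lat m by (auto simp: disc_lattice_def lattice_cell_def dist_norm norm_minus_commute)
      have "(cmod (T f w))\<^sup>2 \<le> K0 * (dens_u w * s n + (dens_v w + dens_uv w) * s k)"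
        unfolding T_apply K0_def dens_u_def dens_v_def dens_uv_def s_def rho_def
        using beta alpha by (intro weighted_difference_pointwise[OF hol lat _ m y(2) n k]) auto
      then have "A2_weight \<alpha> w * (cmod (T f w))\<^sup>2 \<le> A2_weight \<alpha> w * (K0 * (dens_u w * s n + (dens_v w + dens_uv w) * s k))"
        by (rule mult_left_mono[OF _ A2_weight_nonneg[OF alpha]])
      then have "ennreal (A2_weight \<alpha> w * (cmod (T f w))\<^sup>2)
         \<le> ennreal (K0 * (A2_weight \<alpha> w * dens_u w * s n + (A2_weight \<alpha> w * dens_v w * s k + A2_weight \<alpha> w * dens_uv w * s k)))"
        by (intro ennreal_leI) (simp add: algebra_simps)
      also have "\<dots> = ennreal K0 * (ennreal (A2_weight \<alpha> w * dens_u w) * ennreal (s n)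
          + (ennreal (A2_weight \<alpha> w * dens_v w) * ennreal (s k) + ennreal (A2_weight \<alpha> w * dens_uv w) * ennreal (s k)))"
      proof -
        have nn: "0 \<le> A2_weight \<alpha> w * dens_u w" "0 \<le> A2_weight \<alpha> w * dens_v w" "0 \<le> A2_weight \<alpha> w * dens_uv w" "0 \<le> s n" "0 \<le> s k"
          using A2_weight_nonneg[OF alpha, of w] dens_nonneg[of w] by (auto simp: s_def)
        define P Q R where "P = A2_weight \<alpha> w * dens_u w" and "Q = A2_weight \<alpha> w * dens_v w" and "R = A2_weight \<alpha> w * dens_uv w"
        have "ennreal (K0 * (P * s n + (Q * s k + R * s k))) = ennreal K0 * ennreal (P * s n + (Q * s k + R * s k))"
          using nn K0 unfolding P_def Q_def R_def by (intro ennreal_mult) auto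
        also have "ennreal (P * s n + (Q * s k + R * s k)) = ennreal (P * s n) + (ennreal (Q * s k) + ennreal (R * s k))"
          using nn by (simp add: P_def Q_def R_def)
        finally show ?thesis using nn by (simp add: P_def Q_def R_def ennreal_mult)
      qed
      also have "\<dots> \<le> ennreal K0 * (pull_density \<alpha> dens_u w * H \<phi> w + (pull_density \<alpha> dens_v w * H \<psi> w + pull_density \<alpha> dens_uv w * H \<psi> w))"
        using True H_ge[of \<phi>, OF n] H_ge[of \<psi>, OF k]
        by (intro mult_left_mono add_mono mult_mono) (auto simp: pull_density_def A2_weight_def)
      finally show ?thesis .
    qed (simp add: A2_weight_outside)
    have cellb: "lattice_cell (1 / 100) a n \<in> sets borel" for n by (simp add: lattice_cell_def)
    note ps = pull_meas_sum[where S = "\<lambda>n. ennreal (s n)" and B = "lattice_cell (1 / 100) a" and \<alpha> = \<alpha>, OF _ _ cellb, folded H_def]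
    have "bergman_int \<alpha> (T f) \<le> (\<integral>\<^sup>+w. ennreal K0 * (pull_density \<alpha> dens_u w * H \<phi> w + (pull_density \<alpha> dens_v w * H \<psi> w + pull_density \<alpha> dens_uv w * H \<psi> w)) \<partial>lborel)"
      unfolding bergman_int_weight by (intro nn_integral_mono pt)
    also have "\<dots> = ennreal K0 * ((\<Sum>n. ennreal (s n) * pull_meas \<alpha> \<phi> dens_u (lattice_cell (1 / 100) a n))
       + ((\<Sum>n. ennreal (s n) * pull_meas \<alpha> \<psi> dens_v (lattice_cell (1 / 100) a n)) + (\<Sum>n. ennreal (s n) * pull_meas \<alpha> \<psi> dens_uv (lattice_cell (1 / 100) a n))))"
    proof -
      note m1 = ps(1)[OF admissible(1) continuous_dens(1)] ps(1)[OF admissible(2) continuous_dens(2)] ps(1)[OF admissible(2) continuous_dens(3)]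
      note m2 = ps(2)[OF admissible(1) continuous_dens(1)] ps(2)[OF admissible(2) continuous_dens(2)] ps(2)[OF admissible(2) continuous_dens(3)]
      have "(\<integral>\<^sup>+w. ennreal K0 * (pull_density \<alpha> dens_u w * H \<phi> w + (pull_density \<alpha> dens_v w * H \<psi> w + pull_density \<alpha> dens_uv w * H \<psi> w)) \<partial>lborel)
        = ennreal K0 * (\<integral>\<^sup>+w. pull_density \<alpha> dens_u w * H \<phi> w + (pull_density \<alpha> dens_v w * H \<psi> w + pull_density \<alpha> dens_uv w * H \<psi> w) \<partial>lborel)"
        using m1 by (intro nn_integral_cmult borel_measurable_add) simp_all
      also have "(\<integral>\<^sup>+w. pull_density \<alpha> dens_u w * H \<phi> w + (pull_density \<alpha> dens_v w * H \<psi> w + pull_density \<alpha> dens_uv w * H \<psi> w) \<partial>lborel)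
        = (\<integral>\<^sup>+w. pull_density \<alpha> dens_u w * H \<phi> w \<partial>lborel) + (\<integral>\<^sup>+w. (pull_density \<alpha> dens_v w * H \<psi> w + pull_density \<alpha> dens_uv w * H \<psi> w) \<partial>lborel)"
        using m1 by (intro nn_integral_add borel_measurable_add) simp_all
      also have "(\<integral>\<^sup>+w. (pull_density \<alpha> dens_v w * H \<psi> w + pull_density \<alpha> dens_uv w * H \<psi> w) \<partial>lborel)
        = (\<integral>\<^sup>+w. pull_density \<alpha> dens_v w * H \<psi> w \<partial>lborel) + (\<integral>\<^sup>+w. pull_density \<alpha> dens_uv w * H \<psi> w \<partial>lborel)"
        using m1 by (intro nn_integral_add) simp_all
      finally show ?thesis unfolding m2 .
    qed
    also have "\<dots> = ennreal K0 * (\<Sum>n. ennreal (s n) * (pull_meas \<alpha> \<phi> dens_u (lattice_cell (1 / 100) a n)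
       + (pull_meas \<alpha> \<psi> dens_v (lattice_cell (1 / 100) a n) + pull_meas \<alpha> \<psi> dens_uv (lattice_cell (1 / 100) a n))))"
      by (simp add: suminf_add[symmetric] distrib_left)
    also have "\<dots> \<le> ennreal K0 * (\<Sum>n. ennreal K * (total_avg a n * ennreal ((1 / 4) ^ card (S n)) * local_mass \<alpha> f (a n)))"
    proof (intro mult_left_mono suminf_le)
      fix n
      let ?\<mu> = "pull_meas \<alpha> \<phi> dens_u (lattice_cell (1 / 100) a n)
       + (pull_meas \<alpha> \<psi> dens_v (lattice_cell (1 / 100) a n) + pull_meas \<alpha> \<psi> dens_uv (lattice_cell (1 / 100) a n))"
      have "ennreal (s n) * ?\<mu> \<le> (ennreal ((1 / 4) ^ card (S n) * K * inverse ((1 - cmod (a n)) powr (\<alpha> + 2))) * local_mass \<alpha> f (a n)) * ?\<mu>"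
        unfolding s_def using S by (intro mult_right_mono K(2)[OF hol a y(1)]) auto
      also have "ennreal ((1 / 4) ^ card (S n) * K * inverse ((1 - cmod (a n)) powr (\<alpha> + 2)))
         = ennreal ((1 / 4) ^ card (S n)) * ennreal K * ennreal (inverse ((1 - cmod (a n)) powr (\<alpha> + 2)))"
      proof -
        have "ennreal (x * y * z) = ennreal x * ennreal y * ennreal z" if "0 \<le> x" "0 \<le> y" "0 \<le> z" for x y z :: real
          using that by (simp add: ennreal_mult)
        then show ?thesis using K(1) by simp
      qed
      also have "(ennreal ((1 / 4) ^ card (S n)) * ennreal K * ennreal (inverse ((1 - cmod (a n)) powr (\<alpha> + 2))) * local_mass \<alpha> f (a n)) * ?\<mu>
         = ennreal K * ((?\<mu> * ennreal (inverse ((1 - cmod (a n)) powr (\<alpha> + 2)))) * ennreal ((1 / 4) ^ card (S n)) * local_mass \<alpha> f (a n))"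
        by (simp only: mult_ac)
      also have "?\<mu> * ennreal (inverse ((1 - cmod (a n)) powr (\<alpha> + 2))) = total_avg a n"
        by (simp add: total_avg_def lattice_avg_def distrib_right add.assoc)
      finally show "ennreal (s n) * ?\<mu> \<le> ennreal K * (total_avg a n * ennreal ((1 / 4) ^ card (S n)) * local_mass \<alpha> f (a n))" .
    qed auto
    also have "\<dots> = ennreal (K0 * K) * (\<Sum>n. total_avg a n * ennreal ((1 / 4) ^ card (S n)) * local_mass \<alpha> f (a n))"
      using K K0 by (simp add: ennreal_mult mult.assoc)
    finally show ?thesis .
  qed
  moreover have "K0 * K > 0" using K K0 by simp
  ultimately show ?thesis using that by blast
qed

end

section \<open>Counting ranks: from cell averages to summable singular numbers\<close>

lemma ennreal_suminf_swap:
  fixes f :: "nat \<Rightarrow> nat \<Rightarrow> ennreal"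
  shows "(\<Sum>i. \<Sum>j. f i j) = (\<Sum>j. \<Sum>i. f i j)"
proof -
  have "(\<Sum>i. \<Sum>j. f i j) = (\<integral>\<^sup>+i. (\<Sum>j. f i j) \<partial>count_space UNIV)"
    by (simp add: nn_integral_count_space_nat)
  also have "\<dots> = (\<Sum>j. \<integral>\<^sup>+i. f i j \<partial>count_space UNIV)"
    by (rule nn_integral_suminf) simp
  finally show ?thesis by (simp add: nn_integral_count_space_nat)
qed

text \<open>With \<open>t k = B * (1 / 4) ^ k\<close> and \<open>r = (1 / 4) powr q\<close>, each
  term is at most \<open>1 / (1 - r)\<close> times the drop of \<open>min (t k) b powr q\<close>
  from \<open>k\<close> to \<open>k + 1\<close>, so the sum telescopes whatever the position of
  \<open>b\<close> among the levels.\<close>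

lemma geometric_below_sum:
  fixes B b q :: real
  assumes B: "B > 0" and b: "b \<ge> 0" and q: "q > 0"
  shows "(\<Sum>k. if B * (1 / 4) ^ k < b then ennreal ((B * (1 / 4) ^ k) powr q) else 0) \<le> ennreal (b powr q / (1 - (1 / 4) powr q))"
proof -
  define t where "t k = B * (1 / 4) ^ k" for k :: nat
  define r where "r = (1 / 4 :: real) powr q"
  have r: "0 < r" "r < 1" using powr_less_mono2[OF q, of "1 / 4" 1] by (auto simp: r_def)
  have t: "t k > 0" "t (Suc k) \<le> t k" for k using B by (auto simp: t_def)
  have tS: "t (Suc k) powr q = r * t k powr q" for k
  proof -
    have "t (Suc k) = (1 / 4) * t k" by (simp add: t_def)
    then show ?thesis using t(1)[of k] unfolding r_def by (simp only: powr_mult less_imp_le zero_le_divide_1_iff zero_le_numeral)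
  qed
  have step: "(if t k < b then t k powr q else 0) \<le> (min (t k) b powr q - min (t (Suc k)) b powr q) / (1 - r)" for k
  proof (cases "t k < b")
    case True
    then have "min (t k) b = t k" "min (t (Suc k)) b = t (Suc k)" using t(2)[of k] by auto
    then show ?thesis using True r tS[of k] by (simp add: field_simps)
  next
    case False
    have "min (t (Suc k)) b powr q \<le> min (t k) b powr q"
      using t(1)[of "Suc k"] t(2)[of k] b q by (intro powr_mono2 min.mono) auto
    then show ?thesis using False r by simp
  qed
  have part: "(\<Sum>k<n. if t k < b then t k powr q else 0) \<le> b powr q / (1 - r)" for n
  proof -
    have "(\<Sum>k<n. if t k < b then t k powr q else 0) \<le> (\<Sum>k<n. (min (t k) b powr q - min (t (Suc k)) b powr q) / (1 - r))"
      by (intro sum_mono step)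
    also have "\<dots> = (min (t 0) b powr q - min (t n) b powr q) / (1 - r)"
      by (simp only: sum_divide_distrib[symmetric] sum_lessThan_telescope'[of "\<lambda>k. min (t k) b powr q"])
    also have "\<dots> \<le> b powr q / (1 - r)"
    proof (rule divide_right_mono)
      have "min (t 0) b powr q \<le> b powr q" using t(1)[of 0] b q by (intro powr_mono2) auto
      moreover have "min (t n) b powr q \<ge> 0" by simp
      ultimately show "min (t 0) b powr q - min (t n) b powr q \<le> b powr q" by linarith
    qed (use r in auto)
    finally show ?thesis .
  qed
  have "(\<Sum>k. if t k < b then ennreal (t k powr q) else 0) \<le> ennreal (b powr q / (1 - r))"
  proof (rule suminf_le_const)
    fix n
    have "(\<Sum>k<n. if t k < b then ennreal (t k powr q) else 0) = ennreal (\<Sum>k<n. if t k < b then t k powr q else 0)"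
    proof -
      have e: "(if t k < b then ennreal (t k powr q) else 0) = ennreal (if t k < b then t k powr q else 0)" for k by simp
      show ?thesis unfolding e by (rule sum_ennreal) simp
    qed
    also have "\<dots> \<le> ennreal (b powr q / (1 - r))" by (intro ennreal_leI part)
    finally show "(\<Sum>k<n. if t k < b then ennreal (t k powr q) else 0) \<le> ennreal (b powr q / (1 - r))" .
  qed auto
  then show ?thesis unfolding t_def r_def .
qed

text \<open>With \<open>N n\<close> conditions imposed on the \<open>n\<close>-th cell its contribution drops from \<open>b n\<close> to
  \<open>b n / 4 ^ N n\<close>.  Choosing \<open>N n\<close> as the number of levels \<open>B / 4 ^ i\<close>, \<open>1 \<le> i \<le> k\<close>, below \<open>b n\<close>
  makes every contribution at most \<open>B / 4 ^ k\<close>.\<close>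

lemma summable_from_local_ranks:
  fixes b s :: "nat \<Rightarrow> real"
  assumes p: "p > 0" and b: "\<And>n. b n \<ge> 0" "summable (\<lambda>n. b n powr (p / 2))"
    and s: "\<And>l. s l \<ge> 0" and K: "K \<ge> 0"
    and main: "\<And>F N t l. finite F \<Longrightarrow> (\<And>n. n \<notin> F \<Longrightarrow> N n = 0) \<Longrightarrow> (\<And>n. b n * (1 / 4) ^ N n \<le> t) \<Longrightarrow> (\<Sum>n\<in>F. N n) \<le> l \<Longrightarrow> (s l)\<^sup>2 \<le> K * t"
  shows "summable (\<lambda>l. s l powr p)"
proof -
  define q where "q = p / 2"
  have q: "q > 0" using p by (simp add: q_def)
  have b0: "(\<lambda>n. b n powr q) \<longlonglongrightarrow> 0" using summable_LIMSEQ_zero[OF b(2)] by (simp add: q_def)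
  have fin: "finite {n. b n > t}" if "t > 0" for t
  proof -
    have "\<forall>\<^sub>F n in sequentially. b n powr q < t powr q" using b0 that by (intro order_tendstoD(2)) auto
    then obtain n0 where n0: "\<And>n. n \<ge> n0 \<Longrightarrow> b n powr q < t powr q" by (auto simp: eventually_sequentially)
    have "{n. b n > t} \<subseteq> {..<n0}"
    proof
      fix n assume n: "n \<in> {n. b n > t}"
      show "n \<in> {..<n0}"
      proof (rule ccontr)
        assume "n \<notin> {..<n0}"
        then have "b n powr q < t powr q" using n0 by simp
        moreover have "t powr q \<le> b n powr q" using n that q by (intro powr_mono2) auto
        ultimately show False by simp
      qed
    qed
    then show ?thesis using finite_subset by blast
  qed
  obtain B where B: "B > 0" "\<And>n. b n \<le> B"
  proof
    let ?F = "{n. b n > 1}"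
    show "0 < Max (insert 1 (b ` ?F))" using fin[of 1] by (simp add: less_max_iff_disj) (smt (verit) Max_ge finite_imageI finite_insert insertI1)
    fix n
    show "b n \<le> Max (insert 1 (b ` ?F))"
    proof (cases "b n > 1")
      case True
      then show ?thesis using fin[of 1] by (intro Max_ge) auto
    next
      case False
      have "1 \<le> Max (insert 1 (b ` ?F))" using fin[of 1] by (intro Max_ge) auto
      then show ?thesis using False by simp
    qed
  qed
  define t where "t k = B * (1 / 4) ^ k" for k :: nat
  have t: "t k > 0" "t (Suc k) \<le> t k" for k using B by (auto simp: t_def)
  define F where "F k = {n. b n > t k}" for k
  have F: "finite (F k)" "F k \<subseteq> F (Suc k)" for k
    using fin[OF t(1)] t(2)[of k] by (auto simp: F_def)
  \<comment> \<open>\<open>N k n\<close> is the number of levels \<open>t i\<close> with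
    \<open>1 \<le> i \<le> k\<close> below \<open>b n\<close>, built one level at a time so that the
    increase of the total rank can be read off.\<close>
  define N where "N = rec_nat (\<lambda>n. 0 :: nat) (\<lambda>k Nk n. Nk n + (if n \<in> F (Suc k) then 1 else 0))"
  have N0: "N 0 n = 0" and NS: "N (Suc k) n = N k n + (if n \<in> F (Suc k) then 1 else 0)" for k n
    by (simp_all add: N_def)
  have Nout: "N k n = 0" if "n \<notin> F k" for k n
    using that by (induction k) (use F in \<open>auto simp: N0 NS\<close>)
  have Nle: "b n * (1 / 4) ^ N k n \<le> t k" for k n
  proof (induction k)
    case 0
    then show ?case using B by (simp add: N0 t_def)
  next
    case (Suc k)
    show ?case
    proof (cases "n \<in> F (Suc k)")
      case True
      then show ?thesis using Suc by (simp add: NS t_def)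
    next
      case False
      have "b n * (1 / 4) ^ N (Suc k) n \<le> b n * 1" using b(1) by (intro mult_left_mono power_le_one) auto
      then show ?thesis using False by (simp add: F_def)
    qed
  qed
  define r where "r k = (\<Sum>n\<in>F k. N k n)" for k
  \<comment> \<open>Conditions imposed up to level \<open>k\<close> live on \<open>F k\<close>, a
    subset of \<open>F (Suc k)\<close>; the next level adds one condition for each index of
    \<open>F (Suc k)\<close>.\<close>
  have rS: "r (Suc k) = r k + card (F (Suc k))" for k
  proof -
    have "r (Suc k) = (\<Sum>n\<in>F (Suc k). N k n + 1)" unfolding r_def by (intro sum.cong) (auto simp: NS)
    also have "\<dots> = (\<Sum>n\<in>F (Suc k). N k n) + card (F (Suc k))" by (simp add: sum.distrib del: One_nat_def)
    also have "(\<Sum>n\<in>F (Suc k). N k n) = r k"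
      unfolding r_def using F Nout by (intro sum.mono_neutral_right) auto
    finally show ?thesis .
  qed
  have r0: "r 0 = 0" by (simp add: r_def N0)
  have sle: "(s l)\<^sup>2 \<le> K * t k" if "r k \<le> l" for k l
    by (rule main[OF F(1)[of k] Nout Nle]) (use that in \<open>auto simp: r_def\<close>)
  have slep: "s l powr p \<le> (K * t k) powr q" if "r k \<le> l" for k l
  proof -
    have "s l powr p = ((s l)\<^sup>2) powr q"
    proof (cases "s l = 0")
      case False
      then have "(s l)\<^sup>2 = s l powr 2" using s[of l] by simp
      then show ?thesis by (simp only: powr_powr) (simp add: q_def)
    qed simp
    also have "\<dots> \<le> (K * t k) powr q" using sle[OF that] q by (intro powr_mono2) auto
    finally show ?thesis .
  qed
  \<comment> \<open>If the ranks never exceed \<open>l\<close>, the bounds \<open>K * t k\<close>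
    hold for all \<open>k\<close> and force \<open>s l = 0\<close>.\<close>
  have s0: "s l = 0" if "\<And>k. r k \<le> l" for l
  proof -
    have "(\<lambda>k. K * t k) \<longlonglongrightarrow> K * (B * 0)" unfolding t_def
      by (intro tendsto_mult_left LIMSEQ_realpow_zero) auto
    then have "(s l)\<^sup>2 \<le> K * (B * 0)" by (rule LIMSEQ_le_const) (use sle that in blast)
    then show ?thesis by simp
  qed
  \<comment> \<open>Each \<open>l\<close> with \<open>s l > 0\<close> lies in some block from
    \<open>r k\<close> to below \<open>r (Suc k)\<close>, and this block has
    \<open>card (F (Suc k))\<close> elements. Exchanging the sums afterwards leaves, for each
    \<open>n\<close>, a geometric series over the levels below \<open>b n\<close>.\<close>
  have pt: "ennreal (s l powr p) \<le> (\<Sum>k. if r k \<le> l \<and> l < r (Suc k) then ennreal ((K * t k) powr q) else 0)" for l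
  proof (cases "\<forall>k. r k \<le> l")
    case True
    then show ?thesis using s0 p by simp
  next
    case False
    define k' where "k' = (LEAST k. \<not> r k \<le> l)"
    obtain j where "\<not> r j \<le> l" using False by blast
    then have k': "\<not> r k' \<le> l" unfolding k'_def by (rule LeastI[where P = "\<lambda>k. \<not> r k \<le> l"])
    then obtain k where k: "k' = Suc k" using r0 by (cases k') auto
    have rk: "r k \<le> l" using not_less_Least[of k "\<lambda>k. \<not> r k \<le> l"] k by (auto simp: k'_def)
    have "ennreal (s l powr p) \<le> (\<Sum>i\<in>{k}. if r i \<le> l \<and> l < r (Suc i) then ennreal ((K * t i) powr q) else 0)"
      using slep[OF rk] rk k' k by (simp add: ennreal_leI)
    also have "\<dots> \<le> (\<Sum>k. if r k \<le> l \<and> l < r (Suc k) then ennreal ((K * t k) powr q) else 0)"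
      by (rule sum_le_suminf) auto
    finally show ?thesis .
  qed
  have "(\<Sum>l. ennreal (s l powr p)) \<le> (\<Sum>l. \<Sum>k. if r k \<le> l \<and> l < r (Suc k) then ennreal ((K * t k) powr q) else 0)"
    by (intro suminf_le pt) auto
  also have "\<dots> = (\<Sum>k. \<Sum>l. if r k \<le> l \<and> l < r (Suc k) then ennreal ((K * t k) powr q) else 0)"
    by (rule ennreal_suminf_swap)
  also have "\<dots> = (\<Sum>k. \<Sum>n. if n \<in> F (Suc k) then ennreal ((K * t k) powr q) else 0)"
  proof (rule suminf_cong)
    fix k
    have "(\<Sum>l. if r k \<le> l \<and> l < r (Suc k) then ennreal ((K * t k) powr q) else 0) = (\<Sum>l\<in>{r k..<r (Suc k)}. ennreal ((K * t k) powr q))"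
      by (subst suminf_finite[of "{r k..<r (Suc k)}"]) auto
    also have "\<dots> = (\<Sum>n\<in>F (Suc k). ennreal ((K * t k) powr q))" by (simp add: rS)
    also have "\<dots> = (\<Sum>n. if n \<in> F (Suc k) then ennreal ((K * t k) powr q) else 0)"
      using F(1) by (subst suminf_finite[of "F (Suc k)"]) auto
    finally show "(\<Sum>l. if r k \<le> l \<and> l < r (Suc k) then ennreal ((K * t k) powr q) else 0) = (\<Sum>n. if n \<in> F (Suc k) then ennreal ((K * t k) powr q) else 0)" .
  qed
  also have "\<dots> = (\<Sum>n. \<Sum>k. if n \<in> F (Suc k) then ennreal ((K * t k) powr q) else 0)"
    by (rule ennreal_suminf_swap)
  also have "\<dots> \<le> (\<Sum>n. ennreal ((4 * K) powr q / (1 - (1 / 4) powr q)) * ennreal (b n powr q))"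
  proof (intro suminf_le)
    fix n
    have r1: "(1 / 4 :: real) powr q < 1" using powr_less_mono2[OF q, of "1 / 4" 1] by simp
    have e: "(if n \<in> F (Suc k) then ennreal ((K * t k) powr q) else 0)
      = ennreal ((4 * K) powr q) * (if t (Suc k) < b n then ennreal (t (Suc k) powr q) else 0)" for k
    proof -
      \<comment> \<open>Membership is tested at level \<open>Suc k\<close> while the bound is
        available at level \<open>k\<close>; the factor 4 aligns the two.\<close>
      have "K * t k = (4 * K) * t (Suc k)" by (simp add: t_def)
      then have "(K * t k) powr q = (4 * K) powr q * t (Suc k) powr q"
        using K t(1)[of "Suc k"] by (simp only: powr_mult less_imp_le zero_le_mult_iff zero_le_numeral)
      then show ?thesis by (simp add: F_def ennreal_mult)
    qed
    have "(\<Sum>k. if n \<in> F (Suc k) then ennreal ((K * t k) powr q) else 0)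
       = ennreal ((4 * K) powr q) * (\<Sum>k. if t (Suc k) < b n then ennreal (t (Suc k) powr q) else 0)"
      unfolding e by (rule ennreal_suminf_cmult)
    also have "(\<Sum>k. if t (Suc k) < b n then ennreal (t (Suc k) powr q) else 0) \<le> ennreal (b n powr q / (1 - (1 / 4) powr q))"
    proof -
      have tS: "t (Suc k) = B / 4 * (1 / 4) ^ k" for k by (simp add: t_def)
      show ?thesis unfolding tS using B b q by (intro geometric_below_sum) auto
    qed
    finally have "(\<Sum>k. if n \<in> F (Suc k) then ennreal ((K * t k) powr q) else 0) \<le> ennreal ((4 * K) powr q) * ennreal (b n powr q / (1 - (1 / 4) powr q))"
      by (simp add: mult_left_mono)
    also have "\<dots> = ennreal ((4 * K) powr q / (1 - (1 / 4) powr q)) * ennreal (b n powr q)"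
      using r1 by (simp add: ennreal_mult[symmetric])
    finally show "(\<Sum>k. if n \<in> F (Suc k) then ennreal ((K * t k) powr q) else 0) \<le> ennreal ((4 * K) powr q / (1 - (1 / 4) powr q)) * ennreal (b n powr q)" .
  qed auto
  also have "\<dots> = ennreal ((4 * K) powr q / (1 - (1 / 4) powr q)) * (\<Sum>n. ennreal (b n powr q))" by (rule ennreal_suminf_cmult)
  also have "\<dots> < \<infinity>"
  proof -
    have "(\<Sum>n. ennreal (b n powr q)) \<noteq> \<infinity>"
      unfolding infinity_ennreal_def using b(2) unfolding q_def[symmetric] by (rule ennreal_suminf_neq_top) (rule powr_ge_zero)
    then have "(\<Sum>n. ennreal (b n powr q)) < \<infinity>" by (simp only: infinity_ennreal_def less_top)
    then show ?thesis by (simp add: ennreal_mult_less_top)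
  qed
  finally show ?thesis by (intro summable_suminf_not_top) (auto simp: less_top[symmetric])
qed

lemma A2_norm_sum_le:
  assumes \<alpha>: "\<alpha> > -1" and "\<And>i. i \<in> I \<Longrightarrow> in_A2 \<alpha> (f i)"
  shows "A2_norm \<alpha> (\<lambda>z. \<Sum>i\<in>I. f i z) \<le> (\<Sum>i\<in>I. A2_norm \<alpha> (f i))"
  using assms(2)
proof (induction I rule: infinite_finite_induct)
  case (insert x F)
  have "A2_norm \<alpha> (\<lambda>z. f x z + (\<Sum>i\<in>F. f i z)) \<le> A2_norm \<alpha> (f x) + A2_norm \<alpha> (\<lambda>z. \<Sum>i\<in>F. f i z)"
    using insert by (intro A2_norm_triangle[OF \<alpha>] in_A2_sum[OF \<alpha>]) auto
  then show ?case using insert by simp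
qed (simp_all add: A2_norm_def bergman_int_def)

section \<open>Orthonormal systems\<close>

text \<open>Equality is required on the disc only, in keeping with functions being arbitrary
  elsewhere.\<close>

definition in_span :: "nat \<Rightarrow> (nat \<Rightarrow> complex \<Rightarrow> complex) \<Rightarrow> (complex \<Rightarrow> complex) \<Rightarrow> bool" where
  "in_span k e f \<longleftrightarrow> (\<exists>c. \<forall>z\<in>udisc. f z = (\<Sum>j<k. c j * e j z))"

lemma in_spanI: "(\<And>z. z \<in> udisc \<Longrightarrow> f z = (\<Sum>j<k. c j * e j z)) \<Longrightarrow> in_span k e f"
  by (auto simp: in_span_def)

lemma in_span_trans:
  assumes "in_span m e f" "\<And>i. i < m \<Longrightarrow> in_span k g (e i)"
  shows "in_span k g f"
proof -
  obtain c where c: "\<And>z. z \<in> udisc \<Longrightarrow> f z = (\<Sum>j<m. c j * e j z)" using assms(1) by (auto simp: in_span_def)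
  have "\<forall>i. \<exists>d. i < m \<longrightarrow> (\<forall>z\<in>udisc. e i z = (\<Sum>j<k. d j * g j z))" using assms(2) by (auto simp: in_span_def)
  then obtain d where d: "\<And>i z. i < m \<Longrightarrow> z \<in> udisc \<Longrightarrow> e i z = (\<Sum>j<k. d i j * g j z)" by metis
  show ?thesis
  proof (rule in_spanI)
    fix z assume z: "z \<in> udisc"
    have "f z = (\<Sum>i<m. c i * (\<Sum>j<k. d i j * g j z))" using c[OF z] d[OF _ z] by simp
    also have "\<dots> = (\<Sum>i<m. \<Sum>j<k. c i * d i j * g j z)" by (simp add: sum_distrib_left mult.assoc)
    also have "\<dots> = (\<Sum>j<k. \<Sum>i<m. c i * d i j * g j z)" by (rule sum.swap)
    also have "\<dots> = (\<Sum>j<k. (\<Sum>i<m. c i * d i j) * g j z)" by (simp add: sum_distrib_right)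
    finally show "f z = (\<Sum>j<k. (\<Sum>i<m. c i * d i j) * g j z)" .
  qed
qed

lemma in_span_member: "i < k \<Longrightarrow> in_span k e (e i)"
proof (rule in_spanI)
  fix z assume "i < k"
  have "(\<Sum>j<k. (if j = i then 1 else 0) * e j z) = (\<Sum>j<k. if j = i then e j z else 0)"
    by (intro sum.cong) auto
  then show "e i z = (\<Sum>j<k. (if j = i then 1 else 0) * e j z)" using \<open>i < k\<close> by simp
qed

lemma in_span_diff_cmult:
  assumes "in_span k e f" "in_span k e g"
  shows "in_span k e (\<lambda>z. f z + c * g z)"
proof -
  obtain a b where "\<And>z. z \<in> udisc \<Longrightarrow> f z = (\<Sum>j<k. a j * e j z)" "\<And>z. z \<in> udisc \<Longrightarrow> g z = (\<Sum>j<k. b j * e j z)"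
    using assms by (auto simp: in_span_def)
  then show ?thesis
    by (intro in_spanI[where c = "\<lambda>j. a j + c * b j"]) (simp add: sum.distrib sum_distrib_left distrib_right mult.assoc)
qed

lemma in_span_cong: "in_span k e f \<Longrightarrow> (\<And>z. z \<in> udisc \<Longrightarrow> f z = g z) \<Longrightarrow> in_span k e g"
  by (auto simp: in_span_def)

lemma in_span_sum:
  "in_span k e (\<lambda>z. \<Sum>j<k. c j * e j z)"
  by (rule in_spanI) simp

context
  fixes \<alpha> :: real
  assumes alpha: "\<alpha> > -1"
begin

text \<open>Point evaluation is the inner product with a kernel, so by Cauchy-Schwarz it is
  controlled by the norm.\<close>

lemma A2_norm_eq_0_imp:
  assumes "in_A2 \<alpha> f" "A2_norm \<alpha> f = 0" "z \<in> udisc"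
  shows "f z = 0"
  using A2_inner_Cauchy_Schwarz[OF alpha assms(1) in_A2_bergman_kernel[OF alpha assms(3)]]
    A2_reproducing[OF alpha assms(1,3)] assms(2) by simp

lemma A2_inner_in_span:
  assumes "in_span k e f" "\<And>i. i < k \<Longrightarrow> in_A2 \<alpha> (e i)" "in_A2 \<alpha> g" "\<And>i. i < k \<Longrightarrow> A2_inner \<alpha> (e i) g = 0"
  shows "A2_inner \<alpha> f g = 0"
proof -
  obtain c where c: "\<And>z. z \<in> udisc \<Longrightarrow> f z = (\<Sum>j<k. c j * e j z)" using assms(1) by (auto simp: in_span_def)
  have "A2_inner \<alpha> f g = A2_inner \<alpha> (\<lambda>z. \<Sum>j<k. c j * e j z) g" by (rule A2_inner_cong) (auto simp: c)
  also have "\<dots> = (\<Sum>j<k. c j * A2_inner \<alpha> (e j) g)" using assms by (intro A2_inner_sum_left[OF alpha]) auto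
  finally show ?thesis using assms(4) by simp
qed

lemma A2_orthonormal_expansion:
  assumes e: "A2_orthonormal \<alpha> k e" and f: "in_span k e f"
  shows "z \<in> udisc \<Longrightarrow> f z = (\<Sum>j<k. A2_inner \<alpha> f (e j) * e j z)"
    and "(A2_norm \<alpha> f)\<^sup>2 = (\<Sum>j<k. (cmod (A2_inner \<alpha> f (e j)))\<^sup>2)"
    and "in_A2 \<alpha> f"
proof -
  obtain c where c: "\<And>z. z \<in> udisc \<Longrightarrow> f z = (\<Sum>j<k. c j * e j z)" using f by (auto simp: in_span_def)
  have ei: "in_A2 \<alpha> (e i)" if "i < k" for i using e that by (auto simp: A2_orthonormal_def[OF alpha])
  have "in_A2 \<alpha> (\<lambda>z. \<Sum>j<k. c j * e j z)" using ei by (intro in_A2_sum[OF alpha] in_A2_cmult[OF alpha]) auto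
  then show f2: "in_A2 \<alpha> f" by (subst in_A2_cong) (auto simp: c)
  have co: "A2_inner \<alpha> f (e i) = c i" if "i < k" for i
  proof -
    have "A2_inner \<alpha> f (e i) = A2_inner \<alpha> (\<lambda>z. \<Sum>j<k. c j * e j z) (e i)" by (rule A2_inner_cong) (auto simp: c)
    also have "\<dots> = (\<Sum>j<k. c j * A2_inner \<alpha> (e j) (e i))" using ei that by (intro A2_inner_sum_left[OF alpha]) auto
    also have "\<dots> = (\<Sum>j<k. if j = i then c j else 0)" using e that by (intro sum.cong) (auto simp: A2_orthonormal_def[OF alpha])
    finally show ?thesis using that by simp
  qed
  show ex: "f z = (\<Sum>j<k. A2_inner \<alpha> f (e j) * e j z)" if "z \<in> udisc" for z using c[OF that] co by simp
  have "A2_norm \<alpha> (\<lambda>z. f z - (\<Sum>j<k. A2_inner \<alpha> f (e j) * e j z)) = A2_norm \<alpha> (\<lambda>z. 0)"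
    by (rule A2_norm_cong) (use ex in simp)
  then have "(A2_norm \<alpha> (\<lambda>z. f z - (\<Sum>j<k. A2_inner \<alpha> f (e j) * e j z)))\<^sup>2 = 0"
    by (simp add: A2_norm_def bergman_int_def)
  then show "(A2_norm \<alpha> f)\<^sup>2 = (\<Sum>j<k. (cmod (A2_inner \<alpha> f (e j)))\<^sup>2)"
    using A2_orthonormal_residual[OF alpha e f2] by simp
qed

lemma A2_orthonormal_extend:
  assumes e: "A2_orthonormal \<alpha> k e" and h: "in_A2 \<alpha> h" "A2_norm \<alpha> h \<noteq> 0" and ho: "\<And>i. i < k \<Longrightarrow> A2_inner \<alpha> h (e i) = 0"
  shows "A2_orthonormal \<alpha> (Suc k) (e(k := (\<lambda>z. of_real (1 / A2_norm \<alpha> h) * h z)))"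
proof -
  define N where "N = A2_norm \<alpha> h"
  have N: "N \<noteq> 0" using h by (simp add: N_def)
  define e' where "e' = e(k := (\<lambda>z. of_real (1 / N) * h z))"
  have e'k: "e' k = (\<lambda>z. of_real (1 / N) * h z)" and e'i: "i < k \<Longrightarrow> e' i = e i" for i by (auto simp: e'_def)
  have inner_hk: "A2_inner \<alpha> (e' k) f = of_real (1 / N) * A2_inner \<alpha> h f" for f
    unfolding e'k by (rule A2_inner_cmult_left[OF alpha])
  have inner_kh: "A2_inner \<alpha> f (e' k) = of_real (1 / N) * A2_inner \<alpha> f h" for f
    using arg_cong[OF inner_hk[of f], of cnj] by (simp add: A2_inner_cnj[OF alpha])
  have "A2_orthonormal \<alpha> (Suc k) e'"
    unfolding A2_orthonormal_def[OF alpha]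
  proof (intro conjI allI impI)
    fix i assume i: "i < Suc k"
    show "in_A2 \<alpha> (e' i)"
    proof (cases "i = k")
      case True
      then show ?thesis unfolding True e'k by (intro in_A2_cmult[OF alpha] h)
    next
      case False
      then show ?thesis using i e by (auto simp: e'i A2_orthonormal_def[OF alpha])
    qed
  next
    fix i j assume ij: "i < Suc k" "j < Suc k"
    consider "i < k" "j < k" | "i = k" "j < k" | "i < k" "j = k" | "i = k" "j = k" using ij by linarith
    then show "A2_inner \<alpha> (e' i) (e' j) = (if i = j then 1 else 0)"
    proof cases
      case 1
      then show ?thesis using e by (auto simp: A2_orthonormal_def[OF alpha] e'i)
    next
      case 2
      then show ?thesis using ho[of j] by (simp add: inner_hk e'i)
    next
      case 3
      moreover have "A2_inner \<alpha> (e i) h = cnj (A2_inner \<alpha> h (e i))" by (simp add: A2_inner_cnj[OF alpha])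
      ultimately show ?thesis using ho[of i] by (simp add: inner_kh e'i)
    next
      case 4
      have "A2_inner \<alpha> (e' k) (e' k) = of_real (1 / N) * (of_real (1 / N) * A2_inner \<alpha> h h)"
        by (simp only: inner_hk[of "e' k"] inner_kh[of h])
      also have "\<dots> = of_real (1 / N * (1 / N * N\<^sup>2))"
        by (simp only: A2_inner_self[OF alpha h(1)] N_def of_real_mult)
      also have "1 / N * (1 / N * N\<^sup>2) = 1" using N by (simp add: power2_eq_square)
      finally show ?thesis using 4 by simp
    qed
  qed
  then show ?thesis by (simp add: e'_def N_def)
qed

text \<open>Vectors that depend on earlier ones have residual 0 and are skipped, which is why
  \<open>m\<close> may be less than \<open>k\<close>. Both inclusions of spans are recorded: the
  second one keeps the new vectors inside the original span.\<close>

lemma A2_gram_schmidt: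
  assumes "\<And>i. i < k \<Longrightarrow> in_A2 \<alpha> (g i)"
  obtains m e where "m \<le> k" "A2_orthonormal \<alpha> m e" "\<And>i. i < k \<Longrightarrow> in_span m e (g i)" "\<And>i. i < m \<Longrightarrow> in_span k g (e i)"
proof -
  have "\<exists>m e. m \<le> k \<and> A2_orthonormal \<alpha> m e \<and> (\<forall>i<k. in_span m e (g i)) \<and> (\<forall>i<m. in_span k g (e i))"
    using assms
  proof (induction k)
    case 0
    then show ?case by (intro exI[of _ 0]) (auto simp: A2_orthonormal_def[OF alpha])
  next
    case (Suc k)
    then obtain m e where m: "m \<le> k" and e: "A2_orthonormal \<alpha> m e"
      and sp: "\<And>i. i < k \<Longrightarrow> in_span m e (g i)" "\<And>i. i < m \<Longrightarrow> in_span k g (e i)" by auto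
    have ei: "in_A2 \<alpha> (e i)" if "i < m" for i using e that by (auto simp: A2_orthonormal_def[OF alpha])
    have g: "in_A2 \<alpha> (g k)" using Suc.prems by simp
    define h where "h z = g k z - (\<Sum>i<m. A2_inner \<alpha> (g k) (e i) * e i z)" for z
    have h: "in_A2 \<alpha> h"
      unfolding h_def using g ei by (intro in_A2_diff[OF alpha] in_A2_sum[OF alpha] in_A2_cmult[OF alpha]) auto
    have ho: "A2_inner \<alpha> h (e i) = 0" if "i < m" for i
      using A2_residual_orthogonal[OF alpha e g that] by (simp add: h_def[abs_def])
    have gk: "in_span k g f \<Longrightarrow> in_span (Suc k) g f" for f
      by (erule in_span_trans) (simp add: in_span_member)
    show ?case
    proof (cases "A2_norm \<alpha> h = 0")
      case True
      have "in_span m e (g k)"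
        using A2_norm_eq_0_imp[OF h True] by (intro in_spanI[where c = "\<lambda>i. A2_inner \<alpha> (g k) (e i)"]) (simp add: h_def)
      then have "\<forall>i<Suc k. in_span m e (g i)" using sp(1) by (auto simp: less_Suc_eq)
      then show ?thesis using m e sp(2) gk by (intro exI[of _ m] exI[of _ e]) auto
    next
      case False
      define N where "N = A2_norm \<alpha> h"
      have N: "N \<noteq> 0" using False by (simp add: N_def)
      define e' where "e' = e(m := (\<lambda>z. of_real (1 / N) * h z))"
      have e'm: "e' m = (\<lambda>z. of_real (1 / N) * h z)" and e'i: "i < m \<Longrightarrow> e' i = e i" for i by (auto simp: e'_def)
      have on: "A2_orthonormal \<alpha> (Suc m) e'"
        unfolding e'_def N_def by (rule A2_orthonormal_extend[OF e h False ho])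
      have em: "in_span (Suc m) e' f" if "in_span m e f" for f
        using that by (rule in_span_trans) (metis e'i in_span_member less_SucI)
      have "in_span (Suc m) e' (g k)"
      proof (rule in_spanI)
        fix z
        have "g k z = (\<Sum>i<m. A2_inner \<alpha> (g k) (e i) * e i z) + of_real N * (of_real (1 / N) * h z)"
          using N by (simp add: h_def)
        also have "\<dots> = (\<Sum>i<Suc m. (if i = m then of_real N else A2_inner \<alpha> (g k) (e i)) * e' i z)"
          by (simp add: e'm e'i)
        finally show "g k z = (\<Sum>i<Suc m. (if i = m then of_real N else A2_inner \<alpha> (g k) (e i)) * e' i z)" .
      qed
      then have "\<forall>i<Suc k. in_span (Suc m) e' (g i)" using sp(1) em by (auto simp: less_Suc_eq)
      moreover have "in_span (Suc k) g (e' i)" if "i < Suc m" for i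
      proof (cases "i = m")
        case True
        have s: "in_span k g (\<lambda>z. \<Sum>i<m. A2_inner \<alpha> (g k) (e i) * e i z)"
          by (rule in_span_trans[OF in_span_sum]) (rule sp(2))
        have "in_span (Suc k) g (\<lambda>z. g k z + (-1) * (\<Sum>i<m. A2_inner \<alpha> (g k) (e i) * e i z))"
          by (intro in_span_diff_cmult in_span_member gk s) simp
        then have hs: "in_span (Suc k) g h" by (rule in_span_cong) (simp add: h_def)
        have "in_span (Suc k) g (\<lambda>z. h z + (of_real (1 / N) - 1) * h z)" by (intro in_span_diff_cmult hs)
        then show ?thesis unfolding True e'm by (rule in_span_cong) (simp add: algebra_simps)
      next
        case False
        then show ?thesis using that sp(2) gk by (simp add: e'i)
      qed
      ultimately show ?thesis using m on by (intro exI[of _ "Suc m"] exI[of _ e']) auto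
    qed
  qed
  then show ?thesis using that by blast
qed

text \<open>Each \<open>f i\<close> has norm \<open>1\<close>; sum its expansion over \<open>i\<close>, exchange the sums and apply Bessel to each \<open>e j\<close>.\<close>

lemma A2_orthonormal_length_le:
  assumes e: "A2_orthonormal \<alpha> k e" and f: "A2_orthonormal \<alpha> m f" and sp: "\<And>i. i < m \<Longrightarrow> in_span k e (f i)"
  shows "m \<le> k"
proof -
  have ei: "in_A2 \<alpha> (e i)" if "i < k" for i using e that by (auto simp: A2_orthonormal_def[OF alpha])
  have n1: "(A2_norm \<alpha> (e i))\<^sup>2 = 1" if "A2_orthonormal \<alpha> k e" "i < k" for k e i
  proof -
    have "in_A2 \<alpha> (e i)" "A2_inner \<alpha> (e i) (e i) = 1" using that by (auto simp: A2_orthonormal_def[OF alpha])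
    then have "complex_of_real ((A2_norm \<alpha> (e i))\<^sup>2) = of_real 1" using A2_inner_self[OF alpha, of "e i"] by simp
    then show ?thesis by (simp only: of_real_eq_iff)
  qed
  have "real m = (\<Sum>i<m. (A2_norm \<alpha> (f i))\<^sup>2)" using n1[OF f] by simp
  also have "\<dots> = (\<Sum>i<m. \<Sum>j<k. (cmod (A2_inner \<alpha> (f i) (e j)))\<^sup>2)"
    using A2_orthonormal_expansion(2)[OF e sp] by simp
  also have "\<dots> = (\<Sum>j<k. \<Sum>i<m. (cmod (A2_inner \<alpha> (f i) (e j)))\<^sup>2)" by (rule sum.swap)
  also have "\<dots> = (\<Sum>j<k. \<Sum>i<m. (cmod (A2_inner \<alpha> (e j) (f i)))\<^sup>2)"
    by (intro sum.cong refl) (metis A2_inner_cnj[OF alpha] complex_mod_cnj)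
  also have "\<dots> \<le> (\<Sum>j<k. (A2_norm \<alpha> (e j))\<^sup>2)" using ei by (intro sum_mono A2_Bessel[OF alpha f]) auto
  also have "\<dots> = real k" using n1[OF e] by simp
  finally show ?thesis by simp
qed

end

section \<open>Approximation by operators of finite rank\<close>

text \<open>Vanishing at the points of \<open>P\<close> is orthogonality to the kernels at these
  points; orthonormalizing the kernels leaves at most \<open>card P\<close> conditions.\<close>

lemma orthonormal_vanishing:
  assumes \<alpha>: "\<alpha> > -1" and P: "finite P" "P \<subseteq> udisc"
  obtains k e where "k \<le> card P" "A2_orthonormal \<alpha> k e"
    "\<And>f x. in_A2 \<alpha> f \<Longrightarrow> (\<And>i. i < k \<Longrightarrow> A2_inner \<alpha> f (e i) = 0) \<Longrightarrow> x \<in> P \<Longrightarrow> f x = 0"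
proof -
  obtain b where b: "bij_betw b {..<card P} P"
    using ex_bij_betw_nat_finite[OF P(1)] by (auto simp: atLeast0LessThan)
  have bP: "b i \<in> udisc" if "i < card P" for i using b P(2) that by (auto dest: bij_betwE)
  obtain k e where k: "k \<le> card P" and e: "A2_orthonormal \<alpha> k e"
    and sp: "\<And>i. i < card P \<Longrightarrow> in_span k e (bergman_kernel \<alpha> (b i))"
    by (rule A2_gram_schmidt[OF \<alpha> in_A2_bergman_kernel[OF \<alpha> bP]]) (assumption | rule that)+
  have "f x = 0" if f: "in_A2 \<alpha> f" "\<And>i. i < k \<Longrightarrow> A2_inner \<alpha> f (e i) = 0" and x: "x \<in> P" for f x
  proof -
    have "x \<in> b ` {..<card P}" using b x by (simp add: bij_betw_def)
    then obtain i where i: "i < card P" "b i = x" by auto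
    have "A2_inner \<alpha> (bergman_kernel \<alpha> x) f = 0"
    proof (rule A2_inner_in_span[OF \<alpha> sp[OF i(1), unfolded i(2)] _ f(1)])
      fix j assume j: "j < k"
      then show "in_A2 \<alpha> (e j)" using e by (simp add: A2_orthonormal_def[OF \<alpha>])
      show "A2_inner \<alpha> (e j) f = 0" using f(2)[OF j] A2_inner_cnj[OF \<alpha>, of f "e j"] by simp
    qed
    then have "A2_inner \<alpha> f (bergman_kernel \<alpha> x) = 0"
      using A2_inner_cnj[OF \<alpha>, of "bergman_kernel \<alpha> x" f] by simp
    then show ?thesis using A2_reproducing[OF \<alpha> f(1), of x] P(2) x by auto
  qed
  then show ?thesis using that[OF k e] by blast
qed

context weighted_pair
begin

lemma T_diff_sum: "T (\<lambda>z. f z - (\<Sum>i<k. c i * e i z)) = (\<lambda>z. T f z - (\<Sum>i<k. c i * T (e i) z))"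
  by (rule ext) (simp add: T_apply algebra_simps sum_distrib_left sum_subtractf)

text \<open>Compare \<open>T\<close> with \<open>T\<close> composed with the orthogonal projection
  onto the span of the vectors from \<open>orthonormal_vanishing\<close>. The difference is
  \<open>T\<close> applied to the residual, which vanishes on \<open>P\<close> and has no larger
  norm, so \<open>D\<close> bounds it.\<close>

lemma sing_num_le_of_vanishing:
  assumes P: "finite P" "P \<subseteq> udisc" "card P \<le> l" and D: "D \<ge> 0" and maps: "maps_A2 \<alpha> T"
    and main: "\<And>f. in_A2 \<alpha> f \<Longrightarrow> (\<And>x. x \<in> P \<Longrightarrow> f x = 0) \<Longrightarrow> A2_norm \<alpha> (T f) \<le> D * A2_norm \<alpha> f"
  shows "sing_num \<alpha> T l \<le> ennreal D"
proof -
  obtain k e where k: "k \<le> card P" and e: "A2_orthonormal \<alpha> k e"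
    and van: "\<And>f x. in_A2 \<alpha> f \<Longrightarrow> (\<And>i. i < k \<Longrightarrow> A2_inner \<alpha> f (e i) = 0) \<Longrightarrow> x \<in> P \<Longrightarrow> f x = 0"
    by (rule orthonormal_vanishing[OF alpha P(1,2)]) blast
  have ei: "in_A2 \<alpha> (e i)" if "i < k" for i using e that by (auto simp: A2_orthonormal_def[OF alpha])
  have Tei: "in_A2 \<alpha> (T (e i))" if "i < k" for i using maps ei[OF that] by (simp add: maps_A2_def)
  define K where "K f z = (\<Sum>i<k. A2_inner \<alpha> f (e i) * T (e i) z)" for f z
  have "rank_le_A2 \<alpha> l K"
    unfolding rank_le_A2_def
  proof (intro conjI)
    show "maps_A2 \<alpha> K"
      unfolding maps_A2_def K_def using Tei by (intro allI impI in_A2_sum[OF alpha] in_A2_cmult[OF alpha]) auto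
    show "linear_A2 \<alpha> K"
      unfolding linear_A2_def
    proof (intro conjI allI impI ballI)
      fix f g z assume fg: "in_A2 \<alpha> f" "in_A2 \<alpha> g"
      have "K (\<lambda>w. f w + g w) z = (\<Sum>i<k. (A2_inner \<alpha> f (e i) + A2_inner \<alpha> g (e i)) * T (e i) z)"
        unfolding K_def using fg ei by (intro sum.cong refl) (simp add: A2_inner_add_left[OF alpha])
      then show "K (\<lambda>w. f w + g w) z = K f z + K g z" by (simp add: K_def sum.distrib distrib_right)
    next
      fix f c z
      show "K (\<lambda>w. c * f w) z = c * K f z"
        by (simp add: K_def A2_inner_cmult_left[OF alpha] sum_distrib_left mult.assoc)
    qed
    show "bounded_A2 \<alpha> K"
      unfolding bounded_A2_def
    proof (intro exI[of _ "\<Sum>i<k. A2_norm \<alpha> (T (e i))"] allI impI)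
      fix f assume f: "in_A2 \<alpha> f"
      have "A2_norm \<alpha> (K f) \<le> (\<Sum>i<k. A2_norm \<alpha> (\<lambda>z. A2_inner \<alpha> f (e i) * T (e i) z))"
        unfolding K_def using Tei by (intro A2_norm_sum_le[OF alpha] in_A2_cmult[OF alpha]) auto
      also have "\<dots> \<le> (\<Sum>i<k. A2_norm \<alpha> f * A2_norm \<alpha> (T (e i)))"
      proof (rule sum_mono)
        fix i assume "i \<in> {..<k}"
        then have i: "i < k" by simp
        have "A2_norm \<alpha> (e i) = 1"
        proof -
          have "complex_of_real ((A2_norm \<alpha> (e i))\<^sup>2) = of_real 1"
            using A2_inner_self[OF alpha ei[OF i]] e i by (simp add: A2_orthonormal_def[OF alpha])
          then have "(A2_norm \<alpha> (e i))\<^sup>2 = 1" by (simp only: of_real_eq_iff)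
          then show ?thesis using A2_norm_nonneg[of \<alpha> "e i"] by (simp add: power2_eq_1_iff)
        qed
        then have "cmod (A2_inner \<alpha> f (e i)) \<le> A2_norm \<alpha> f"
          using A2_inner_Cauchy_Schwarz[OF alpha f ei[OF i]] by simp
        then show "A2_norm \<alpha> (\<lambda>z. A2_inner \<alpha> f (e i) * T (e i) z) \<le> A2_norm \<alpha> f * A2_norm \<alpha> (T (e i))"
          using Tei[OF i] by (simp add: A2_norm_cmult[OF alpha] mult_right_mono)
      qed
      finally show "A2_norm \<alpha> (K f) \<le> (\<Sum>i<k. A2_norm \<alpha> (T (e i))) * A2_norm \<alpha> f"
        by (simp add: sum_distrib_left mult.commute)
    qed
    show "\<exists>gs. length gs \<le> l \<and> (\<forall>g\<in>set gs. in_A2 \<alpha> g) \<and>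
      (\<forall>f. in_A2 \<alpha> f \<longrightarrow> (\<exists>c. \<forall>z\<in>udisc. K f z = (\<Sum>i<length gs. c i * (gs ! i) z)))"
    proof (intro exI[of _ "map (\<lambda>i. T (e i)) [0..<k]"] conjI allI impI)
      fix f
      show "\<exists>c. \<forall>z\<in>udisc. K f z = (\<Sum>i<length (map (\<lambda>i. T (e i)) [0..<k]). c i * (map (\<lambda>i. T (e i)) [0..<k] ! i) z)"
        by (intro exI[of _ "\<lambda>i. A2_inner \<alpha> f (e i)"]) (simp add: K_def)
    qed (use k P Tei in auto)
  qed
  then have "sing_num \<alpha> T l \<le> op_norm \<alpha> (\<lambda>f z. T f z - K f z)"
    unfolding sing_num_def by (intro INF_lower) simp
  also have "\<dots> \<le> ennreal D"
    unfolding op_norm_def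
  proof (rule SUP_least)
    fix f assume "f \<in> {f. in_A2 \<alpha> f \<and> A2_norm \<alpha> f \<le> 1}"
    then have f: "in_A2 \<alpha> f" "A2_norm \<alpha> f \<le> 1" by auto
    define h where "h z = f z - (\<Sum>i<k. A2_inner \<alpha> f (e i) * e i z)" for z
    have h: "in_A2 \<alpha> h"
      unfolding h_def using f ei by (intro in_A2_diff[OF alpha] in_A2_sum[OF alpha] in_A2_cmult[OF alpha]) auto
    have ho: "A2_inner \<alpha> h (e i) = 0" if "i < k" for i
      using A2_residual_orthogonal[OF alpha e f(1) that] by (simp add: h_def[abs_def])
    have "(A2_norm \<alpha> h)\<^sup>2 \<le> (A2_norm \<alpha> f)\<^sup>2"
      unfolding h_def A2_orthonormal_residual[OF alpha e f(1)] by (simp add: sum_nonneg)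
    then have "A2_norm \<alpha> h \<le> A2_norm \<alpha> f" by (rule power2_le_imp_le) simp
    then have h1: "A2_norm \<alpha> h \<le> 1" using f by simp
    have "(\<lambda>z. T f z - K f z) = T h" unfolding h_def K_def by (rule T_diff_sum[symmetric])
    then have "A2_norm \<alpha> (\<lambda>z. T f z - K f z) = A2_norm \<alpha> (T h)" by simp
    also have "\<dots> \<le> D * A2_norm \<alpha> h" using van[OF h ho] by (intro main[OF h]) auto
    also have "\<dots> \<le> D" using h1 D by (simp add: mult_left_le)
    finally show "ennreal (A2_norm \<alpha> (\<lambda>z. T f z - K f z)) \<le> ennreal D" by (rule ennreal_leI)
  qed
  finally show ?thesis .
qed

text \<open>A uniform bound \<open>t\<close> on the reduced averages comes out of the cell sum, and
  the local masses that remain overlap boundedly. Without zeros this gives boundedness of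
  \<open>T\<close>, with zeros the bounds on approximation numbers.\<close>

lemma T_norm_bound:
  assumes lat: "disc_lattice (1 / 100) a" and fin: "\<And>n. total_avg a n < \<infinity>"
  obtains K where "K \<ge> 0"
    "\<And>f S t. in_A2 \<alpha> f \<Longrightarrow> (\<And>n. finite (S n)) \<Longrightarrow> (\<And>n. S n \<subseteq> cball (a n) (1 / 20 * (1 - cmod (a n)))) \<Longrightarrow>
      (\<And>n x. x \<in> S n \<Longrightarrow> f x = 0) \<Longrightarrow> (\<And>n. enn2real (total_avg a n) * (1 / 4) ^ card (S n) \<le> t) \<Longrightarrow>
      in_A2 \<alpha> (T f) \<and> (A2_norm \<alpha> (T f))\<^sup>2 \<le> K * t * (A2_norm \<alpha> f)\<^sup>2"
proof -
  obtain K where K: "K > 0"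
    "\<And>f S. f holomorphic_on udisc \<Longrightarrow> (\<And>n. finite (S n)) \<Longrightarrow> (\<And>n. S n \<subseteq> cball (a n) (1 / 20 * (1 - cmod (a n)))) \<Longrightarrow>
      (\<And>n x. x \<in> S n \<Longrightarrow> f x = 0) \<Longrightarrow>
      bergman_int \<alpha> (T f) \<le> ennreal K * (\<Sum>n. total_avg a n * ennreal ((1 / 4) ^ card (S n)) * local_mass \<alpha> f (a n))"
    using T_lattice_bound[OF lat] by blast
  obtain N :: nat where N: "\<And>f. in_A2 \<alpha> f \<Longrightarrow> (\<Sum>n. local_mass \<alpha> f (a n)) \<le> of_nat N * bergman_int \<alpha> f"
    using local_mass_sum_le[OF alpha lat] by auto
  have "in_A2 \<alpha> (T f) \<and> (A2_norm \<alpha> (T f))\<^sup>2 \<le> (K * real N) * t * (A2_norm \<alpha> f)\<^sup>2"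
    if f: "in_A2 \<alpha> f" and S: "\<And>n. finite (S n)" "\<And>n. S n \<subseteq> cball (a n) (1 / 20 * (1 - cmod (a n)))"
      "\<And>n x. x \<in> S n \<Longrightarrow> f x = 0" and t: "\<And>n. enn2real (total_avg a n) * (1 / 4) ^ card (S n) \<le> t" for f S t
  proof -
    have holf: "f holomorphic_on udisc" using f by (simp add: in_A2_def)
    have t0: "t \<ge> 0" by (rule order_trans[OF _ t[of 0]]) simp
    have "total_avg a n * ennreal ((1 / 4) ^ card (S n)) \<le> ennreal t" for n
    proof -
      have "total_avg a n * ennreal ((1 / 4) ^ card (S n)) = ennreal (enn2real (total_avg a n)) * ennreal ((1 / 4) ^ card (S n))"
        using fin[of n] by simp
      also have "\<dots> = ennreal (enn2real (total_avg a n) * (1 / 4) ^ card (S n))" by (rule ennreal_mult[symmetric]) auto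
      finally show ?thesis using t[of n] by (simp add: ennreal_leI)
    qed
    then have "(\<Sum>n. total_avg a n * ennreal ((1 / 4) ^ card (S n)) * local_mass \<alpha> f (a n)) \<le> (\<Sum>n. ennreal t * local_mass \<alpha> f (a n))"
      by (intro suminf_le mult_right_mono) auto
    also have "\<dots> = ennreal t * (\<Sum>n. local_mass \<alpha> f (a n))" by (rule ennreal_suminf_cmult)
    also have "\<dots> \<le> ennreal t * (of_nat N * bergman_int \<alpha> f)" by (intro mult_left_mono N f) auto
    finally have "ennreal K * (\<Sum>n. total_avg a n * ennreal ((1 / 4) ^ card (S n)) * local_mass \<alpha> f (a n)) \<le> ennreal K * (ennreal t * (of_nat N * bergman_int \<alpha> f))"
      by (intro mult_left_mono) auto
    then have "bergman_int \<alpha> (T f) \<le> ennreal K * (ennreal t * (of_nat N * bergman_int \<alpha> f))"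
      using K(2)[OF holf S] by (rule order_trans[rotated])
    also have "\<dots> = ennreal (K * real N * t * (A2_norm \<alpha> f)\<^sup>2)"
    proof -
      have "ennreal x * (ennreal y * (ennreal z * ennreal w)) = ennreal (x * z * y * w)" if "0 \<le> x" "0 \<le> y" "0 \<le> z" "0 \<le> w" for x y z w :: real
        using that by (simp add: ennreal_mult mult_ac)
      then show ?thesis using K(1) t0 unfolding bergman_int_A2_norm[OF alpha f] ennreal_of_nat_eq_real_of_nat by simp
    qed
    finally have le: "bergman_int \<alpha> (T f) \<le> ennreal (K * real N * t * (A2_norm \<alpha> f)\<^sup>2)" .
    have Tf: "in_A2 \<alpha> (T f)" using T_holomorphic[OF holf] le_less_trans[OF le] by (simp add: in_A2_def)
    have "ennreal ((A2_norm \<alpha> (T f))\<^sup>2) \<le> ennreal (K * real N * t * (A2_norm \<alpha> f)\<^sup>2)"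
      using le unfolding bergman_int_A2_norm[OF alpha Tf] .
    then have "(A2_norm \<alpha> (T f))\<^sup>2 \<le> K * real N * t * (A2_norm \<alpha> f)\<^sup>2"
      using K(1) t0 by (subst (asm) ennreal_le_iff) auto
    then show ?thesis using Tf by simp
  qed
  moreover have "K * real N \<ge> 0" using K by simp
  ultimately show ?thesis using that by blast
qed

text \<open>Montel's theorem provides a locally uniformly convergent subsequence. For differences of
  its members the cells of large index contribute little because the averages tend to 0, and the
  balls belonging to the finitely many other cells lie in a compact set on which the differences
  become small.\<close>

lemma T_compact:
  assumes lat: "disc_lattice (1 / 100) a" and fin: "\<And>n. total_avg a n < \<infinity>"
    and lim: "(\<lambda>n. enn2real (total_avg a n)) \<longlonglongrightarrow> 0"
  shows "compact_A2 \<alpha> T"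
  unfolding compact_A2_def
proof (intro allI impI)
  fix fs :: "nat \<Rightarrow> complex \<Rightarrow> complex"
  assume fs: "\<forall>k. in_A2 \<alpha> (fs k) \<and> A2_norm \<alpha> (fs k) \<le> 1"
  define \<H> where "\<H> = {f. in_A2 \<alpha> f \<and> A2_norm \<alpha> f \<le> 1}"
  have a: "cmod (a n) < 1" for n using lat by (simp add: disc_lattice_def)
  obtain K where K: "K > 0"
    "\<And>f S. f holomorphic_on udisc \<Longrightarrow> (\<And>n. finite (S n)) \<Longrightarrow> (\<And>n. S n \<subseteq> cball (a n) (1 / 20 * (1 - cmod (a n)))) \<Longrightarrow>
      (\<And>n x. x \<in> S n \<Longrightarrow> f x = 0) \<Longrightarrow>
      bergman_int \<alpha> (T f) \<le> ennreal K * (\<Sum>n. total_avg a n * ennreal ((1 / 4) ^ card (S n)) * local_mass \<alpha> f (a n))"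
    using T_lattice_bound[OF lat] by blast
  obtain N :: nat where N: "\<And>f. in_A2 \<alpha> f \<Longrightarrow> (\<Sum>n. local_mass \<alpha> f (a n)) \<le> of_nat N * bergman_int \<alpha> f"
    using local_mass_sum_le[OF alpha lat] by auto
  define b where "b n = enn2real (total_avg a n)" for n
  have b0: "b n \<ge> 0" for n by (simp add: b_def)
  obtain g r where r: "strict_mono (r :: nat \<Rightarrow> nat)"
    and unif: "\<And>L. compact L \<Longrightarrow> L \<subseteq> udisc \<Longrightarrow> uniform_limit L (fs \<circ> r) g sequentially"
  proof (rule Montel[of udisc \<H> fs])
    show "open udisc" by (rule open_udisc)
    show "\<And>h. h \<in> \<H> \<Longrightarrow> h holomorphic_on udisc" by (auto simp: \<H>_def in_A2_def)
    show "range fs \<subseteq> \<H>" using fs by (auto simp: \<H>_def)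
    fix L :: "complex set" assume L: "compact L" "L \<subseteq> udisc"
    \<comment> \<open>Norms of kernels are bounded on compact subsets of the disc, so the unit ball
      is locally bounded.\<close>
    show "\<exists>B. \<forall>h\<in>\<H>. \<forall>z\<in>L. cmod (h z) \<le> B"
    proof (cases "L = {}")
      case False
      obtain z0 where z0: "z0 \<in> L" "\<And>z. z \<in> L \<Longrightarrow> cmod z \<le> cmod z0"
        using continuous_attains_sup[OF L(1) False, of cmod] continuous_on_norm_id by blast
      have z01: "cmod z0 < 1" using z0 L by (auto simp: mem_udisc)
      show ?thesis
      proof (intro exI ballI)
        fix h z assume h: "h \<in> \<H>" and z: "z \<in> L"
        have zd: "z \<in> udisc" using z L by auto
        have "(A2_norm \<alpha> (bergman_kernel \<alpha> z))\<^sup>2 \<le> (1 - (cmod z0)\<^sup>2) powr (- (\<alpha> + 2))"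
          unfolding A2_norm_bergman_kernel[OF alpha zd] using alpha z01 z0(2)[OF z]
          by (intro powr_mono2') (auto simp: abs_square_less_1 power_mono)
        then have "A2_norm \<alpha> (bergman_kernel \<alpha> z) \<le> sqrt ((1 - (cmod z0)\<^sup>2) powr (- (\<alpha> + 2)))"
          by (rule real_le_rsqrt)
        moreover have "cmod (h z) \<le> A2_norm \<alpha> h * A2_norm \<alpha> (bergman_kernel \<alpha> z)"
          using A2_inner_Cauchy_Schwarz[OF alpha _ in_A2_bergman_kernel[OF alpha zd], of h] A2_reproducing[OF alpha _ zd, of h] h
          by (simp add: \<H>_def)
        moreover have "A2_norm \<alpha> h * A2_norm \<alpha> (bergman_kernel \<alpha> z) \<le> 1 * A2_norm \<alpha> (bergman_kernel \<alpha> z)"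
          using h by (intro mult_right_mono) (auto simp: \<H>_def)
        ultimately show "cmod (h z) \<le> sqrt ((1 - (cmod z0)\<^sup>2) powr (- (\<alpha> + 2)))" by linarith
      qed
    qed auto
  qed blast
  show "\<exists>r. strict_mono r \<and> (\<forall>\<epsilon>>0. \<exists>N::nat. \<forall>m\<ge>N. \<forall>n\<ge>N. A2_norm \<alpha> (\<lambda>z. T (fs (r m)) z - T (fs (r n)) z) < \<epsilon>)"
  proof (intro exI[of _ r] conjI r allI impI)
    fix \<epsilon> :: real assume \<epsilon>: "\<epsilon> > 0"
    \<comment> \<open>The differences have norm at most 2, so \<open>\<delta>\<close> makes the far
      cells contribute at most \<open>\<epsilon>\<^sup>2 / 4\<close>; \<open>\<tau>\<close> below
      does the same for the near cells, and the total stays below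
      \<open>\<epsilon>\<^sup>2\<close>.\<close>
    define \<delta> where "\<delta> = \<epsilon>\<^sup>2 / (16 * K * (real N + 1))"
    have \<delta>: "\<delta> > 0" using \<epsilon> K by (simp add: \<delta>_def)
    have "\<forall>\<^sub>F n in sequentially. b n < \<delta>" using lim \<delta> unfolding b_def by (intro order_tendstoD(2)) auto
    then obtain n0 where n0: "\<And>n. n \<ge> n0 \<Longrightarrow> b n < \<delta>" by (auto simp: eventually_sequentially)
    define B where "B = (\<Sum>n<n0. b n)"
    have B0: "B \<ge> 0" unfolding B_def by (intro sum_nonneg b0)
    define \<tau> where "\<tau> = \<epsilon> / sqrt (4 * K * (B + 1))"
    have \<tau>: "\<tau> > 0" using \<epsilon> K B0 by (simp add: \<tau>_def)
    define L where "L = (\<Union>n<n0. cball (a n) ((1 - cmod (a n)) / 2))"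
    have "compact L" unfolding L_def by (intro compact_UN) auto
    moreover have "L \<subseteq> udisc"
    proof
      fix z assume "z \<in> L"
      then obtain n where "cmod (z - a n) \<le> (1 - cmod (a n)) / 2" by (auto simp: L_def dist_norm norm_minus_commute)
      then show "z \<in> udisc" using a[of n] norm_triangle_ineq2[of z "a n"] by (simp add: mem_udisc)
    qed
    ultimately have "uniform_limit L (fs \<circ> r) g sequentially" by (rule unif)
    then have "\<forall>\<^sub>F n in sequentially. \<forall>z\<in>L. dist ((fs \<circ> r) n z) (g z) < \<tau> / 2"
      by (rule uniform_limitD) (use \<tau> in simp)
    then obtain M where M: "\<And>n z. n \<ge> M \<Longrightarrow> z \<in> L \<Longrightarrow> dist (fs (r n) z) (g z) < \<tau> / 2"
      by (auto simp: eventually_sequentially)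
    show "\<exists>N::nat. \<forall>m\<ge>N. \<forall>n\<ge>N. A2_norm \<alpha> (\<lambda>z. T (fs (r m)) z - T (fs (r n)) z) < \<epsilon>"
    proof (intro exI[of _ M] allI impI)
      fix i j assume ij: "i \<ge> M" "j \<ge> M"
      define h where "h z = fs (r i) z - fs (r j) z" for z
      have fsi: "in_A2 \<alpha> (fs (r i))" "in_A2 \<alpha> (fs (r j))" using fs by auto
      have h: "in_A2 \<alpha> h" unfolding h_def using fsi by (rule in_A2_diff[OF alpha])
      have hT: "(\<lambda>z. T (fs (r i)) z - T (fs (r j)) z) = T h" by (rule ext) (simp add: h_def T_apply algebra_simps)
      have hn: "A2_norm \<alpha> h \<le> 2"
      proof -
        have "A2_norm \<alpha> (\<lambda>z. fs (r i) z + (-1) * fs (r j) z) \<le> A2_norm \<alpha> (fs (r i)) + A2_norm \<alpha> (\<lambda>z. (-1) * fs (r j) z)"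
          using fsi by (intro A2_norm_triangle[OF alpha] in_A2_cmult[OF alpha])
        also have "A2_norm \<alpha> (\<lambda>z. (-1) * fs (r j) z) = A2_norm \<alpha> (fs (r j))"
          using fsi by (subst A2_norm_cmult[OF alpha]) auto
        finally show ?thesis using fs[rule_format, of "r i"] fs[rule_format, of "r j"] by (simp add: h_def[abs_def])
      qed
      have hsmall: "cmod (h z) \<le> \<tau>" if "z \<in> L" for z
        using M[OF ij(1) that] M[OF ij(2) that] dist_triangle2[of "fs (r i) z" "fs (r j) z" "g z"] by (simp add: h_def dist_norm)
      have lm: "local_mass \<alpha> h (a n) \<le> ennreal (\<tau>\<^sup>2)" if "n < n0" for n
      proof -
        have c: "in_A2 \<alpha> (\<lambda>z. of_real \<tau>)" "A2_norm \<alpha> (\<lambda>z. of_real \<tau>) \<le> \<tau>"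
          using \<tau> by (auto intro!: in_A2_bounded[OF alpha, where B = \<tau>])
        have "local_mass \<alpha> h (a n) \<le> bergman_int \<alpha> (\<lambda>z. of_real \<tau>)"
          unfolding local_mass_def bergman_int_weight
        proof (intro nn_integral_mono)
          fix w
          show "indicator (ball (a n) ((1 - cmod (a n)) / 2)) w * ennreal (A2_weight \<alpha> w * (cmod (h w))\<^sup>2) \<le> ennreal (A2_weight \<alpha> w * (cmod (complex_of_real \<tau>))\<^sup>2)"
          proof (cases "w \<in> ball (a n) ((1 - cmod (a n)) / 2)")
            case True
            then have "w \<in> L" using that by (auto simp: L_def intro!: bexI[of _ n])
            then have "(cmod (h w))\<^sup>2 \<le> (cmod (complex_of_real \<tau>))\<^sup>2" using hsmall \<tau> by (intro power_mono) auto
            then have "A2_weight \<alpha> w * (cmod (h w))\<^sup>2 \<le> A2_weight \<alpha> w * (cmod (complex_of_real \<tau>))\<^sup>2"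
              by (rule mult_left_mono[OF _ A2_weight_nonneg[OF alpha]])
            then show ?thesis using True by (simp add: ennreal_leI)
          qed simp
        qed
        also have "\<dots> = ennreal ((A2_norm \<alpha> (\<lambda>z. of_real \<tau>))\<^sup>2)" by (rule bergman_int_A2_norm[OF alpha c(1)])
        also have "\<dots> \<le> ennreal (\<tau>\<^sup>2)" using c(2) by (intro ennreal_leI power_mono) auto
        finally show ?thesis .
      qed
      have "bergman_int \<alpha> (T h) \<le> ennreal K * (\<Sum>n. total_avg a n * ennreal ((1 / 4) ^ card ({} :: complex set)) * local_mass \<alpha> h (a n))"
        using h by (intro K(2)) (auto simp: in_A2_def)
      also have "(\<Sum>n. total_avg a n * ennreal ((1 / 4) ^ card ({} :: complex set)) * local_mass \<alpha> h (a n)) = (\<Sum>n. ennreal (b n) * local_mass \<alpha> h (a n))"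
        using fin by (simp add: b_def)
      also have "\<dots> \<le> (\<Sum>n. ennreal \<delta> * local_mass \<alpha> h (a n) + (if n < n0 then ennreal (b n) * ennreal (\<tau>\<^sup>2) else 0))"
      proof (intro suminf_le)
        fix n
        show "ennreal (b n) * local_mass \<alpha> h (a n) \<le> ennreal \<delta> * local_mass \<alpha> h (a n) + (if n < n0 then ennreal (b n) * ennreal (\<tau>\<^sup>2) else 0)"
        proof (cases "n < n0")
          case True
          then have "ennreal (b n) * local_mass \<alpha> h (a n) \<le> ennreal (b n) * ennreal (\<tau>\<^sup>2)" by (intro mult_left_mono lm) auto
          then show ?thesis using True by (simp add: add_increasing)
        next
          case False
          then have "b n \<le> \<delta>" using n0[of n] by simp
          then show ?thesis using False by (simp add: mult_right_mono ennreal_leI)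
        qed
      qed auto
      also have "\<dots> = (\<Sum>n. ennreal \<delta> * local_mass \<alpha> h (a n)) + (\<Sum>n. if n < n0 then ennreal (b n) * ennreal (\<tau>\<^sup>2) else 0)"
        by (rule suminf_add[symmetric]) auto
      also have "(\<Sum>n. ennreal \<delta> * local_mass \<alpha> h (a n)) = ennreal \<delta> * (\<Sum>n. local_mass \<alpha> h (a n))" by (rule ennreal_suminf_cmult)
      also have "\<dots> \<le> ennreal \<delta> * (of_nat N * bergman_int \<alpha> h)" by (intro mult_left_mono N h) auto
      also have "\<dots> = ennreal (\<delta> * (real N * (A2_norm \<alpha> h)\<^sup>2))"
        using \<delta> by (simp add: bergman_int_A2_norm[OF alpha h] ennreal_of_nat_eq_real_of_nat ennreal_mult)
      also have "(\<Sum>n. if n < n0 then ennreal (b n) * ennreal (\<tau>\<^sup>2) else 0) = ennreal (B * \<tau>\<^sup>2)"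
      proof -
        have "(\<Sum>n. if n < n0 then ennreal (b n) * ennreal (\<tau>\<^sup>2) else 0) = (\<Sum>n<n0. ennreal (b n * \<tau>\<^sup>2))"
          by (subst suminf_finite[of "{..<n0}"]) (auto simp: ennreal_mult b0)
        also have "\<dots> = ennreal (\<Sum>n<n0. b n * \<tau>\<^sup>2)" by (rule sum_ennreal) (simp add: b0)
        finally show ?thesis by (simp add: B_def sum_distrib_right)
      qed
      also have "ennreal (\<delta> * (real N * (A2_norm \<alpha> h)\<^sup>2)) + ennreal (B * \<tau>\<^sup>2) = ennreal (\<delta> * (real N * (A2_norm \<alpha> h)\<^sup>2) + B * \<tau>\<^sup>2)"
        using \<delta> B0 by (intro ennreal_plus[symmetric]) auto
      also have "ennreal K * \<dots> = ennreal (K * (\<delta> * (real N * (A2_norm \<alpha> h)\<^sup>2) + B * \<tau>\<^sup>2))"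
        using K \<delta> B0 by (intro ennreal_mult[symmetric]) auto
      finally have le: "bergman_int \<alpha> (T h) \<le> ennreal (K * (\<delta> * (real N * (A2_norm \<alpha> h)\<^sup>2) + B * \<tau>\<^sup>2))"
        by (simp add: mult_left_mono)
      have Th: "in_A2 \<alpha> (T h)"
        using T_holomorphic[of h] h le_less_trans[OF le] by (simp add: in_A2_def)
      have "(A2_norm \<alpha> (T h))\<^sup>2 \<le> K * (\<delta> * (real N * (A2_norm \<alpha> h)\<^sup>2) + B * \<tau>\<^sup>2)"
        using le K \<delta> B0 unfolding bergman_int_A2_norm[OF alpha Th] by (subst (asm) ennreal_le_iff) auto
      also have "\<dots> \<le> K * (\<delta> * (real N * 4) + B * \<tau>\<^sup>2)"
      proof -
        have "(A2_norm \<alpha> h)\<^sup>2 \<le> 2\<^sup>2" using hn by (intro power_mono) auto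
        then show ?thesis using K \<delta> by (intro mult_left_mono add_right_mono) auto
      qed
      also have "\<dots> < \<epsilon>\<^sup>2"
      proof -
        have "K * \<delta> * (real N * 4) \<le> K * \<delta> * ((real N + 1) * 4)" using K \<delta> by (intro mult_left_mono) auto
        also have "\<dots> = \<epsilon>\<^sup>2 / 4"
        proof -
          have "k * (e / (16 * k * c)) * (c * 4) = e / 4" if "k \<noteq> 0" "c \<noteq> 0" for k c e :: real
            using that by simp
          moreover have "K \<noteq> 0" "real N + 1 \<noteq> 0" using K(1) by auto
          ultimately show ?thesis unfolding \<delta>_def by blast
        qed
        finally have 1: "K * \<delta> * (real N * 4) \<le> \<epsilon>\<^sup>2 / 4" .
        have "\<tau>\<^sup>2 = \<epsilon>\<^sup>2 / (4 * K * (B + 1))" using K B0 by (simp add: \<tau>_def power_divide)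
        moreover have "k * (c * (e / (4 * k * c))) = e / 4" if "k \<noteq> 0" "c \<noteq> 0" for k c e :: real
          using that by simp
        moreover have "K \<noteq> 0" "B + 1 \<noteq> 0" using K(1) B0 by auto
        ultimately have "K * ((B + 1) * \<tau>\<^sup>2) = \<epsilon>\<^sup>2 / 4" by (simp only:)
        moreover have "K * (B * \<tau>\<^sup>2) \<le> K * ((B + 1) * \<tau>\<^sup>2)" using K by (intro mult_left_mono mult_right_mono) auto
        ultimately have "K * (\<delta> * (real N * 4) + B * \<tau>\<^sup>2) \<le> \<epsilon>\<^sup>2 / 4 + \<epsilon>\<^sup>2 / 4" using 1 by (simp add: algebra_simps)
        moreover have "\<epsilon>\<^sup>2 > 0" using \<epsilon> by simp
        ultimately show ?thesis by linarith
      qed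
      finally have "A2_norm \<alpha> (T h) < \<epsilon>" by (rule power2_less_imp_less) (use \<epsilon> in simp)
      then show "A2_norm \<alpha> (\<lambda>z. T (fs (r i)) z - T (fs (r j)) z) < \<epsilon>" by (simp add: hT)
    qed
  qed
qed

text \<open>The three summable families of averages are merged into one sequence \<open>b\<close>;
  prescribed zeros then translate \<open>T_norm_bound\<close> into the rank condition required by
  \<open>summable_from_local_ranks\<close>.\<close>

lemma T_schatten:
  assumes p: "p > 0" and lat: "disc_lattice (1 / 100) a"
    and L: "lattice_summable \<alpha> (p / 2) (1 / 100) a \<phi> dens_u" "lattice_summable \<alpha> (p / 2) (1 / 100) a \<psi> dens_v"
      "lattice_summable \<alpha> (p / 2) (1 / 100) a \<psi> dens_uv"
  shows "schatten_A2 \<alpha> p T"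
proof -
  define q where "q = p / 2"
  have q: "q > 0" using p by (simp add: q_def)
  have a: "cmod (a n) < 1" for n using lat by (simp add: disc_lattice_def)
  \<comment> \<open>Indexing the three averages by 0, 1, 2 lets \<open>powr_sum_le\<close> handle
    the \<open>q\<close>-th power of their sum for every \<open>q > 0\<close>.\<close>
  define x where "x i n = enn2real (if i = 0 then lattice_avg \<alpha> (1 / 100) a \<phi> dens_u n
    else if i = 1 then lattice_avg \<alpha> (1 / 100) a \<psi> dens_v n else lattice_avg \<alpha> (1 / 100) a \<psi> dens_uv n)" for i n :: nat
  define b where "b n = enn2real (total_avg a n)" for n
  have fin3: "lattice_avg \<alpha> (1 / 100) a \<phi> dens_u n < \<infinity>" "lattice_avg \<alpha> (1 / 100) a \<psi> dens_v n < \<infinity>"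
    "lattice_avg \<alpha> (1 / 100) a \<psi> dens_uv n < \<infinity>" for n
    using L by (auto simp: lattice_summable_def)
  have fin: "total_avg a n < \<infinity>" for n using fin3[of n] by (simp add: total_avg_def)
  have bx: "b n = (\<Sum>i\<in>{0, 1, 2}. x i n)" for n
    using fin3[of n] by (simp add: b_def total_avg_def x_def enn2real_plus)
  have sum_pw: "summable (\<lambda>n. y n powr q)" if "(\<Sum>n. ennreal (y n powr (p / 2))) < \<infinity>" for y :: "nat \<Rightarrow> real"
    using that unfolding q_def infinity_ennreal_def less_top[symmetric] by (intro summable_suminf_not_top) auto
  have sx: "summable (\<lambda>n. x i n powr q)" for i
  proof -
    consider "i = 0" | "i = 1" | "i \<noteq> 0" "i \<noteq> 1" by blast
    then show ?thesis
      using L unfolding x_def lattice_summable_def by cases (simp_all only: if_True if_False refl sum_pw simp_thms one_neq_zero)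
  qed
  have b0: "b n \<ge> 0" for n by (simp add: b_def)
  have sb: "summable (\<lambda>n. b n powr q)"
  proof (rule summable_comparison_test')
    show "summable (\<lambda>n. real 3 powr q * (\<Sum>i\<in>{0, 1, 2}. x i n powr q))"
      by (intro summable_mult summable_sum sx)
    show "norm (b n powr q) \<le> real 3 powr q * (\<Sum>i\<in>{0, 1, 2}. x i n powr q)" for n
      unfolding bx real_norm_def abs_of_nonneg[OF powr_ge_zero]
      by (intro powr_sum_le q) (auto simp: x_def)
  qed
  have lim: "b \<longlonglongrightarrow> 0"
  proof -
    have "(\<lambda>n. (b n powr q) powr (1 / q)) \<longlonglongrightarrow> 0 powr (1 / q)"
      using summable_LIMSEQ_zero[OF sb] q by (intro tendsto_powr') auto
    moreover have "(b n powr q) powr (1 / q) = b n" for n using q b0[of n] by (simp add: powr_powr)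
    ultimately show ?thesis by simp
  qed
  obtain K where K: "K \<ge> 0"
    "\<And>f S t. in_A2 \<alpha> f \<Longrightarrow> (\<And>n. finite (S n)) \<Longrightarrow> (\<And>n. S n \<subseteq> cball (a n) (1 / 20 * (1 - cmod (a n)))) \<Longrightarrow>
      (\<And>n x. x \<in> S n \<Longrightarrow> f x = 0) \<Longrightarrow> (\<And>n. b n * (1 / 4) ^ card (S n) \<le> t) \<Longrightarrow>
      in_A2 \<alpha> (T f) \<and> (A2_norm \<alpha> (T f))\<^sup>2 \<le> K * t * (A2_norm \<alpha> f)\<^sup>2"
    using T_norm_bound[OF lat fin] unfolding b_def by blast
  obtain B where B: "\<And>n. b n \<le> B"
    using convergent_imp_Bseq[of b] lim b0 unfolding Bseq_def convergent_def by (metis abs_of_nonneg real_norm_def)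
  have TB: "in_A2 \<alpha> (T f) \<and> (A2_norm \<alpha> (T f))\<^sup>2 \<le> K * B * (A2_norm \<alpha> f)\<^sup>2" if "in_A2 \<alpha> f" for f
    using that B by (intro K(2)[where S = "\<lambda>_. {}"]) auto
  have maps: "maps_A2 \<alpha> T" using TB by (simp add: maps_A2_def)
  have B0: "B \<ge> 0" using order_trans[OF b0 B] .
  have sqrt_bound: "A2_norm \<alpha> (T f) \<le> sqrt (K * t) * A2_norm \<alpha> f"
    if "(A2_norm \<alpha> (T f))\<^sup>2 \<le> K * t * (A2_norm \<alpha> f)\<^sup>2" "t \<ge> 0" for f t
  proof (rule power2_le_imp_le)
    show "(A2_norm \<alpha> (T f))\<^sup>2 \<le> (sqrt (K * t) * A2_norm \<alpha> f)\<^sup>2" using that K(1) by (simp add: power_mult_distrib)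
    show "0 \<le> sqrt (K * t) * A2_norm \<alpha> f" using that K(1) by simp
  qed
  have bounded: "bounded_A2 \<alpha> T"
    unfolding bounded_A2_def using sqrt_bound TB B0 by blast
  have "summable (\<lambda>l. enn2real (sing_num \<alpha> T l) powr p)"
  proof (rule summable_from_local_ranks[OF p b0 _ _ K(1)])
    show "summable (\<lambda>n. b n powr (p / 2))" using sb by (simp add: q_def)
    show "0 \<le> enn2real (sing_num \<alpha> T l)" for l by simp
    fix F N t l
    assume F: "finite F" "\<And>n. n \<notin> F \<Longrightarrow> N n = 0" and t: "\<And>n. b n * (1 / 4) ^ N n \<le> t" and l: "(\<Sum>n\<in>F. N n) \<le> l"
    have t0: "t \<ge> 0" by (rule order_trans[OF _ t[of 0]]) (simp add: b0)
    \<comment> \<open>Any \<open>N n\<close> distinct points of the small ball will do; the estimate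
      uses only their number and the relative radius \<open>1 / 20\<close>.\<close>
    have "\<exists>S. finite S \<and> card S = N n \<and> S \<subseteq> cball (a n) (1 / 20 * (1 - cmod (a n)))" for n
    proof -
      have "uncountable (ball (a n) (1 / 20 * (1 - cmod (a n))))" using a[of n] by (intro uncountable_ball) auto
      then have "infinite (ball (a n) (1 / 20 * (1 - cmod (a n))))" using countable_finite by blast
      then obtain S where "finite S" "card S = N n" "S \<subseteq> ball (a n) (1 / 20 * (1 - cmod (a n)))"
        using infinite_arbitrarily_large by blast
      then show ?thesis using ball_subset_cball by blast
    qed
    then obtain S where S: "\<And>n. finite (S n)" "\<And>n. card (S n) = N n" "\<And>n. S n \<subseteq> cball (a n) (1 / 20 * (1 - cmod (a n)))"
      by metis
    have Sd: "S n \<subseteq> udisc" for n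
    proof
      fix z assume "z \<in> S n"
      then have "cmod (z - a n) \<le> 1 / 20 * (1 - cmod (a n))" using S(3)[of n] by (auto simp: dist_norm norm_minus_commute)
      then show "z \<in> udisc" using a[of n] norm_triangle_ineq2[of z "a n"] by (simp add: mem_udisc)
    qed
    have S0: "S n = {}" if "n \<notin> F" for n using F(2)[OF that] S(1,2)[of n] by simp
    have "sing_num \<alpha> T l \<le> ennreal (sqrt (K * t))"
    proof (rule sing_num_le_of_vanishing[where P = "\<Union>n\<in>F. S n"])
      show "(\<Union>n\<in>F. S n) \<subseteq> udisc" using Sd by blast
      show "card (\<Union>n\<in>F. S n) \<le> l"
        using card_UN_le[OF F(1), of S] l S(2) by simp
      fix f assume f: "in_A2 \<alpha> f" "\<And>x. x \<in> (\<Union>n\<in>F. S n) \<Longrightarrow> f x = 0"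
      have "f x = 0" if "x \<in> S n" for x n using f(2) S0[of n] that by (cases "n \<in> F") auto
      then have "(A2_norm \<alpha> (T f))\<^sup>2 \<le> K * t * (A2_norm \<alpha> f)\<^sup>2"
        using K(2)[OF f(1) S(1,3), of t] t S(2) by simp
      then show "A2_norm \<alpha> (T f) \<le> sqrt (K * t) * A2_norm \<alpha> f" using t0 by (rule sqrt_bound)
    qed (use F S Sd maps K(1) t0 in auto)
    then have "enn2real (sing_num \<alpha> T l) \<le> sqrt (K * t)" using K(1) t0 by (intro enn2real_leI) auto
    then have "(enn2real (sing_num \<alpha> T l))\<^sup>2 \<le> (sqrt (K * t))\<^sup>2" by (intro power_mono) auto
    then show "(enn2real (sing_num \<alpha> T l))\<^sup>2 \<le> K * t" using K(1) t0 by simp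
  qed
  then show ?thesis
    unfolding schatten_A2_def using maps T_linear bounded T_compact[OF lat fin] lim by (simp add: b_def[abs_def])
qed

end

section \<open>Singular vectors\<close>

text \<open>A single eigenvector at a time is enough, because \<open>singular_vectors\<close> passes
  to the orthogonal complement and repeats.\<close>

lemma exists_eigenvector:
  fixes A :: "nat \<Rightarrow> nat \<Rightarrow> complex"
  assumes "n > 0"
  obtains c k where "\<exists>i<n. c i \<noteq> 0" "\<And>i. i < n \<Longrightarrow> (\<Sum>j<n. A i j * c j) = k * c i"
proof -
  define M where "M = mat n n (\<lambda>(i, j). A i j)"
  have M: "M \<in> carrier_mat n n" by (simp add: M_def)
  obtain k where "k \<in> spectrum M" using spectrum_non_empty[OF M assms] by auto
  then obtain v where v: "eigenvector M v k" by (auto simp: spectrum_def eigenvalue_def)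
  have dv: "dim_vec v = n" and vn: "v \<noteq> 0\<^sub>v n" and Mv: "M *\<^sub>v v = k \<cdot>\<^sub>v v"
    using v by (auto simp: eigenvector_def M_def)
  show ?thesis
  proof (rule that[of "\<lambda>i. vec_index v i" k])
    show "\<exists>i<n. vec_index v i \<noteq> 0"
      using vn dv by (metis eq_vecI index_zero_vec(1) index_zero_vec(2))
    fix i assume i: "i < n"
    have "vec_index (M *\<^sub>v v) i = k * vec_index v i"
      using i dv by (simp add: Mv)
    moreover have "vec_index (M *\<^sub>v v) i = (\<Sum>j<n. A i j * vec_index v j)"
      using i dv by (simp add: M_def scalar_prod_def atLeast0LessThan)
    ultimately show "(\<Sum>j<n. A i j * vec_index v j) = k * vec_index v i" by simp
  qed
qed

text \<open>Elimination of the last unknown: if it occurs in equation \<open>l0\<close>, that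
  equation is solved for it and multiples of it are subtracted from the others, which leaves a
  smaller system.\<close>

lemma homogeneous_system_nontrivial:
  fixes A :: "nat \<Rightarrow> nat \<Rightarrow> complex" and m k :: nat
  assumes "m < k"
  obtains c where "\<exists>i<k. c i \<noteq> 0" "\<And>l. l < m \<Longrightarrow> (\<Sum>i<k. A l i * c i) = 0"
proof -
  have "\<exists>c. (\<exists>i<k. c i \<noteq> 0) \<and> (\<forall>l<m. (\<Sum>i<k. A l i * c i) = 0)"
    using assms
  proof (induction k arbitrary: m A)
    case (Suc k)
    show ?case
    proof (cases "\<exists>l<m. A l k \<noteq> 0")
      case False
      have "(\<Sum>i<Suc k. A l i * (if i = k then 1 else 0)) = A l k" for l
        by (simp add: if_distrib cong: if_cong)
      then show ?thesis using False by (intro exI[of _ "\<lambda>i. if i = k then 1 else 0"]) auto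
    next
      case True
      then obtain l0 where l0: "l0 < m" "A l0 k \<noteq> 0" by blast
      then obtain m' where m': "m = Suc m'" by (cases m) auto
      \<comment> \<open>Enumerates the equations other than \<open>l0\<close>.\<close>
      define \<pi> where "\<pi> l = (if l < l0 then l else Suc l)" for l
      define A' where "A' l i = A (\<pi> l) i - A (\<pi> l) k / A l0 k * A l0 i" for l i
      obtain c where c: "\<exists>i<k. c i \<noteq> 0" "\<And>l. l < m' \<Longrightarrow> (\<Sum>i<k. A' l i * c i) = 0"
        using Suc.IH[of m' A'] Suc.prems m' by auto
      define ck where "ck = - (\<Sum>i<k. A l0 i * c i) / A l0 k"
      define c' where "c' = c(k := ck)"
      have c'sum: "(\<Sum>i<Suc k. A l i * c' i) = (\<Sum>i<k. A l i * c i) + A l k * ck" for l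
        by (simp add: c'_def)
      have z0: "(\<Sum>i<Suc k. A l0 i * c' i) = 0" using l0 unfolding c'sum by (simp add: ck_def)
      have "(\<Sum>i<Suc k. A l i * c' i) = 0" if "l < m" for l
      proof (cases "l = l0")
        case False
        define j where "j = (if l < l0 then l else l - 1)"
        have j: "j < m'" "\<pi> j = l" using False that l0 m' by (auto simp: j_def \<pi>_def)
        have "0 = (\<Sum>i<k. A' j i * c i)" using c(2)[OF j(1)] by simp
        also have "\<dots> = (\<Sum>i<k. A l i * c i) - A l k / A l0 k * (\<Sum>i<k. A l0 i * c i)"
          by (simp add: A'_def j left_diff_distrib sum_subtractf sum_distrib_left mult.assoc)
        also have "\<dots> = (\<Sum>i<Suc k. A l i * c' i)" unfolding c'sum by (simp add: ck_def)
        finally show ?thesis by simp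
      qed (use z0 in simp)
      moreover have "\<exists>i<Suc k. c' i \<noteq> 0"
      proof -
        obtain i where "i < k" "c i \<noteq> 0" using c(1) by blast
        then show ?thesis by (intro exI[of _ i]) (auto simp: c'_def)
      qed
      ultimately show ?thesis by blast
    qed
  qed simp
  then show ?thesis using that by blast
qed

lemma linear_A2_sum:
  fixes k :: nat
  assumes \<alpha>: "\<alpha> > -1" and lin: "linear_A2 \<alpha> K" and e: "\<And>i. i < k \<Longrightarrow> in_A2 \<alpha> (e i)" and z: "z \<in> udisc"
  shows "K (\<lambda>w. \<Sum>i<k. c i * e i w) z = (\<Sum>i<k. c i * K (e i) z)"
  using e
proof (induction k)
  case 0
  have "K (\<lambda>w. 0 * (\<lambda>w. 0) w) z = 0 * K (\<lambda>w. 0) z"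
    using lin in_A2_zero[OF \<alpha>] z unfolding linear_A2_def by blast
  then show ?case by simp
next
  case (Suc k)
  have A: "in_A2 \<alpha> (\<lambda>w. \<Sum>i<k. c i * e i w)" "in_A2 \<alpha> (\<lambda>w. c k * e k w)" "in_A2 \<alpha> (e k)"
    using Suc.prems by (auto intro!: in_A2_sum[OF \<alpha>] in_A2_cmult[OF \<alpha>])
  have "K (\<lambda>w. \<Sum>i<Suc k. c i * e i w) z = K (\<lambda>w. (\<Sum>i<k. c i * e i w) + c k * e k w) z" by simp
  also have "\<dots> = K (\<lambda>w. \<Sum>i<k. c i * e i w) z + K (\<lambda>w. c k * e k w) z"
    using lin A(1,2) z unfolding linear_A2_def by blast
  also have "K (\<lambda>w. c k * e k w) z = c k * K (e k) z" using lin A(3) z unfolding linear_A2_def by blast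
  finally show ?case using Suc by simp
qed

context weighted_pair
begin

lemma T_cong: "(\<And>z. z \<in> udisc \<Longrightarrow> f z = g z) \<Longrightarrow> z \<in> udisc \<Longrightarrow> T f z = T g z"
  using map_in_disc[of z] by (simp add: T_apply mem_udisc)

lemma T_sum: "T (\<lambda>z. \<Sum>i<k. c i * e i z) = (\<lambda>z. \<Sum>i<k. c i * T (e i) z)"
  by (rule ext) (simp add: T_apply algebra_simps sum_distrib_left sum_subtractf)

text \<open>The form that pairs \<open>f\<close> and \<open>g\<close> to the inner product of
  \<open>T f\<close> and \<open>T g\<close> is diagonalized on the span. For a normalized
  eigenvector \<open>X\<close> of its Gram matrix, vectors of the span orthogonal to
  \<open>X\<close> are also orthogonal to \<open>X\<close> for the form, so the induction continues
  on the complement of \<open>X\<close>.\<close>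

lemma singular_vectors:
  assumes maps: "maps_A2 \<alpha> T" and e: "A2_orthonormal \<alpha> k e"
  obtains m f where "A2_orthonormal \<alpha> m f" "\<And>i. i < k \<Longrightarrow> in_span m f (e i)" "\<And>i. i < m \<Longrightarrow> in_span k e (f i)"
    "\<And>i j. i < m \<Longrightarrow> j < m \<Longrightarrow> i \<noteq> j \<Longrightarrow> A2_inner \<alpha> (T (f i)) (T (f j)) = 0"
proof -
  have "\<exists>m f. A2_orthonormal \<alpha> m f \<and> (\<forall>i<k. in_span m f (e i)) \<and> (\<forall>i<m. in_span k e (f i)) \<and>
    (\<forall>i<m. \<forall>j<m. i \<noteq> j \<longrightarrow> A2_inner \<alpha> (T (f i)) (T (f j)) = 0)"
    using e
  proof (induction k arbitrary: e rule: less_induct)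
    case (less k e)
    show ?case
    proof (cases "k = 0")
      case True
      then show ?thesis using less.prems by (intro exI[of _ 0] exI[of _ e]) auto
    next
      case False
      have ei: "in_A2 \<alpha> (e i)" if "i < k" for i using less.prems that by (auto simp: A2_orthonormal_def[OF alpha])
      have Tei: "in_A2 \<alpha> (T (e i))" if "i < k" for i using ei[OF that] maps by (simp add: maps_A2_def)
      obtain c \<mu> where c: "\<exists>i<k. c i \<noteq> 0"
        "\<And>i. i < k \<Longrightarrow> (\<Sum>j<k. A2_inner \<alpha> (T (e j)) (T (e i)) * c j) = \<mu> * c i"
        by (rule exists_eigenvector[of k "\<lambda>i j. A2_inner \<alpha> (T (e j)) (T (e i))"]) (use False in auto)
      define x where "x z = (\<Sum>j<k. c j * e j z)" for z
      have xs: "in_span k e x" by (rule in_spanI) (simp add: x_def)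
      have x: "in_A2 \<alpha> x" by (rule A2_orthonormal_expansion(3)[OF alpha less.prems xs])
      have Tx: "in_A2 \<alpha> (T x)" using x maps by (simp add: maps_A2_def)
      have xi: "A2_inner \<alpha> x (e i) = c i" if "i < k" for i
      proof -
        have "A2_inner \<alpha> x (e i) = (\<Sum>j<k. c j * A2_inner \<alpha> (e j) (e i))"
          unfolding x_def using ei that by (intro A2_inner_sum_left[OF alpha]) auto
        also have "\<dots> = (\<Sum>j<k. if j = i then c j else 0)"
          using less.prems that by (intro sum.cong) (auto simp: A2_orthonormal_def[OF alpha])
        finally show ?thesis using that by simp
      qed
      have xn: "A2_norm \<alpha> x \<noteq> 0"
      proof
        assume "A2_norm \<alpha> x = 0"
        then have "(\<Sum>j<k. (cmod (A2_inner \<alpha> x (e j)))\<^sup>2) = 0"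
          using A2_orthonormal_expansion(2)[OF alpha less.prems xs] by simp
        then have "\<forall>j<k. c j = 0" using xi by (subst (asm) sum_nonneg_eq_0_iff) auto
        then show False using c(1) by blast
      qed
      have Qx: "A2_inner \<alpha> (T x) (T y) = \<mu> * A2_inner \<alpha> x y" if y: "in_span k e y" for y
      proof -
        obtain d where d: "\<And>z. z \<in> udisc \<Longrightarrow> y z = (\<Sum>j<k. d j * e j z)" using y by (auto simp: in_span_def)
        have "A2_inner \<alpha> (T x) (T y) = A2_inner \<alpha> (T x) (\<lambda>z. \<Sum>i<k. d i * T (e i) z)"
          by (rule A2_inner_cong) (use T_cong[of y "\<lambda>z. \<Sum>j<k. d j * e j z"] d in \<open>auto simp: T_sum\<close>)
        also have "\<dots> = (\<Sum>i<k. cnj (d i) * A2_inner \<alpha> (T x) (T (e i)))"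
          using Tei Tx by (intro A2_inner_sum_right[OF alpha]) auto
        also have "\<dots> = (\<Sum>i<k. cnj (d i) * (\<mu> * c i))"
        proof (intro sum.cong refl arg_cong2[where f = "(*)"])
          fix i assume "i \<in> {..<k}"
          then have i: "i < k" by simp
          have "A2_inner \<alpha> (T x) (T (e i)) = (\<Sum>j<k. c j * A2_inner \<alpha> (T (e j)) (T (e i)))"
            unfolding x_def[abs_def] T_sum using Tei i by (intro A2_inner_sum_left[OF alpha]) auto
          then show "A2_inner \<alpha> (T x) (T (e i)) = \<mu> * c i" using c(2)[OF i] by (simp add: mult.commute)
        qed
        also have "\<dots> = \<mu> * (\<Sum>i<k. cnj (d i) * A2_inner \<alpha> x (e i))"
          by (simp add: xi sum_distrib_left mult_ac)
        also have "(\<Sum>i<k. cnj (d i) * A2_inner \<alpha> x (e i)) = A2_inner \<alpha> x (\<lambda>z. \<Sum>i<k. d i * e i z)"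
          using ei x by (intro A2_inner_sum_right[OF alpha, symmetric]) auto
        also have "\<dots> = A2_inner \<alpha> x y" by (rule A2_inner_cong) (auto simp: d)
        finally show ?thesis .
      qed
      have x1: "A2_orthonormal \<alpha> 1 (\<lambda>i z. of_real (1 / A2_norm \<alpha> x) * x z)"
        using A2_orthonormal_extend[OF alpha _ x xn, of 0 "\<lambda>_ z. of_real (1 / A2_norm \<alpha> x) * x z"]
        by (simp add: A2_orthonormal_def[OF alpha] fun_upd_idem)
      define X where "X z = of_real (1 / A2_norm \<alpha> x) * x z" for z
      have X: "in_A2 \<alpha> X" and XX: "A2_inner \<alpha> X X = 1"
        using x1 by (auto simp: A2_orthonormal_def[OF alpha] X_def[abs_def])
      have Xl: "A2_inner \<alpha> X f = of_real (1 / A2_norm \<alpha> x) * A2_inner \<alpha> x f" for f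
        unfolding X_def by (rule A2_inner_cmult_left[OF alpha])
      \<comment> \<open>The projections of the \<open>e j\<close> to the complement of
        \<open>X\<close> are still \<open>k\<close> vectors and are orthonormalized again. Fewer
        than \<open>k\<close> remain, because together with \<open>X\<close> they form an
        orthonormal system inside a span of \<open>k\<close> vectors; this makes the induction
        descend.\<close>
      define g where "g j z = e j z - A2_inner \<alpha> (e j) X * X z" for j z
      have g: "in_A2 \<alpha> (g j)" if "j < k" for j
        unfolding g_def using ei[OF that] X by (intro in_A2_diff[OF alpha] in_A2_cmult[OF alpha])
      have gX: "A2_inner \<alpha> (g j) X = 0" if "j < k" for j
      proof -
        have "A2_inner \<alpha> (g j) X = A2_inner \<alpha> (e j) X - A2_inner \<alpha> (\<lambda>z. A2_inner \<alpha> (e j) X * X z) X"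
          unfolding g_def[abs_def] using ei[OF that] X by (intro A2_inner_diff_left[OF alpha] in_A2_cmult[OF alpha])
        then show ?thesis by (simp add: A2_inner_cmult_left[OF alpha] XX)
      qed
      have Xs: "in_span k e X"
      proof (rule in_span_trans[of 1 "\<lambda>_. x"])
        show "in_span 1 (\<lambda>_. x) X" by (rule in_spanI[where c = "\<lambda>_. of_real (1 / A2_norm \<alpha> x)"]) (simp add: X_def)
      qed (rule xs)
      have gs: "in_span k e (g j)" if "j < k" for j
        using in_span_diff_cmult[OF in_span_member[OF that, of e] Xs, of "- A2_inner \<alpha> (e j) X"]
        by (rule in_span_cong) (simp add: g_def)
      obtain m f where f: "m \<le> k" "A2_orthonormal \<alpha> m f" "\<And>i. i < k \<Longrightarrow> in_span m f (g i)" "\<And>i. i < m \<Longrightarrow> in_span k g (f i)"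
      proof (rule A2_gram_schmidt[OF alpha, of k g])
        show "in_A2 \<alpha> (g i)" if "i < k" for i by (rule g[OF that])
      qed (rule that)
      have fX: "A2_inner \<alpha> h X = 0" if "in_span m f h" for h
        by (rule A2_inner_in_span[OF alpha in_span_trans[OF that f(4)] g X gX])
      have fA: "in_A2 \<alpha> (f i)" if "i < m" for i using f(2) that by (auto simp: A2_orthonormal_def[OF alpha])
      have Xn: "A2_norm \<alpha> X = 1"
      proof -
        have "complex_of_real ((A2_norm \<alpha> X)\<^sup>2) = of_real 1" using A2_inner_self[OF alpha X] XX by simp
        then have "(A2_norm \<alpha> X)\<^sup>2 = 1" by (simp only: of_real_eq_iff)
        then show ?thesis using A2_norm_nonneg[of \<alpha> X] by (simp add: power2_eq_1_iff)
      qed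
      have extend: "A2_orthonormal \<alpha> (Suc n) (h(n := X))" if h: "A2_orthonormal \<alpha> n h" "\<And>i. i < n \<Longrightarrow> in_span m f (h i)" for n h
      proof -
        have "A2_inner \<alpha> X (h i) = 0" if "i < n" for i
          using fX[OF h(2)[OF that]] A2_inner_cnj[OF alpha, of "h i" X] by simp
        then have "A2_orthonormal \<alpha> (Suc n) (h(n := (\<lambda>z. of_real (1 / A2_norm \<alpha> X) * X z)))"
          by (intro A2_orthonormal_extend[OF alpha h(1) X]) (auto simp: Xn)
        then show ?thesis by (simp add: Xn)
      qed
      have "Suc m \<le> k"
      proof (rule A2_orthonormal_length_le[OF alpha less.prems extend[OF f(2) in_span_member]])
        fix i assume "i < Suc m"
        then show "in_span k e ((f(m := X)) i)"
          using Xs in_span_trans[OF f(4)[of i] gs] by (cases "i = m") auto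
      qed
      then obtain n h where h: "A2_orthonormal \<alpha> n h" "\<forall>i<m. in_span n h (f i)" "\<forall>i<n. in_span m f (h i)"
        "\<forall>i<n. \<forall>j<n. i \<noteq> j \<longrightarrow> A2_inner \<alpha> (T (h i)) (T (h j)) = 0"
        using less.IH[OF _ f(2)] by auto
      define H where "H = h(n := X)"
      have Hn: "H n = X" and Hi: "i < n \<Longrightarrow> H i = h i" for i by (auto simp: H_def)
      have on: "A2_orthonormal \<alpha> (Suc n) H" unfolding H_def using h(3) by (intro extend h) auto
      have hH: "in_span (Suc n) H y" if "in_span n h y" for y
        using that by (rule in_span_trans) (metis Hi in_span_member less_SucI)
      have hk: "in_span k e (h i)" if "i < n" for i
        by (rule in_span_trans[OF in_span_trans[OF h(3)[rule_format, OF that] f(4)] gs])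
      have "in_span (Suc n) H (e i)" if "i < k" for i
      proof -
        have "in_span n h (g i)" by (rule in_span_trans[OF f(3)[OF that]]) (use h(2) in auto)
        then have "in_span (Suc n) H (\<lambda>z. g i z + A2_inner \<alpha> (e i) X * H n z)"
          by (intro in_span_diff_cmult hH in_span_member) simp_all
        then show ?thesis by (rule in_span_cong) (simp add: g_def Hn)
      qed
      moreover have "in_span k e (H i)" if "i < Suc n" for i
        using Xs hk that by (cases "i = n") (auto simp: Hn Hi)
      moreover have "A2_inner \<alpha> (T (H i)) (T (H j)) = 0" if ij: "i < Suc n" "j < Suc n" "i \<noteq> j" for i j
      proof -
        have TX: "T X = (\<lambda>z. of_real (1 / A2_norm \<alpha> x) * T x z)" by (rule ext) (simp add: T_apply X_def algebra_simps diff_divide_distrib)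
        have 0: "A2_inner \<alpha> (T X) (T (h j)) = 0" if "j < n" for j
        proof -
          have "A2_inner \<alpha> (T X) (T (h j)) = of_real (1 / A2_norm \<alpha> x) * (\<mu> * A2_inner \<alpha> x (h j))"
            unfolding TX A2_inner_cmult_left[OF alpha] Qx[OF hk[OF that]] ..
          also have "\<dots> = \<mu> * A2_inner \<alpha> X (h j)" by (simp add: Xl)
          also have "A2_inner \<alpha> X (h j) = 0"
            using fX[OF h(3)[rule_format, OF that]] A2_inner_cnj[OF alpha, of "h j" X] by simp
          finally show ?thesis by simp
        qed
        consider "i < n" "j < n" | "i = n" "j < n" | "i < n" "j = n" using ij by linarith
        then show ?thesis
        proof cases
          case 1
          then show ?thesis using h(4) ij by (simp add: Hi)
        next
          case 2
          then show ?thesis using 0 by (simp add: Hi Hn)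
        next
          case 3
          then show ?thesis using 0[of i] A2_inner_cnj[OF alpha, of "T X" "T (h i)"] by (simp add: Hi Hn)
        qed
      qed
      ultimately show ?thesis using on by (intro exI[of _ "Suc n"] exI[of _ H]) auto
    qed
  qed
  then obtain m f where "A2_orthonormal \<alpha> m f" "\<forall>i<k. in_span m f (e i)" "\<forall>i<m. in_span k e (f i)"
    "\<forall>i<m. \<forall>j<m. i \<noteq> j \<longrightarrow> A2_inner \<alpha> (T (f i)) (T (f j)) = 0" by (elim exE conjE)
  then show ?thesis by (intro that[of m f]) simp_all
qed

end

section \<open>Jensen's inequality and majorants for families of test functions\<close>

lemma weighted_power_mean:
  fixes a t :: "nat \<Rightarrow> real"
  assumes q: "q \<ge> 1" and a: "\<And>i. i < m \<Longrightarrow> a i \<ge> 0" "(\<Sum>i<m. a i) \<le> A" and t: "\<And>i. i < m \<Longrightarrow> t i \<ge> 0"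
  shows "(\<Sum>i<m. a i * t i) powr q \<le> A powr (q - 1) * (\<Sum>i<m. a i * t i powr q)"
proof -
  \<comment> \<open>Only indices with a positive term are kept, so that the \<open>t i\<close> are
    positive and the total weight \<open>S\<close> can be divided out. Jensen's inequality is
    applied with weights \<open>a i / S\<close>, and \<open>S\<close> is replaced by its bound
    \<open>A\<close> at the end.\<close>
  define J where "J = {i. i < m \<and> a i * t i > 0}"
  have J: "finite J" "J \<subseteq> {..<m}" by (auto simp: J_def)
  have Jt: "t i > 0" "a i > 0" if "i \<in> J" for i
    using that a(1)[of i] t[of i] by (auto simp: J_def zero_less_mult_iff)
  have out: "a i * t i = 0" if "i < m" "i \<notin> J" for i
    using that a(1)[of i] t[of i] by (auto simp: J_def not_less) (metis antisym mult_eq_0_iff mult_nonneg_nonneg)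
  have s1: "(\<Sum>i<m. a i * t i) = (\<Sum>i\<in>J. a i * t i)"
    using J out by (intro sum.mono_neutral_right) auto
  have s2: "(\<Sum>i\<in>J. a i * t i powr q) \<le> (\<Sum>i<m. a i * t i powr q)"
    using J a by (intro sum_mono2) auto
  show ?thesis
  proof (cases "J = {}")
    case True
    then have "(\<Sum>i<m. a i * t i) = 0" using s1 by simp
    moreover have "0 \<le> A powr (q - 1) * (\<Sum>i<m. a i * t i powr q)" using a by (intro mult_nonneg_nonneg sum_nonneg) auto
    ultimately show ?thesis by simp
  next
    case False
    define S where "S = (\<Sum>i\<in>J. a i)"
    have S: "S > 0" unfolding S_def using J False Jt by (intro sum_pos) auto
    have "S \<le> (\<Sum>i<m. a i)" unfolding S_def using J a by (intro sum_mono2) auto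
    then have SA: "S \<le> A" using a(2) by simp
    have cv: "((\<Sum>i\<in>J. (a i / S) *\<^sub>R t i)) powr q \<le> (\<Sum>i\<in>J. (a i / S) * (t i powr q))"
    proof (rule convex_on_sum[OF J(1) False powr_convex[OF q]])
      show "(\<Sum>i\<in>J. a i / S) = 1" using S by (simp add: sum_divide_distrib[symmetric] S_def)
    qed (use S Jt in \<open>auto simp: less_imp_le\<close>)
    define R where "R = (\<Sum>i\<in>J. (a i / S) *\<^sub>R t i)"
    have "(\<Sum>i\<in>J. a i * t i) = S * R" using S by (simp add: R_def sum_distrib_left)
    moreover have "R \<ge> 0" unfolding R_def using S Jt by (intro sum_nonneg) (simp add: less_imp_le)
    ultimately have "(\<Sum>i\<in>J. a i * t i) powr q = S powr q * R powr q"
      using S by (simp add: powr_mult)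
    also have "\<dots> = S powr q * (\<Sum>i\<in>J. (a i / S) *\<^sub>R t i) powr q" by (simp only: R_def)
    also have "\<dots> \<le> S powr q * (\<Sum>i\<in>J. (a i / S) * (t i powr q))" using cv by (intro mult_left_mono) auto
    also have "\<dots> = S powr (q - 1) * (\<Sum>i\<in>J. a i * t i powr q)"
    proof -
      have "S powr q = S powr (q - 1) * S" using S by (simp add: powr_diff)
      then show ?thesis using S by (simp add: sum_distrib_left mult.assoc)
    qed
    also have "\<dots> \<le> A powr (q - 1) * (\<Sum>i\<in>J. a i * t i powr q)"
      using SA S q Jt by (intro mult_right_mono powr_mono2 sum_nonneg) (auto simp: less_imp_le)
    also have "\<dots> \<le> A powr (q - 1) * (\<Sum>i<m. a i * t i powr q)" using s2 by (intro mult_left_mono) auto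
    finally show ?thesis by (simp add: s1)
  qed
qed

lemma A2_norm_monomial_sum:
  assumes \<alpha>: "\<alpha> > -1"
  shows "(A2_norm \<alpha> (\<lambda>w. \<Sum>n<N. d n * w ^ n))\<^sup>2 = (\<Sum>n<N. (cmod (d n))\<^sup>2 * monomial_norm2 \<alpha> n)"
proof -
  let ?e = "\<lambda>w. \<Sum>n<N. d n * w ^ n"
  have m: "in_A2 \<alpha> (\<lambda>w. w ^ n)" for n by (rule in_A2_monomial[OF \<alpha>])
  have e: "in_A2 \<alpha> ?e" by (intro in_A2_sum[OF \<alpha>] in_A2_cmult[OF \<alpha>] m)
  have "A2_inner \<alpha> (\<lambda>w. w ^ n) ?e = cnj (d n) * of_real (monomial_norm2 \<alpha> n)" if "n < N" for n
  proof -
    have "A2_inner \<alpha> (\<lambda>w. w ^ n) ?e = (\<Sum>k<N. cnj (d k) * A2_inner \<alpha> (\<lambda>w. w ^ n) (\<lambda>w. w ^ k))"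
      by (intro A2_inner_sum_right[OF \<alpha>] m)
    also have "\<dots> = (\<Sum>k<N. if k = n then cnj (d n) * of_real (monomial_norm2 \<alpha> n) else 0)"
      by (intro sum.cong) (auto simp: A2_inner_monomials[OF \<alpha>])
    finally show ?thesis using that by simp
  qed
  then have "A2_inner \<alpha> ?e ?e = (\<Sum>n<N. d n * (cnj (d n) * of_real (monomial_norm2 \<alpha> n)))"
    using A2_inner_sum_left[OF \<alpha> m e, where c = d and I = "{..<N}"] by simp
  also have "\<dots> = of_real (\<Sum>n<N. (cmod (d n))\<^sup>2 * monomial_norm2 \<alpha> n)"
    unfolding of_real_sum of_real_mult complex_norm_square by (simp add: mult.assoc)
  finally show ?thesis unfolding A2_inner_self[OF \<alpha> e] of_real_eq_iff .
qed

lemma A2_inner_monomial_powser: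
  assumes \<alpha>: "\<alpha> > -1" and c: "summable (\<lambda>n. norm (c n))" and G: "\<And>w. w \<in> udisc \<Longrightarrow> (\<lambda>n. c n * w ^ n) sums G w"
  shows "A2_inner \<alpha> (\<lambda>w. w ^ m) G = cnj (c m) * of_real (monomial_norm2 \<alpha> m)"
proof -
  have "(\<lambda>n. cnj (c n) * A2_inner \<alpha> (\<lambda>w. w ^ m) (\<lambda>w. w ^ n)) sums A2_inner \<alpha> (\<lambda>w. w ^ m) G"
    by (rule A2_inner_powser[OF \<alpha> in_A2_monomial[OF \<alpha>] c G])
  moreover have "(\<lambda>n. cnj (c n) * A2_inner \<alpha> (\<lambda>w. w ^ m) (\<lambda>w. w ^ n))
      = (\<lambda>n. if n = m then cnj (c m) * of_real (monomial_norm2 \<alpha> m) else 0)"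
    by (auto simp: A2_inner_monomials[OF \<alpha>])
  ultimately show ?thesis
    using sums_single[of m "\<lambda>_. cnj (c m) * of_real (monomial_norm2 \<alpha> m)"] sums_unique2 by auto
qed

context weighted_pair
begin

lemma norm_T_combination:
  fixes m :: nat
  assumes maps: "maps_A2 \<alpha> T" and f: "\<And>i. i < m \<Longrightarrow> in_A2 \<alpha> (f i)"
    and Q: "\<And>i j. i < m \<Longrightarrow> j < m \<Longrightarrow> i \<noteq> j \<Longrightarrow> A2_inner \<alpha> (T (f i)) (T (f j)) = 0"
  shows "(A2_norm \<alpha> (T (\<lambda>z. \<Sum>i<m. c i * f i z)))\<^sup>2 = (\<Sum>i<m. (cmod (c i))\<^sup>2 * (A2_norm \<alpha> (T (f i)))\<^sup>2)"
proof -
  have Tf: "in_A2 \<alpha> (T (f i))" if "i < m" for i using maps f[OF that] by (simp add: maps_A2_def)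
  let ?S = "\<lambda>z. \<Sum>i<m. c i * T (f i) z"
  have S: "in_A2 \<alpha> ?S" using Tf by (intro in_A2_sum[OF alpha] in_A2_cmult[OF alpha]) auto
  have "A2_inner \<alpha> (T (f i)) ?S = cnj (c i) * of_real ((A2_norm \<alpha> (T (f i)))\<^sup>2)" if i: "i < m" for i
  proof -
    have "A2_inner \<alpha> (T (f i)) ?S = (\<Sum>j<m. cnj (c j) * A2_inner \<alpha> (T (f i)) (T (f j)))"
      using Tf i by (intro A2_inner_sum_right[OF alpha]) auto
    also have "\<dots> = (\<Sum>j<m. if j = i then cnj (c i) * of_real ((A2_norm \<alpha> (T (f i)))\<^sup>2) else 0)"
      using Q i A2_inner_self[OF alpha Tf[OF i]] by (intro sum.cong) auto
    finally show ?thesis using i by simp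
  qed
  then have "A2_inner \<alpha> ?S ?S = (\<Sum>i<m. c i * (cnj (c i) * of_real ((A2_norm \<alpha> (T (f i)))\<^sup>2)))"
    using A2_inner_sum_left[OF alpha _ S, of "{..<m}" "\<lambda>i. T (f i)" c] Tf by simp
  also have "\<dots> = of_real (\<Sum>i<m. (cmod (c i))\<^sup>2 * (A2_norm \<alpha> (T (f i)))\<^sup>2)"
    unfolding of_real_sum of_real_mult[of "(cmod _)\<^sup>2"] complex_norm_square by (simp add: mult.assoc)
  finally show ?thesis unfolding A2_inner_self[OF alpha S] of_real_eq_iff T_sum .
qed

text \<open>Decreasing order matches the \<open>i\<close>-th vector with the \<open>i\<close>-th
  approximation number, both counted from 0.\<close>

lemma sorted_singular_vectors:
  assumes maps: "maps_A2 \<alpha> T" and e: "A2_orthonormal \<alpha> k e"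
  obtains m f where "A2_orthonormal \<alpha> m f" "\<And>i. i < k \<Longrightarrow> in_span m f (e i)" "\<And>i. i < m \<Longrightarrow> in_span k e (f i)"
    "\<And>i j. i < m \<Longrightarrow> j < m \<Longrightarrow> i \<noteq> j \<Longrightarrow> A2_inner \<alpha> (T (f i)) (T (f j)) = 0"
    "\<And>i j. i \<le> j \<Longrightarrow> j < m \<Longrightarrow> A2_norm \<alpha> (T (f j)) \<le> A2_norm \<alpha> (T (f i))"
proof -
  obtain m f where f: "A2_orthonormal \<alpha> m f" "\<And>i. i < k \<Longrightarrow> in_span m f (e i)" "\<And>i. i < m \<Longrightarrow> in_span k e (f i)"
    "\<And>i j. i < m \<Longrightarrow> j < m \<Longrightarrow> i \<noteq> j \<Longrightarrow> A2_inner \<alpha> (T (f i)) (T (f j)) = 0"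
    by (rule singular_vectors[OF maps e]) blast
  define L where "L = sort_key (\<lambda>i. - A2_norm \<alpha> (T (f i))) [0..<m]"
  have L: "length L = m" "set L = {0..<m}" "distinct L" by (simp_all add: L_def)
  define \<pi> where "\<pi> i = L ! i" for i
  have \<pi>: "\<pi> i < m" if "i < m" for i using nth_mem[of i L] L that by (auto simp: \<pi>_def)
  have inj: "\<pi> i \<noteq> \<pi> j" if "i < m" "j < m" "i \<noteq> j" for i j
    using L that by (simp add: \<pi>_def nth_eq_iff_index_eq)
  have surj: "\<exists>j<m. \<pi> j = i" if "i < m" for i
    using that L unfolding \<pi>_def by (metis atLeastLessThan_iff in_set_conv_nth le0)
  show ?thesis
  proof (rule that[of m "f \<circ> \<pi>"])
    show "A2_orthonormal \<alpha> m (f \<circ> \<pi>)"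
      using f(1) \<pi> inj by (auto simp: A2_orthonormal_def[OF alpha])
    have "in_span m (f \<circ> \<pi>) (f i)" if "i < m" for i
      using surj[OF that] in_span_member[of _ m "f \<circ> \<pi>"] by auto
    then show "in_span m (f \<circ> \<pi>) (e i)" if "i < k" for i using in_span_trans[OF f(2)[OF that]] by blast
    show "in_span k e ((f \<circ> \<pi>) i)" if "i < m" for i using f(3) \<pi> that by simp
    show "A2_inner \<alpha> (T ((f \<circ> \<pi>) i)) (T ((f \<circ> \<pi>) j)) = 0" if "i < m" "j < m" "i \<noteq> j" for i j
      using f(4) \<pi> inj that by simp
    fix i j :: nat assume ij: "i \<le> j" "j < m"
    have "sorted (map (\<lambda>i. - A2_norm \<alpha> (T (f i))) L)" by (simp add: L_def)
    then have "map (\<lambda>i. - A2_norm \<alpha> (T (f i))) L ! i \<le> map (\<lambda>i. - A2_norm \<alpha> (T (f i))) L ! j"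
      using ij L by (intro sorted_nth_mono) auto
    then show "A2_norm \<alpha> (T ((f \<circ> \<pi>) j)) \<le> A2_norm \<alpha> (T ((f \<circ> \<pi>) i))" using ij L by (simp add: \<pi>_def)
  qed
qed

text \<open>An operator of rank at most \<open>n\<close> annihilates a nonzero combination of the
  \<open>n + 1\<close> vectors \<open>f 0\<close> to \<open>f n\<close>, and on their span
  \<open>T\<close> stretches by at least \<open>A2_norm \<alpha> (T (f n))\<close>, the smallest of
  the values. Hence no such operator is closer to \<open>T\<close> than that.\<close>

lemma singular_value_le_sing_num:
  assumes maps: "maps_A2 \<alpha> T" and f: "A2_orthonormal \<alpha> m f"
    and Q: "\<And>i j. i < m \<Longrightarrow> j < m \<Longrightarrow> i \<noteq> j \<Longrightarrow> A2_inner \<alpha> (T (f i)) (T (f j)) = 0"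
    and dec: "\<And>i j. i \<le> j \<Longrightarrow> j < m \<Longrightarrow> A2_norm \<alpha> (T (f j)) \<le> A2_norm \<alpha> (T (f i))"
    and n: "n < m"
  shows "ennreal (A2_norm \<alpha> (T (f n))) \<le> sing_num \<alpha> T n"
  unfolding sing_num_def
proof (rule INF_greatest)
  fix K assume "K \<in> {K. rank_le_A2 \<alpha> n K}"
  then have K: "rank_le_A2 \<alpha> n K" by simp
  have fi: "in_A2 \<alpha> (f i)" if "i < m" for i using f that by (auto simp: A2_orthonormal_def[OF alpha])
  obtain gs where gs: "length gs \<le> n" "\<And>h. in_A2 \<alpha> h \<Longrightarrow> \<exists>c. \<forall>z\<in>udisc. K h z = (\<Sum>i<length gs. c i * (gs ! i) z)"
    using K by (auto simp: rank_le_A2_def)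
  have "\<forall>i. \<exists>c. i < m \<longrightarrow> (\<forall>z\<in>udisc. K (f i) z = (\<Sum>l<length gs. c l * (gs ! l) z))" using gs(2) fi by blast
  then obtain A where A: "\<And>i z. i < m \<Longrightarrow> z \<in> udisc \<Longrightarrow> K (f i) z = (\<Sum>l<length gs. A i l * (gs ! l) z)" by metis
  \<comment> \<open>At most \<open>n\<close> equations, one for each vector spanning the range of
    \<open>K\<close>, in \<open>n + 1\<close> unknowns.\<close>
  obtain c where c: "\<exists>i<Suc n. c i \<noteq> 0" "\<And>l. l < length gs \<Longrightarrow> (\<Sum>i<Suc n. A i l * c i) = 0"
    by (rule homogeneous_system_nontrivial[of "length gs" "Suc n" "\<lambda>l i. A i l"]) (use gs(1) in auto)
  define x where "x z = (\<Sum>i<Suc n. c i * f i z)" for z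
  have fn: "A2_orthonormal \<alpha> (Suc n) f" using f n by (auto simp: A2_orthonormal_def[OF alpha])
  have fiS: "in_A2 \<alpha> (f i)" if "i < Suc n" for i using fi that n by simp
  have x: "in_A2 \<alpha> x" unfolding x_def using fiS by (intro in_A2_sum[OF alpha] in_A2_cmult[OF alpha]) auto
  have Kx: "K x z = 0" if z: "z \<in> udisc" for z
  proof -
    have "K x z = (\<Sum>i<Suc n. c i * K (f i) z)"
      unfolding x_def[abs_def] using K fiS by (intro linear_A2_sum[OF alpha _ _ z]) (auto simp: rank_le_A2_def)
    also have "\<dots> = (\<Sum>i<Suc n. c i * (\<Sum>l<length gs. A i l * (gs ! l) z))"
      using A[OF _ z] n by (intro sum.cong refl) auto
    also have "\<dots> = (\<Sum>l<length gs. (\<Sum>i<Suc n. A i l * c i) * (gs ! l) z)"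
      unfolding sum_distrib_left sum_distrib_right by (subst sum.swap) (simp add: mult_ac)
    also have "\<dots> = 0" using c(2) by simp
    finally show ?thesis .
  qed
  define \<tau> where "\<tau> = A2_norm \<alpha> (T (f n))"
  define X where "X = A2_norm \<alpha> x"
  have cx: "A2_inner \<alpha> x (f i) = c i" if "i < Suc n" for i
  proof -
    have "A2_inner \<alpha> x (f i) = (\<Sum>j<Suc n. c j * A2_inner \<alpha> (f j) (f i))"
      unfolding x_def using fiS that by (intro A2_inner_sum_left[OF alpha]) auto
    also have "\<dots> = (\<Sum>j<Suc n. if j = i then c j else 0)"
      using fn that by (intro sum.cong) (auto simp: A2_orthonormal_def[OF alpha])
    finally show ?thesis using that by simp
  qed
  have X2: "X\<^sup>2 = (\<Sum>i<Suc n. (cmod (c i))\<^sup>2)"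
    using A2_orthonormal_expansion(2)[OF alpha fn, of x] in_span_sum[of "Suc n" f c] cx by (simp add: X_def x_def[abs_def])
  obtain i0 where "i0 < Suc n" "c i0 \<noteq> 0" using c(1) by blast
  then have "X\<^sup>2 > 0" unfolding X2 by (intro sum_pos2[where i = i0]) auto
  then have "X \<noteq> 0" by auto
  moreover have "X \<ge> 0" unfolding X_def by (rule A2_norm_nonneg)
  ultimately have X0: "X > 0" by linarith
  have "\<tau>\<^sup>2 * X\<^sup>2 = (\<Sum>i<Suc n. (cmod (c i))\<^sup>2 * \<tau>\<^sup>2)"
    by (simp only: X2 mult.commute[of "\<tau>\<^sup>2"] sum_distrib_right)
  also have "\<dots> \<le> (\<Sum>i<Suc n. (cmod (c i))\<^sup>2 * (A2_norm \<alpha> (T (f i)))\<^sup>2)"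
    using dec n by (intro sum_mono mult_left_mono power_mono) (auto simp: \<tau>_def)
  also have "\<dots> = (A2_norm \<alpha> (T x))\<^sup>2"
    unfolding x_def[abs_def] using fiS Q n by (intro norm_T_combination[OF maps, symmetric]) auto
  finally have "(\<tau> * X)\<^sup>2 \<le> (A2_norm \<alpha> (T x))\<^sup>2" by (simp add: power_mult_distrib)
  then have tx: "\<tau> * X \<le> A2_norm \<alpha> (T x)" by (rule power2_le_imp_le) simp
  define y where "y z = of_real (1 / X) * x z" for z
  have y: "in_A2 \<alpha> y" unfolding y_def by (rule in_A2_cmult[OF alpha x])
  have y1: "A2_norm \<alpha> y \<le> 1"
    unfolding y_def A2_norm_cmult[OF alpha x] using X0 by (simp add: X_def norm_divide)
  have Ty: "T y = (\<lambda>z. of_real (1 / X) * T x z)" by (rule ext) (simp add: T_apply y_def algebra_simps diff_divide_distrib)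
  have "K y z = 0" if z: "z \<in> udisc" for z
  proof -
    have "K y z = of_real (1 / X) * K x z"
      using K x z unfolding y_def[abs_def] rank_le_A2_def linear_A2_def by blast
    then show ?thesis using Kx[OF z] by simp
  qed
  then have "A2_norm \<alpha> (\<lambda>z. T y z - K y z) = A2_norm \<alpha> (T y)" by (intro A2_norm_cong) simp
  also have "\<dots> = 1 / X * A2_norm \<alpha> (T x)"
    using x maps X0 unfolding Ty by (subst A2_norm_cmult[OF alpha]) (auto simp: maps_A2_def norm_divide)
  finally have "A2_norm \<alpha> (\<lambda>z. T y z - K y z) = A2_norm \<alpha> (T x) / X" by simp
  moreover have "\<tau> \<le> A2_norm \<alpha> (T x) / X" using tx X0 by (simp add: pos_le_divide_eq)
  ultimately have "\<tau> \<le> A2_norm \<alpha> (\<lambda>z. T y z - K y z)" by simp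
  then have "ennreal \<tau> \<le> ennreal (A2_norm \<alpha> (\<lambda>z. T y z - K y z))" by (rule ennreal_leI)
  also have "\<dots> \<le> op_norm \<alpha> (\<lambda>f z. T f z - K f z)"
    unfolding op_norm_def using y y1 by (intro SUP_upper) simp
  finally show "ennreal (A2_norm \<alpha> (T (f n))) \<le> op_norm \<alpha> (\<lambda>f z. T f z - K f z)" by (simp add: \<tau>_def)
qed

text \<open>The zero operator competes in the infimum. Finiteness is what allows comparisons after
  \<open>enn2real\<close>, which sends infinity to 0.\<close>

lemma sing_num_finite:
  assumes "bounded_A2 \<alpha> T"
  shows "sing_num \<alpha> T n < \<infinity>"
proof -
  obtain C where C: "\<And>f. in_A2 \<alpha> f \<Longrightarrow> A2_norm \<alpha> (T f) \<le> C * A2_norm \<alpha> f" using assms by (auto simp: bounded_A2_def)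
  have z: "A2_norm \<alpha> (\<lambda>z. 0) = 0" by (simp add: A2_norm_def bergman_int_def)
  have "rank_le_A2 \<alpha> n (\<lambda>f z. 0)"
    unfolding rank_le_A2_def maps_A2_def linear_A2_def bounded_A2_def
    using in_A2_zero[OF alpha] z by (auto intro!: exI[of _ 0] exI[of _ "[]"])
  then have "sing_num \<alpha> T n \<le> op_norm \<alpha> (\<lambda>f z. T f z - 0)" unfolding sing_num_def by (intro INF_lower) simp
  also have "\<dots> \<le> ennreal \<bar>C\<bar>"
    unfolding op_norm_def
  proof (intro SUP_least ennreal_leI)
    fix f assume f: "f \<in> {f. in_A2 \<alpha> f \<and> A2_norm \<alpha> f \<le> 1}"
    have "A2_norm \<alpha> (T f) \<le> C * A2_norm \<alpha> f" using C f by simp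
    also have "\<dots> \<le> \<bar>C\<bar> * 1" using f by (intro mult_mono) auto
    finally show "A2_norm \<alpha> (\<lambda>z. T f z - 0) \<le> \<bar>C\<bar>" by simp
  qed
  finally show ?thesis by (simp add: le_less_trans)
qed

text \<open>Expanding a test function in the singular vectors of the compression of \<open>T\<close> to polynomials of
  degree less than \<open>N\<close> and applying Jensen's inequality bounds the \<open>p\<close>-th power of the norm
  by a square-integrable expression weighted with the \<open>p\<close>-th powers of the singular values.\<close>

lemma truncated_test_family_majorant:
  fixes c :: "complex \<Rightarrow> nat \<Rightarrow> complex"
  assumes p: "p \<ge> 2" and maps: "maps_A2 \<alpha> T" and bdd: "bounded_A2 \<alpha> T"
    and sm: "summable (\<lambda>n. enn2real (sing_num \<alpha> T n) powr p)"
    and c: "\<And>z. z \<in> udisc \<Longrightarrow> summable (\<lambda>n. norm (c z n))"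
    and ser: "\<And>z w. z \<in> udisc \<Longrightarrow> w \<in> udisc \<Longrightarrow> (\<lambda>n. c z n * w ^ n) sums h z w"
    and h: "\<And>z. z \<in> udisc \<Longrightarrow> in_A2 \<alpha> (h z)" "\<And>z. z \<in> udisc \<Longrightarrow> A2_norm \<alpha> (h z) \<le> H"
    and meas: "\<And>n. (\<lambda>z. indicat_real udisc z *\<^sub>R c z n) \<in> borel_measurable borel"
    and D: "D \<ge> 0"
    and bes: "\<And>N d. (\<integral>\<^sup>+z. indicator udisc z * ennreal ((cmod (\<Sum>n<N. d n * (cnj (c z n) * of_real (monomial_norm2 \<alpha> n))))\<^sup>2) * ennreal (dlambda_dens z) \<partial>lborel)
      \<le> ennreal (D * (\<Sum>n<N. (cmod (d n))\<^sup>2 * monomial_norm2 \<alpha> n))"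
  shows "\<exists>G \<in> borel_measurable borel. (\<forall>z\<in>udisc. ennreal (A2_norm \<alpha> (T (\<lambda>w. \<Sum>n<N. c z n * w ^ n)) powr p) \<le> G z) \<and>
    (\<integral>\<^sup>+z. indicator udisc z * G z * ennreal (dlambda_dens z) \<partial>lborel)
      \<le> ennreal ((H\<^sup>2) powr (p / 2 - 1) * D * (\<Sum>n. enn2real (sing_num \<alpha> T n) powr p))"
proof -
  define q where "q = p / 2"
  have q: "q \<ge> 1" using p by (simp add: q_def)
  have m: "in_A2 \<alpha> (\<lambda>w. w ^ n)" for n by (rule in_A2_monomial[OF alpha])
  define \<epsilon> where "\<epsilon> n w = of_real (1 / sqrt (monomial_norm2 \<alpha> n)) * w ^ n" for n and w :: complex
  have gp: "monomial_norm2 \<alpha> n > 0" for n by (rule monomial_norm2_pos[OF alpha])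
  have \<epsilon>: "A2_orthonormal \<alpha> N \<epsilon>"
    unfolding A2_orthonormal_def[OF alpha]
  proof (intro conjI allI impI)
    show "in_A2 \<alpha> (\<epsilon> i)" for i unfolding \<epsilon>_def by (intro in_A2_cmult[OF alpha] m)
    fix i j
    have r: "A2_inner \<alpha> f (\<epsilon> j) = of_real (1 / sqrt (monomial_norm2 \<alpha> j)) * A2_inner \<alpha> f (\<lambda>w. w ^ j)" for f
    proof -
      have "A2_inner \<alpha> f (\<epsilon> j) = cnj (A2_inner \<alpha> (\<epsilon> j) f)" by (simp add: A2_inner_cnj[OF alpha])
      also have "A2_inner \<alpha> (\<epsilon> j) f = of_real (1 / sqrt (monomial_norm2 \<alpha> j)) * A2_inner \<alpha> (\<lambda>w. w ^ j) f"
        unfolding \<epsilon>_def by (rule A2_inner_cmult_left[OF alpha])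
      finally show ?thesis by (simp add: A2_inner_cnj[OF alpha])
    qed
    have l: "A2_inner \<alpha> (\<epsilon> i) f = of_real (1 / sqrt (monomial_norm2 \<alpha> i)) * A2_inner \<alpha> (\<lambda>w. w ^ i) f" for f
      unfolding \<epsilon>_def by (rule A2_inner_cmult_left[OF alpha])
    have "A2_inner \<alpha> (\<epsilon> i) (\<epsilon> j) = of_real (1 / sqrt (monomial_norm2 \<alpha> j)) * (of_real (1 / sqrt (monomial_norm2 \<alpha> i)) * A2_inner \<alpha> (\<lambda>w. w ^ i) (\<lambda>w. w ^ j))"
      by (simp only: r[of "\<epsilon> i"] l[of "\<lambda>w. w ^ j"])
    also have "\<dots> = (if i = j then 1 else 0)"
    proof (cases "i = j")
      case True
      have "1 / sqrt (monomial_norm2 \<alpha> i) * (1 / sqrt (monomial_norm2 \<alpha> i) * monomial_norm2 \<alpha> i) = 1"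
        using gp[of i] by (simp add: real_div_sqrt)
      then have "complex_of_real (1 / sqrt (monomial_norm2 \<alpha> i)) * (of_real (1 / sqrt (monomial_norm2 \<alpha> i)) * of_real (monomial_norm2 \<alpha> i)) = 1"
        by (simp only: of_real_mult[symmetric]) simp
      then show ?thesis using True by (simp only: A2_inner_monomials[OF alpha] if_True refl)
    qed (simp add: A2_inner_monomials[OF alpha])
    finally show "A2_inner \<alpha> (\<epsilon> i) (\<epsilon> j) = (if i = j then 1 else 0)" .
  qed
  obtain k f where f: "A2_orthonormal \<alpha> k f" "\<And>i. i < N \<Longrightarrow> in_span k f (\<epsilon> i)" "\<And>i. i < k \<Longrightarrow> in_span N \<epsilon> (f i)"
    "\<And>i j. i < k \<Longrightarrow> j < k \<Longrightarrow> i \<noteq> j \<Longrightarrow> A2_inner \<alpha> (T (f i)) (T (f j)) = 0"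
    "\<And>i j. i \<le> j \<Longrightarrow> j < k \<Longrightarrow> A2_norm \<alpha> (T (f j)) \<le> A2_norm \<alpha> (T (f i))"
    by (rule sorted_singular_vectors[OF maps \<epsilon>]) blast
  have fA: "in_A2 \<alpha> (f i)" if "i < k" for i using f(1) that by (auto simp: A2_orthonormal_def[OF alpha])
  define \<tau> where "\<tau> i = A2_norm \<alpha> (T (f i))" for i
  have \<tau>: "\<tau> i \<le> enn2real (sing_num \<alpha> T i)" if "i < k" for i
  proof -
    have "enn2real (ennreal (\<tau> i)) \<le> enn2real (sing_num \<alpha> T i)"
      using singular_value_le_sing_num[OF maps f(1,4,5) that] sing_num_finite[OF bdd]
      by (intro enn2real_mono) (auto simp: \<tau>_def)
    then show ?thesis by (simp add: \<tau>_def)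
  qed
  have "\<forall>i. \<exists>d. i < k \<longrightarrow> (\<forall>w\<in>udisc. f i w = (\<Sum>n<N. d n * w ^ n))"
  proof (intro allI)
    fix i
    show "\<exists>d. i < k \<longrightarrow> (\<forall>w\<in>udisc. f i w = (\<Sum>n<N. d n * w ^ n))"
    proof (cases "i < k")
      case True
      from f(3)[OF True] obtain a where "\<And>w. w \<in> udisc \<Longrightarrow> f i w = (\<Sum>n<N. a n * \<epsilon> n w)"
        unfolding in_span_def by blast
      then show ?thesis
        by (intro exI[of _ "\<lambda>n. a n * of_real (1 / sqrt (monomial_norm2 \<alpha> n))"]) (simp add: \<epsilon>_def mult.assoc)
    qed simp
  qed
  then obtain d where d: "\<And>i w. i < k \<Longrightarrow> w \<in> udisc \<Longrightarrow> f i w = (\<Sum>n<N. d i n * w ^ n)" by metis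
  have d1: "(\<Sum>n<N. (cmod (d i n))\<^sup>2 * monomial_norm2 \<alpha> n) = 1" if i: "i < k" for i
  proof -
    have "A2_norm \<alpha> (f i) = A2_norm \<alpha> (\<lambda>w. \<Sum>n<N. d i n * w ^ n)" by (rule A2_norm_cong) (simp add: d i)
    then have "(\<Sum>n<N. (cmod (d i n))\<^sup>2 * monomial_norm2 \<alpha> n) = (A2_norm \<alpha> (f i))\<^sup>2"
      by (simp only: A2_norm_monomial_sum[OF alpha])
    moreover have "complex_of_real ((A2_norm \<alpha> (f i))\<^sup>2) = of_real 1"
      using A2_inner_self[OF alpha fA[OF i]] f(1) i by (simp add: A2_orthonormal_def[OF alpha])
    ultimately show ?thesis by (simp only: of_real_eq_iff)
  qed
  \<comment> \<open>For \<open>z\<close> in the disc \<open>b i z\<close> is the inner product of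
    \<open>f i\<close> with \<open>h z\<close>, and equally with the truncation \<open>P z\<close>,
    since \<open>f i\<close> is a polynomial of degree below \<open>N\<close>. The first reading
    gives Bessel's inequality with the bound \<open>H\<close>, the second the norm of
    \<open>T (P z)\<close>.\<close>
  define b where "b i z = (\<Sum>n<N. d i n * (cnj (c z n) * of_real (monomial_norm2 \<alpha> n)))" for i z
  have inner_expand: "A2_inner \<alpha> (f i) g = (\<Sum>n<N. d i n * A2_inner \<alpha> (\<lambda>w. w ^ n) g)" if "i < k" "in_A2 \<alpha> g" for i g
  proof -
    have "A2_inner \<alpha> (f i) g = A2_inner \<alpha> (\<lambda>w. \<Sum>n<N. d i n * w ^ n) g" by (rule A2_inner_cong) (simp_all add: d that)
    also have "\<dots> = (\<Sum>n<N. d i n * A2_inner \<alpha> (\<lambda>w. w ^ n) g)" using that by (intro A2_inner_sum_left[OF alpha] m) auto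
    finally show ?thesis .
  qed
  have bh: "A2_inner \<alpha> (f i) (h z) = b i z" if "i < k" "z \<in> udisc" for i z
    using inner_expand[OF that(1) h(1)[OF that(2)]] A2_inner_monomial_powser[OF alpha c ser] that(2) by (simp add: b_def)
  define P where "P z w = (\<Sum>n<N. c z n * w ^ n)" for z w
  have PA: "in_A2 \<alpha> (P z)" for z unfolding P_def by (intro in_A2_sum[OF alpha] in_A2_cmult[OF alpha] m)
  have bP: "A2_inner \<alpha> (P z) (f i) = cnj (b i z)" if i: "i < k" for i z
  proof -
    have "A2_inner \<alpha> (\<lambda>w. w ^ n) (P z) = cnj (c z n) * of_real (monomial_norm2 \<alpha> n)" if "n < N" for n
    proof -
      have "A2_inner \<alpha> (\<lambda>w. w ^ n) (P z) = (\<Sum>j<N. cnj (c z j) * A2_inner \<alpha> (\<lambda>w. w ^ n) (\<lambda>w. w ^ j))"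
        unfolding P_def by (intro A2_inner_sum_right[OF alpha] m)
      also have "\<dots> = (\<Sum>j<N. if j = n then cnj (c z n) * of_real (monomial_norm2 \<alpha> n) else 0)"
        by (intro sum.cong) (auto simp: A2_inner_monomials[OF alpha])
      finally show ?thesis using that by simp
    qed
    then have "A2_inner \<alpha> (f i) (P z) = b i z" using inner_expand[OF i PA] by (simp add: b_def)
    then show ?thesis by (metis A2_inner_cnj[OF alpha])
  qed
  have Pspan: "in_span k f (P z)" for z
  proof (rule in_span_trans)
    have gn: "complex_of_real (sqrt (monomial_norm2 \<alpha> n)) * of_real (1 / sqrt (monomial_norm2 \<alpha> n)) = 1" for n
      using gp[of n] by (simp only: of_real_mult[symmetric]) simp
    have ce: "c z n * of_real (sqrt (monomial_norm2 \<alpha> n)) * \<epsilon> n w = c z n * w ^ n" for n w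
    proof -
      have "c z n * of_real (sqrt (monomial_norm2 \<alpha> n)) * \<epsilon> n w
        = (complex_of_real (sqrt (monomial_norm2 \<alpha> n)) * of_real (1 / sqrt (monomial_norm2 \<alpha> n))) * (c z n * w ^ n)"
        unfolding \<epsilon>_def by (simp only: mult_ac)
      then show ?thesis unfolding gn by simp
    qed
    show "in_span N \<epsilon> (P z)"
      by (intro in_spanI[where c = "\<lambda>n. c z n * of_real (sqrt (monomial_norm2 \<alpha> n))"]) (simp only: P_def ce)
  qed (rule f(2))
  have TP: "(A2_norm \<alpha> (T (P z)))\<^sup>2 = (\<Sum>i<k. (cmod (b i z))\<^sup>2 * (\<tau> i)\<^sup>2)" for z
  proof -
    have "A2_norm \<alpha> (T (P z)) = A2_norm \<alpha> (T (\<lambda>w. \<Sum>i<k. cnj (b i z) * f i w))"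
    proof (rule A2_norm_cong, rule T_cong)
      fix w assume "w \<in> udisc"
      then show "P z w = (\<Sum>i<k. cnj (b i z) * f i w)"
        using A2_orthonormal_expansion(1)[OF alpha f(1) Pspan, of w z] bP by simp
    qed
    then show ?thesis using norm_T_combination[OF maps fA f(4), where c = "\<lambda>i. cnj (b i z)"] by (simp add: \<tau>_def)
  qed
  have bessel: "(\<Sum>i<k. (cmod (b i z))\<^sup>2) \<le> H\<^sup>2" if z: "z \<in> udisc" for z
  proof -
    have "(\<Sum>i<k. (cmod (b i z))\<^sup>2) = (\<Sum>i<k. (cmod (A2_inner \<alpha> (h z) (f i)))\<^sup>2)"
    proof (intro sum.cong refl)
      fix i assume "i \<in> {..<k}"
      then have "A2_inner \<alpha> (h z) (f i) = cnj (b i z)" using bh[of i z] z by (metis A2_inner_cnj[OF alpha] lessThan_iff)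
      then show "(cmod (b i z))\<^sup>2 = (cmod (A2_inner \<alpha> (h z) (f i)))\<^sup>2" by simp
    qed
    also have "\<dots> \<le> (A2_norm \<alpha> (h z))\<^sup>2" by (rule A2_Bessel[OF alpha f(1) h(1)[OF z]])
    also have "\<dots> \<le> H\<^sup>2" using h(2)[OF z] by (intro power_mono) auto
    finally show ?thesis .
  qed
  \<comment> \<open>The total weight in the power mean is at most \<open>H\<^sup>2\<close> by
    Bessel's inequality.\<close>
  define M where "M = (H\<^sup>2) powr (q - 1)"
  have pw: "A2_norm \<alpha> (T (P z)) powr p \<le> (\<Sum>i<k. M * \<tau> i powr p * (cmod (b i z))\<^sup>2)" if z: "z \<in> udisc" for z
  proof -
    have pq: "x powr p = (x\<^sup>2) powr q" if "x \<ge> 0" for x :: real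
    proof (cases "x = 0")
      case False
      then have "x\<^sup>2 = x powr 2" using that by simp
      then show ?thesis by (simp only: powr_powr) (simp add: q_def)
    qed (use p in simp)
    have "A2_norm \<alpha> (T (P z)) powr p = (\<Sum>i<k. (cmod (b i z))\<^sup>2 * (\<tau> i)\<^sup>2) powr q"
      by (simp only: pq[OF A2_norm_nonneg] TP)
    also have "\<dots> \<le> M * (\<Sum>i<k. (cmod (b i z))\<^sup>2 * ((\<tau> i)\<^sup>2) powr q)"
      unfolding M_def using bessel[OF z] by (intro weighted_power_mean[OF q]) auto
    also have "\<dots> = (\<Sum>i<k. M * \<tau> i powr p * (cmod (b i z))\<^sup>2)"
    proof -
      have "((\<tau> i)\<^sup>2) powr q = \<tau> i powr p" for i by (rule pq[symmetric]) (simp add: \<tau>_def)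
      then show ?thesis by (simp add: sum_distrib_left mult_ac)
    qed
    finally show ?thesis .
  qed
  have M0: "M \<ge> 0" by (simp add: M_def)
  \<comment> \<open>The indicator inside makes \<open>G\<close> Borel on the whole plane; on the
    disc it is the sum that has just been estimated.\<close>
  define G where "G z = (\<Sum>i<k. ennreal (M * \<tau> i powr p) * ennreal ((cmod (\<Sum>n<N. d i n * (cnj (indicat_real udisc z *\<^sub>R c z n) * of_real (monomial_norm2 \<alpha> n))))\<^sup>2))" for z
  have Gd: "G z = (\<Sum>i<k. ennreal (M * \<tau> i powr p) * ennreal ((cmod (b i z))\<^sup>2))" if "z \<in> udisc" for z
    using that by (simp add: G_def b_def)
  have Gm: "G \<in> borel_measurable borel"
  proof -
    have [measurable]: "cnj \<in> borel_measurable borel" by (intro borel_measurable_continuous_onI continuous_intros)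
    define C where "C n z = indicat_real udisc z *\<^sub>R c z n" for n z
    have [measurable]: "C n \<in> borel_measurable borel" for n using meas[of n] by (simp add: C_def[abs_def])
    have "(\<lambda>z. \<Sum>i<k. ennreal (M * \<tau> i powr p) * ennreal ((cmod (\<Sum>n<N. d i n * (cnj (C n z) * of_real (monomial_norm2 \<alpha> n))))\<^sup>2)) \<in> borel_measurable borel"
      by measurable
    then show ?thesis by (simp only: C_def G_def[abs_def])
  qed
  have bound: "ennreal (A2_norm \<alpha> (T (P z)) powr p) \<le> G z" if z: "z \<in> udisc" for z
  proof -
    have "ennreal (A2_norm \<alpha> (T (P z)) powr p) \<le> ennreal (\<Sum>i<k. M * \<tau> i powr p * (cmod (b i z))\<^sup>2)"
      by (rule ennreal_leI[OF pw[OF z]])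
    also have "\<dots> = (\<Sum>i<k. ennreal (M * \<tau> i powr p * (cmod (b i z))\<^sup>2))" using M0 by (intro sum_ennreal[symmetric]) auto
    also have "\<dots> = G z" using M0 by (simp add: Gd[OF z] ennreal_mult)
    finally show ?thesis .
  qed
  have "(\<integral>\<^sup>+z. indicator udisc z * G z * ennreal (dlambda_dens z) \<partial>lborel)
    = (\<integral>\<^sup>+z. (\<Sum>i<k. ennreal (M * \<tau> i powr p) * (indicator udisc z * ennreal ((cmod (b i z))\<^sup>2) * ennreal (dlambda_dens z))) \<partial>lborel)"
  proof (intro nn_integral_cong)
    fix z
    show "indicator udisc z * G z * ennreal (dlambda_dens z)
      = (\<Sum>i<k. ennreal (M * \<tau> i powr p) * (indicator udisc z * ennreal ((cmod (b i z))\<^sup>2) * ennreal (dlambda_dens z)))"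
      by (cases "z \<in> udisc") (simp_all add: Gd sum_distrib_right mult.assoc)
  qed
  also have "\<dots> = (\<Sum>i<k. ennreal (M * \<tau> i powr p) * (\<integral>\<^sup>+z. indicator udisc z * ennreal ((cmod (b i z))\<^sup>2) * ennreal (dlambda_dens z) \<partial>lborel))"
  proof -
    have bm: "(\<lambda>z. indicator udisc z * ennreal ((cmod (b i z))\<^sup>2) * ennreal (dlambda_dens z)) \<in> borel_measurable lborel" for i
    proof -
      have [measurable]: "cnj \<in> borel_measurable borel" by (intro borel_measurable_continuous_onI continuous_intros)
      define C where "C n z = indicat_real udisc z *\<^sub>R c z n" for n z
      have [measurable]: "C n \<in> borel_measurable borel" for n using meas[of n] by (simp add: C_def[abs_def])
      have 1: "(\<lambda>z. indicator udisc z * ennreal ((cmod (\<Sum>n<N. d i n * (cnj (C n z) * of_real (monomial_norm2 \<alpha> n))))\<^sup>2) * ennreal (dlambda_dens z)) \<in> borel_measurable lborel"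
        by measurable
      have 2: "(\<lambda>z. indicator udisc z * ennreal ((cmod (\<Sum>n<N. d i n * (cnj (C n z) * of_real (monomial_norm2 \<alpha> n))))\<^sup>2) * ennreal (dlambda_dens z))
        = (\<lambda>z. indicator udisc z * ennreal ((cmod (b i z))\<^sup>2) * ennreal (dlambda_dens z))"
        by (auto simp: C_def b_def indicator_def)
      show ?thesis using 1 unfolding 2 .
    qed
    show ?thesis
      unfolding nn_integral_sum[OF borel_measurable_times_ennreal[OF borel_measurable_const bm]]
      by (intro sum.cong refl nn_integral_cmult bm)
  qed
  \<comment> \<open>The hypothesis \<open>bes\<close> is applied to the coefficients of
    \<open>f i\<close>, whose weighted square sum is 1 because \<open>f i\<close> is a unit vector.
    The resulting bound does not depend on \<open>N\<close>.\<close>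
  also have "\<dots> \<le> (\<Sum>i<k. ennreal (M * \<tau> i powr p) * ennreal (D * 1))"
  proof (intro sum_mono mult_left_mono)
    fix i assume "i \<in> {..<k}"
    then show "(\<integral>\<^sup>+z. indicator udisc z * ennreal ((cmod (b i z))\<^sup>2) * ennreal (dlambda_dens z) \<partial>lborel) \<le> ennreal (D * 1)"
      using bes[of "d i" N] d1[of i] by (simp add: b_def)
  qed auto
  also have "\<dots> = (\<Sum>i<k. ennreal (M * D * \<tau> i powr p))"
    using M0 D by (intro sum.cong refl) (simp add: ennreal_mult[symmetric] mult_ac)
  also have "\<dots> = ennreal (\<Sum>i<k. M * D * \<tau> i powr p)" using M0 D by (intro sum_ennreal) auto
  also have "\<dots> \<le> ennreal (M * D * (\<Sum>n. enn2real (sing_num \<alpha> T n) powr p))"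
  proof (rule ennreal_leI)
    have "(\<Sum>i<k. \<tau> i powr p) \<le> (\<Sum>i<k. enn2real (sing_num \<alpha> T i) powr p)"
      using \<tau> p by (intro sum_mono powr_mono2) (auto simp: \<tau>_def)
    also have "\<dots> \<le> (\<Sum>n. enn2real (sing_num \<alpha> T n) powr p)" using sm by (intro sum_le_suminf) auto
    finally show "(\<Sum>i<k. M * D * \<tau> i powr p) \<le> M * D * (\<Sum>n. enn2real (sing_num \<alpha> T n) powr p)"
      using M0 D by (simp add: sum_distrib_left[symmetric] mult_left_mono)
  qed
  finally have "(\<integral>\<^sup>+z. indicator udisc z * G z * ennreal (dlambda_dens z) \<partial>lborel)
    \<le> ennreal ((H\<^sup>2) powr (p / 2 - 1) * D * (\<Sum>n. enn2real (sing_num \<alpha> T n) powr p))" by (simp add: M_def q_def)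
  then show ?thesis using Gm bound unfolding P_def by blast
qed

text \<open>Truncations converge to the test function in norm and \<open>T\<close> is bounded, so
  the lower limit of the majorants is again a majorant, and Fatou's lemma bounds its integral.
  Working with a Borel majorant avoids the question whether the norm itself is measurable in
  \<open>z\<close>.\<close>

lemma test_family_majorant:
  fixes c :: "complex \<Rightarrow> nat \<Rightarrow> complex"
  assumes p: "p \<ge> 2" and maps: "maps_A2 \<alpha> T" and bdd: "bounded_A2 \<alpha> T"
    and sm: "summable (\<lambda>n. enn2real (sing_num \<alpha> T n) powr p)"
    and c: "\<And>z. z \<in> udisc \<Longrightarrow> summable (\<lambda>n. norm (c z n))"
    and ser: "\<And>z w. z \<in> udisc \<Longrightarrow> w \<in> udisc \<Longrightarrow> (\<lambda>n. c z n * w ^ n) sums h z w"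
    and h: "\<And>z. z \<in> udisc \<Longrightarrow> in_A2 \<alpha> (h z)" "\<And>z. z \<in> udisc \<Longrightarrow> A2_norm \<alpha> (h z) \<le> H"
    and meas: "\<And>n. (\<lambda>z. indicat_real udisc z *\<^sub>R c z n) \<in> borel_measurable borel"
    and D: "D \<ge> 0"
    and bes: "\<And>N d. (\<integral>\<^sup>+z. indicator udisc z * ennreal ((cmod (\<Sum>n<N. d n * (cnj (c z n) * of_real (monomial_norm2 \<alpha> n))))\<^sup>2) * ennreal (dlambda_dens z) \<partial>lborel)
      \<le> ennreal (D * (\<Sum>n<N. (cmod (d n))\<^sup>2 * monomial_norm2 \<alpha> n))"
  obtains F where "F \<in> borel_measurable borel" "\<And>z. z \<in> udisc \<Longrightarrow> ennreal (A2_norm \<alpha> (T (h z)) powr p) \<le> F z"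
    "(\<integral>\<^sup>+z. indicator udisc z * F z * ennreal (dlambda_dens z) \<partial>lborel) < \<infinity>"
proof -
  define B where "B = (H\<^sup>2) powr (p / 2 - 1) * D * (\<Sum>n. enn2real (sing_num \<alpha> T n) powr p)"
  have "\<forall>N. \<exists>G. G \<in> borel_measurable borel \<and> (\<forall>z\<in>udisc. ennreal (A2_norm \<alpha> (T (\<lambda>w. \<Sum>n<N. c z n * w ^ n)) powr p) \<le> G z) \<and>
    (\<integral>\<^sup>+z. indicator udisc z * G z * ennreal (dlambda_dens z) \<partial>lborel) \<le> ennreal B"
    using truncated_test_family_majorant[OF p maps bdd sm c ser h meas D bes] unfolding B_def by blast
  from choice[OF this] obtain G where G': "\<forall>N. G N \<in> borel_measurable borel \<and> (\<forall>z\<in>udisc. ennreal (A2_norm \<alpha> (T (\<lambda>w. \<Sum>n<N. c z n * w ^ n)) powr p) \<le> G N z) \<and>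
    (\<integral>\<^sup>+z. indicator udisc z * G N z * ennreal (dlambda_dens z) \<partial>lborel) \<le> ennreal B" by (elim exE)
  have G: "G N \<in> borel_measurable borel"
    "z \<in> udisc \<Longrightarrow> ennreal (A2_norm \<alpha> (T (\<lambda>w. \<Sum>n<N. c z n * w ^ n)) powr p) \<le> G N z"
    "(\<integral>\<^sup>+z. indicator udisc z * G N z * ennreal (dlambda_dens z) \<partial>lborel) \<le> ennreal B" for N z
    using G'[rule_format, of N] by simp_all
  obtain C where C: "\<And>f. in_A2 \<alpha> f \<Longrightarrow> A2_norm \<alpha> (T f) \<le> C * A2_norm \<alpha> f" using bdd by (auto simp: bounded_A2_def)
  note [measurable] = G(1)
  define F where "F z = liminf (\<lambda>N. G N z)" for z
  show ?thesis
  proof (rule that[of F])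
    show "F \<in> borel_measurable borel" unfolding F_def by measurable
    fix z assume z: "z \<in> udisc"
    define P where "P N w = (\<Sum>n<N. c z n * w ^ n)" for N w
    have PA: "in_A2 \<alpha> (P N)" for N
      unfolding P_def by (intro in_A2_sum[OF alpha] in_A2_cmult[OF alpha] in_A2_monomial[OF alpha])
    note hz = h(1)[OF z]
    have "(\<lambda>N. A2_norm \<alpha> (\<lambda>w. h z w - P N w)) \<longlonglongrightarrow> 0"
      unfolding P_def using A2_norm_powser_tail(2)[OF alpha c[OF z] ser[OF z]] hz by (simp add: in_A2_def)
    then have l0: "(\<lambda>N. C * A2_norm \<alpha> (\<lambda>w. h z w - P N w)) \<longlonglongrightarrow> 0" by (rule tendsto_mult_right_zero)
    have close: "norm (A2_norm \<alpha> (T (P N)) - A2_norm \<alpha> (T (h z))) \<le> C * A2_norm \<alpha> (\<lambda>w. h z w - P N w)" for N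
    proof -
      define r where "r w = h z w - P N w" for w
      have r: "in_A2 \<alpha> r" unfolding r_def by (intro in_A2_diff[OF alpha] hz PA)
      have Tr: "in_A2 \<alpha> (T r)" "in_A2 \<alpha> (T (h z))" "in_A2 \<alpha> (T (P N))" using maps r hz PA by (auto simp: maps_A2_def)
      have "A2_norm \<alpha> (\<lambda>w. T (P N) w + T r w) \<le> A2_norm \<alpha> (T (P N)) + A2_norm \<alpha> (T r)"
        by (intro A2_norm_triangle[OF alpha] Tr)
      moreover have "(\<lambda>w. T (P N) w + T r w) = T (h z)" by (rule ext) (simp add: T_apply r_def algebra_simps)
      moreover have "A2_norm \<alpha> (\<lambda>w. T (h z) w + (-1) * T r w) \<le> A2_norm \<alpha> (T (h z)) + A2_norm \<alpha> (\<lambda>w. (-1) * T r w)"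
        by (intro A2_norm_triangle[OF alpha] in_A2_cmult[OF alpha] Tr)
      moreover have "(\<lambda>w. T (h z) w + (-1) * T r w) = T (P N)" by (rule ext) (simp add: T_apply r_def algebra_simps)
      moreover have "A2_norm \<alpha> (\<lambda>w. (-1) * T r w) = A2_norm \<alpha> (T r)" using A2_norm_cmult[OF alpha Tr(1), of "-1"] by simp
      ultimately have "\<bar>A2_norm \<alpha> (T (P N)) - A2_norm \<alpha> (T (h z))\<bar> \<le> A2_norm \<alpha> (T r)" by simp
      then show ?thesis using C[OF r] by (simp add: r_def[abs_def])
    qed
    have "(\<lambda>N. A2_norm \<alpha> (T (P N)) - A2_norm \<alpha> (T (h z))) \<longlonglongrightarrow> 0"
      by (rule Lim_null_comparison[OF _ l0]) (simp add: close[unfolded real_norm_def])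
    then have "(\<lambda>N. A2_norm \<alpha> (T (P N))) \<longlonglongrightarrow> A2_norm \<alpha> (T (h z))" by (rule LIM_zero_cancel)
    then have "(\<lambda>N. A2_norm \<alpha> (T (P N)) powr p) \<longlonglongrightarrow> A2_norm \<alpha> (T (h z)) powr p"
      using p by (intro tendsto_powr') auto
    then have "(\<lambda>N. ennreal (A2_norm \<alpha> (T (P N)) powr p)) \<longlonglongrightarrow> ennreal (A2_norm \<alpha> (T (h z)) powr p)"
      by (rule tendsto_ennrealI)
    then have "liminf (\<lambda>N. ennreal (A2_norm \<alpha> (T (P N)) powr p)) = ennreal (A2_norm \<alpha> (T (h z)) powr p)"
      by (intro lim_imp_Liminf) auto
    moreover have "liminf (\<lambda>N. ennreal (A2_norm \<alpha> (T (P N)) powr p)) \<le> F z"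
      unfolding F_def using G(2)[OF z] by (intro Liminf_mono) (simp add: P_def[abs_def])
    ultimately show "ennreal (A2_norm \<alpha> (T (h z)) powr p) \<le> F z" by simp
  next
    have "(\<integral>\<^sup>+z. indicator udisc z * F z * ennreal (dlambda_dens z) \<partial>lborel)
      \<le> (\<integral>\<^sup>+z. liminf (\<lambda>N. indicator udisc z * G N z * ennreal (dlambda_dens z)) \<partial>lborel)"
    proof (intro nn_integral_mono)
      fix z
      show "indicator udisc z * F z * ennreal (dlambda_dens z) \<le> liminf (\<lambda>N. indicator udisc z * G N z * ennreal (dlambda_dens z))"
      proof (cases "z \<in> udisc")
        case True
        have "F z * ennreal (dlambda_dens z) = liminf (\<lambda>N. ennreal (dlambda_dens z) * G N z)"
        proof -
          have "liminf (\<lambda>N. ennreal (dlambda_dens z) * G N z) = ennreal (dlambda_dens z) * liminf (\<lambda>N. G N z)"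
            by (rule Liminf_compose_continuous_mono)
              (auto intro!: ennreal_continuous_on_cmult continuous_on_id monoI mult_left_mono)
          then show ?thesis by (simp add: F_def mult.commute)
        qed
        then show ?thesis using True by (simp add: mult.commute)
      qed simp
    qed
    also have "\<dots> \<le> liminf (\<lambda>N. \<integral>\<^sup>+z. indicator udisc z * G N z * ennreal (dlambda_dens z) \<partial>lborel)"
      by (rule nn_integral_liminf) measurable
    also have "\<dots> \<le> liminf (\<lambda>N. ennreal B)" by (intro Liminf_mono) (simp add: G(3))
    also have "\<dots> = ennreal B" by (simp add: Liminf_const)
    finally show "(\<integral>\<^sup>+z. indicator udisc z * F z * ennreal (dlambda_dens z) \<partial>lborel) < \<infinity>" by (simp add: le_less_trans)
  qed
qed

end

section \<open>Test functions\<close>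

text \<open>Mean value inequality on the convex set of points of the right half-plane with modulus
  at most \<open>M\<close>; the derivative of the power is bounded there because
  \<open>s - 1\<close> is nonnegative.\<close>

lemma powr_difference_bound:
  fixes x y :: complex and s M :: real
  assumes x: "Re x > 0" "cmod x \<le> M" and y: "Re y > 0" "cmod y \<le> M" and s: "s \<ge> 1"
  shows "cmod (x powr of_real s - y powr of_real s) \<le> s * M powr (s - 1) * cmod (x - y)"
proof (rule field_differentiable_bound[where S = "{w. Re w > 0} \<inter> cball 0 M"])
  show "convex ({w. Re w > 0} \<inter> cball 0 M)" by (intro convex_Int convex_halfspace_Re_gt convex_cball)
  fix w assume w: "w \<in> {w. Re w > 0} \<inter> cball 0 M"
  then have "w \<notin> \<real>\<^sub>\<le>\<^sub>0" by (auto simp: complex_nonpos_Reals_iff)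
  then show "((\<lambda>w. w powr of_real s) has_field_derivative of_real s * w powr (of_real s - 1)) (at w within {w. Re w > 0} \<inter> cball 0 M)"
    by (intro DERIV_subset[OF has_field_derivative_powr]) auto
  have "cmod (w powr (of_real s - 1)) = cmod w powr (s - 1)"
    using norm_powr_real_powr'[of "of_real s - 1" w] by simp
  also have "\<dots> \<le> M powr (s - 1)" using w s by (intro powr_mono2) (auto simp: dist_norm)
  finally show "cmod (of_real s * w powr (of_real s - 1)) \<le> s * M powr (s - 1)"
    using s by (simp add: norm_mult mult_left_mono)
qed (use x y in \<open>auto simp: dist_norm\<close>)

text \<open>The reproducing kernel divided by its norm.\<close>

definition test_fun :: "real \<Rightarrow> complex \<Rightarrow> complex \<Rightarrow> complex" where
  "test_fun \<alpha> z w = of_real ((1 - (cmod z)\<^sup>2) powr ((\<alpha> + 2) / 2)) * bergman_kernel \<alpha> z w"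

text \<open>For \<open>z\<close> in the disc this is \<open>bergman_kernel' \<alpha> z\<close>
  scaled by \<open>(1 - (cmod z)\<^sup>2) powr ((\<alpha> + 4) / 2)\<close>, which keeps its norm
  bounded. It is written as a multiple of \<open>test_fun\<close> because the quotient of the two
  functions carries the argument.\<close>

definition test_fun' :: "real \<Rightarrow> complex \<Rightarrow> complex \<Rightarrow> complex" where
  "test_fun' \<alpha> z w = of_real (1 - (cmod z)\<^sup>2) * (w / (1 - cnj z * w)) * test_fun \<alpha> z w"

lemma one_minus_norm_square_bounds:
  assumes "cmod z < 1"
  shows "1 - cmod z \<le> 1 - (cmod z)\<^sup>2" "1 - (cmod z)\<^sup>2 \<le> 2 * (1 - cmod z)" "0 < 1 - (cmod z)\<^sup>2"
proof -
  have "1 - (cmod z)\<^sup>2 = (1 - cmod z) * (1 + cmod z)" by (simp add: power2_eq_square algebra_simps)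
  moreover have "(1 - cmod z) * 1 \<le> (1 - cmod z) * (1 + cmod z)" "(1 - cmod z) * (1 + cmod z) \<le> (1 - cmod z) * 2"
    using assms by (intro mult_left_mono; simp)+
  ultimately show "1 - cmod z \<le> 1 - (cmod z)\<^sup>2" "1 - (cmod z)\<^sup>2 \<le> 2 * (1 - cmod z)" by simp_all
  then show "0 < 1 - (cmod z)\<^sup>2" using assms by linarith
qed

lemma norm_test_fun:
  assumes "cmod z < 1" "cmod w < 1"
  shows "cmod (test_fun \<alpha> z w) = (1 - (cmod z)\<^sup>2) powr ((\<alpha> + 2) / 2) * cmod (1 - cnj z * w) powr (- (\<alpha> + 2))"
  using norm_powr_real_powr'[of "of_real (- (\<alpha> + 2))" "1 - cnj z * w"]
  by (simp add: test_fun_def bergman_kernel_def norm_mult)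

text \<open>The test functions at a point near \<open>x\<close>, combined so that either the value at \<open>y\<close> or the
  value at \<open>x\<close> drops out, recover both weights.\<close>

lemma test_fun_difference_estimates:
  fixes z x y U V :: complex and \<alpha> t :: real
  assumes \<alpha>: "\<alpha> > -1" and z: "cmod z < 1" and x: "cmod x < 1" and y: "cmod y < 1"
    and zx: "pseudo_hyp z x \<le> t" and t: "t < 1"
  defines "K \<equiv> 2 / (1 - t)" and "d \<equiv> pseudo_hyp x y"
    and "P \<equiv> cmod (U * test_fun \<alpha> z x - V * test_fun \<alpha> z y)" and "Q \<equiv> cmod (U * test_fun' \<alpha> z x - V * test_fun' \<alpha> z y)"
  defines "A \<equiv> K * (1 + K) * (Q + 2 * P)"
  shows "d * cmod U * cmod (test_fun \<alpha> z x) \<le> A" "d * cmod V * cmod (test_fun \<alpha> z y) \<le> A"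
    "(1 - d) powr (\<alpha> + 2) * cmod (U - V) * cmod (test_fun \<alpha> z x)
      \<le> P + (\<alpha> + 2) * (1 + K) powr (\<alpha> + 1) * 4 powr (\<alpha> + 2) * A"
    "inverse ((1 - (cmod z)\<^sup>2) powr (\<alpha> + 2)) \<le> K powr (2 * (\<alpha> + 2)) * (cmod (test_fun \<alpha> z x))\<^sup>2"
proof -
  define s where "s = \<alpha> + 2"
  have s: "s \<ge> 1" using \<alpha> by (simp add: s_def)
  define e where "e = 1 - (cmod z)\<^sup>2"
  note e = one_minus_norm_square_bounds[OF z, folded e_def]
  define X Y Z where "X = 1 - cnj z * x" and "Y = 1 - cnj z * y" and "Z = cmod (1 - cnj x * y)"
  have t0: "0 \<le> t" using pseudo_hyp_bounds(1)[OF z x] zx by linarith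
  have K2: "K \<ge> 2" using t t0 by (simp add: K_def pos_le_divide_eq)
  have d: "0 \<le> d" "d < 1" using pseudo_hyp_bounds[OF x y] by (auto simp: d_def)
  have X0: "X \<noteq> 0" "Re X > 0" and Y0: "Y \<noteq> 0" "Re Y > 0"
    using one_minus_cnj_mult_Re_pos(1,3)[OF z x] one_minus_cnj_mult_Re_pos(1,3)[OF z y] by (auto simp: X_def Y_def)
  have Zx: "1 - cmod x \<le> Z" "1 - cmod y \<le> Z" using norm_one_minus_cnj_mult_ge[OF x y] by (auto simp: Z_def)
  then have Z0: "Z > 0" using x by linarith
  have XK: "cmod X \<le> K * (1 - cmod z)" "cmod X \<le> K * (1 - cmod x)"
    using pseudo_hyp_le_comparison[OF z x zx t] by (auto simp: X_def K_def)
  have XZ: "cmod X \<le> K * Z" using XK(2) Zx(1) mult_left_mono[OF Zx(1), of K] K2 by linarith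
  have Xe: "cmod X \<le> K * e" using XK(1) mult_left_mono[OF e(1), of K] K2 by linarith
  have X_ge: "1 - cmod z \<le> cmod X" "1 - cmod x \<le> cmod X" "1 - cmod z \<le> cmod Y"
    using norm_one_minus_cnj_mult_ge[OF z x] norm_one_minus_cnj_mult_ge[OF z y] by (auto simp: X_def Y_def)
  have YZ: "cmod Y \<le> (1 + K) * Z"
  proof -
    have "cmod (z - x) \<le> 1 * cmod X"
      unfolding pseudo_hyp_mult[OF z x] X_def using pseudo_hyp_bounds[OF z x] by (intro mult_right_mono) auto
    moreover have "Y = (1 - cnj x * y) + cnj (x - z) * y" by (simp add: Y_def algebra_simps)
    then have "cmod Y \<le> Z + cmod (x - z) * cmod y"
      unfolding Z_def by (metis norm_triangle_ineq norm_mult complex_mod_cnj)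
    moreover have "cmod (x - z) * cmod y \<le> cmod (x - z) * 1" using y by (intro mult_left_mono) auto
    ultimately show ?thesis using XZ by (simp add: norm_minus_commute algebra_simps)
  qed
  have xy: "cmod (x - y) = d * Z" unfolding d_def Z_def by (rule pseudo_hyp_mult[OF x y])
  define hx hy where "hx = test_fun \<alpha> z x" and "hy = test_fun \<alpha> z y"
  \<comment> \<open>The quotient of \<open>test_fun'\<close> by \<open>test_fun\<close> is bounded
    by 2 in modulus; this is the 2 in \<open>A\<close>.\<close>
  have quot: "cmod (of_real e * (a / W)) \<le> 2" if "cmod a < 1" "1 - cmod z \<le> cmod W" "W \<noteq> 0" for a W
  proof -
    have "e * cmod a \<le> e * 1" using that e(3) by (intro mult_left_mono) auto
    also have "\<dots> \<le> 2 * cmod W" using e(2) mult_left_mono[OF that(2), of 2] by simp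
    finally show ?thesis using that(3) e(3) by (simp add: norm_mult norm_divide field_simps)
  qed
  \<comment> \<open>The difference of the two quotients is the determinant, up to sign, of the
    linear system for the unknowns \<open>U * hx\<close> and \<open>V * hy\<close>.\<close>
  have eq: "of_real e * (x / X) - of_real e * (y / Y) = of_real e * ((x - y) / (X * Y))"
  proof -
    have "x * Y - y * X = x - y" by (simp add: X_def Y_def algebra_simps)
    moreover have "x / X - y / Y = (x * Y - y * X) / (X * Y)" using X0 Y0 by (simp add: diff_frac_eq)
    ultimately have "x / X - y / Y = (x - y) / (X * Y)" by simp
    then show ?thesis by (simp only: right_diff_distrib[symmetric])
  qed
  \<comment> \<open>The determinant has modulus at least \<open>d / (K * (1 + K))\<close> by the
    bounds on \<open>X\<close> and \<open>Y\<close>; dividing by it produces the constant in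
    \<open>A\<close>.\<close>
  have key: "d * B \<le> A" if "B \<ge> 0" "B * cmod (of_real e * ((x - y) / (X * Y))) \<le> Q + 2 * P" for B
  proof -
    have n: "cmod (of_real e * ((x - y) / (X * Y))) = e * (d * Z) / (cmod X * cmod Y)"
      using e(3) by (simp add: norm_mult norm_divide xy)
    have XY: "cmod X * cmod Y \<le> (K * e) * ((1 + K) * Z)" using Xe YZ K2 e(3) by (intro mult_mono) auto
    have "B * (e * (d * Z)) \<le> (Q + 2 * P) * (cmod X * cmod Y)"
      using that(2) X0(1) Y0(1) unfolding n by (simp add: field_simps)
    also have "\<dots> \<le> (Q + 2 * P) * ((K * e) * ((1 + K) * Z))" using XY by (intro mult_left_mono) (auto simp: P_def Q_def)
    finally have "(d * B) * (e * Z) \<le> A * (e * Z)" by (simp add: A_def mult_ac)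
    then show ?thesis using e(3) Z0 by (simp add: mult_le_cancel_right)
  qed
  have Qe: "Q = cmod (U * (of_real e * (x / X) * hx) - V * (of_real e * (y / Y) * hy))"
    by (simp add: Q_def test_fun'_def hx_def hy_def e_def X_def Y_def)
  have Pe: "P = cmod (U * hx - V * hy)" by (simp add: P_def hx_def hy_def)
  show 1: "d * cmod U * cmod (test_fun \<alpha> z x) \<le> A"
  proof -
    define c where "c = of_real e * (y / Y)"
    have "(U * hx) * (of_real e * ((x - y) / (X * Y))) = (U * (of_real e * (x / X) * hx) - V * (c * hy)) - c * (U * hx - V * hy)"
      unfolding eq[symmetric] c_def by (simp add: algebra_simps)
    then have "cmod ((U * hx) * (of_real e * ((x - y) / (X * Y)))) \<le> Q + cmod c * P"
      unfolding Qe Pe c_def[symmetric] by (metis norm_triangle_ineq4 norm_mult)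
    moreover have "cmod c * P \<le> 2 * P" unfolding c_def by (intro mult_right_mono quot y X_ge Y0) (simp add: P_def)
    ultimately have "(cmod U * cmod hx) * cmod (of_real e * ((x - y) / (X * Y))) \<le> Q + 2 * P" by (simp only: norm_mult)
    from key[OF _ this] show ?thesis by (simp add: hx_def mult.assoc)
  qed
  show 2: "d * cmod V * cmod (test_fun \<alpha> z y) \<le> A"
  proof -
    define c where "c = of_real e * (x / X)"
    have "(V * hy) * (of_real e * ((x - y) / (X * Y))) = (U * (c * hx) - V * (of_real e * (y / Y) * hy)) - c * (U * hx - V * hy)"
      unfolding eq[symmetric] c_def by (simp add: algebra_simps)
    then have "cmod ((V * hy) * (of_real e * ((x - y) / (X * Y)))) \<le> Q + cmod c * P"
      unfolding Qe Pe c_def[symmetric] by (metis norm_triangle_ineq4 norm_mult)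
    moreover have "cmod c * P \<le> 2 * P" unfolding c_def by (intro mult_right_mono quot x X_ge X0) (simp add: P_def)
    ultimately have "(cmod V * cmod hy) * cmod (of_real e * ((x - y) / (X * Y))) \<le> Q + 2 * P" by (simp only: norm_mult)
    from key[OF _ this] show ?thesis by (simp add: hy_def mult.assoc)
  qed
  define C where "C = s * (1 + K) powr (s - 1) * 4 powr s"
  \<comment> \<open>\<open>cmod X\<close> is comparable to the boundary distance of \<open>x\<close>
    and may be much smaller than \<open>Z\<close>. The identity \<open>(1 - d\<^sup>2) * Z\<^sup>2 =
    (1 - (cmod x)\<^sup>2) * (1 - (cmod y)\<^sup>2)\<close> limits the loss to a factor
    \<open>4 / (1 - d)\<close>, the source of \<open>(1 - d) powr s\<close>.\<close>
  have dZ: "(1 - d) * Z \<le> 4 * cmod X"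
  proof -
    have "Z\<^sup>2 = (d * Z)\<^sup>2 + (1 - (cmod x)\<^sup>2) * (1 - (cmod y)\<^sup>2)"
      using pseudo_hyp_identity[of x y] xy by (simp only: Z_def)
    then have "(1 - d\<^sup>2) * Z\<^sup>2 = (1 - (cmod x)\<^sup>2) * (1 - (cmod y)\<^sup>2)" by (simp add: algebra_simps power_mult_distrib)
    also have "\<dots> \<le> (2 * (1 - cmod x)) * (2 * (1 - cmod y))"
      using one_minus_norm_square_bounds[OF x] one_minus_norm_square_bounds[OF y] x by (intro mult_mono) auto
    also have "\<dots> \<le> (2 * cmod X) * (2 * Z)" using X_ge(2) Zx(2) x y by (intro mult_mono) auto
    finally have "(1 - d\<^sup>2) * Z\<^sup>2 \<le> (4 * cmod X) * Z" by simp
    then have "((1 - d\<^sup>2) * Z) * Z \<le> (4 * cmod X) * Z" by (simp add: power2_eq_square mult.assoc)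
    then have "(1 - d\<^sup>2) * Z \<le> 4 * cmod X" using Z0 by (simp add: mult_le_cancel_right)
    moreover have "d\<^sup>2 \<le> d" using d by (simp add: power2_eq_square mult_left_le_one_le)
    then have "(1 - d) * Z \<le> (1 - d\<^sup>2) * Z" using Z0 by (intro mult_right_mono) auto
    ultimately show ?thesis by linarith
  qed
  \<comment> \<open>The bound is expressed through \<open>hy\<close> because \<open>hx - hy\<close>
    will be multiplied by \<open>V\<close>, and \<open>d * cmod V * cmod hy\<close> is already under
    control.\<close>
  have hdiff: "(1 - d) powr s * cmod (hx - hy) \<le> C * (d * cmod hy)"
  proof -
    define E where "E = e powr (s / 2)"
    have XYs: "cmod (X powr of_real s) = cmod X powr s" "cmod (Y powr of_real s) = cmod Y powr s"
      using norm_powr_real_powr'[of "of_real s"] by auto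
    have hx_eq: "hx = of_real E / X powr of_real s" and hy_eq: "hy = of_real E / Y powr of_real s"
      using powr_minus_divide[of X "of_real s"] powr_minus_divide[of Y "of_real s"]
      by (simp_all add: hx_def hy_def test_fun_def bergman_kernel_def s_def E_def e_def X_def Y_def)
    have "hx - hy = hy * ((Y powr of_real s - X powr of_real s) / X powr of_real s)"
      unfolding hx_eq hy_eq using X0 Y0 by (simp add: field_simps)
    then have n: "cmod (hx - hy) = cmod hy * cmod (X powr of_real s - Y powr of_real s) / cmod X powr s"
      by (simp add: norm_mult norm_divide XYs norm_minus_commute)
    have "cmod (X powr of_real s - Y powr of_real s) \<le> s * ((1 + K) * Z) powr (s - 1) * cmod (X - Y)"
      using XZ Z0 by (intro powr_difference_bound X0 Y0 YZ s) (simp add: algebra_simps)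
    also have "\<dots> \<le> s * ((1 + K) * Z) powr (s - 1) * (d * Z)"
    proof -
      have "X - Y = cnj z * (y - x)" by (simp add: X_def Y_def algebra_simps)
      then have "cmod (X - Y) = cmod z * cmod (x - y)" by (simp add: norm_mult norm_minus_commute)
      also have "\<dots> \<le> 1 * (d * Z)" unfolding xy using z d(1) Z0 by (intro mult_right_mono) auto
      finally show ?thesis using s by (intro mult_left_mono) auto
    qed
    also have "\<dots> = s * (1 + K) powr (s - 1) * d * Z powr s"
      using Z0 K2 powr_add[of Z "s - 1" 1] by (simp add: powr_mult)
    finally have "(1 - d) powr s * cmod (X powr of_real s - Y powr of_real s)
      \<le> (1 - d) powr s * (s * (1 + K) powr (s - 1) * d * Z powr s)" by (intro mult_left_mono) auto
    also have "\<dots> = s * (1 + K) powr (s - 1) * d * ((1 - d) * Z) powr s"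
      using d Z0 by (simp add: powr_mult)
    also have "\<dots> \<le> s * (1 + K) powr (s - 1) * d * (4 * cmod X) powr s"
      using dZ d s Z0 by (intro mult_left_mono powr_mono2) auto
    also have "\<dots> = C * d * cmod X powr s" by (simp add: C_def powr_mult)
    finally have "cmod hy * ((1 - d) powr s * cmod (X powr of_real s - Y powr of_real s)) \<le> cmod hy * (C * d * cmod X powr s)"
      by (rule mult_left_mono) simp
    moreover have "cmod X powr s > 0" using X0 by simp
    ultimately show ?thesis unfolding n by (simp add: field_simps)
  qed
  have C0: "C \<ge> 0" using s by (simp add: C_def)
  have d1: "(1 - d) powr s \<le> 1" using d s powr_mono2[of s "1 - d" 1] by simp
  have "(1 - d) powr s * (cmod (U - V) * cmod hx) \<le> (1 - d) powr s * (P + cmod V * cmod (hx - hy))"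
  proof (rule mult_left_mono)
    have "(U - V) * hx = (U * hx - V * hy) - V * (hx - hy)" by (simp add: algebra_simps)
    then show "cmod (U - V) * cmod hx \<le> P + cmod V * cmod (hx - hy)"
      unfolding Pe by (metis norm_triangle_ineq4 norm_mult)
  qed simp
  also have "\<dots> = (1 - d) powr s * P + cmod V * ((1 - d) powr s * cmod (hx - hy))" by (simp add: algebra_simps)
  also have "\<dots> \<le> 1 * P + cmod V * (C * (d * cmod hy))"
    using d1 hdiff by (intro add_mono mult_right_mono mult_left_mono) (auto simp: P_def)
  also have "\<dots> = P + C * (d * cmod V * cmod hy)" by (simp add: mult_ac)
  also have "\<dots> \<le> P + C * A" using 2 C0 by (intro add_left_mono mult_left_mono) (auto simp: hy_def)
  finally show "(1 - d) powr (\<alpha> + 2) * cmod (U - V) * cmod (test_fun \<alpha> z x)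
      \<le> P + (\<alpha> + 2) * (1 + K) powr (\<alpha> + 1) * 4 powr (\<alpha> + 2) * A"
    by (simp add: hx_def C_def s_def mult.assoc add.commute[of 1 \<alpha>])
  show "inverse ((1 - (cmod z)\<^sup>2) powr (\<alpha> + 2)) \<le> K powr (2 * (\<alpha> + 2)) * (cmod (test_fun \<alpha> z x))\<^sup>2"
  proof -
    have "cmod X powr (2 * s) \<le> (K * e) powr (2 * s)" using Xe s by (intro powr_mono2) auto
    then have "cmod X powr (2 * s) \<le> K powr (2 * s) * e powr (2 * s)" using K2 e(3) by (simp add: powr_mult)
    then have "1 / e powr s \<le> K powr (2 * s) * (e powr s / cmod X powr (2 * s))"
      using e(3) X0(1) powr_add[of e s s] by (simp add: field_simps)
    moreover have "(cmod (test_fun \<alpha> z x))\<^sup>2 = e powr s / cmod X powr (2 * s)"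
    proof -
      have "(e powr (s / 2))\<^sup>2 = e powr s" using powr_add[of e "s / 2" "s / 2"] by (simp add: power2_eq_square)
      moreover have "(cmod X powr - s)\<^sup>2 = 1 / cmod X powr (2 * s)"
        using powr_add[of "cmod X" "- s" "- s"] powr_minus_divide[of "cmod X" "2 * s"] by (simp add: power2_eq_square)
      ultimately show ?thesis
        unfolding norm_test_fun[OF z x] by (simp add: power_mult_distrib e_def s_def X_def)
    qed
    ultimately show ?thesis by (simp add: e_def s_def inverse_eq_divide)
  qed
qed

text \<open>The estimates are divided by \<open>cmod (test_fun \<alpha> z x)\<close>, which for
  \<open>x\<close> near \<open>z\<close> is at least a constant times the inverse square root of
  \<open>(1 - (cmod z)\<^sup>2) powr (\<alpha> + 2)\<close>, and then squared. The weight
  \<open>V\<close> is reached in applications by exchanging \<open>x\<close> with \<open>y\<close>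
  and \<open>U\<close> with \<open>V\<close>.\<close>

lemma test_functions_control_densities:
  fixes \<alpha> \<beta> t :: real
  assumes \<alpha>: "\<alpha> > -1" and \<beta>: "\<beta> \<ge> 2 * (\<alpha> + 2)" and t: "0 \<le> t" "t < 1"
  obtains C where "C > 0"
    "\<And>z x y U V. cmod z < 1 \<Longrightarrow> cmod x < 1 \<Longrightarrow> cmod y < 1 \<Longrightarrow> pseudo_hyp z x \<le> t \<Longrightarrow>
      (pseudo_hyp x y * cmod U)\<^sup>2 \<le> C * ((cmod (U * test_fun \<alpha> z x - V * test_fun \<alpha> z y))\<^sup>2
        + (cmod (U * test_fun' \<alpha> z x - V * test_fun' \<alpha> z y))\<^sup>2) * (1 - (cmod z)\<^sup>2) powr (\<alpha> + 2)"
    "\<And>z x y U V. cmod z < 1 \<Longrightarrow> cmod x < 1 \<Longrightarrow> cmod y < 1 \<Longrightarrow> pseudo_hyp z x \<le> t \<Longrightarrow>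
      (1 - pseudo_hyp x y) powr \<beta> * (cmod (U - V))\<^sup>2 \<le> C * ((cmod (U * test_fun \<alpha> z x - V * test_fun \<alpha> z y))\<^sup>2
        + (cmod (U * test_fun' \<alpha> z x - V * test_fun' \<alpha> z y))\<^sup>2) * (1 - (cmod z)\<^sup>2) powr (\<alpha> + 2)"
proof -
  define K where "K = 2 / (1 - t)"
  define k where "k = K powr (2 * (\<alpha> + 2))"
  define L where "L = K * (1 + K)"
  define D where "D = (\<alpha> + 2) * (1 + K) powr (\<alpha> + 1) * 4 powr (\<alpha> + 2)"
  define C where "C = k * (2 + (1 + 2 * D\<^sup>2) * (5 * L\<^sup>2))"
  have K0: "K > 0" using t by (simp add: K_def)
  have k0: "k > 0" using K0 by (simp add: k_def)
  have C0: "C > 0" using k0 by (auto simp: C_def intro!: mult_pos_pos add_pos_nonneg)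
  have main: "(pseudo_hyp x y * cmod U)\<^sup>2 \<le> C * (P\<^sup>2 + Q\<^sup>2) * (1 - (cmod z)\<^sup>2) powr (\<alpha> + 2) \<and>
     (1 - pseudo_hyp x y) powr \<beta> * (cmod (U - V))\<^sup>2 \<le> C * (P\<^sup>2 + Q\<^sup>2) * (1 - (cmod z)\<^sup>2) powr (\<alpha> + 2)"
    if z: "cmod z < 1" and x: "cmod x < 1" and y: "cmod y < 1" and zx: "pseudo_hyp z x \<le> t"
      and PQ: "P = cmod (U * test_fun \<alpha> z x - V * test_fun \<alpha> z y)" "Q = cmod (U * test_fun' \<alpha> z x - V * test_fun' \<alpha> z y)"
    for z x y U V P Q
  proof -
    define h where "h = cmod (test_fun \<alpha> z x)"
    define d where "d = pseudo_hyp x y"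
    define A where "A = L * (Q + 2 * P)"
    define e where "e = (1 - (cmod z)\<^sup>2) powr (\<alpha> + 2)"
    have est: "d * cmod U * h \<le> A" "(1 - d) powr (\<alpha> + 2) * cmod (U - V) * h \<le> P + D * A" "inverse e \<le> k * h\<^sup>2"
      using test_fun_difference_estimates(1)[OF \<alpha> z x y zx t(2), of U V] test_fun_difference_estimates(3)[OF \<alpha> z x y zx t(2), of U V]
        test_fun_difference_estimates(4)[OF \<alpha> z x y zx t(2)]
      unfolding d_def h_def A_def L_def K_def D_def k_def e_def PQ by -
    have d: "0 \<le> d" "d < 1" using pseudo_hyp_bounds[OF x y] by (auto simp: d_def)
    have e0: "e > 0" using one_minus_norm_square_bounds(3)[OF z] by (simp add: e_def)
    have PQ0: "P \<ge> 0" "Q \<ge> 0" by (auto simp: PQ)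
    have D0: "D \<ge> 0" using \<alpha> by (simp add: D_def)
    have L0: "L \<ge> 0" using K0 by (simp add: L_def)
    have A0: "A \<ge> 0" using L0 PQ0 by (simp add: A_def)
    have lift: "w\<^sup>2 \<le> k * B\<^sup>2 * e" if "0 \<le> w" "w * h \<le> B" for w B
    proof -
      have "w\<^sup>2 * inverse e \<le> w\<^sup>2 * (k * h\<^sup>2)" using est(3) by (intro mult_left_mono) auto
      also have "\<dots> = k * (w * h)\<^sup>2" by (simp add: power_mult_distrib mult_ac)
      also have "\<dots> \<le> k * B\<^sup>2" using that k0 by (intro mult_left_mono power_mono) (auto simp: h_def)
      finally show ?thesis using e0 by (simp add: field_simps)
    qed
    \<comment> \<open>The 5 is \<open>1 + 4\<close>, from Cauchy-Schwarz with the coefficients 1 and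
      2 of \<open>Q + 2 * P\<close>.\<close>
    have sq: "(a + b)\<^sup>2 \<le> 2 * a\<^sup>2 + 2 * b\<^sup>2" "(a + 2 * b)\<^sup>2 \<le> 5 * (b\<^sup>2 + a\<^sup>2)" for a b :: real
      using zero_le_power2[of "a - b"] zero_le_power2[of "2 * a - b"] by (simp_all add: power2_eq_square algebra_simps)
    have A2: "A\<^sup>2 \<le> (5 * L\<^sup>2) * (P\<^sup>2 + Q\<^sup>2)"
      unfolding A_def power_mult_distrib using mult_left_mono[OF sq(2)[of Q P] zero_le_power2[of L]] by (simp only: mult_ac)
    have fin: "k * B\<^sup>2 * e \<le> C * (P\<^sup>2 + Q\<^sup>2) * e" if "B\<^sup>2 \<le> (2 + (1 + 2 * D\<^sup>2) * (5 * L\<^sup>2)) * (P\<^sup>2 + Q\<^sup>2)" for B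
      using mult_left_mono[OF that, of k] k0 e0 by (simp add: C_def mult.assoc mult_right_mono)
    have "(d * cmod U)\<^sup>2 \<le> k * A\<^sup>2 * e" using est(1) d by (intro lift) auto
    also have "\<dots> \<le> C * (P\<^sup>2 + Q\<^sup>2) * e"
    proof (rule fin)
      have "5 * L\<^sup>2 * (P\<^sup>2 + Q\<^sup>2) \<le> (2 + (1 + 2 * D\<^sup>2) * (5 * L\<^sup>2)) * (P\<^sup>2 + Q\<^sup>2)"
        by (intro mult_right_mono) (auto simp: algebra_simps)
      with A2 show "A\<^sup>2 \<le> (2 + (1 + 2 * D\<^sup>2) * (5 * L\<^sup>2)) * (P\<^sup>2 + Q\<^sup>2)" by linarith
    qed
    finally have 1: "(d * cmod U)\<^sup>2 \<le> C * (P\<^sup>2 + Q\<^sup>2) * e" .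
    \<comment> \<open>The lower bound on \<open>\<beta>\<close> enters here: \<open>1 - d\<close> is
      at most 1, so raising the exponent from \<open>2 * (\<alpha> + 2)\<close> to
      \<open>\<beta>\<close> does not increase the power.\<close>
    have "(1 - d) powr \<beta> \<le> (1 - d) powr (2 * (\<alpha> + 2))" using \<beta> d by (intro powr_mono') auto
    also have "\<dots> = ((1 - d) powr (\<alpha> + 2))\<^sup>2" using d powr_add[of "1 - d" "\<alpha> + 2" "\<alpha> + 2"] by (simp only: mult_2 power2_eq_square)
    finally have "(1 - d) powr \<beta> * (cmod (U - V))\<^sup>2 \<le> ((1 - d) powr (\<alpha> + 2) * cmod (U - V))\<^sup>2"
      unfolding power_mult_distrib by (rule mult_right_mono) simp
    also have "\<dots> \<le> k * (P + D * A)\<^sup>2 * e" using est(2) by (intro lift) auto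
    also have "\<dots> \<le> C * (P\<^sup>2 + Q\<^sup>2) * e"
    proof (rule fin)
      have "(P + D * A)\<^sup>2 \<le> 2 * P\<^sup>2 + 2 * D\<^sup>2 * A\<^sup>2" using sq(1)[of P "D * A"] by (simp add: power_mult_distrib)
      also have "\<dots> \<le> 2 * (P\<^sup>2 + Q\<^sup>2) + 2 * D\<^sup>2 * ((5 * L\<^sup>2) * (P\<^sup>2 + Q\<^sup>2))"
        using A2 by (intro add_mono mult_left_mono) auto
      also have "\<dots> \<le> (2 + (1 + 2 * D\<^sup>2) * (5 * L\<^sup>2)) * (P\<^sup>2 + Q\<^sup>2)" by (simp add: algebra_simps)
      finally show "(P + D * A)\<^sup>2 \<le> (2 + (1 + 2 * D\<^sup>2) * (5 * L\<^sup>2)) * (P\<^sup>2 + Q\<^sup>2)" .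
    qed
    finally show ?thesis using 1 by (simp add: d_def e_def)
  qed
  show ?thesis by (rule that[OF C0]) (use main in blast)+
qed

text \<open>The pointwise bound integrates to the squared norms, and its factor
  \<open>(1 - (cmod z)\<^sup>2) powr (\<alpha> + 2)\<close> cancels the denominator of
  \<open>Mr\<close>.\<close>

lemma Mr_le_A2_norms:
  assumes \<alpha>: "\<alpha> > -1" and z: "cmod z < 1" and f: "in_A2 \<alpha> f" and g: "in_A2 \<alpha> g" and C: "C \<ge> 0"
    and le: "\<And>w. w \<in> udisc \<Longrightarrow> \<phi> w \<in> bdisc z R \<Longrightarrow>
      q w \<le> C * ((cmod (f w))\<^sup>2 + (cmod (g w))\<^sup>2) * (1 - (cmod z)\<^sup>2) powr (\<alpha> + 2)"
  shows "Mr \<alpha> R \<phi> q z \<le> ennreal (C * ((A2_norm \<alpha> f)\<^sup>2 + (A2_norm \<alpha> g)\<^sup>2))"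
proof -
  define e where "e = (1 - (cmod z)\<^sup>2) powr (\<alpha> + 2)"
  have e0: "e > 0" using one_minus_norm_square_bounds(3)[OF z] by (simp add: e_def)
  have meas: "(\<lambda>w. ennreal (A2_weight \<alpha> w * (cmod (h w))\<^sup>2)) \<in> borel_measurable lborel" if "in_A2 \<alpha> h" for h
    using measurable_weight_norm2[of h \<alpha>] that by (simp add: in_A2_def)
  have "pull_meas \<alpha> \<phi> q (bdisc z R)
    \<le> (\<integral>\<^sup>+w. ennreal (C * e) * (ennreal (A2_weight \<alpha> w * (cmod (f w))\<^sup>2) + ennreal (A2_weight \<alpha> w * (cmod (g w))\<^sup>2)) \<partial>lborel)"
    unfolding pull_meas_def
  proof (rule nn_integral_mono)
    fix w
    show "indicator (udisc \<inter> \<phi> -` bdisc z R) w * ennreal (dA_dens \<alpha> w * q w)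
      \<le> ennreal (C * e) * (ennreal (A2_weight \<alpha> w * (cmod (f w))\<^sup>2) + ennreal (A2_weight \<alpha> w * (cmod (g w))\<^sup>2))"
    proof (cases "w \<in> udisc \<inter> \<phi> -` bdisc z R")
      case True
      have W: "A2_weight \<alpha> w = dA_dens \<alpha> w" "A2_weight \<alpha> w \<ge> 0" using True A2_weight_nonneg[OF \<alpha>, of w] by (auto simp: A2_weight_def)
      have "A2_weight \<alpha> w * q w \<le> A2_weight \<alpha> w * (C * ((cmod (f w))\<^sup>2 + (cmod (g w))\<^sup>2) * e)"
        using le[of w] True W(2) unfolding e_def by (intro mult_left_mono) auto
      also have "\<dots> = (C * e) * (A2_weight \<alpha> w * (cmod (f w))\<^sup>2 + A2_weight \<alpha> w * (cmod (g w))\<^sup>2)" by (simp add: algebra_simps)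
      finally have "ennreal (A2_weight \<alpha> w * q w) \<le> ennreal ((C * e) * (A2_weight \<alpha> w * (cmod (f w))\<^sup>2 + A2_weight \<alpha> w * (cmod (g w))\<^sup>2))"
        by (rule ennreal_leI)
      then show ?thesis using True W C e0 by (simp add: ennreal_mult)
    qed simp
  qed
  also have "\<dots> = ennreal (C * e) * (bergman_int \<alpha> f + bergman_int \<alpha> g)"
    unfolding bergman_int_weight using meas[OF f] meas[OF g] by (simp add: nn_integral_cmult nn_integral_add)
  also have "\<dots> = ennreal (C * e * ((A2_norm \<alpha> f)\<^sup>2 + (A2_norm \<alpha> g)\<^sup>2))"
    unfolding bergman_int_A2_norm[OF \<alpha> f] bergman_int_A2_norm[OF \<alpha> g] using C e0 by (simp add: ennreal_mult)
  finally have "Mr \<alpha> R \<phi> q z \<le> ennreal (C * e * ((A2_norm \<alpha> f)\<^sup>2 + (A2_norm \<alpha> g)\<^sup>2)) * ennreal (inverse e)"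
    unfolding Mr_eq[OF z] e_def[symmetric] by (rule mult_right_mono) simp
  also have "\<dots> = ennreal (C * ((A2_norm \<alpha> f)\<^sup>2 + (A2_norm \<alpha> g)\<^sup>2))"
    using e0 C by (subst ennreal_mult[symmetric]) (auto simp: mult_ac)
  finally show ?thesis .
qed

lemma in_L_lambda_majorized:
  assumes \<phi>: "admissible_map \<phi>" and g: "continuous_on udisc g" and p: "p > 0" and C: "C > 0"
    and M: "\<And>z. z \<in> udisc \<Longrightarrow> Mr \<alpha> R \<phi> g z \<le> ennreal (C * ((a z)\<^sup>2 + (b z)\<^sup>2))"
    and ab: "\<And>z. a z \<ge> 0" "\<And>z. b z \<ge> (0::real)"
    and F: "F \<in> borel_measurable borel" "\<And>z. z \<in> udisc \<Longrightarrow> ennreal (a z powr p) \<le> F z"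
      "(\<integral>\<^sup>+z. indicator udisc z * F z * ennreal (dlambda_dens z) \<partial>lborel) < \<infinity>"
    and G: "G \<in> borel_measurable borel" "\<And>z. z \<in> udisc \<Longrightarrow> ennreal (b z powr p) \<le> G z"
      "(\<integral>\<^sup>+z. indicator udisc z * G z * ennreal (dlambda_dens z) \<partial>lborel) < \<infinity>"
  shows "in_L_lambda (p / 2) (Mr \<alpha> R \<phi> g)"
  unfolding in_L_lambda_def
proof (intro conjI)
  show "(\<lambda>z. indicator udisc z * Mr \<alpha> R \<phi> g z) \<in> borel_measurable lborel" by (rule Mr_measurable[OF \<phi> g])
  show "AE z in lborel. z \<in> udisc \<longrightarrow> Mr \<alpha> R \<phi> g z \<noteq> \<infinity>"
  proof (rule AE_I2, rule impI)
    fix z assume "z \<in> udisc"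
    then have "Mr \<alpha> R \<phi> g z < \<infinity>" using le_less_trans[OF M ennreal_less_top] by (simp add: infinity_ennreal_def)
    then show "Mr \<alpha> R \<phi> g z \<noteq> \<infinity>" by simp
  qed
  note [measurable] = F(1) G(1) udisc_borel
  define B where "B = (2 * C) powr (p / 2)"
  have "(\<integral>\<^sup>+z. indicator udisc z * ennreal (enn2real (Mr \<alpha> R \<phi> g z) powr (p / 2)) * ennreal (dlambda_dens z) \<partial>lborel)
    \<le> (\<integral>\<^sup>+z. ennreal B * (indicator udisc z * F z * ennreal (dlambda_dens z) + indicator udisc z * G z * ennreal (dlambda_dens z)) \<partial>lborel)"
  proof (rule nn_integral_mono)
    fix z
    show "indicator udisc z * ennreal (enn2real (Mr \<alpha> R \<phi> g z) powr (p / 2)) * ennreal (dlambda_dens z)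
      \<le> ennreal B * (indicator udisc z * F z * ennreal (dlambda_dens z) + indicator udisc z * G z * ennreal (dlambda_dens z))"
    proof (cases "z \<in> udisc")
      case True
      have pw: "(x\<^sup>2) powr (p / 2) = x powr p" if "x \<ge> 0" for x :: real
        using that powr_powr[of x 2 "p / 2"] by (cases "x = 0") (simp_all add: powr_numeral)
      \<comment> \<open>Passing to the larger of the two values handles the power
        \<open>p / 2\<close> of the sum by monotonicity alone.\<close>
      define m where "m = max (a z) (b z)"
      have m0: "m \<ge> 0" using ab[of z] by (simp add: m_def)
      have "(a z)\<^sup>2 \<le> m\<^sup>2" "(b z)\<^sup>2 \<le> m\<^sup>2" using ab[of z] by (auto simp: m_def intro!: power_mono)
      then have "C * ((a z)\<^sup>2 + (b z)\<^sup>2) \<le> C * (2 * m\<^sup>2)" using C by (intro mult_left_mono) auto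
      moreover have "enn2real (Mr \<alpha> R \<phi> g z) \<le> C * ((a z)\<^sup>2 + (b z)\<^sup>2)"
        using M[OF True] C by (intro enn2real_leI) auto
      ultimately have "enn2real (Mr \<alpha> R \<phi> g z) powr (p / 2) \<le> (2 * C * m\<^sup>2) powr (p / 2)"
        using p by (intro powr_mono2) auto
      also have "\<dots> = B * m powr p" unfolding B_def using C m0 pw[OF m0] by (subst powr_mult) auto
      also have "\<dots> \<le> B * (a z powr p + b z powr p)"
        unfolding m_def by (intro mult_left_mono) (auto simp: max_def B_def)
      finally have "ennreal (enn2real (Mr \<alpha> R \<phi> g z) powr (p / 2)) \<le> ennreal (B * (a z powr p + b z powr p))" by (rule ennreal_leI)
      also have "\<dots> = ennreal B * (ennreal (a z powr p) + ennreal (b z powr p))" by (simp add: ennreal_mult B_def)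
      also have "\<dots> \<le> ennreal B * (F z + G z)" using F(2)[OF True] G(2)[OF True] by (intro mult_left_mono add_mono) auto
      finally have "ennreal (enn2real (Mr \<alpha> R \<phi> g z) powr (p / 2)) * ennreal (dlambda_dens z) \<le> ennreal B * (F z + G z) * ennreal (dlambda_dens z)"
        by (rule mult_right_mono) simp
      then show ?thesis using True by (simp add: distrib_right mult.assoc)
    qed simp
  qed
  also have "\<dots> = ennreal B * ((\<integral>\<^sup>+z. indicator udisc z * F z * ennreal (dlambda_dens z) \<partial>lborel) + (\<integral>\<^sup>+z. indicator udisc z * G z * ennreal (dlambda_dens z) \<partial>lborel))"
    by (subst nn_integral_cmult, measurable, subst nn_integral_add, measurable)
  also have "\<dots> < \<infinity>" using F(3) G(3) by (simp add: ennreal_mult_less_top infinity_ennreal_def)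
  finally show "(\<integral>\<^sup>+z. indicator udisc z * ennreal (enn2real (Mr \<alpha> R \<phi> g z) powr (p / 2)) * ennreal (dlambda_dens z) \<partial>lborel) < \<infinity>" .
qed

section \<open>Norms, coefficients and Bessel inequalities of the two test families\<close>

context
  fixes \<alpha> :: real
  assumes alpha: "\<alpha> > -1"
begin

lemma A2_norm_test_fun:
  assumes z: "z \<in> udisc"
  shows "in_A2 \<alpha> (test_fun \<alpha> z)" "A2_norm \<alpha> (test_fun \<alpha> z) = 1"
    and "in_A2 \<alpha> (test_fun' \<alpha> z)" "A2_norm \<alpha> (test_fun' \<alpha> z) \<le> 2"
proof -
  have z1: "cmod z < 1" using z by (simp add: mem_udisc)
  note e = one_minus_norm_square_bounds[OF z1]
  define e where "e = 1 - (cmod z)\<^sup>2"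
  have k: "in_A2 \<alpha> (bergman_kernel \<alpha> z)" by (rule in_A2_bergman_kernel[OF alpha z])
  show h: "in_A2 \<alpha> (test_fun \<alpha> z)" unfolding test_fun_def[abs_def] by (rule in_A2_cmult[OF alpha k])
  have "(A2_norm \<alpha> (test_fun \<alpha> z))\<^sup>2 = (e powr ((\<alpha> + 2) / 2))\<^sup>2 * e powr (- (\<alpha> + 2))"
    unfolding test_fun_def[abs_def] A2_norm_cmult[OF alpha k] power_mult_distrib A2_norm_bergman_kernel[OF alpha z]
    by (simp add: e_def)
  also have "\<dots> = e powr ((\<alpha> + 2) / 2 + (\<alpha> + 2) / 2 + (- (\<alpha> + 2)))"
    by (simp only: powr_add power2_eq_square)
  also have "\<dots> = 1" using e(3) by (simp add: e_def)
  finally show h1: "A2_norm \<alpha> (test_fun \<alpha> z) = 1" by (simp add: power2_eq_1_iff)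
      (smt (verit) A2_norm_nonneg)
  have hol: "test_fun' \<alpha> z holomorphic_on udisc"
    unfolding test_fun'_def[abs_def] using h one_minus_cnj_mult_Re_pos(3)[OF z1]
    by (intro holomorphic_intros) (auto simp: in_A2_def mem_udisc)
  have "cmod (test_fun' \<alpha> z w) \<le> 2 * cmod (test_fun \<alpha> z w)" if "w \<in> udisc" for w
  proof -
    have w: "cmod w < 1" using that by (simp add: mem_udisc)
    have "e * cmod w \<le> e * 1" using w e(3) by (intro mult_left_mono) (auto simp: e_def)
    also have "\<dots> \<le> 2 * cmod (1 - cnj z * w)"
      using e(2) mult_left_mono[OF norm_one_minus_cnj_mult_ge(1)[OF z1 w], of 2] by (simp add: e_def)
    finally have "e * cmod w / cmod (1 - cnj z * w) \<le> 2"
      using one_minus_cnj_mult_Re_pos(3)[OF z1 w] by (simp add: pos_divide_le_eq)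
    moreover have "cmod (test_fun' \<alpha> z w) = e * cmod w / cmod (1 - cnj z * w) * cmod (test_fun \<alpha> z w)"
      using e(3) unfolding test_fun'_def e_def[symmetric] norm_mult norm_divide norm_of_real by simp
    ultimately show ?thesis by (simp only: mult_right_mono[OF _ norm_ge_zero])
  qed
  from in_A2_bound[OF alpha hol h this] h1
  show "in_A2 \<alpha> (test_fun' \<alpha> z)" "A2_norm \<alpha> (test_fun' \<alpha> z) \<le> 2" by auto
qed

definition test_coeff :: "complex \<Rightarrow> nat \<Rightarrow> complex" where
  "test_coeff z n = of_real ((1 - (cmod z)\<^sup>2) powr ((\<alpha> + 2) / 2)) * (of_real (binom_coeff (\<alpha> + 2) n) * cnj z ^ n)"

definition test_coeff' :: "complex \<Rightarrow> nat \<Rightarrow> complex" where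
  "test_coeff' z n = of_real ((1 - (cmod z)\<^sup>2) * (1 - (cmod z)\<^sup>2) powr ((\<alpha> + 2) / 2)) * bergman_kernel_coeff' \<alpha> z n"

lemma test_fun_series:
  assumes z: "z \<in> udisc"
  shows "w \<in> udisc \<Longrightarrow> (\<lambda>n. test_coeff z n * w ^ n) sums test_fun \<alpha> z w" "summable (\<lambda>n. norm (test_coeff z n))"
    and "w \<in> udisc \<Longrightarrow> (\<lambda>n. test_coeff' z n * w ^ n) sums test_fun' \<alpha> z w" "summable (\<lambda>n. norm (test_coeff' z n))"
proof -
  show "summable (\<lambda>n. norm (test_coeff z n))"
    using summable_mult[OF bergman_kernel_series(2)[OF z, of \<alpha>], of "norm (complex_of_real ((1 - (cmod z)\<^sup>2) powr ((\<alpha> + 2) / 2)))"]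
    by (simp add: test_coeff_def norm_mult)
  show "summable (\<lambda>n. norm (test_coeff' z n))"
    using summable_mult[OF bergman_kernel'_series(2)[OF z, of \<alpha>], of "norm (complex_of_real ((1 - (cmod z)\<^sup>2) * (1 - (cmod z)\<^sup>2) powr ((\<alpha> + 2) / 2)))"]
    by (simp add: test_coeff'_def norm_mult mult.assoc)
  show "(\<lambda>n. test_coeff z n * w ^ n) sums test_fun \<alpha> z w" if w: "w \<in> udisc"
    unfolding test_coeff_def test_fun_def mult.assoc[of "of_real _"] by (intro sums_mult bergman_kernel_series(1)[OF z w, unfolded mult.assoc])
  show "(\<lambda>n. test_coeff' z n * w ^ n) sums test_fun' \<alpha> z w" if w: "w \<in> udisc"
  proof -
    define E where "E = complex_of_real ((1 - (cmod z)\<^sup>2) powr ((\<alpha> + 2) / 2))"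
    have "test_fun' \<alpha> z w = of_real ((1 - (cmod z)\<^sup>2) * (1 - (cmod z)\<^sup>2) powr ((\<alpha> + 2) / 2)) * bergman_kernel' \<alpha> z w"
      unfolding test_fun'_def test_fun_def bergman_kernel'_def of_real_mult E_def[symmetric] by (simp only: mult_ac)
    then show ?thesis
      using sums_mult[OF bergman_kernel'_series(1)[OF z w]] by (simp only: test_coeff'_def mult.assoc)
  qed
qed

lemma measurable_test_coeff:
  "(\<lambda>z. indicat_real udisc z *\<^sub>R test_coeff z n) \<in> borel_measurable borel"
  "(\<lambda>z. indicat_real udisc z *\<^sub>R test_coeff' z n) \<in> borel_measurable borel"
proof -
  have [measurable]: "cnj \<in> borel_measurable borel" by (intro borel_measurable_continuous_onI continuous_intros)
  note [measurable] = udisc_borel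
  show "(\<lambda>z. indicat_real udisc z *\<^sub>R test_coeff z n) \<in> borel_measurable borel"
    unfolding test_coeff_def by measurable
  show "(\<lambda>z. indicat_real udisc z *\<^sub>R test_coeff' z n) \<in> borel_measurable borel"
    unfolding test_coeff'_def bergman_kernel_coeff'_def by (cases "n = 0") (simp_all, measurable)
qed

text \<open>The sum is the inner product of the polynomial \<open>E\<close> with
  \<open>test_fun \<alpha> z\<close>, that is \<open>E z\<close> times
  \<open>(1 - (cmod z)\<^sup>2) powr ((\<alpha> + 2) / 2)\<close>. Squaring and multiplying by the
  density of \<open>d\<lambda>\<close> gives the weight of the Bergman space up to the factor
  \<open>\<alpha> + 1\<close>, so the integral is a norm.\<close>

lemma test_fun_Bessel:
  "(\<integral>\<^sup>+z. indicator udisc z * ennreal ((cmod (\<Sum>n<N. d n * (cnj (test_coeff z n) * of_real (monomial_norm2 \<alpha> n))))\<^sup>2) * ennreal (dlambda_dens z) \<partial>lborel)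
    \<le> ennreal (1 / (\<alpha> + 1) * (\<Sum>n<N. (cmod (d n))\<^sup>2 * monomial_norm2 \<alpha> n))"
proof -
  define E where "E z = (\<Sum>n<N. d n * z ^ n)" for z
  have E: "in_A2 \<alpha> E" unfolding E_def[abs_def] by (intro in_A2_sum[OF alpha] in_A2_cmult[OF alpha] in_A2_monomial[OF alpha])
  have "(\<integral>\<^sup>+z. indicator udisc z * ennreal ((cmod (\<Sum>n<N. d n * (cnj (test_coeff z n) * of_real (monomial_norm2 \<alpha> n))))\<^sup>2) * ennreal (dlambda_dens z) \<partial>lborel)
    = (\<integral>\<^sup>+z. ennreal (1 / (\<alpha> + 1)) * ennreal (A2_weight \<alpha> z * (cmod (E z))\<^sup>2) \<partial>lborel)"
  proof (rule nn_integral_cong)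
    fix z
    show "indicator udisc z * ennreal ((cmod (\<Sum>n<N. d n * (cnj (test_coeff z n) * of_real (monomial_norm2 \<alpha> n))))\<^sup>2) * ennreal (dlambda_dens z)
      = ennreal (1 / (\<alpha> + 1)) * ennreal (A2_weight \<alpha> z * (cmod (E z))\<^sup>2)"
    proof (cases "z \<in> udisc")
      case True
      define e where "e = 1 - (cmod z)\<^sup>2"
      have e: "e > 0" using one_minus_norm_square_bounds(3) True by (simp add: e_def mem_udisc)
      have "cnj (test_coeff z n) * of_real (monomial_norm2 \<alpha> n) = of_real (e powr ((\<alpha> + 2) / 2)) * z ^ n" for n
      proof -
        have "cnj (test_coeff z n) * of_real (monomial_norm2 \<alpha> n)
          = of_real (e powr ((\<alpha> + 2) / 2)) * z ^ n * of_real (binom_coeff (\<alpha> + 2) n * monomial_norm2 \<alpha> n)"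
          by (simp add: test_coeff_def e_def mult_ac)
        then show ?thesis by (simp add: monomial_norm2_binom_coeff[OF alpha])
      qed
      then have "(\<Sum>n<N. d n * (cnj (test_coeff z n) * of_real (monomial_norm2 \<alpha> n))) = of_real (e powr ((\<alpha> + 2) / 2)) * E z"
        by (simp add: E_def sum_distrib_left sum_distrib_right mult_ac)
      then have "(cmod (\<Sum>n<N. d n * (cnj (test_coeff z n) * of_real (monomial_norm2 \<alpha> n))))\<^sup>2 = (e powr ((\<alpha> + 2) / 2))\<^sup>2 * (cmod (E z))\<^sup>2"
        by (simp add: norm_mult power_mult_distrib)
      moreover have "(e powr ((\<alpha> + 2) / 2))\<^sup>2 = e powr \<alpha> * e\<^sup>2"
        using e powr_add[of e "(\<alpha> + 2) / 2" "(\<alpha> + 2) / 2"] powr_add[of e \<alpha> 2] by (simp add: power2_eq_square powr_numeral)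
      ultimately have S: "(cmod (\<Sum>n<N. d n * (cnj (test_coeff z n) * of_real (monomial_norm2 \<alpha> n))))\<^sup>2 = e powr \<alpha> * e\<^sup>2 * (cmod (E z))\<^sup>2"
        by simp
      have "(cmod (\<Sum>n<N. d n * (cnj (test_coeff z n) * of_real (monomial_norm2 \<alpha> n))))\<^sup>2 * dlambda_dens z
        = 1 / (\<alpha> + 1) * (A2_weight \<alpha> z * (cmod (E z))\<^sup>2)"
      proof -
        have dl: "dlambda_dens z = 1 / (pi * e\<^sup>2)" by (simp add: dlambda_dens_def e_def)
        have A: "A2_weight \<alpha> z = (\<alpha> + 1) / pi * e powr \<alpha>" using True by (simp add: A2_weight_def dA_dens_def e_def)
        show ?thesis unfolding S dl A using e alpha by simp
      qed
      then show ?thesis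
        using True alpha A2_weight_nonneg[OF alpha, of z]
        by (simp add: ennreal_mult[symmetric] ennreal_mult''[symmetric] dlambda_dens_def del: times_divide_eq_left times_divide_eq_right)
    next
      case False
      then show ?thesis by (simp add: A2_weight_def)
    qed
  qed
  also have "\<dots> = ennreal (1 / (\<alpha> + 1)) * bergman_int \<alpha> E"
    unfolding bergman_int_weight using measurable_weight_norm2[of E \<alpha>] E by (intro nn_integral_cmult) (simp add: in_A2_def)
  also have "\<dots> = ennreal (1 / (\<alpha> + 1) * (\<Sum>n<N. (cmod (d n))\<^sup>2 * monomial_norm2 \<alpha> n))"
    unfolding bergman_int_A2_norm[OF alpha E] unfolding E_def[abs_def] A2_norm_monomial_sum[OF alpha]
    using alpha less_imp_le[OF monomial_norm2_pos[OF alpha]] by (intro ennreal_mult[symmetric] sum_nonneg mult_nonneg_nonneg zero_le_power2) auto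
  finally show ?thesis by simp
qed

text \<open>On monomials this says that differentiation is bounded from the space with weight
  \<open>\<alpha>\<close> to the one with weight \<open>\<alpha> + 2\<close>. The exact quotient
  contains the factor \<open>(n + 1) / (\<alpha> + 3 + n)\<close>, which is at most 1.\<close>

lemma monomial_norm2_shift:
  "(real n + 1)\<^sup>2 * monomial_norm2 (\<alpha> + 2) n \<le> (\<alpha> + 2) * (\<alpha> + 3) * monomial_norm2 \<alpha> (Suc n)"
proof -
  have a2: "\<alpha> + 2 > -1" using alpha by simp
  have nz: "(\<alpha> + 2) * (\<alpha> + 3) \<noteq> 0" using alpha by simp
  define B where "B = pochhammer (\<alpha> + 2) (Suc n)"
  have B0: "B > 0" unfolding B_def using alpha by (intro pochhammer_pos) simp
  have "(\<alpha> + 2) * (\<alpha> + 3) * pochhammer (\<alpha> + 4) n = pochhammer (\<alpha> + 2) (Suc (Suc n))"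
    using pochhammer_rec[of "\<alpha> + 2" "Suc n"] pochhammer_rec[of "\<alpha> + 3" n] by (simp add: add.assoc)
  also have "\<dots> = B * (\<alpha> + 3 + n)" unfolding B_def pochhammer_Suc[of "\<alpha> + 2" "Suc n"] by simp
  finally have "pochhammer (\<alpha> + 4) n = B * (\<alpha> + 3 + n) / ((\<alpha> + 2) * (\<alpha> + 3))"
    using alpha by (metis nonzero_mult_div_cancel_left nz)
  moreover have m: "monomial_norm2 (\<alpha> + 2) n = fact n / pochhammer (\<alpha> + 4) n"
    using monomial_norm2_binom_coeff[OF a2, of n] pochhammer_pos[of "\<alpha> + 4" n] alpha
    by (simp add: binom_coeff_def field_simps)
  ultimately have 1: "monomial_norm2 (\<alpha> + 2) n = fact n * ((\<alpha> + 2) * (\<alpha> + 3)) / (B * (\<alpha> + 3 + n))" by simp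
  have 2: "monomial_norm2 \<alpha> (Suc n) = fact n * (real n + 1) / B"
    using monomial_norm2_binom_coeff[OF alpha, of "Suc n"] B0 by (simp add: binom_coeff_def B_def[symmetric] field_simps)
  have "(real n + 1)\<^sup>2 * monomial_norm2 (\<alpha> + 2) n
    = ((\<alpha> + 2) * (\<alpha> + 3) * monomial_norm2 \<alpha> (Suc n)) * ((real n + 1) / (\<alpha> + 3 + n))"
    unfolding 1 2 using B0 alpha by (simp add: power2_eq_square mult_ac)
  also have "\<dots> \<le> ((\<alpha> + 2) * (\<alpha> + 3) * monomial_norm2 \<alpha> (Suc n)) * 1"
    using alpha monomial_norm2_pos[OF alpha, of "Suc n"] by (intro mult_left_mono) (auto simp: divide_le_eq_1)
  finally show ?thesis by simp
qed

text \<open>Pairing with \<open>test_fun'\<close> evaluates a derivative, here \<open>E\<close>,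
  times a power of \<open>1 - (cmod z)\<^sup>2\<close>. Compared with \<open>test_fun\<close> this
  power is larger by one, by two after squaring, so the integral is the squared norm of the
  derivative for the weight \<open>\<alpha> + 2\<close>, and \<open>monomial_norm2_shift\<close>
  leads back to the weight \<open>\<alpha>\<close>.\<close>

lemma test_fun'_Bessel:
  "(\<integral>\<^sup>+z. indicator udisc z * ennreal ((cmod (\<Sum>n<N. d n * (cnj (test_coeff' z n) * of_real (monomial_norm2 \<alpha> n))))\<^sup>2) * ennreal (dlambda_dens z) \<partial>lborel)
    \<le> ennreal (1 / (\<alpha> + 2) * (\<Sum>n<N. (cmod (d n))\<^sup>2 * monomial_norm2 \<alpha> n))"
proof (cases N)
  case 0
  then show ?thesis by simp
next
  case (Suc M)
  have a2: "\<alpha> + 2 > -1" using alpha by simp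
  define E where "E z = (\<Sum>n<M. (d (Suc n) * of_nat (Suc n)) * z ^ n)" for z
  \<comment> \<open>\<open>(\<alpha> + 2)\<^sup>2\<close> stems from the normalization of
    \<open>bergman_kernel'\<close>, and \<open>\<alpha> + 3\<close> from that of the measure with
    weight \<open>\<alpha> + 2\<close>.\<close>
  define c where "c = 1 / ((\<alpha> + 3) * (\<alpha> + 2)\<^sup>2)"
  have c0: "c > 0" using alpha by (simp add: c_def)
  have E: "in_A2 (\<alpha> + 2) E" unfolding E_def[abs_def] by (intro in_A2_sum[OF a2] in_A2_cmult[OF a2] in_A2_monomial[OF a2])
  have "(\<integral>\<^sup>+z. indicator udisc z * ennreal ((cmod (\<Sum>n<N. d n * (cnj (test_coeff' z n) * of_real (monomial_norm2 \<alpha> n))))\<^sup>2) * ennreal (dlambda_dens z) \<partial>lborel)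
    = (\<integral>\<^sup>+z. ennreal c * ennreal (A2_weight (\<alpha> + 2) z * (cmod (E z))\<^sup>2) \<partial>lborel)"
  proof (rule nn_integral_cong)
    fix z
    show "indicator udisc z * ennreal ((cmod (\<Sum>n<N. d n * (cnj (test_coeff' z n) * of_real (monomial_norm2 \<alpha> n))))\<^sup>2) * ennreal (dlambda_dens z)
      = ennreal c * ennreal (A2_weight (\<alpha> + 2) z * (cmod (E z))\<^sup>2)"
    proof (cases "z \<in> udisc")
      case True
      define e where "e = 1 - (cmod z)\<^sup>2"
      have e: "e > 0" using one_minus_norm_square_bounds(3) True by (simp add: e_def mem_udisc)
      define S where "S = (\<Sum>n<N. d n * (cnj (test_coeff' z n) * of_real (monomial_norm2 \<alpha> n)))"
      define k where "k = e * e powr ((\<alpha> + 2) / 2) / (\<alpha> + 2)"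
      have "cnj (test_coeff' z n) * of_real (monomial_norm2 \<alpha> n) = of_real k * (of_nat n * z ^ (n - 1))" for n
      proof -
        have "cnj (bergman_kernel_coeff' \<alpha> z n) * of_real (monomial_norm2 \<alpha> n) = of_nat n * z ^ (n - 1) / of_real (\<alpha> + 2)"
          using arg_cong[OF bergman_kernel_coeff'_monomial_norm2[OF alpha, of z n], of cnj] by simp
        then show ?thesis by (simp add: test_coeff'_def k_def e_def mult.assoc)
      qed
      then have "S = (\<Sum>n<Suc M. d n * (of_real k * (of_nat n * z ^ (n - 1))))" by (simp add: S_def Suc)
      also have "\<dots> = of_real k * E z"
        unfolding sum.lessThan_Suc_shift E_def by (simp add: sum_distrib_left mult_ac del: of_nat_Suc)
      finally have S: "(cmod S)\<^sup>2 = k\<^sup>2 * (cmod (E z))\<^sup>2" by (simp add: norm_mult power_mult_distrib)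
      have "(e powr ((\<alpha> + 2) / 2))\<^sup>2 = e powr (\<alpha> + 2)"
        using powr_add[of e "(\<alpha> + 2) / 2" "(\<alpha> + 2) / 2"] by (simp add: power2_eq_square)
      then have k: "k\<^sup>2 = e\<^sup>2 * e powr (\<alpha> + 2) / (\<alpha> + 2)\<^sup>2" by (simp add: k_def power_mult_distrib power_divide)
      have "(cmod S)\<^sup>2 * dlambda_dens z = c * (A2_weight (\<alpha> + 2) z * (cmod (E z))\<^sup>2)"
      proof -
        have dl: "dlambda_dens z = 1 / (pi * e\<^sup>2)" by (simp add: dlambda_dens_def e_def)
        have A: "A2_weight (\<alpha> + 2) z = (\<alpha> + 3) / pi * e powr (\<alpha> + 2)" using True by (simp add: A2_weight_def dA_dens_def e_def)
        show ?thesis unfolding S k dl A c_def using e alpha by simp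
      qed
      then show ?thesis
        using True c0 A2_weight_nonneg[OF a2, of z]
        by (simp add: ennreal_mult[symmetric] ennreal_mult''[symmetric] dlambda_dens_def S_def del: times_divide_eq_left times_divide_eq_right)
    next
      case False
      then show ?thesis by (simp add: A2_weight_def)
    qed
  qed
  also have "\<dots> = ennreal c * bergman_int (\<alpha> + 2) E"
    unfolding bergman_int_weight using measurable_weight_norm2[of E "\<alpha> + 2"] E by (intro nn_integral_cmult) (simp add: in_A2_def)
  also have "\<dots> = ennreal (c * (\<Sum>n<M. (cmod (d (Suc n) * of_nat (Suc n)))\<^sup>2 * monomial_norm2 (\<alpha> + 2) n))"
    unfolding bergman_int_A2_norm[OF a2 E] unfolding E_def[abs_def] A2_norm_monomial_sum[OF a2]
    using c0 less_imp_le[OF monomial_norm2_pos[OF a2]] by (intro ennreal_mult[symmetric] sum_nonneg mult_nonneg_nonneg zero_le_power2) auto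
  also have "\<dots> \<le> ennreal (1 / (\<alpha> + 2) * (\<Sum>n<N. (cmod (d n))\<^sup>2 * monomial_norm2 \<alpha> n))"
  proof (rule ennreal_leI)
    have "(\<Sum>n<M. (cmod (d (Suc n) * of_nat (Suc n)))\<^sup>2 * monomial_norm2 (\<alpha> + 2) n)
      \<le> (\<Sum>n<M. (\<alpha> + 2) * (\<alpha> + 3) * ((cmod (d (Suc n)))\<^sup>2 * monomial_norm2 \<alpha> (Suc n)))"
    proof (rule sum_mono)
      fix n
      have "(cmod (d (Suc n) * of_nat (Suc n)))\<^sup>2 * monomial_norm2 (\<alpha> + 2) n
        = (cmod (d (Suc n)))\<^sup>2 * ((real n + 1)\<^sup>2 * monomial_norm2 (\<alpha> + 2) n)"
        by (simp add: norm_mult power_mult_distrib add.commute del: of_nat_Suc)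
      also have "\<dots> \<le> (cmod (d (Suc n)))\<^sup>2 * ((\<alpha> + 2) * (\<alpha> + 3) * monomial_norm2 \<alpha> (Suc n))"
        by (intro mult_left_mono monomial_norm2_shift) simp
      finally show "(cmod (d (Suc n) * of_nat (Suc n)))\<^sup>2 * monomial_norm2 (\<alpha> + 2) n
        \<le> (\<alpha> + 2) * (\<alpha> + 3) * ((cmod (d (Suc n)))\<^sup>2 * monomial_norm2 \<alpha> (Suc n))" by (simp only: mult_ac)
    qed
    also have "\<dots> = (\<alpha> + 2) * (\<alpha> + 3) * (\<Sum>n<M. (cmod (d (Suc n)))\<^sup>2 * monomial_norm2 \<alpha> (Suc n))"
      by (simp only: sum_distrib_left)
    also have "\<dots> \<le> (\<alpha> + 2) * (\<alpha> + 3) * (\<Sum>n<N. (cmod (d n))\<^sup>2 * monomial_norm2 \<alpha> n)"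
      unfolding Suc sum.lessThan_Suc_shift using alpha monomial_norm2_pos[OF alpha, of 0]
      by (intro mult_left_mono) auto
    finally have "c * (\<Sum>n<M. (cmod (d (Suc n) * of_nat (Suc n)))\<^sup>2 * monomial_norm2 (\<alpha> + 2) n)
      \<le> c * ((\<alpha> + 2) * (\<alpha> + 3) * (\<Sum>n<N. (cmod (d n))\<^sup>2 * monomial_norm2 \<alpha> n))"
      using c0 by (intro mult_left_mono) auto
    also have "\<dots> = c * ((\<alpha> + 2) * (\<alpha> + 3)) * (\<Sum>n<N. (cmod (d n))\<^sup>2 * monomial_norm2 \<alpha> n)" by (simp only: mult.assoc)
    also have "c * ((\<alpha> + 2) * (\<alpha> + 3)) = 1 / (\<alpha> + 2)"
    proof -
      have "\<alpha> + 2 \<noteq> 0" "\<alpha> + 3 \<noteq> 0" using alpha by auto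
      then show ?thesis unfolding c_def power2_eq_square by (simp add: divide_simps)
    qed
    finally show "c * (\<Sum>n<M. (cmod (d (Suc n) * of_nat (Suc n)))\<^sup>2 * monomial_norm2 (\<alpha> + 2) n)
      \<le> 1 / (\<alpha> + 2) * (\<Sum>n<N. (cmod (d n))\<^sup>2 * monomial_norm2 \<alpha> n)" .
  qed
  finally show ?thesis .
qed

end

context weighted_pair
begin

lemma densities_in_L_lambda:
  assumes p: "p \<ge> 2" and S: "schatten_A2 \<alpha> p T" and R: "R > 0"
  shows "in_L_lambda (p / 2) (Mr \<alpha> R \<phi> dens_u)" "in_L_lambda (p / 2) (Mr \<alpha> R \<phi> dens_uv)"
    and "in_L_lambda (p / 2) (Mr \<alpha> R \<psi> dens_v)" "in_L_lambda (p / 2) (Mr \<alpha> R \<psi> dens_uv)"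
proof -
  have maps: "maps_A2 \<alpha> T" and bdd: "bounded_A2 \<alpha> T" and sm: "summable (\<lambda>n. enn2real (sing_num \<alpha> T n) powr p)"
    using S by (auto simp: schatten_A2_def)
  have D: "1 / (\<alpha> + 1) \<ge> 0" "1 / (\<alpha> + 2) \<ge> 0" using alpha by auto
  have h1: "A2_norm \<alpha> (test_fun \<alpha> z) \<le> 1" if "z \<in> udisc" for z using A2_norm_test_fun(2)[OF alpha that] by simp
  obtain F where F: "F \<in> borel_measurable borel" "\<And>z. z \<in> udisc \<Longrightarrow> ennreal (A2_norm \<alpha> (T (test_fun \<alpha> z)) powr p) \<le> F z"
      "(\<integral>\<^sup>+z. indicator udisc z * F z * ennreal (dlambda_dens z) \<partial>lborel) < \<infinity>"
    by (rule test_family_majorant[OF p maps bdd sm test_fun_series(2)[OF alpha] test_fun_series(1)[OF alpha]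
          A2_norm_test_fun(1)[OF alpha] h1 measurable_test_coeff(1)[OF alpha] D(1) test_fun_Bessel[OF alpha]]) (assumption | rule that)+
  obtain G where G: "G \<in> borel_measurable borel" "\<And>z. z \<in> udisc \<Longrightarrow> ennreal (A2_norm \<alpha> (T (test_fun' \<alpha> z)) powr p) \<le> G z"
      "(\<integral>\<^sup>+z. indicator udisc z * G z * ennreal (dlambda_dens z) \<partial>lborel) < \<infinity>"
    by (rule test_family_majorant[OF p maps bdd sm test_fun_series(4)[OF alpha] test_fun_series(3)[OF alpha]
          A2_norm_test_fun(3)[OF alpha] A2_norm_test_fun(4)[OF alpha] measurable_test_coeff(2)[OF alpha] D(2) test_fun'_Bessel[OF alpha]]) (assumption | rule that)+
  have t: "0 \<le> tanh R" "tanh R < 1" using R tanh_real_lt_1[of R] by auto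
  obtain C where C: "C > 0"
    "\<And>z x y U V. cmod z < 1 \<Longrightarrow> cmod x < 1 \<Longrightarrow> cmod y < 1 \<Longrightarrow> pseudo_hyp z x \<le> tanh R \<Longrightarrow>
      (pseudo_hyp x y * cmod U)\<^sup>2 \<le> C * ((cmod (U * test_fun \<alpha> z x - V * test_fun \<alpha> z y))\<^sup>2
        + (cmod (U * test_fun' \<alpha> z x - V * test_fun' \<alpha> z y))\<^sup>2) * (1 - (cmod z)\<^sup>2) powr (\<alpha> + 2)"
    "\<And>z x y U V. cmod z < 1 \<Longrightarrow> cmod x < 1 \<Longrightarrow> cmod y < 1 \<Longrightarrow> pseudo_hyp z x \<le> tanh R \<Longrightarrow>
      (1 - pseudo_hyp x y) powr \<beta> * (cmod (U - V))\<^sup>2 \<le> C * ((cmod (U * test_fun \<alpha> z x - V * test_fun \<alpha> z y))\<^sup>2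
        + (cmod (U * test_fun' \<alpha> z x - V * test_fun' \<alpha> z y))\<^sup>2) * (1 - (cmod z)\<^sup>2) powr (\<alpha> + 2)"
    by (rule test_functions_control_densities[OF alpha beta t]) (rule that)
  have M: "Mr \<alpha> R \<theta> q z \<le> ennreal (C * ((A2_norm \<alpha> (T (test_fun \<alpha> z)))\<^sup>2 + (A2_norm \<alpha> (T (test_fun' \<alpha> z)))\<^sup>2))"
    if z: "z \<in> udisc" and q: "\<theta> = \<phi> \<and> (q = dens_u \<or> q = dens_uv) \<or> \<theta> = \<psi> \<and> (q = dens_v \<or> q = dens_uv)" for q \<theta> z
  proof (rule Mr_le_A2_norms[OF alpha])
    show z1: "cmod z < 1" using z by (simp add: mem_udisc)
    show "in_A2 \<alpha> (T (test_fun \<alpha> z))" "in_A2 \<alpha> (T (test_fun' \<alpha> z))"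
      using maps A2_norm_test_fun(1,3)[OF alpha z] by (auto simp: maps_A2_def)
    show "C \<ge> 0" using C(1) by simp
    fix w assume w: "w \<in> udisc" "\<theta> w \<in> bdisc z R"
    note m = map_in_disc[OF w(1)[unfolded mem_udisc]]
    have d: "pseudo_hyp z (\<theta> w) \<le> tanh R" using w(2) by (simp add: mem_bdisc[OF z1])
    show "q w \<le> C * ((cmod (T (test_fun \<alpha> z) w))\<^sup>2 + (cmod (T (test_fun' \<alpha> z) w))\<^sup>2) * (1 - (cmod z)\<^sup>2) powr (\<alpha> + 2)"
    proof (cases "\<theta> = \<phi> \<and> (q = dens_u \<or> q = dens_uv)")
      case True
      then show ?thesis
        using C(2)[OF z1 m(1,2), of "u w" "v w"] C(3)[OF z1 m(1,2), of "u w" "v w"] d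
        unfolding T_apply by (auto simp: dens_u_def dens_uv_def rho_def)
    next
      case False
      then have q': "\<theta> = \<psi>" "q = dens_v \<or> q = dens_uv" using q by auto
      \<comment> \<open>The pairs \<open>\<phi>\<close>, \<open>u\<close> and \<open>\<psi>\<close>,
        \<open>v\<close> are exchanged; this changes \<open>T f w\<close> only by its sign and
        leaves the symmetric quantities as they are.\<close>
      have sw: "cmod (v w * f (\<psi> w) - u w * f (\<phi> w)) = cmod (T f w)" for f by (simp add: T_apply norm_minus_commute)
      show ?thesis
        using C(2)[OF z1 m(2,1), of "v w" "u w"] C(3)[OF z1 m(2,1), of "v w" "u w"] d q'
        unfolding sw by (auto simp: dens_v_def dens_uv_def rho_def pseudo_hyp_commute[of "\<psi> w"] norm_minus_commute[of "v w"])
    qed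
  qed
  have p0: "p > 0" using p by simp
  have N: "0 \<le> A2_norm \<alpha> (T (test_fun \<alpha> z))" "0 \<le> A2_norm \<alpha> (T (test_fun' \<alpha> z))" for z by simp_all
  have L: "in_L_lambda (p / 2) (Mr \<alpha> R \<theta> q)" if "admissible_map \<theta>" "continuous_on udisc q"
    "\<theta> = \<phi> \<and> (q = dens_u \<or> q = dens_uv) \<or> \<theta> = \<psi> \<and> (q = dens_v \<or> q = dens_uv)" for \<theta> q
    by (rule in_L_lambda_majorized[OF that(1,2) p0 C(1) M[OF _ that(3)] N F G])
  show "in_L_lambda (p / 2) (Mr \<alpha> R \<phi> dens_u)" "in_L_lambda (p / 2) (Mr \<alpha> R \<phi> dens_uv)"
    "in_L_lambda (p / 2) (Mr \<alpha> R \<psi> dens_v)" "in_L_lambda (p / 2) (Mr \<alpha> R \<psi> dens_uv)"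
    by (intro L admissible continuous_dens; simp)+
qed

end

text \<open>Both radii are compared with the same lattice sums, which do not mention a radius; the
  lattice only has to be fine enough for \<open>r\<close>.\<close>

lemma in_L_lambda_radius_independent:
  assumes \<alpha>: "\<alpha> > -1" and q: "q > 0" and \<phi>: "admissible_map \<phi>" and g: "continuous_on udisc g"
    and r: "r > 0" and R: "R > 0" and L: "in_L_lambda q (Mr \<alpha> r \<phi> g)"
  shows "in_L_lambda q (Mr \<alpha> R \<phi> g)"
proof -
  have \<eta>: "0 < tanh r / 4" "tanh r / 4 \<le> 1 / 2" "tanh r / 4 < 1" using r tanh_real_lt_1[of r] by auto
  obtain a where a: "disc_lattice (tanh r / 4) a" using disc_lattice_exists[OF \<eta>(1,3)] .
  show ?thesis
    by (rule lattice_summable_imp_in_L_lambda[OF \<alpha> q a \<eta>(1,2) \<phi> g R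
          in_L_lambda_imp_lattice_summable[OF \<alpha> q a \<eta>(1) order_refl L]])
qed

theorem theorem1p3:
  fixes \<alpha> p \<beta> :: real and u v \<phi> \<psi> :: "complex \<Rightarrow> complex"
  assumes "\<alpha> > -1" and "0 < p" and "\<beta> \<ge> 2 * (\<alpha> + 2)"
    and "u holomorphic_on udisc" and "v holomorphic_on udisc"
    and "\<phi> holomorphic_on udisc" and "\<phi> ` udisc \<subseteq> udisc"
    and "\<psi> holomorphic_on udisc" and "\<psi> ` udisc \<subseteq> udisc"
  shows "((\<exists>r>0. cond_r \<alpha> p \<beta> u v \<phi> \<psi> r) \<longleftrightarrow> (\<forall>r>0. cond_r \<alpha> p \<beta> u v \<phi> \<psi> r))
    \<and> ((\<exists>r>0. cond_r \<alpha> p \<beta> u v \<phi> \<psi> r) \<longrightarrow>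
         schatten_A2 \<alpha> p (\<lambda>f z. wcomp u \<phi> f z - wcomp v \<psi> f z))
    \<and> (p \<ge> 2 \<longrightarrow> schatten_A2 \<alpha> p (\<lambda>f z. wcomp u \<phi> f z - wcomp v \<psi> f z) \<longrightarrow>
         (\<forall>r>0. cond_r \<alpha> p \<beta> u v \<phi> \<psi> r))"
proof -
  interpret W: weighted_pair \<alpha> \<beta> u v \<phi> \<psi> by unfold_locales (use assms in auto)
  have q: "p / 2 > 0" using assms(2) by simp
  have cond: "cond_r \<alpha> p \<beta> u v \<phi> \<psi> r \<longleftrightarrow>
      in_L_lambda (p / 2) (Mr \<alpha> r \<phi> W.dens_u) \<and> in_L_lambda (p / 2) (Mr \<alpha> r \<psi> W.dens_v) \<and>
      in_L_lambda (p / 2) (Mr \<alpha> r \<phi> W.dens_uv) \<and> in_L_lambda (p / 2) (Mr \<alpha> r \<psi> W.dens_uv)" for r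
    unfolding cond_r_def W.dens_u_def[abs_def] W.dens_v_def[abs_def] W.dens_uv_def[abs_def] ..
  have indep: "cond_r \<alpha> p \<beta> u v \<phi> \<psi> R" if c: "cond_r \<alpha> p \<beta> u v \<phi> \<psi> r" and r: "r > 0" "R > 0" for r R
  proof -
    have "in_L_lambda (p / 2) (Mr \<alpha> R \<theta> g)"
      if "in_L_lambda (p / 2) (Mr \<alpha> r \<theta> g)" "admissible_map \<theta>" "continuous_on udisc g" for \<theta> g
      by (rule in_L_lambda_radius_independent[OF assms(1) q that(2,3) r that(1)])
    then show ?thesis using c unfolding cond by (simp add: W.admissible W.continuous_dens)
  qed
  have suff: "schatten_A2 \<alpha> p W.T" if "cond_r \<alpha> p \<beta> u v \<phi> \<psi> r" "r > 0" for r
  proof -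
    \<comment> \<open>\<open>tanh (ln 2) = 3 / 5\<close> exceeds \<open>4 / 100\<close>, so the
      fixed lattice of mesh \<open>1 / 100\<close> is fine enough for this radius, and the condition
      can be moved to it from any other.\<close>
    define R where "R = ln (2 :: real)"
    have R: "tanh R = 3 / 5" "R > 0" by (simp_all add: R_def tanh_ln_real)
    obtain a where a: "disc_lattice (1 / 100) a" using disc_lattice_exists[of "1 / 100"] by auto
    have \<eta>: "0 < (1 / 100 :: real)" "1 / 100 \<le> tanh R / 4" using R by auto
    have "cond_r \<alpha> p \<beta> u v \<phi> \<psi> R" using indep that R by blast
    then show ?thesis
      unfolding cond by (intro W.T_schatten[OF assms(2) a] in_L_lambda_imp_lattice_summable[OF assms(1) q a \<eta>]) auto
  qed
  have nec: "cond_r \<alpha> p \<beta> u v \<phi> \<psi> r" if "p \<ge> 2" "schatten_A2 \<alpha> p W.T" "r > 0" for r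
    unfolding cond using W.densities_in_L_lambda[OF that] by simp
  show ?thesis
  proof (intro conjI iffI allI impI)
    show "cond_r \<alpha> p \<beta> u v \<phi> \<psi> R" if "\<exists>r>0. cond_r \<alpha> p \<beta> u v \<phi> \<psi> r" "R > 0" for R
      using that(1) indep[OF _ _ that(2)] by auto
    show "\<exists>r>0. cond_r \<alpha> p \<beta> u v \<phi> \<psi> r" if "\<forall>r>0. cond_r \<alpha> p \<beta> u v \<phi> \<psi> r"
      using that by (intro exI[of _ 1]) simp
    show "schatten_A2 \<alpha> p (\<lambda>f z. wcomp u \<phi> f z - wcomp v \<psi> f z)" if "\<exists>r>0. cond_r \<alpha> p \<beta> u v \<phi> \<psi> r"
      using that suff unfolding W.T_def by auto
  qed (rule nec, auto simp: W.T_def)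
qed

end
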